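(* Let $k,\ell\in\mathbb{N}$, let $z_1,\dots,z_{k+\ell}\in\mathbb{C}\setminus\mathbb{R}$, let $A_1,\dots,A_{k+\ell}\in\mathbb{C}^{N\times N}$, and put $\alpha=((z_1,A_1),\dots,(z_k,A_k))$, $\beta=((z_{k+1},A_{k+1}),\dots,(z_{k+\ell},A_{k+\ell}))$. Let $\mathfrak{m}_{GUE}[\cdot|\cdot]$ be the recursively defined function of the context, let $m_\circ$ be the first-order free cumulant function of the divided differences $m[\cdot]$, and let $m_{\circ\circ}$ be the second-order free cumulant function associated with $m_{GUE}[\cdot|\cdot]$ and $m[\cdot]$. Then $$\mathfrak{m}_{GUE}[\alpha|\beta]=\sum_{\pi\in \overrightarrow{NCP}(k,\ell)}\Big(\prod_{B\in K(\pi)}\Big\langle \prod_{j\in B}A_j\Big\rangle\Big)\prod_{B\in\pi}m_{\circ}[B]$$ $$+\sum_{\substack{\pi_1\times\pi_2\in NCP(k)\times NCP(\ell),\\ U_1\in\pi_1,\,U_2\in\pi_2\text{ marked}}}\Big(\prod_{\substack{B_1\in K(\pi_1),\\ B_2\in K(\pi_2)}}\Big\langle \prod_{j\in B_1} A_j\Big\rangle\Big\langle \prod_{j\in B_2} A_j\Big\rangle\Big)\,m_{\circ\circ}[U_1|U_2]\prod_{\substack{B_1\in \pi_1\setminus \{U_1\},\\ B_2\in\pi_2\setminus \{U_2\}}}m_{\circ}[B_1]\,m_{\circ}[B_2],$$ where the products over pairs $(B_1,B_2)$ mean: one factor for each block $B_1$ and one factor for each block $B_2$.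
   Context: Basic notation. $[k]=\{1,\dots,k\}$, $[a,b]=\{a,\dots,b\}$, $\langle A\rangle=N^{-1}\mathrm{Tr}\,A$. $\rho_{sc}(x)=\frac{\sqrt{4-x^2}}{2\pi}\mathbf 1_{[-2,2]}(x)$ and $m(z)=\int\frac{\rho_{sc}(x)}{x-z}dx$ for $z\in\mathbb{C}\setminus\mathbb{R}$; equivalently $m$ is the unique solution of $-1/m(z)=m(z)+z$ with $\Im z\,\Im m(z)>0$. Write $m_j=m(z_j)$ and $q_{i,j}=\frac{m_im_j}{1-m_im_j}$. Divided differences. For a finite multi-set in $\mathbb{C}\setminus\mathbb{R}$, $m[z_1,\dots,z_n]=\frac{m[z_2,\dots,z_n]-m[z_1,\dots,z_{n-1}]}{z_n-z_1}$ if the multi-set has two distinct elements, ordered so that $z_1\neq z_n$, and $m[z,\dots,z]=m^{(n-1)}(z)/(n-1)!$ ($n$ copies of $z$); this does not depend on the order. Write $m[i_1,\dots,i_n]=m[z_{i_1},\dots,z_{i_n}]$. Non-crossing partitions. For a finite (cyclically) ordered set $S$ of labels, $NCP(S)$ is the set of partitions of $S$ without blocks $B\neq B'$ and $a,b\in B$, $c,d\in B'$ with $a<c<b<d$; $NCP(k)=NCP([k])$. In $NCP(k)\times NCP(\ell)$ the second factor consists of partitions of $[k+1,k+\ell]$. The (disk) Kreweras complement $K(\pi)\in NCP(S)$: place the points of $S$ clockwise on a circle, label the arc following point $s$ also by $s$, and let $r,s$ lie in the same block of $K(\pi)$ iff the arcs $r,s$ lie in the same connected component of the disk minus the convex hulls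 of the blocks of $\pi$. For a set function $f$, its first-order free cumulant function $f_\circ$ is defined by $f[S]=\sum_{\pi\in NCP(S)}\prod_{B\in\pi}f_\circ[B]$ for all $S$. Annular non-crossing permutations. The $(k,\ell)$-annulus has labels $1,\dots,k$ clockwise on the outer circle and $k+1,\dots,k+\ell$ counter-clockwise on the inner circle. $\overrightarrow{NCP}(k,\ell)$ is the set of permutations of $[k+\ell]$ whose cycles can be drawn in the annulus such that (i) cycles do not cross, (ii) each cycle encloses a region in the annulus homeomorphic to the disk with boundary oriented clockwise, (iii) at least one cycle connects both circles. For $\pi\in\overrightarrow{NCP}(k,\ell)$, the annular Kreweras complement $K(\pi)$ is the maximal annular non-crossing permutation that can be drawn on the labels of the arcs (arc $s$ follows point $s$ in the orientation of its circle) without intersecting the cycles of $\pi$; equivalently $K(\pi)=\pi^{-1}\circ\gamma$ with $\gamma=(1\,2\cdots k)(k+1\cdots k+\ell)$. "$B\in\pi$" means a cycle of $\pi$, and matrix products over a cycle (block) are taken in the cyclic order of the cycle (in increasing order of the block). Marked partitions. A marked element of $NCP(k)\times NCP(\ell)$ is $\pi_1\times\pi_2$ together with one chosen block $U_1\in\pi_1$ and one chosen block $U_2\in\pi_2$; sums over marked partitions run over all choices of $(\pi_1,\pi_2,U_1,U_2)$. Second-order free cumulants. Given $f[\cdot]$ and a symmetric function $f[\cdot|\cdot]$ of two (cyclically) ordered label sets, vanishing if either argument is empty, $f_{\circ\circ}$ is defined recursively by $$f[S_1|S_2]=\sum_{\pi\in \overrightarrow{NCP}(|S_1|,|S_2|)}\prod_{B\in\pi}f_{\circ}[B]+\sum_{\substack{\pi_1\times\pi_2\in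 NCP(|S_1|)\times NCP(|S_2|),\\ U_1\in\pi_1,U_2\in\pi_2\text{ marked}}} f_{\circ\circ}[U_1|U_2]\prod_{B\in (\pi_1\setminus \{U_1\})\cup(\pi_2\setminus \{U_2\})}f_{\circ}[B],$$ where the labels of the annulus (circles) are identified with the elements of $S_1$ and $S_2$. First-order quantity $\mathfrak m$. With $T_j$ standing for the pair $(z_j,A_j)$ and $G_j$ for $(z_j,\mathrm{Id})$ (more generally $G_jA$ stands for $(z_j,A)$), set for any finite list $$\mathfrak{m}[T_1,\dots,T_n]=\sum_{\pi\in NCP(n)}\Big(\prod_{B\in K(\pi)}\Big\langle\prod_{j\in B}A_j\Big\rangle\Big)\prod_{B\in\pi}m_\circ[B].$$ Lists with repeated labels are treated by identifying positions with $1,\dots,n$. Definition of $\mathfrak m_{GUE}[\cdot|\cdot]$. It is the function of pairs of such lists that is symmetric under interchange of its two arguments, vanishes if either argument is empty, and satisfies $$\mathfrak m_{GUE}[T_1,\dots,T_k|\beta]=m_1\Big(\mathfrak m_{GUE}[T_2,\dots,T_{k-1},G_kA_kA_1|\beta]+q_{1,k}\mathfrak m_{GUE}[T_2,\dots,T_{k-1},G_kA_1|\beta]\langle A_k\rangle$$ $$+\sum_{j=1}^{k-1}\mathfrak m_{GUE}[T_1,\dots,T_{j-1},G_j|\beta]\big(\mathfrak m[T_j,\dots,T_k]+q_{1,k}\mathfrak m[T_j,\dots,T_{k-1},G_k]\langle A_k\rangle\big)$$ $$+\sum_{j=2}^{k}\mathfrak m[T_1,\dots,T_{j-1},G_j]\big(\mathfrak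 m_{GUE}[T_j,\dots,T_k|\beta]+q_{1,k}\mathfrak m_{GUE}[T_j,\dots,T_{k-1},G_k|\beta]\langle A_k\rangle\big)+\mathfrak s_{GUE}\Big),$$ with $\beta=(T_{k+1},\dots,T_{k+\ell})$ and $$\mathfrak s_{GUE}=\sum_{j=1}^{\ell}\Big(\mathfrak m[T_1,\dots,T_k,T_{k+j},\dots,T_{k+\ell},T_{k+1},\dots,T_{k+j-1},G_{k+j}]+q_{1,k}\langle A_k\rangle\,\mathfrak m[T_1,\dots,T_{k-1},G_k,T_{k+j},\dots,T_{k+\ell},T_{k+1},\dots,T_{k+j-1},G_{k+j}]\Big).$$ For $k=1$ the first two terms on the right (empty chain) are interpreted as zero. Finally $m_{GUE}[1,\dots,k|k+1,\dots,k+\ell]:=\mathfrak m_{GUE}[G_1,\dots,G_k|G_{k+1},\dots,G_{k+\ell}]$, i.e. the case where all matrices are the identity. *)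

theory Defs
  imports "HOL-Analysis.Analysis" "HOL-Combinatorics.Cycles" "HOL-Combinatorics.Orbits"
begin

(* Labels and list positions start at 0: the outer circle carries 0, ..., k-1 and the inner circle
   k, ..., k+l-1. A (cyclically) ordered label set is represented by a list, and a set function on
   such sets by a function on lists. *)

section \<open>Semicircle law and divided differences\<close>

definition semicircle_density :: "real \<Rightarrow> real" where
  "semicircle_density x = sqrt (4 - x\<^sup>2) / (2 * pi) * indicator {-2..2} x"

definition msc :: "complex \<Rightarrow> complex" where
  "msc z = (LINT x|lborel. complex_of_real (semicircle_density x) / (complex_of_real x - z))"

definition qsc :: "complex \<Rightarrow> complex \<Rightarrow> complex" where
  "qsc z w = msc z * msc w / (1 - msc z * msc w)"

(* If the nodes are not all equal, z_1 is taken to be the head of the list and z_n the first entry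
   w different from it. For msc on nonreal nodes the value does not depend on this choice. The value
   at [] is never used. *)
function divided_difference :: "(complex \<Rightarrow> complex) \<Rightarrow> complex list \<Rightarrow> complex" where
  "divided_difference f zs =
     (if zs = [] then 0
      else if \<forall>w\<in>set zs. w = hd zs
      then (deriv ^^ (length zs - 1)) f (hd zs) / fact (length zs - 1)
      else let w = hd (filter (\<lambda>w. w \<noteq> hd zs) zs)
           in (divided_difference f (tl zs) - divided_difference f (remove1 w zs)) / (w - hd zs))"
  by pat_completeness auto

lemma hd_filter_neq_mem:
  assumes "\<not> (\<forall>w\<in>set zs. w = hd zs)"
  shows "hd (filter (\<lambda>w. w \<noteq> hd zs) zs) \<in> set zs"
proof -
  have "filter (\<lambda>w. w \<noteq> hd zs) zs \<noteq> []"
    using assms by (auto simp: filter_empty_conv)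
  then have "hd (filter (\<lambda>w. w \<noteq> hd zs) zs) \<in> set (filter (\<lambda>w. w \<noteq> hd zs) zs)"
    by (rule hd_in_set)
  then show ?thesis by simp
qed

termination
proof (relation "Wellfounded.measure (\<lambda>(f, zs). length zs)", goal_cases)
  case (3 f zs w)
  then have "w \<in> set zs" using hd_filter_neq_mem[of zs] by simp
  then show ?case using 3 by (simp add: length_remove1)
qed simp_all

declare divided_difference.simps [simp del]

abbreviation mdd :: "complex list \<Rightarrow> complex" where
  "mdd \<equiv> divided_difference msc"

section \<open>Non-crossing partitions of a disk\<close>

definition NCP :: "nat set \<Rightarrow> nat set set set" where
  "NCP S = {P. partition_on S P \<and>
     (\<forall>B\<in>P. \<forall>B'\<in>P. B \<noteq> B' \<longrightarrow>
        \<not> (\<exists>a\<in>B. \<exists>b\<in>B. \<exists>c\<in>B'. \<exists>d\<in>B'. a < c \<and> c < b \<and> b < d))}"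

(* For r < s, the arcs following r and s cut the circle into the points in {r<..s} and the remaining
   points. As the hulls of the blocks are disjoint, the two arcs lie in the same component of the
   complement iff no single hull separates them, i.e. iff no block has points on both sides. *)
definition kreweras :: "nat set \<Rightarrow> nat set set \<Rightarrow> nat set set" where
  "kreweras S P = S // {(r, s). r \<in> S \<and> s \<in> S \<and>
     (\<forall>B\<in>P. B \<subseteq> {min r s<..max r s} \<or> B \<inter> {min r s<..max r s} = {})}"

definition marked_NCP_pairs ::
  "nat set \<Rightarrow> nat set \<Rightarrow> (nat set set \<times> nat set \<times> nat set set \<times> nat set) set" where
  "marked_NCP_pairs S T = {(P, U, Q, V). P \<in> NCP S \<and> U \<in> P \<and> Q \<in> NCP T \<and> V \<in> Q}"

section \<open>Annular non-crossing permutations\<close>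

definition annulus_rotation :: "nat \<Rightarrow> nat \<Rightarrow> nat \<Rightarrow> nat" where
  "annulus_rotation k l i =
     (if i < k then Suc i mod k
      else if i < k + l then k + Suc (i - k) mod l
      else i)"

definition cyclic_succ :: "nat set \<Rightarrow> nat \<Rightarrow> nat" where
  "cyclic_succ B i = (if \<exists>j\<in>B. i < j then Min {j \<in> B. i < j} else Min B)"

(* A drawing with a cycle joining the two circles can be slit open next to such a cycle, from the
   outer arc preceding a point a to the inner arc preceding a point b, without meeting any cycle.
   The slit annulus is a disk; clockwise along its boundary one meets the outer points from a on and
   then the inner points from b on, which is the list w below. The drawings are thus those of
   non-crossing, clockwise oriented polygons in this disk: the cycles sit on the blocks of a
   non-crossing partition of the positions of w, and each moves to the cyclically next position of
   its block. The last clause says that some cycle connects the circles. *)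
definition annular_NCP :: "nat \<Rightarrow> nat \<Rightarrow> (nat \<Rightarrow> nat) set" where
  "annular_NCP k l = {p. p permutes {..<k + l} \<and>
     (\<exists>a<k. \<exists>b<l. \<exists>P\<in>NCP {..<k + l}.
        let w = rotate a [0..<k] @ rotate b [k..<k + l]
        in \<forall>B\<in>P. \<forall>i\<in>B. p (w ! i) = w ! cyclic_succ B i) \<and>
     (\<exists>i<k. \<exists>j\<in>{k..<k + l}. j \<in> orbit p i)}"

definition annular_kreweras :: "nat \<Rightarrow> nat \<Rightarrow> (nat \<Rightarrow> nat) \<Rightarrow> nat \<Rightarrow> nat" where
  "annular_kreweras k l p = inv p \<circ> annulus_rotation k l"

(* The cycles of p on {..<n}, each listed once, in cyclic order, starting from its least element.
   The cyclic order matters below: a free cumulant is invariant under rotating its argument list, but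
   not under arbitrary permutations. *)
definition cycles_upto :: "nat \<Rightarrow> (nat \<Rightarrow> nat) \<Rightarrow> nat list set" where
  "cycles_upto n p = support p ` {i. i < n \<and> (\<forall>j. i \<le> (p ^^ j) i)}"

section \<open>Free cumulant functions\<close>

lemma NCP_block_subset: "P \<in> NCP S \<Longrightarrow> B \<in> P \<Longrightarrow> B \<subseteq> S"
  by (auto simp: NCP_def partition_on_def)

lemma NCP_full_block:
  assumes "P \<in> NCP S" "S \<in> P"
  shows "P = {S}"
proof -
  have "B = S" if "B \<in> P" for B
  proof (rule ccontr)
    assume "B \<noteq> S"
    moreover have P: "disjoint P" "{} \<notin> P" "\<Union>P = S"
      using assms(1) by (simp_all add: NCP_def partition_on_def)
    ultimately have "B \<inter> S = {}"
      using that assms(2) by (intro disjointD[of P]) auto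
    moreover have "B \<subseteq> S" "B \<noteq> {}"
      using that P by auto
    ultimately show False by auto
  qed
  then show ?thesis using assms(2) by blast
qed

lemma finite_NCP: "finite S \<Longrightarrow> finite (NCP S)"
  by (rule finite_subset[where B = "Pow (Pow S)"]) (auto simp: NCP_def partition_on_def)

lemma full_in_NCP: "S \<noteq> {} \<Longrightarrow> {S} \<in> NCP S"
  by (auto simp: NCP_def partition_on_def)

lemma length_nths_block:
  assumes "B \<subseteq> {..<length xs}"
  shows "length (nths xs B) = card B"
proof -
  have "{i. i < length xs \<and> i \<in> B} = B" using assms by auto
  then show ?thesis by (simp add: length_nths)
qed

lemma length_nths_proper_block:
  assumes "B \<subseteq> {..<length xs}" "B \<noteq> {..<length xs}"
  shows "length (nths xs B) < length xs"
  using assms psubset_card_mono[of "{..<length xs}" B] by (simp add: length_nths_block psubset_eq)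

(* The relation f = (sum over NCP), solved for its one-block term. *)
function free_cumulant :: "('a list \<Rightarrow> complex) \<Rightarrow> 'a list \<Rightarrow> complex" where
  "free_cumulant f xs =
     f xs - (\<Sum>P\<in>NCP {..<length xs} - {{{..<length xs}}}. \<Prod>B\<in>P. free_cumulant f (nths xs B))"
  by pat_completeness auto
termination
proof (relation "Wellfounded.measure (\<lambda>(f, xs). length xs)", simp, clarsimp)
  fix xs :: "'a list" and P B
  assume "P \<in> NCP {..<length xs}" "P \<noteq> {{..<length xs}}" "B \<in> P"
  then have "B \<subseteq> {..<length xs}" "B \<noteq> {..<length xs}"
    using NCP_block_subset NCP_full_block by blast+
  then show "length (nths xs B) < length xs" by (rule length_nths_proper_block)
qed

declare free_cumulant.simps [simp del]

lemma moment_free_cumulant: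
  assumes "xs \<noteq> []"
  shows "f xs = (\<Sum>P\<in>NCP {..<length xs}. \<Prod>B\<in>P. free_cumulant f (nths xs B))"
proof -
  let ?n = "{..<length xs}"
  have "(\<Sum>P\<in>NCP ?n. \<Prod>B\<in>P. free_cumulant f (nths xs B)) =
      (\<Prod>B\<in>{?n}. free_cumulant f (nths xs B)) +
      (\<Sum>P\<in>NCP ?n - {{?n}}. \<Prod>B\<in>P. free_cumulant f (nths xs B))"
    using assms by (intro sum.remove finite_NCP full_in_NCP) (auto simp: lessThan_empty_iff)
  also have "\<dots> = f xs"
    using free_cumulant.simps[of f xs] by (simp add: nths_all)
  finally show ?thesis by simp
qed

lemma length_nths_marked_pair:
  fixes xs :: "'a list" and ys :: "'b list"
  defines "m \<equiv> {..<length xs}" and "n \<equiv> {..<length ys}"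
  assumes "(P, U, Q, V) \<in> marked_NCP_pairs m n"
    and "\<not> (P = {m} \<and> U = m \<and> Q = {n} \<and> V = n)"
  shows "length (nths xs U) + length (nths ys V) < length xs + length ys"
proof -
  have *: "P \<in> NCP m" "U \<in> P" "Q \<in> NCP n" "V \<in> Q"
    using assms(3) by (simp_all add: marked_NCP_pairs_def)
  then have UV: "U \<subseteq> m" "V \<subseteq> n"
    by (simp_all add: NCP_block_subset)
  have "length (nths xs U) \<le> length xs" "length (nths ys V) \<le> length ys"
    using UV card_mono[of m U] card_mono[of n V]
    by (simp_all add: length_nths_block m_def n_def)
  moreover have "U \<noteq> m \<or> V \<noteq> n"
    using * assms(4) NCP_full_block[of P m] NCP_full_block[of Q n] by blast
  then have "length (nths xs U) < length xs \<or> length (nths ys V) < length ys"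
    using UV length_nths_proper_block[of U xs] length_nths_proper_block[of V ys]
    unfolding m_def n_def by blast
  ultimately show ?thesis
    by linarith
qed

(* f and f2 are the first- and second-order moment functions; again the defining relation is solved
   for the term in which both marked blocks are everything. *)
function second_order_cumulant ::
  "('a list \<Rightarrow> complex) \<Rightarrow> ('a list \<Rightarrow> 'a list \<Rightarrow> complex) \<Rightarrow> 'a list \<Rightarrow> 'a list \<Rightarrow> complex" where
  "second_order_cumulant f f2 xs ys =
     (if xs = [] \<or> ys = [] then 0 else
      f2 xs ys
      - (\<Sum>p\<in>annular_NCP (length xs) (length ys).
           \<Prod>c\<in>cycles_upto (length xs + length ys) p. free_cumulant f (map ((!) (xs @ ys)) c))
      - (\<Sum>(P, U, Q, V)\<in>marked_NCP_pairs {..<length xs} {..<length ys}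
             - {({{..<length xs}}, {..<length xs}, {{..<length ys}}, {..<length ys})}.
           second_order_cumulant f f2 (nths xs U) (nths ys V)
           * (\<Prod>B\<in>P - {U}. free_cumulant f (nths xs B))
           * (\<Prod>B\<in>Q - {V}. free_cumulant f (nths ys B))))"
  by pat_completeness auto
termination
  by (relation "Wellfounded.measure (\<lambda>(f, f2, xs, ys). length xs + length ys)")
     (auto intro!: length_nths_marked_pair)

declare second_order_cumulant.simps [simp del]

lemma moment_second_order_cumulant:
  assumes "xs \<noteq> []" "ys \<noteq> []"
  shows "f2 xs ys =
      (\<Sum>p\<in>annular_NCP (length xs) (length ys).
         \<Prod>c\<in>cycles_upto (length xs + length ys) p. free_cumulant f (map ((!) (xs @ ys)) c))
    + (\<Sum>(P, U, Q, V)\<in>marked_NCP_pairs {..<length xs} {..<length ys}.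
         second_order_cumulant f f2 (nths xs U) (nths ys V)
         * (\<Prod>B\<in>P - {U}. free_cumulant f (nths xs B))
         * (\<Prod>B\<in>Q - {V}. free_cumulant f (nths ys B)))"
proof -
  let ?m = "{..<length xs}" and ?n = "{..<length ys}"
  let ?t = "\<lambda>(P, U, Q, V). second_order_cumulant f f2 (nths xs U) (nths ys V)
         * (\<Prod>B\<in>P - {U}. free_cumulant f (nths xs B))
         * (\<Prod>B\<in>Q - {V}. free_cumulant f (nths ys B))"
  have "finite (marked_NCP_pairs ?m ?n)"
    by (rule finite_subset[where B = "NCP ?m \<times> Pow ?m \<times> NCP ?n \<times> Pow ?n"])
       (use NCP_block_subset in \<open>auto simp: marked_NCP_pairs_def finite_NCP\<close>)
  moreover have "({?m}, ?m, {?n}, ?n) \<in> marked_NCP_pairs ?m ?n"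
    using assms by (auto simp: marked_NCP_pairs_def lessThan_empty_iff intro!: full_in_NCP)
  ultimately have "sum ?t (marked_NCP_pairs ?m ?n) =
      ?t ({?m}, ?m, {?n}, ?n) + sum ?t (marked_NCP_pairs ?m ?n - {({?m}, ?m, {?n}, ?n)})"
    by (rule sum.remove)
  also have "?t ({?m}, ?m, {?n}, ?n) = second_order_cumulant f f2 xs ys"
    by (simp add: nths_all)
  finally show ?thesis
    using assms second_order_cumulant.simps[of f f2 xs ys] by simp
qed

section \<open>The functions of lists of pairs of spectral parameters and matrices\<close>

definition ntr :: "complex^'n^'n \<Rightarrow> complex" where
  "ntr A = trace A / of_nat CARD('n)"

definition matrix_prod_list :: "(complex^'n^'n) list \<Rightarrow> complex^'n^'n" where
  "matrix_prod_list As = foldr (**) As (mat 1)"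

definition mfrak :: "(complex \<times> (complex^'n^'n)) list \<Rightarrow> complex" where
  "mfrak Ts = (\<Sum>P\<in>NCP {..<length Ts}.
     (\<Prod>B\<in>kreweras {..<length Ts} P. ntr (matrix_prod_list (map snd (nths Ts B))))
     * (\<Prod>B\<in>P. free_cumulant mdd (map fst (nths Ts B))))"

(* Replaces the last entry (z, A) of a nonempty list by (z, Id), e.g. [T_j, ..., T_(n-1), G_n]. *)
definition close_list :: "(complex \<times> (complex^'n^'n)) list \<Rightarrow> (complex \<times> (complex^'n^'n)) list" where
  "close_list Ts = butlast Ts @ [(fst (last Ts), mat 1)]"

lemma length_close_list: "0 < length Ts \<Longrightarrow> length (close_list Ts) = length Ts"
  by (simp add: close_list_def)

(* The list [T_(k+j), ..., T_(k+l), T_(k+1), ..., T_(k+j-1), G_(k+j)] appearing below is obtained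
   from b = [T_(k+1), ..., T_(k+l)] by rotation. *)
definition sfrak_GUE ::
  "(complex \<times> (complex^'n^'n)) list \<Rightarrow> (complex \<times> (complex^'n^'n)) list \<Rightarrow> complex" where
  "sfrak_GUE a b =
     (let q = qsc (fst (hd a)) (fst (last a));
          t = ntr (snd (last a))
      in \<Sum>j = 1..length b.
           mfrak (a @ rotate (j - 1) b @ [(fst (b ! (j - 1)), mat 1)])
           + q * t * mfrak (close_list a @ rotate (j - 1) b @ [(fst (b ! (j - 1)), mat 1)]))"

(* The recursion shortens the first argument, so it determines the function together with its
   vanishing for an empty first argument. The vanishing for an empty second argument and the
   symmetry are consequences and are not needed as part of the definition. *)
function mfrak_GUE ::
  "(complex \<times> (complex^'n^'n)) list \<Rightarrow> (complex \<times> (complex^'n^'n)) list \<Rightarrow> complex" where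
  "mfrak_GUE a b =
     (if a = [] then 0 else
      let k = length a;
          z1 = fst (hd a); A1 = snd (hd a);
          zk = fst (last a); Ak = snd (last a);
          q = qsc z1 zk
      in msc z1 *
         ((if k = 1 then 0
           else mfrak_GUE (tl (butlast a) @ [(zk, Ak ** A1)]) b
                + q * mfrak_GUE (tl (butlast a) @ [(zk, A1)]) b * ntr Ak)
          + (\<Sum>j = 1..k - 1. mfrak_GUE (close_list (take j a)) b
               * (mfrak (drop (j - 1) a) + q * mfrak (close_list (drop (j - 1) a)) * ntr Ak))
          + (\<Sum>j = 2..k. mfrak (close_list (take j a))
               * (mfrak_GUE (drop (j - 1) a) b
                  + q * mfrak_GUE (close_list (drop (j - 1) a)) b * ntr Ak))
          + sfrak_GUE a b))"
  by pat_completeness auto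
termination
proof (relation "Wellfounded.measure (\<lambda>(a, b). length a)", goal_cases)
  case (2 a b k)
  then have "length a \<noteq> 0" "length a \<noteq> 1" by blast+
  then have "2 \<le> length a" by linarith
  then show ?case by simp
next
  case (3 a b k)
  then have "length a \<noteq> 0" "length a \<noteq> 1" by blast+
  then have "2 \<le> length a" by linarith
  then show ?case by simp
next
  case (4 a b k z1 A1 zk Ak q j)
  then have "j \<in> {1..length a - 1}" "a \<noteq> []" by blast+
  then have "1 \<le> j" "j < length a"
    using length_greater_0_conv[of a] by (simp, force)
  then show ?case by (simp add: length_close_list)
next
  case (5 a b k z1 A1 zk Ak q j)
  then have "j \<in> {2..length a}" by blast
  then have "2 \<le> j" "j \<le> length a" by simp_all
  then show ?case by simp
next
  case (6 a b k z1 A1 zk Ak q j)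
  then have "j \<in> {2..length a}" by blast
  then have "2 \<le> j" "j \<le> length a" by simp_all
  then show ?case by (simp add: length_close_list)
next
  case 1 show ?case by (rule wf_measure)
qed

declare mfrak_GUE.simps [simp del]

lemma mfrak_GUE_Nil [simp]: "mfrak_GUE [] b = 0"
  by (subst mfrak_GUE.simps) simp

(* All matrices equal to the identity. The value does not depend on the matrix size N = CARD('n),
   which is only passed to fix the type. *)
definition m_GUE :: "'n::finite itself \<Rightarrow> complex list \<Rightarrow> complex list \<Rightarrow> complex" where
  "m_GUE _ zs ws = mfrak_GUE (map (\<lambda>z. (z, mat 1 :: complex^'n^'n)) zs) (map (\<lambda>w. (w, mat 1)) ws)"

definition m_circ :: "complex list \<Rightarrow> complex" where
  "m_circ = free_cumulant mdd"

definition m_circcirc :: "'n::finite itself \<Rightarrow> complex list \<Rightarrow> complex list \<Rightarrow> complex" where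
  "m_circcirc N = second_order_cumulant mdd (m_GUE N)"

end

theory Submission
  imports Defs "HOL-Complex_Analysis.Complex_Analysis" "HOL-Computational_Algebra.Polynomial"
begin

text \<open>Both sides are sums over permutations. A genus bound limits the number of cycles of a permutation p
plus that of its complement; non-crossing partitions of a word are the permutations attaining the bound for
one circle (\<open>disc\<close>), annular non-crossing permutations those attaining the bound for two joined circles
(\<open>annulus\<close>). Blocks become cycles, the Kreweras complement becomes \<open>inv p o cl w\<close>, and the right-hand side
becomes \<open>circ_sum\<close>, with a weight \<open>\<tau>\<close> on the cycles of the complement (traces), a weight \<open>\<kappa>\<close> on
the cycles of p (first-order cumulants) and a weight \<open>\<kappa>\<kappa>\<close> on the marked pair. Planar geometry is replaced by
left multiplication with transpositions, which split and join the cycle of the first letter.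

The recursion that defines the left-hand side is the solution, for its term j = k, of
X[T_1..T_k|b] = m_1 (X[T_2..G_k A_k A_1|b] + sum over j = 1..k of X[T_1..G_j|b] m[T_j..T_k]
+ sum over j = 2..k of m[T_1..G_j] X[T_j..T_k|b] + sum over x in b of m[T_1..T_k,T_x..,G_x]).
When \<open>circ_sum\<close> is inserted for X, the difference of the two sides is computed for arbitrary weights in
\<open>two_circle_expansion\<close>: it is a sum over pairs of planar permutations whose summands are a product of the weights
\<open>\<tau>\<close> with a quantity, \<open>defect2\<close>, that depends on the cumulants only and on no more than the cycle of the
first letter and one cycle of the other circle. The matrices therefore cannot influence whether the defects vanish.
For identity matrices \<open>circ_sum\<close> is the function m_GUE, by the definition of the second-order cumulants, and the
recursion holds; the summand of the pair of one-cycle permutations is the defect of the two full words, and all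
other summands vanish by induction. So every defect vanishes (\<open>defect2_m_circcirc\<close>), the recursion holds for
all matrices, and induction on the length of the first word proves the theorem (\<open>mfrak_GUE_circ_sum\<close>).

The same argument on one circle turns a recursion for the divided differences of m into the vanishing of the
first-order defect (\<open>defect_m_circ\<close>). That recursion (\<open>mdd_recursion\<close>) is the Leibniz rule applied to
m^2 + z m + 1 = 0, which is obtained from the integral by the substitution x = 2 cos t.\<close>

section \<open>Cycles of permutations\<close>

lemmas sum_congI = sum.cong[OF refl]

abbreviation swp :: "'a => 'a => 'a => 'a" where
 "swp \<equiv> Transposition.transpose"

text \<open>Stability of T under p is enough, so that p can also be restricted to a union of its cycles.\<close>

definition perm_on :: "'a set => ('a => 'a) => bool" where
 "perm_on T p \<longleftrightarrow> finite T \<and> permutation p \<and> p ` T = T"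

definition cycle_list :: "('a => 'a) => 'a list => bool" where
 "cycle_list p c \<longleftrightarrow> c ~= [] \<and> distinct c \<and> map p c = rotate1 c"

definition orbs :: "'a set => ('a => 'a) => 'a set set" where
 "orbs T p = orbit p ` T"

definition ncyc :: "'a set => ('a => 'a) => nat" where
 "ncyc T p = card (orbs T p)"

definition rot_inv :: "('a list => 'b) => bool" where
 "rot_inv f \<longleftrightarrow> (\<forall>c. f (rotate1 c) = f c)"

text \<open>The choice of the starting point of a cycle is irrelevant as soon as f is invariant under rotation.\<close>

definition cprod :: "'a set => ('a list => 'r::comm_ring_1) => ('a => 'a) => 'r" where
 "cprod T f p = (\<Prod>X\<in>orbs T p. f (support p (SOME i. i \<in> X)))"

lemma rot_inv_rotate: "rot_inv f ==> f (rotate n c) = f c"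
 by (induction n) (auto simp: rot_inv_def)

lemma perm_onD:
 assumes "perm_on T p"
 shows "finite T" "permutation p" "p ` T = T" "bij p" "inj p" "!!x. x \<in> T ==> p x \<in> T"
  "!!x. p x \<in> T ==> x \<in> T"
proof -
 show *: "finite T" "permutation p" "p ` T = T" using assms by (auto simp: perm_on_def)
 show "bij p" using *(2) by (simp add: permutation_bijective)
 thus "inj p" by (simp add: bij_is_inj)
 thus "!!x. p x \<in> T ==> x \<in> T" using *(3) by (metis image_iff injD)
 show "!!x. x \<in> T ==> p x \<in> T" using *(3) by blast
qed

lemma orbit_sub: "perm_on T p ==> x \<in> T ==> orbit p x <= T"
proof
 fix y assume a: "perm_on T p" "x \<in> T" "y \<in> orbit p x"
 from a(3) show "y \<in> T" by induction (use a perm_onD in auto)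
qed

lemma in_own_orbit: "perm_on T p ==> x \<in> orbit p x"
 by (simp add: perm_onD(2) permutation_self_in_orbit)

lemma orbit_eq_iff:
 assumes "permutation p" shows "orbit p x = orbit p y \<longleftrightarrow> x \<in> orbit p y"
 using orbit_cyclic_eq3[OF cyclic_on_orbit'[OF assms, of y], of x] permutation_self_in_orbit[OF assms, of x]
 by auto

lemma orbit_sym: "permutation p ==> x \<in> orbit p y \<longleftrightarrow> y \<in> orbit p x"
 using orbit_eq_iff[of p x y] orbit_eq_iff[of p y x] by auto

lemma cycle_list_rotate: "cycle_list p c ==> cycle_list p (rotate n c)"
proof (induction n)
 case (Suc n)
 hence "cycle_list p (rotate n c)" by simp
 hence "cycle_list p (rotate1 (rotate n c))"
  unfolding cycle_list_def by (metis rotate1_map distinct1_rotate rotate1_is_Nil_conv)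
 thus ?case by simp
qed simp

lemma cycle_list_nth:
 assumes "cycle_list p c" "i < length c"
 shows "p (c ! i) = c ! (Suc i mod length c)"
 using assms by (metis cycle_list_def nth_map nth_rotate1)

lemma cycle_list_nth_funpow:
 assumes "cycle_list p c" "i < length c"
 shows "c ! i = (p ^^ i) (hd c)"
 using assms(2)
proof (induction i)
 case 0 thus ?case using assms by (simp add: hd_conv_nth cycle_list_def)
next
 case (Suc i)
 thus ?case using cycle_list_nth[OF assms(1), of i] by simp
qed

lemma cycle_list_closed:
 assumes "cycle_list p c" shows "p ` set c = set c"
 using assms by (metis cycle_list_def list.set_map set_rotate1)

lemma cycle_list_orbit:
 assumes "cycle_list p c" "x \<in> set c"
 shows "orbit p x = set c"
proof
 show "orbit p x <= set c"
 proof
  fix y assume "y \<in> orbit p x"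
  thus "y \<in> set c" by induction (use assms cycle_list_closed in blast)+
 qed
 obtain n where n: "n < length c" "c ! n = x" using assms(2) by (auto simp: in_set_conv_nth)
 define d where "d = rotate n c"
 have d: "cycle_list p d" "hd d = x" "set d = set c"
  using n assms cycle_list_rotate[OF assms(1), of n] hd_rotate_conv_nth[of c n]
  by (auto simp: d_def cycle_list_def)
 have dl: "d ~= []" using d by (simp add: cycle_list_def)
 have "p (last d) = hd d"
  using cycle_list_nth[OF d(1), of "length d - 1"] dl by (simp add: last_conv_nth hd_conv_nth)
 have *: "d ! i \<in> orbit p x \<or> i = 0" if "i < length d" for i
  using cycle_list_nth_funpow[OF d(1) that] d(2) by (auto simp: orbit_altdef)
 have "x \<in> orbit p x"
 proof (cases "length d = 1")
  case True
  hence "last d = hd d" using dl by (cases d) auto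
  thus ?thesis using \<open>p (last d) = hd d\<close> d(2) by (metis orbit.base)
 next
  case False
  hence "length d - 1 < length d" "length d - 1 ~= 0" using dl by (cases d; simp)+
  hence "last d \<in> orbit p x" using *[of "length d - 1"] dl by (simp add: last_conv_nth)
  thus ?thesis using \<open>p (last d) = hd d\<close> d(2) by (metis orbit.step)
 qed
 hence "d ! i \<in> orbit p x" if "i < length d" for i
  using *[OF that] d(2) dl by (metis hd_conv_nth)
 hence "set d <= orbit p x" by (auto simp: in_set_conv_nth)
 thus "set c <= orbit p x" using d(3) by simp
qed

lemma cycle_support:
 assumes "permutation p" shows "cycle_list p (support p x)" "hd (support p x) = x"
proof -
 let ?n = "least_power p x"
 have n: "(p ^^ ?n) x = x" "?n > 0" using least_power_of_permutation[OF assms] by auto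
 have "map p (support p x) = rotate1 (support p x)"
 proof (rule nth_equalityI)
  fix i assume "i < length (map p (support p x))"
  hence i: "i < ?n" by simp
  show "map p (support p x) ! i = rotate1 (support p x) ! i"
  proof (cases "Suc i = ?n")
   case True
   thus ?thesis using i n by (simp add: nth_rotate1) (metis comp_apply funpow.simps(2))
  next
   case False
   thus ?thesis using i n by (simp add: nth_rotate1)
  qed
 qed simp
 thus "cycle_list p (support p x)"
  using cycle_of_permutation[OF assms] n by (auto simp: cycle_list_def)
 show "hd (support p x) = x" using n by (simp add: hd_map)
qed

lemma set_support: "permutation p ==> set (support p x) = orbit p x"
 using cycle_list_orbit[OF cycle_support(1), of p x x] cycle_support[of p x]
 by (metis cycle_list_def hd_in_set)

lemma cycle_list_eq_hd:
 assumes "cycle_list p c" "cycle_list p d" "hd c = hd d"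
 shows "c = d"
proof -
 have s: "set c = set d"
  using cycle_list_orbit[OF assms(1), of "hd c"] cycle_list_orbit[OF assms(2), of "hd c"] assms
  by (metis cycle_list_def hd_in_set)
 hence l: "length c = length d" using assms by (metis cycle_list_def distinct_card)
 show ?thesis
  by (rule nth_equalityI) (use l assms cycle_list_nth_funpow in metis)+
qed

lemma support_eqI:
 assumes "permutation p" "cycle_list p c" shows "support p (hd c) = c"
 using cycle_list_eq_hd[OF cycle_support(1)[OF assms(1)] assms(2)]
  cycle_support(2)[OF assms(1)] by simp

lemma rot_inv_cycle_list:
 assumes "rot_inv f" "cycle_list p c" "cycle_list p d" "set c = set d"
 shows "f c = f d"
proof -
 have "hd d \<in> set c" using assms by (simp add: cycle_list_def)
 then obtain n where n: "n < length c" "c ! n = hd d" by (auto simp: in_set_conv_nth)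
 have "rotate n c = d"
  by (rule cycle_list_eq_hd[OF cycle_list_rotate[OF assms(2)] assms(3)])
   (use n assms in "auto simp: hd_rotate_conv_nth cycle_list_def")
 thus ?thesis using rot_inv_rotate[OF assms(1), of n c] by simp
qed

lemma finite_orbs: "finite T ==> finite (orbs T p)" by (simp add: orbs_def)

lemma orbs_union: "orbs (S Un T) p = orbs S p Un orbs T p" by (auto simp: orbs_def)

lemma orbs_disjoint:
 assumes "perm_on S p" "S Int T = {}" "perm_on T p"
 shows "orbs S p Int orbs T p = {}"
proof -
 have False if "X \<in> orbs S p" "X \<in> orbs T p" for X
 proof -
  obtain x y where x: "x \<in> S" "X = orbit p x" and y: "y \<in> T" "X = orbit p y"
   using \<open>X \<in> orbs S p\<close> \<open>X \<in> orbs T p\<close> by (auto simp: orbs_def)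
  hence "x \<in> T" using in_own_orbit[OF assms(1), of x]
   orbit_sub[OF assms(3), of y] by auto
  thus False using x assms by auto
 qed
 thus ?thesis by blast
qed

lemma ncyc_union:
 assumes "perm_on S p" "perm_on T p" "S Int T = {}"
 shows "ncyc (S Un T) p = ncyc S p + ncyc T p"
 unfolding ncyc_def orbs_union
 by (rule card_Un_disjoint) (use assms orbs_disjoint finite_orbs perm_onD in metis)+

lemma cprod_union:
 assumes "perm_on S p" "perm_on T p" "S Int T = {}"
 shows "cprod (S Un T) f p = cprod S f p * cprod T f p"
 unfolding cprod_def orbs_union
 by (rule prod.union_disjoint) (use assms orbs_disjoint finite_orbs perm_onD in metis)+

lemma cycle_list_perm_on:
 "permutation p ==> cycle_list p c ==> perm_on (set c) p"
 by (simp add: perm_on_def cycle_list_closed)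

lemma perm_on_Diff: "perm_on S p ==> perm_on T p ==> perm_on (S - T) p"
 unfolding perm_on_def by (metis finite_Diff image_set_diff permutation_bijective bij_is_inj)

lemma perm_on_Un: "perm_on S p ==> perm_on T p ==> perm_on (S Un T) p"
 unfolding perm_on_def by (simp add: image_Un)

lemma perm_on_compose: "perm_on S p ==> perm_on S q ==> perm_on S (p o q)"
 unfolding perm_on_def by (metis image_comp permutation_compose)

lemma perm_on_inv: "perm_on S p ==> perm_on S (inv p)"
 unfolding perm_on_def
 by (metis permutation_inverse permutation_bijective bij_is_inj image_inv_f_f)

lemma perm_on_transpose: "finite S ==> a \<in> S ==> b \<in> S ==> perm_on S (swp a b)"
 unfolding perm_on_def by (simp add: permutation_swap_id)

lemma permutes_perm_on: "p permutes S ==> finite S ==> perm_on S p"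
 unfolding perm_on_def by (auto simp: permutes_image permutation_permutes)

lemma permutes_perm_on_superset:
 "p permutes S ==> S <= T ==> finite T ==> perm_on T p"
 by (rule permutes_perm_on[OF permutes_subset])

lemma perm_on_finite_closed: "finite T ==> permutation p ==> p ` T <= T ==> perm_on T p"
 unfolding perm_on_def
 by (metis permutation_bijective bij_is_inj endo_inj_surj inj_on_subset subset_UNIV)

lemma orbs_cycle_list: "cycle_list p c ==> orbs (set c) p = {set c}"
 unfolding orbs_def using cycle_list_orbit[of p c] cycle_list_def[of p c]
 by (auto simp: image_iff intro: hd_in_set)

lemma ncyc_cycle_list: "cycle_list p c ==> ncyc (set c) p = 1"
 by (simp add: ncyc_def orbs_cycle_list)

lemma cprod_cycle_list:
 assumes "permutation p" "rot_inv f" "cycle_list p c"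
 shows "cprod (set c) f p = f c"
proof -
 define i where "i = (SOME i. i \<in> set c)"
 have i: "i \<in> set c" unfolding i_def using assms(3) by (metis cycle_list_def hd_in_set someI)
 have "f (support p i) = f c"
  using assms cycle_list_orbit[OF assms(3) i]
  by (intro rot_inv_cycle_list[of f p]) (auto simp: cycle_support simp del: set_map simp add: set_support)
 thus ?thesis by (simp add: cprod_def orbs_cycle_list[OF assms(3)] i_def)
qed

lemma cprod_remove_cycle:
 assumes "perm_on T p" "rot_inv f" "cycle_list p c" "set c <= T"
 shows "cprod T f p = f c * cprod (T - set c) f p"
proof -
 have p: "permutation p" using assms perm_onD by metis
 have "T = set c Un (T - set c)" using assms by auto
 hence "cprod T f p = cprod (set c) f p * cprod (T - set c) f p"
  using cprod_union[of "set c" p "T - set c" f] assms cycle_list_perm_on[OF p assms(3)]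
  by (metis Diff_disjoint perm_on_Diff)
 thus ?thesis using cprod_cycle_list[OF p assms(2,3)] by simp
qed

lemma ncyc_remove_cycle:
 assumes "perm_on T p" "cycle_list p c" "set c <= T"
 shows "ncyc T p = Suc (ncyc (T - set c) p)"
proof -
 have p: "permutation p" using assms perm_onD by metis
 have "T = set c Un (T - set c)" using assms by auto
 hence "ncyc T p = ncyc (set c) p + ncyc (T - set c) p"
  using ncyc_union[of "set c" p "T - set c"] assms cycle_list_perm_on[OF p assms(2)]
  by (metis Diff_disjoint perm_on_Diff)
 thus ?thesis using ncyc_cycle_list[OF assms(2)] by simp
qed

lemma orbit_cong_on:
 assumes "perm_on T p" "!!x. x \<in> T ==> p x = q x" "x \<in> T"
 shows "orbit p x = orbit q x"
proof (rule orbit_cong0)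
 show "x \<in> T" "p \<in> T \<rightarrow> T" using assms(3) perm_onD(6)[OF assms(1)] by auto
qed (use assms in auto)

lemma orbs_cong:
 assumes "perm_on T p" "!!x. x \<in> T ==> p x = q x"
 shows "orbs T p = orbs T q"
 unfolding orbs_def using orbit_cong_on[OF assms] by auto

lemma ncyc_cong:
 assumes "perm_on T p" "!!x. x \<in> T ==> p x = q x"
 shows "ncyc T p = ncyc T q"
 unfolding ncyc_def using orbs_cong[OF assms] by simp

lemma cycle_list_cong: "(!!x. x \<in> set c ==> p x = q x) ==> cycle_list p c = cycle_list q c"
 unfolding cycle_list_def by (metis (mono_tags, lifting) map_eq_conv)

lemma cprod_cong_perm:
 assumes "perm_on T p" "permutation q" "!!x. x \<in> T ==> p x = q x"
 shows "cprod T f p = cprod T f q"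
proof -
 have *: "support p x = support q x" if "x \<in> T" for x
 proof -
  have "cycle_list q (support p x)"
  proof -
   have "set (support p x) <= T"
    using set_support[of p x] orbit_sub[OF assms(1) that] perm_onD(2)[OF assms(1)] by simp
   thus ?thesis
    using cycle_support(1)[of p x] cycle_list_cong[of "support p x" p q] assms perm_onD(2)[OF assms(1)]
    by blast
  qed
  thus ?thesis using support_eqI[OF assms(2)] cycle_support(2)[of p x] perm_onD(2)[OF assms(1)]
   by metis
 qed
 have "(SOME i. i \<in> X) \<in> T" if X: "X \<in> orbs T p" for X
 proof -
  obtain x where x: "x \<in> T" "X = orbit p x" using X by (auto simp: orbs_def)
  hence "(SOME i. i \<in> X) \<in> X" using in_own_orbit[OF assms(1), of x] by (auto intro: someI)
  thus ?thesis using orbit_sub[OF assms(1)] x by auto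
 qed
 hence "f (support p (SOME i. i \<in> X)) = f (support q (SOME i. i \<in> X))" if "X \<in> orbs T p" for X
  using *[of "SOME i. i \<in> X"] that by simp
 hence "cprod T f p = (\<Prod>X\<in>orbs T p. f (support q (SOME i. i \<in> X)))"
  unfolding cprod_def by (rule prod.cong[OF refl])
 thus ?thesis unfolding cprod_def using orbs_cong[OF assms(1,3)] by simp
qed

lemma cprod_cong_fun:
 assumes "perm_on T p" "!!c. cycle_list p c ==> set c <= T ==> f c = g c"
 shows "cprod T f p = cprod T g p"
 unfolding cprod_def
proof (rule prod.cong[OF refl])
 fix X assume "X \<in> orbs T p"
 then obtain x where x: "x \<in> T" "X = orbit p x" by (auto simp: orbs_def)
 define i where "i = (SOME i. i \<in> X)"
 have "i \<in> X" using in_own_orbit[OF assms(1), of x] x unfolding i_def by (auto intro: someI)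
 hence "i \<in> T" using orbit_sub[OF assms(1)] x by auto
 have "f (support p i) = g (support p i)"
  using assms perm_onD(2)[OF assms(1)] orbit_sub[OF assms(1) \<open>i \<in> T\<close>]
  by (intro assms(2)) (auto simp: cycle_support set_support simp del: set_map)
 thus "f (support p (SOME i. i \<in> X)) = g (support p (SOME i. i \<in> X))" by (simp add: i_def)
qed

lemma ncyc_empty [simp]: "ncyc {} p = 0" by (simp add: ncyc_def orbs_def)

lemma cprod_empty [simp]: "cprod {} f p = 1" by (simp add: cprod_def orbs_def)

lemma cycle_list_single: "p e = e ==> cycle_list p [e]" by (simp add: cycle_list_def)

lemma ncyc_insert_fixed:
 assumes "perm_on T p" "p e = e" "e ~: T"
 shows "ncyc (insert e T) p = Suc (ncyc T p)"
proof -
 have "perm_on (insert e T) p" using assms unfolding perm_on_def by auto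
 from ncyc_remove_cycle[OF this cycle_list_single[of p e, OF assms(2)]]
 show ?thesis using assms by simp
qed

lemma cprod_insert_fixed:
 assumes "perm_on T p" "p e = e" "e ~: T" "rot_inv f"
 shows "cprod (insert e T) f p = f [e] * cprod T f p"
proof -
 have "perm_on (insert e T) p" using assms unfolding perm_on_def by auto
 from cprod_remove_cycle[OF this assms(4) cycle_list_single[of p e, OF assms(2)]]
 show ?thesis using assms by simp
qed

subsection \<open>Joining and splitting cycles by a transposition\<close>

lemma rotate1_append: "c1 ~= [] ==> c2 ~= [] ==> rotate1 (c1 @ c2) = (tl c1 @ [hd c2]) @ (tl c2 @ [hd c1])"
 by (cases c1; cases c2) auto

lemma rotate1_hd_tl: "c ~= [] ==> rotate1 c = tl c @ [hd c]"
 by (cases c) auto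

lemma map_transpose_id: "a ~: set l ==> b ~: set l ==> map (swp a b) l = l"
 by (induction l) (auto simp: Transposition.transpose_def)

lemma hd_notin_tl: "distinct c ==> c ~= [] ==> hd c ~: set (tl c)"
 by (cases c) auto

text \<open>Left multiplication by the transposition of two first letters exchanges the successors that lead to them,
so a cycle falls apart into the two arcs that start at these letters; the next lemma reverses this.\<close>

lemma cycle_list_append_split:
 assumes "cycle_list p (c1 @ c2)" "c1 ~= []" "c2 ~= []"
 shows "cycle_list (swp (hd c1) (hd c2) o p) c1" "cycle_list (swp (hd c1) (hd c2) o p) c2"
proof -
 let ?t = "swp (hd c1) (hd c2)"
 have d: "distinct (c1 @ c2)" and m: "map p (c1 @ c2) = (tl c1 @ [hd c2]) @ (tl c2 @ [hd c1])"
  using assms rotate1_append[of c1 c2] by (auto simp: cycle_list_def)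
 have m1: "map p c1 = tl c1 @ [hd c2]" and m2: "map p c2 = tl c2 @ [hd c1]"
  using m assms(2) append_eq_append_conv[of "map p c1" "tl c1 @ [hd c2]" "map p c2" "tl c2 @ [hd c1]"]
  by (simp_all del: append_assoc add: Suc_diff_1)
 have ND: "distinct c1" "distinct c2" "set c1 Int set c2 = {}" "c1 ~= []" "c2 ~= []"
  using d assms by auto
 have h: "hd c1 \<in> set c1" "hd c2 \<in> set c2" "set (tl c1) <= set c1" "set (tl c2) <= set c2"
  using assms by (auto simp: list.set_sel(2))
 have n: "hd c1 ~: set (tl c1)" "hd c2 ~: set (tl c2)" using ND hd_notin_tl by auto
 have n': "hd c2 ~: set (tl c1)" "hd c1 ~: set (tl c2)" using ND h by (meson disjoint_iff subsetD)+
 note n = n n'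
 have "map (?t o p) c1 = rotate1 c1"
  using m1 n assms by (simp add: map_map[symmetric] map_transpose_id rotate1_hd_tl del: map_map)
 moreover have "map (?t o p) c2 = rotate1 c2"
  using m2 n assms by (simp add: map_map[symmetric] map_transpose_id rotate1_hd_tl del: map_map)
 ultimately show "cycle_list (?t o p) c1" "cycle_list (?t o p) c2"
  using assms d by (auto simp: cycle_list_def)
qed

lemma cycle_list_append_join:
 assumes "cycle_list p c1" "cycle_list p c2" "set c1 Int set c2 = {}"
 shows "cycle_list (swp (hd c1) (hd c2) o p) (c1 @ c2)"
proof -
 let ?t = "swp (hd c1) (hd c2)"
 have ne: "c1 ~= []" "c2 ~= []" and d: "distinct (c1 @ c2)" using assms by (auto simp: cycle_list_def)
 have ND: "distinct c1" "distinct c2" "set c1 Int set c2 = {}" "c1 ~= []" "c2 ~= []"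
  using d ne by auto
 have h: "hd c1 \<in> set c1" "hd c2 \<in> set c2" "set (tl c1) <= set c1" "set (tl c2) <= set c2"
  using ne by (auto simp: list.set_sel(2))
 have n: "hd c1 ~: set (tl c1)" "hd c2 ~: set (tl c2)" using ND hd_notin_tl by auto
 have n': "hd c2 ~: set (tl c1)" "hd c1 ~: set (tl c2)" using ND h by (meson disjoint_iff subsetD)+
 note n = n n'
 have m: "map p c1 = tl c1 @ [hd c1]" "map p c2 = tl c2 @ [hd c2]"
  using assms ne by (auto simp: cycle_list_def rotate1_hd_tl)
 have "map (?t o p) (c1 @ c2) = rotate1 (c1 @ c2)"
  using m n ne by (simp add: map_map[symmetric] map_transpose_id rotate1_append del: map_map)
 thus ?thesis using ne d by (auto simp: cycle_list_def)
qed

lemma transpose_outside_cycles: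
 assumes "permutation p" "p ` A = A" "a \<in> A" "b \<in> A" "x ~: A"
 shows "(swp a b o p) x = p x"
proof -
 have "p x ~: A" using assms by (metis bij_is_inj image_iff injD permutation_bijective)
 thus ?thesis using assms by (auto simp: Transposition.transpose_def)
qed

lemma exists_cycle_list:
 assumes "permutation p" obtains c where "cycle_list p c" "hd c = x" "set c = orbit p x"
 using assms cycle_support set_support by metis

lemma ncyc_join:
 assumes "perm_on S p" "a \<in> S" "b \<in> S" "b ~: orbit p a"
 shows "Suc (ncyc S (swp a b o p)) = ncyc S p"
proof -
 have p: "permutation p" using assms perm_onD by metis
 obtain c1 where c1: "cycle_list p c1" "hd c1 = a" "set c1 = orbit p a" using exists_cycle_list[OF p] .
 obtain c2 where c2: "cycle_list p c2" "hd c2 = b" "set c2 = orbit p b" using exists_cycle_list[OF p] .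
 let ?q = "swp a b o p"
 have dis: "set c1 Int set c2 = {}" using c1 c2 assms(4) p
  by (metis disjoint_iff orbit_eq_iff)
 have q: "perm_on S ?q" using assms perm_on_compose perm_on_transpose perm_onD(1) by metis
 have j: "cycle_list ?q (c1 @ c2)" using cycle_list_append_join[OF c1(1) c2(1) dis] c1 c2 by simp
 have sub: "set c1 <= S" "set c2 <= S" using c1 c2 orbit_sub assms by metis+
 have mem: "a \<in> set c1" "b \<in> set c2" using c1 c2 p by (simp_all add: permutation_self_in_orbit)
 have 1: "ncyc S ?q = Suc (ncyc (S - set (c1 @ c2)) ?q)" by (rule ncyc_remove_cycle[OF q j]) (use sub in auto)
 have 2: "ncyc S p = Suc (ncyc (S - set c1) p)" by (rule ncyc_remove_cycle[OF assms(1) c1(1) sub(1)])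
 have 3: "ncyc (S - set c1) p = Suc (ncyc (S - set c1 - set c2) p)"
  by (rule ncyc_remove_cycle[OF perm_on_Diff[OF assms(1) cycle_list_perm_on[OF p c1(1)]] c2(1)]) (use sub dis in auto)
 have 4: "ncyc (S - set (c1 @ c2)) p = ncyc (S - set (c1 @ c2)) ?q"
 proof (rule ncyc_cong)
  show "perm_on (S - set (c1 @ c2)) p"
   using perm_on_Diff[OF assms(1) perm_on_Un[OF cycle_list_perm_on[OF p c1(1)] cycle_list_perm_on[OF p c2(1)]]] by simp
  fix x assume "x \<in> S - set (c1 @ c2)"
  thus "p x = ?q x"
   using transpose_outside_cycles[OF p, of "set c1 Un set c2" a b x] mem cycle_list_closed[OF c1(1)] cycle_list_closed[OF c2(1)]
   by (simp add: image_Un)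
 qed
 have 5: "S - set c1 - set c2 = S - set (c1 @ c2)" by auto
 show ?thesis using 1 2 3 4 5 by simp
qed

lemma split_cycle_obtain:
 assumes "permutation p" "a ~= b" "b \<in> orbit p a"
 obtains c1 c2 where "cycle_list p (c1 @ c2)" "c1 ~= []" "c2 ~= []" "hd c1 = a" "hd c2 = b"
  "set (c1 @ c2) = orbit p a"
proof -
 obtain c where c: "cycle_list p c" "hd c = a" "set c = orbit p a" using exists_cycle_list[OF assms(1)] .
 then obtain n where n: "n < length c" "c ! n = b" using assms by (metis in_set_conv_nth)
 have n0: "n > 0" using c n assms(2) by (metis cycle_list_def gr0I hd_conv_nth)
 show ?thesis
 proof (rule that[of "take n c" "drop n c"])
  show "cycle_list p (take n c @ drop n c)" "set (take n c @ drop n c) = orbit p a" using c by simp_all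
  show "take n c ~= []" "drop n c ~= []" "hd (drop n c) = b" "hd (take n c) = a"
   using n n0 c(2) by (auto simp: hd_drop_conv_nth)
 qed
qed

lemma ncyc_split:
 assumes "perm_on S p" "a \<in> S" "a ~= b" "b \<in> orbit p a"
 shows "ncyc S (swp a b o p) = Suc (ncyc S p)" "b ~: orbit (swp a b o p) a"
proof -
 have p: "permutation p" using assms perm_onD by metis
 obtain c1 c2 where c: "cycle_list p (c1 @ c2)" "c1 ~= []" "c2 ~= []" "hd c1 = a" "hd c2 = b"
  "set (c1 @ c2) = orbit p a" using split_cycle_obtain[OF p assms(3,4)] .
 let ?q = "swp a b o p"
 have b: "b \<in> S" using orbit_sub[OF assms(1,2)] assms(4) by blast
 have s: "cycle_list ?q c1" using cycle_list_append_split(1)[OF c(1,2,3)] c(4,5) by simp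
 have "a \<in> set c1" using c(2,4) by auto
 hence o: "orbit ?q a = set c1" by (rule cycle_list_orbit[OF s])
 have "b \<in> set c2" using c(3,5) by auto
 moreover have "set c1 Int set c2 = {}" using c(1) by (simp add: cycle_list_def)
 ultimately show nb: "b ~: orbit ?q a" using o by auto
 have q: "perm_on S ?q"
  using perm_on_compose[OF perm_on_transpose assms(1)] assms(2) b perm_onD(1)[OF assms(1)] by blast
 have "swp a b o ?q = p" by (simp add: fun_eq_iff)
 thus "ncyc S ?q = Suc (ncyc S p)" using ncyc_join[OF q assms(2) b nb] by simp
qed

section \<open>The genus inequality\<close>

lemma inv_swp_comp:
 assumes "permutation p" shows "inv (swp a b o p) = inv p o swp a b"
 using assms by (simp add: o_inv_distrib permutation_bijective inv_swap_id)

lemma comp_swp: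
 assumes "permutation q" shows "q o swp a b = swp (q a) (q b) o q"
proof
 fix x
 have "inj q" using assms by (simp add: permutation_bijective bij_is_inj)
 thus "(q o swp a b) x = (swp (q a) (q b) o q) x"
  by (auto simp: Transposition.transpose_def inj_eq)
qed

lemma swp_swp_comp [simp]: "swp a b o (swp a b o p) = p"
 by (simp add: fun_eq_iff)

lemma perm_on_swp_comp: "perm_on S p ==> a \<in> S ==> b \<in> S ==> perm_on S (swp a b o p)"
 using perm_on_compose[OF perm_on_transpose[OF perm_onD(1)[of S p]], of a b p] by simp

lemma perm_on_inv_in: "perm_on S p ==> x \<in> S ==> inv p x \<in> S"
 using perm_onD(6)[OF perm_on_inv[of S p], of x] by simp

lemma perm_on_inv_f: "perm_on S p ==> inv p (p x) = x" "perm_on S p ==> p (inv p x) = x"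
 using perm_onD(4,5)[of S p] by (auto simp: bij_is_surj surj_f_inv_f)

lemma ncyc_swp_le:
 assumes "perm_on S p" "a \<in> S" "b \<in> S"
 shows "ncyc S (swp a b o p) \<le> Suc (ncyc S p)"
proof (cases "a = b \<or> b ~: orbit p a")
 case True thus ?thesis using ncyc_join[OF assms] by auto
next
 case False thus ?thesis using ncyc_split(1)[OF assms(1,2)] by auto
qed

text \<open>A transposition on the left of p becomes a transposition on the left of the complement. Every
count below compares the effect on p with the effect on the complement.\<close>

lemma kreweras_swp:
 assumes "perm_on S p"
 shows "inv (swp a b o p) o g = swp (inv p a) (inv p b) o (inv p o g)"
proof -
 have "permutation (inv p)" using assms perm_onD(2) perm_on_inv by metis
 thus ?thesis using inv_swp_comp[of p a b] comp_swp[of "inv p" a b] perm_onD(2)[OF assms]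
  by (simp add: comp_assoc[symmetric])
qed

lemma ncyc_le_card: "finite S ==> ncyc S p \<le> card S"
 unfolding ncyc_def orbs_def by (rule card_image_le)

definition transitive_on :: "'a set => ('a => 'a) => ('a => 'a) => bool" where
 "transitive_on S p g \<longleftrightarrow> (\<forall>T\<subseteq>S. p ` T = T \<longrightarrow> g ` T = T \<longrightarrow> T = {} \<or> T = S)"

lemma swp_image_same: "(a \<in> T \<longleftrightarrow> b \<in> T) ==> swp a b ` T = T"
 by (auto simp: Transposition.transpose_def image_iff split: if_splits)

lemma perm_on_subset: "perm_on S p ==> T <= S ==> p ` T = T ==> perm_on T p"
 unfolding perm_on_def using finite_subset by auto

text \<open>Euler's inequality for the surface glued from the cycles of p, of its complement and of g. Splitting a cycle
of p gives a permutation with one more cycle, while the complement gains or loses one. If the pair is then no longer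
transitive, S consists of two invariant parts, and the inequalities for the parts add up.\<close>

theorem genus_inequality:
 assumes "perm_on S p" "perm_on S g" "S ~= {}" "transitive_on S p g"
 shows "ncyc S p + ncyc S (inv p o g) + ncyc S g \<le> card S + 2"
 using assms
proof (induction "card S - ncyc S p" arbitrary: S p rule: less_induct)
 case less
 note p = less.prems(1) and g = less.prems(2)
 have fin: "finite S" using p perm_onD by metis
 show ?case
 proof (cases "\<forall>x\<in>S. p x = x")
  case True
  have "orbit p x = {x}" if "x \<in> S" for x using True that by (simp add: orbit_eq_singleton_iff)
  hence "orbs S p = (%x. {x}) ` S" by (auto simp: orbs_def)
  hence 1: "ncyc S p = card S" by (simp add: ncyc_def card_image)
  have "orbit g x = S" if "x \<in> S" for x
  proof -
   have sub: "orbit g x <= S" using orbit_sub[OF g that] .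
   have "p ` orbit g x = orbit g x" using True sub by force
   moreover have "g ` orbit g x = orbit g x"
    using cycle_list_closed[OF cycle_support(1)[OF perm_onD(2)[OF g], of x]]
     set_support[OF perm_onD(2)[OF g], of x] by simp
   ultimately show ?thesis using less.prems(4) sub in_own_orbit[OF g, of x]
    unfolding transitive_on_def by blast
  qed
  hence "orbs S g = {S}" using \<open>S ~= {}\<close> by (auto simp: orbs_def)
  hence 2: "ncyc S g = 1" by (simp add: ncyc_def)
  have "ncyc S (inv p o g) = ncyc S g"
  proof (rule ncyc_cong)
   show "perm_on S (inv p o g)" by (rule perm_on_compose[OF perm_on_inv[OF p] g])
   fix x assume "x \<in> S"
   hence "p (g x) = g x" using True perm_onD(6)[OF g] by blast
   thus "(inv p o g) x = g x" using perm_on_inv_f(1)[OF p, of "g x"] by simp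
  qed
  thus ?thesis using 1 2 by simp
 next
  case False
  then obtain a where a: "a \<in> S" "p a ~= a" by auto
  define b where "b = p a"
  have b: "b \<in> S" "a ~= b" "b \<in> orbit p a"
   using a perm_onD(6)[OF p] by (auto simp: b_def orbit.base)
  define q where "q = swp a b o p"
  have q: "perm_on S q" unfolding q_def by (rule perm_on_swp_comp[OF p a(1) b(1)])
  have pq: "p = swp a b o q" by (simp add: q_def)
  have nq: "ncyc S q = Suc (ncyc S p)" unfolding q_def by (rule ncyc_split(1)[OF p a(1) b(2,3)])
  have mea: "ncyc S q \<le> card S" by (rule ncyc_le_card[OF fin])
  have Kp: "inv p o g = swp (inv q a) (inv q b) o (inv q o g)"
   unfolding pq by (rule kreweras_swp[OF q])
  have Kq: "perm_on S (inv q o g)" by (rule perm_on_compose[OF perm_on_inv[OF q] g])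
  have ab: "inv q a \<in> S" "inv q b \<in> S" using a b perm_on_inv_in[OF q] by auto
  show ?thesis
  proof (cases "transitive_on S q g")
   case True
   have "ncyc S q + ncyc S (inv q o g) + ncyc S g \<le> card S + 2"
    by (rule less.hyps) (use q g less.prems True nq mea in auto)
   moreover have "ncyc S (inv p o g) \<le> Suc (ncyc S (inv q o g))"
    unfolding Kp by (rule ncyc_swp_le[OF Kq ab])
   ultimately show ?thesis using nq by simp
  next
   case False
   then obtain T0 where T0: "T0 <= S" "q ` T0 = T0" "g ` T0 = T0" "T0 ~= {}" "T0 ~= S"
    unfolding transitive_on_def by auto
   have inv_p: "T = {} \<or> T = S" if "T <= S" "q ` T = T" "g ` T = T" "a \<in> T \<longleftrightarrow> b \<in> T" for T
   proof -
    have "p ` T = T" unfolding pq using that(2) swp_image_same[OF that(4)] by (metis image_comp)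
    thus ?thesis using less.prems(4) that unfolding transitive_on_def by blast
   qed
   define T where "T = (if a \<in> T0 then T0 else S - T0)"
   have T0p: "perm_on T0 q" "perm_on T0 g" using T0 perm_on_subset q g by blast+
   have xor: "a \<in> T0 \<longleftrightarrow> b ~: T0" using inv_p[OF T0(1,2,3)] T0(4,5) by blast
   have T: "T <= S" "perm_on T q" "perm_on T g" "a \<in> T" "b ~: T"
    using T0 T0p xor a b perm_on_Diff[OF q T0p(1)] perm_on_Diff[OF g T0p(2)] by (auto simp: T_def)
   let ?U = "S - T"
   have U: "perm_on ?U q" "perm_on ?U g" "b \<in> ?U" "a ~: ?U"
    using T a b perm_on_Diff[OF q T(2)] perm_on_Diff[OF g T(3)] by auto
   have tr: "transitive_on X q g"
    if X: "X <= S" "perm_on X q" "perm_on X g" "a \<in> X \<longleftrightarrow> b ~: X" for X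
    unfolding transitive_on_def
   proof (intro allI impI)
    fix Y assume Y: "Y <= X" "q ` Y = Y" "g ` Y = Y"
    have Yp: "perm_on Y q" "perm_on Y g"
     using perm_on_subset[OF X(2) Y(1,2)] perm_on_subset[OF X(3) Y(1,3)] by simp_all
    show "Y = {} \<or> Y = X"
    proof (cases "a \<in> Y \<longleftrightarrow> b \<in> Y")
     case True
     hence "Y = {} \<or> Y = S" using inv_p[of Y] Y X by blast
     thus ?thesis using Y X by blast
    next
     case False
     have "X - Y <= S" "q ` (X - Y) = X - Y" "g ` (X - Y) = X - Y"
      using X perm_onD(3)[OF perm_on_Diff[OF X(2) Yp(1)]] perm_onD(3)[OF perm_on_Diff[OF X(3) Yp(2)]] by auto
     hence "X - Y = {} \<or> X - Y = S" using inv_p[of "X - Y"] False X Y by blast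
     thus ?thesis using Y X False by blast
    qed
   qed
   have un: "T Un ?U = S" "T Int ?U = {}" using T by auto
   have split: "ncyc S r = ncyc T r + ncyc ?U r" if "perm_on T r" "perm_on ?U r" for r
    using ncyc_union[OF that un(2)] un(1) by simp
   have KT: "perm_on T (inv q o g)" "perm_on ?U (inv q o g)"
    by (intro perm_on_compose perm_on_inv T U)+
   have c: "card S = card T + card ?U"
    using card_Un_disjoint[of T ?U] un perm_onD(1)[OF T(2)] perm_onD(1)[OF U(1)] by simp
   have le: "ncyc T q \<le> card T" "ncyc ?U q \<le> card ?U"
    by (intro ncyc_le_card perm_onD(1)[OF T(2)] perm_onD(1)[OF U(1)])+
   have nq': "ncyc S q = ncyc T q + ncyc ?U q" using split[OF T(2) U(1)] .
   have 1: "ncyc T q + ncyc T (inv q o g) + ncyc T g \<le> card T + 2"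
    by (rule less.hyps) (use T tr[of T] nq nq' c le in auto)
   have 2: "ncyc ?U q + ncyc ?U (inv q o g) + ncyc ?U g \<le> card ?U + 2"
    by (rule less.hyps) (use T U tr[of ?U] nq nq' c le in auto)
   have "inv q b ~: T" using T(5) perm_onD(6)[OF T(2), of "inv q b"] perm_on_inv_f(2)[OF q, of b] by auto
   moreover have "orbit (inv q o g) (inv q a) <= T"
    by (rule orbit_sub[OF KT(1)]) (use perm_on_inv_in[OF T(2) T(4)] in simp)
   ultimately have "inv q b ~: orbit (inv q o g) (inv q a)" by blast
   hence "Suc (ncyc S (inv p o g)) = ncyc S (inv q o g)"
    unfolding Kp by (rule ncyc_join[OF Kq ab])
   thus ?thesis using 1 2 c nq nq' split[OF KT] split[OF T(3) U(2)] by simp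
  qed
 qed
qed

section \<open>Planar permutations of discs and annuli\<close>

abbreviation cl :: "'a list => 'a => 'a" where "cl \<equiv> cycle_of_list"

text \<open>The permutations for which the genus inequality, with g the single cycle along w, is an equality.\<close>

definition disc :: "'a list => ('a => 'a) set" where
 "disc w = {p. p permutes set w \<and> ncyc (set w) p + ncyc (set w) (inv p o cl w) = Suc (length w)}"

text \<open>The analogue for two cycles. The last clause makes the action transitive, so that the right-hand side is
the maximum, two less than for permutations that preserve both circles.\<close>

definition annulus :: "'a list => 'a list => ('a => 'a) set" where
 "annulus u v = {p. p permutes (set u Un set v) \<and>
   ncyc (set u Un set v) p + ncyc (set u Un set v) (inv p o (cl u o cl v)) = length u + length v \<and>
   (\<exists>i\<in>set u. p i \<in> set v)}"

text \<open>The weight of the Kreweras complement in the disc, and below in the annulus.\<close>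

abbreviation (input) dwt where "dwt \<tau> u p \<equiv> cprod (set u) \<tau> (inv p o cl u)"

abbreviation (input) awt where "awt \<tau> u v p \<equiv> cprod (set u Un set v) \<tau> (inv p o (cl u o cl v))"

lemma cl_permutes: "cl w permutes set w" by (rule cycle_permutes)

lemma cl_permutation: "permutation (cl w)" by (rule permutation_of_cycle)

lemma cl_outside: "x ~: set w ==> cl w x = x" by (rule id_outside_supp)

lemma cycle_list_cl: "distinct w ==> w ~= [] ==> cycle_list (cl w) w"
 using cyclic_rotation[of w 1] by (simp add: cycle_list_def)

lemma cycle_list_agree: "cycle_list p c ==> cycle_list q c ==> x \<in> set c ==> p x = q x"
 unfolding cycle_list_def by (metis map_eq_conv)

lemma cl_eqI:
 assumes "cycle_list p w" "!!x. x ~: set w ==> p x = x" shows "p = cl w"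
proof
 fix x
 have "cycle_list (cl w) w" using assms by (auto simp: cycle_list_def intro!: cycle_list_cl[unfolded cycle_list_def, THEN conjunct2, THEN conjunct2])
 thus "p x = cl w x" using assms cycle_list_agree[of p w "cl w" x] cl_outside[of x w] by (cases "x \<in> set w") auto
qed

lemma cl_rotate: "distinct w ==> cl (rotate n w) = cl w"
proof (cases "w = []")
 case False
 assume "distinct w"
 hence "cycle_list (cl w) (rotate n w)" using False cycle_list_rotate cycle_list_cl by blast
 hence "cl w = cl (rotate n w)" by (rule cl_eqI) (simp add: cl_outside)
 thus ?thesis by simp
qed simp

lemma cl_append:
 assumes "distinct (u @ v)" "u ~= []" "v ~= []"
 shows "cl (u @ v) = swp (hd u) (hd v) o (cl u o cl v)"
proof -
 have d: "set u Int set v = {}" using assms by auto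
 let ?f = "cl u o cl v"
 have 1: "cycle_list ?f u"
  using cycle_list_cl[of u] assms d
  by (subst cycle_list_cong[of u ?f "cl u"]) (auto simp: cl_outside disjoint_iff)
 have out: "cl v x ~: set u" if "x \<in> set v" for x
  using d cl_permutes[of v] that by (metis disjoint_iff permutes_in_image)
 have 2: "cycle_list ?f v"
  using cycle_list_cl[of v] assms out
  by (subst cycle_list_cong[of v ?f "cl v"]) (auto simp: cl_outside)
 have "cycle_list (swp (hd u) (hd v) o ?f) (u @ v)" by (rule cycle_list_append_join[OF 1 2 d])
 thus ?thesis
  by (rule cl_eqI[symmetric]) (use assms in "auto simp: cl_outside intro!: transpose_apply_other")
qed

lemma cl_Cons: "distinct (x # w) ==> w ~= [] ==> cl (x # w) = swp x (hd w) o cl w"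
 using cl_append[of "[x]" w] by simp

lemma cl_snoc: "distinct (w @ [e]) ==> w ~= [] ==> cl (w @ [e]) = swp (hd w) e o cl w"
 using cl_append[of w "[e]"] by simp

lemma cl_perm_on: "set w <= S ==> finite S ==> perm_on S (cl w)"
 by (rule permutes_perm_on_superset[OF cl_permutes])

lemma cl_comp_apply:
 assumes "set u Int set v = {}"
 shows "x \<in> set u ==> (cl u o cl v) x = cl u x" "x \<in> set v ==> (cl u o cl v) x = cl v x"
  "x ~: set u ==> x ~: set v ==> (cl u o cl v) x = x"
proof -
 show "x \<in> set u ==> (cl u o cl v) x = cl u x" using assms by (auto simp: cl_outside disjoint_iff)
 assume "x \<in> set v"
 hence "cl v x ~: set u" using assms cl_permutes[of v] by (metis disjoint_iff permutes_in_image)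
 thus "(cl u o cl v) x = cl v x" by (simp add: cl_outside)
qed (simp add: cl_outside)

lemma cycle_list_invariant_subset:
 assumes "cycle_list g c" "finite T" "permutation g" "g ` T = T" "x \<in> T" "x \<in> set c"
 shows "set c <= T"
 using orbit_sub[of T g x] cycle_list_orbit[OF assms(1,6)] assms by (auto simp: perm_on_def)

lemma cycle_list_g:
 assumes "distinct (u @ v)"
 shows "u ~= [] ==> cycle_list (cl u o cl v) u" "v ~= [] ==> cycle_list (cl u o cl v) v"
proof -
 have d: "set u Int set v = {}" using assms by auto
 show "u ~= [] ==> cycle_list (cl u o cl v) u"
  using cycle_list_cong[of u "cl u o cl v" "cl u"] cl_comp_apply(1)[OF d] cycle_list_cl[of u] assms by auto
 show "v ~= [] ==> cycle_list (cl u o cl v) v"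
  using cycle_list_cong[of v "cl u o cl v" "cl v"] cl_comp_apply(2)[OF d] cycle_list_cl[of v] assms by auto
qed

lemma disc_bound:
 assumes "distinct w" "w ~= []" "perm_on (set w) p"
 shows "ncyc (set w) p + ncyc (set w) (inv p o cl w) \<le> Suc (length w)"
proof -
 have c: "cycle_list (cl w) w" using assms cycle_list_cl by blast
 have "transitive_on (set w) p (cl w)"
  unfolding transitive_on_def
 proof (intro allI impI)
  fix T assume T: "T <= set w" "cl w ` T = T"
  show "T = {} \<or> T = set w"
   using cycle_list_invariant_subset[OF c _ cl_permutation T(2)] T finite_subset[OF T(1)] by blast
 qed
 hence "ncyc (set w) p + ncyc (set w) (inv p o cl w) + ncyc (set w) (cl w) \<le> card (set w) + 2"
  using assms by (intro genus_inequality) (auto simp: cl_perm_on)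
 thus ?thesis using ncyc_cycle_list[OF c] assms by (simp add: distinct_card)
qed

lemma perm_on_comp_cl: "set u <= S ==> set v <= S ==> finite S ==> perm_on S (cl u o cl v)"
 by (intro perm_on_compose cl_perm_on)

lemma annulus_bound:
 assumes "distinct (u @ v)" "perm_on (set u Un set v) p" "i \<in> set u" "p i \<in> set v"
 shows "ncyc (set u Un set v) p + ncyc (set u Un set v) (inv p o (cl u o cl v)) \<le> length u + length v"
proof -
 let ?S = "set u Un set v" and ?g = "cl u o cl v"
 have ne: "u ~= []" "v ~= []" and d: "set u Int set v = {}" using assms by auto
 note cu = cycle_list_g(1)[OF assms(1) ne(1)] and cv = cycle_list_g(2)[OF assms(1) ne(2)]
 have g: "perm_on ?S ?g" by (rule perm_on_comp_cl) auto
 have "transitive_on ?S p ?g"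
  unfolding transitive_on_def
 proof (intro allI impI)
  fix T assume T: "T <= ?S" "p ` T = T" "?g ` T = T"
  have f: "finite T" using T(1) finite_subset by auto
  have 1: "set u <= T" if "x \<in> T" "x \<in> set u" for x
   using cycle_list_invariant_subset[OF cu f perm_onD(2)[OF g] T(3) that] .
  have 2: "set v <= T" if "x \<in> T" "x \<in> set v" for x
   using cycle_list_invariant_subset[OF cv f perm_onD(2)[OF g] T(3) that] .
  have 3: "i \<in> T \<longleftrightarrow> p i \<in> T"
   using T(2) perm_onD(5)[OF assms(2)] by (metis image_eqI image_iff injD)
  show "T = {} \<or> T = ?S" using 1 2 3 assms T(1) by blast
 qed
 hence "ncyc ?S p + ncyc ?S (inv p o ?g) + ncyc ?S ?g \<le> card ?S + 2"
  using assms g by (intro genus_inequality) auto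
 moreover have "ncyc ?S ?g = 2"
 proof -
  have "ncyc ?S ?g = Suc (ncyc (?S - set u) ?g)" by (rule ncyc_remove_cycle[OF g cu]) auto
  moreover have "?S - set u = set v" using d by auto
  ultimately show ?thesis using ncyc_cycle_list[OF cv] by simp
 qed
 moreover have "card ?S = length u + length v"
  using assms(1) d by (simp add: card_Un_disjoint distinct_card)
 ultimately show ?thesis by simp
qed

lemma perm_split:
 assumes "q permutes A Un B" "A Int B = {}" "q ` A = A"
 obtains p1 p2 where "p1 permutes A" "p2 permutes B" "q = p1 o p2"
  "!!x. x \<in> A ==> q x = p1 x" "!!x. x \<in> B ==> q x = p2 x"
proof -
 have qB: "q ` B = B"
 proof -
  have "q ` (A Un B) = A Un B" by (rule permutes_image[OF assms(1)])
  moreover have "inj q" by (rule permutes_inj[OF assms(1)])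
  ultimately have "q ` ((A Un B) - A) = (A Un B) - A" by (metis assms(3) image_set_diff)
  moreover have "(A Un B) - A = B" using assms by auto
  ultimately show ?thesis by simp
 qed
 have inj: "inj q" by (rule permutes_inj[OF assms(1)])
 define p1 where "p1 = perm_restrict q A"
 define p2 where "p2 = perm_restrict q B"
 have restr: "perm_restrict q X permutes X" if "q ` X = X" for X
 proof (rule bij_imp_permutes)
  have "bij_betw q X X" unfolding bij_betw_def using that inj_on_subset[OF inj, of X] by simp
  thus "bij_betw (perm_restrict q X) X X"
   using bij_betw_cong[of X q "perm_restrict q X" X] by (simp add: perm_restrict_def)
 qed (simp add: perm_restrict_def)
 have p1: "p1 permutes A" unfolding p1_def by (rule restr[OF assms(3)])
 have p2: "p2 permutes B" unfolding p2_def by (rule restr[OF qB])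
 have e1: "q x = p1 x" if "x \<in> A" for x using that by (simp add: p1_def perm_restrict_def)
 have e2: "q x = p2 x" if "x \<in> B" for x using that by (simp add: p2_def perm_restrict_def)
 have "q = p1 o p2"
 proof
  fix x
  consider "x \<in> A" | "x \<in> B" | "x ~: A Un B" by blast
  thus "q x = (p1 o p2) x"
  proof cases
   case 1
   hence "p2 x = x" using assms(2) permutes_not_in[OF p2] by blast
   thus ?thesis using e1 1 by simp
  next
   case 2
   hence "p2 x \<in> B" using permutes_in_image[OF p2] by blast
   hence "p1 (p2 x) = p2 x" using assms(2) permutes_not_in[OF p1] by blast
   thus ?thesis using e2 2 by simp
  next
   case 3
   hence "q x = x" "p1 x = x" "p2 x = x" using permutes_not_in assms(1) p1 p2 by (metis UnI1 UnI2)+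
   thus ?thesis by simp
  qed
 qed
 thus ?thesis using that p1 p2 e1 e2 by blast
qed

lemma perm_prod_apply:
 assumes "p1 permutes A" "p2 permutes B" "A Int B = {}"
 shows "x \<in> A ==> (p1 o p2) x = p1 x" "x \<in> B ==> (p1 o p2) x = p2 x"
proof -
 show "x \<in> A ==> (p1 o p2) x = p1 x" using permutes_not_in[OF assms(2)] assms(3) by (metis IntI comp_apply empty_iff)
 show "x \<in> B ==> (p1 o p2) x = p2 x"
  using permutes_not_in[OF assms(1)] permutes_in_image[OF assms(2)] assms(3) by (metis IntI comp_apply empty_iff)
qed

lemma perm_prod_permutes:
 assumes "p1 permutes A" "p2 permutes B" shows "(p1 o p2) permutes (A Un B)"
 using permutes_compose[OF permutes_subset[OF assms(2)] permutes_subset[OF assms(1)]] by auto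

lemma perm_prod_inj:
 assumes "p1 permutes A" "p2 permutes B" "q1 permutes A" "q2 permutes B" "A Int B = {}" "p1 o p2 = q1 o q2"
 shows "p1 = q1" "p2 = q2"
proof -
 have "p1 x = q1 x" for x
  using perm_prod_apply(1)[OF assms(1,2,5)] perm_prod_apply(1)[OF assms(3,4,5)] assms(6)
   permutes_not_in[OF assms(1)] permutes_not_in[OF assms(3)] by metis
 thus "p1 = q1" by auto
 have "p2 x = q2 x" for x
  using perm_prod_apply(2)[OF assms(1,2,5)] perm_prod_apply(2)[OF assms(3,4,5)] assms(6)
   permutes_not_in[OF assms(2)] permutes_not_in[OF assms(4)] by metis
 thus "p2 = q2" by auto
qed

lemma perm_on_sub_fixed: "p permutes A ==> finite T ==> A <= T \<or> T Int A = {} ==> finite A ==> perm_on T p"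
proof -
 assume a: "p permutes A" "finite T" "A <= T \<or> T Int A = {}" "finite A"
 have "p ` T = T"
 proof (cases "A <= T")
  case True thus ?thesis using permutes_perm_on_superset[OF a(1) True a(2)] perm_onD by metis
 next
  case False
  hence "p x = x" if "x \<in> T" for x using a that permutes_not_in by (metis IntI empty_iff)
  thus ?thesis by auto
 qed
 thus ?thesis using a permutation_permutes unfolding perm_on_def by blast
qed

lemma ncyc_restrict:
 assumes T: "perm_on T q" "perm_on T p" and eq: "!!x. x \<in> T ==> q x = p x"
  and g: "perm_on T g" "perm_on T h" "!!x. x \<in> T ==> g x = h x"
 shows "ncyc T q = ncyc T p" "ncyc T (inv q o g) = ncyc T (inv p o h)"
proof -
 show "ncyc T q = ncyc T p" by (rule ncyc_cong[OF T(1) eq])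
 show "ncyc T (inv q o g) = ncyc T (inv p o h)"
 proof (rule ncyc_cong)
  show "perm_on T (inv q o g)" by (intro perm_on_compose perm_on_inv T g)
  fix x assume x: "x \<in> T"
  have "inv q (h x) = inv p (h x)"
   using x T g eq perm_on_inv_in[OF T(2), of "h x"] perm_onD(6)[OF g(2)] perm_on_inv_f[OF T(1)] perm_on_inv_f[OF T(2)]
   by metis
  thus "(inv q o g) x = (inv p o h) x" using g x by simp
 qed
qed

section \<open>Cutting and inserting\<close>

lemma prod_count:
 assumes "p1 permutes A" "p2 permutes B" "gA permutes A" "gB permutes B" "A Int B = {}" "finite A" "finite B"
 shows "ncyc (A Un B) (p1 o p2) = ncyc A p1 + ncyc B p2"
  "ncyc (A Un B) (inv (p1 o p2) o (gA o gB)) = ncyc A (inv p1 o gA) + ncyc B (inv p2 o gB)"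
proof -
 let ?q = "p1 o p2" and ?g = "gA o gB"
 have BA: "B Int A = {}" using assms(5) by auto
 have A1: "perm_on A p1" "perm_on A p2" "perm_on A gA" "perm_on A gB"
  using perm_on_sub_fixed assms by (metis order_refl)+
 have B1: "perm_on B p1" "perm_on B p2" "perm_on B gA" "perm_on B gB"
  using perm_on_sub_fixed assms BA by (metis order_refl)+
 have A2: "perm_on A ?q" "perm_on A ?g" by (intro perm_on_compose A1)+
 have B2: "perm_on B ?q" "perm_on B ?g" by (intro perm_on_compose B1)+
 note ap = perm_prod_apply[OF assms(1,2,5)] and ag = perm_prod_apply[OF assms(3,4,5)]
 note rA = ncyc_restrict[OF A2(1) A1(1) ap(1) A2(2) A1(3) ag(1)]
 note rB = ncyc_restrict[OF B2(1) B1(2) ap(2) B2(2) B1(4) ag(2)]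
 show "ncyc (A Un B) ?q = ncyc A p1 + ncyc B p2"
  using ncyc_union[OF A2(1) B2(1) assms(5)] rA(1) rB(1) by simp
 have "perm_on A (inv ?q o ?g)" "perm_on B (inv ?q o ?g)"
  by (intro perm_on_compose[OF perm_on_inv] A2 B2)+
 from ncyc_union[OF this assms(5)]
 show "ncyc (A Un B) (inv ?q o ?g) = ncyc A (inv p1 o gA) + ncyc B (inv p2 o gB)"
  using rA(2) rB(2) by simp
qed

lemma kreweras_cut:
 "permutation p ==> inv (swp a b o p) o g = inv p o (swp a b o g)"
 by (simp add: inv_swp_comp comp_assoc)

lemma in_orbit_swp:
 assumes "perm_on S q" "a \<in> S" "b \<in> S" "b ~: orbit q a"
 shows "b \<in> orbit (swp a b o q) a"
proof (rule ccontr)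
 assume "b ~: orbit (swp a b o q) a"
 from ncyc_join[OF perm_on_swp_comp[OF assms(1-3)] assms(2,3) this] ncyc_join[OF assms]
 show False by simp
qed

lemma perm_on_of_image_subset:
 "p permutes S ==> finite S ==> T <= S ==> (!!i. i \<in> T ==> p i \<in> T) ==> perm_on T p"
 by (intro perm_on_finite_closed) (auto simp: permutation_permutes intro: finite_subset)

lemma discD:
 assumes "p \<in> disc w"
 shows "p permutes set w" "perm_on (set w) p"
  "ncyc (set w) p + ncyc (set w) (inv p o cl w) = Suc (length w)" "permutation p"
 using assms permutes_perm_on[of p "set w"] perm_onD(2)[of "set w" p] by (auto simp: disc_def)

lemma annulusD:
 assumes "p \<in> annulus u v"
 shows "p permutes (set u Un set v)" "perm_on (set u Un set v) p"
  "ncyc (set u Un set v) p + ncyc (set u Un set v) (inv p o (cl u o cl v)) = length u + length v"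
  "permutation p" "\<exists>i\<in>set u. p i \<in> set v"
 using assms permutes_perm_on[of p "set u Un set v"] perm_onD(2)[of "set u Un set v" p]
 by (auto simp: annulus_def)

lemma finite_disc: "finite (disc w)"
 by (rule finite_subset[OF _ finite_permutations[of "set w"]]) (auto simp: disc_def)

lemma finite_annulus: "finite (annulus u v)"
 by (rule finite_subset[OF _ finite_permutations[of "set u Un set v"]]) (auto simp: annulus_def)

lemma two_disc_split:
 assumes "distinct (u @ v)" "u ~= []" "v ~= []" "q permutes (set u Un set v)"
  "ncyc (set u Un set v) q + ncyc (set u Un set v) (inv q o (cl u o cl v)) = length u + length v + 2"
 obtains p1 p2 where "p1 \<in> disc u" "p2 \<in> disc v" "q = p1 o p2"
proof -
 let ?S = "set u Un set v"
 have q: "perm_on ?S q" using assms(4) by (simp add: permutes_perm_on)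
 have "q i \<in> set u" if "i \<in> set u" for i
 proof (rule ccontr)
  assume "q i ~: set u"
  hence "q i \<in> set v" using perm_onD(6)[OF q, of i] that by auto
  from annulus_bound[OF assms(1) q that this] assms(5) show False by simp
 qed
 hence "perm_on (set u) q" using perm_on_of_image_subset[OF assms(4), of "set u"] by auto
 hence im: "q ` set u = set u" by (rule perm_onD)
 have dis: "set u Int set v = {}" using assms(1) by auto
 obtain p1 p2 where p: "p1 permutes set u" "p2 permutes set v" "q = p1 o p2"
  using perm_split[OF assms(4) dis im] by metis
 note c = prod_count[OF p(1,2) cl_permutes cl_permutes dis finite_set finite_set, folded p(3)]
 have "ncyc (set u) p1 + ncyc (set u) (inv p1 o cl u) \<le> Suc (length u)"
  by (rule disc_bound) (use assms p permutes_perm_on in auto)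
 moreover have "ncyc (set v) p2 + ncyc (set v) (inv p2 o cl v) \<le> Suc (length v)"
  by (rule disc_bound) (use assms p permutes_perm_on in auto)
 ultimately have "p1 \<in> disc u" "p2 \<in> disc v" using c assms(5) p by (auto simp: disc_def)
 thus ?thesis using that p by blast
qed

lemma two_disc_count:
 assumes "distinct (u @ v)" "p1 \<in> disc u" "p2 \<in> disc v"
 shows "(p1 o p2) permutes (set u Un set v)"
  "ncyc (set u Un set v) (p1 o p2) + ncyc (set u Un set v) (inv (p1 o p2) o (cl u o cl v)) = length u + length v + 2"
  "(p1 o p2) ` set u = set u"
proof -
 have dis: "set u Int set v = {}" using assms(1) by auto
 note d1 = discD[OF assms(2)] and d2 = discD[OF assms(3)]
 show "(p1 o p2) permutes (set u Un set v)" by (rule perm_prod_permutes[OF d1(1) d2(1)])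
 show "ncyc (set u Un set v) (p1 o p2) + ncyc (set u Un set v) (inv (p1 o p2) o (cl u o cl v)) = length u + length v + 2"
  using prod_count[OF d1(1) d2(1) cl_permutes cl_permutes dis finite_set finite_set] d1(3) d2(3) by simp
 have "(p1 o p2) ` set u = p1 ` set u"
  using perm_prod_apply(1)[OF d1(1) d2(1) dis] by (intro image_cong) auto
 thus "(p1 o p2) ` set u = set u" using permutes_image[OF d1(1)] by simp
qed

text \<open>Planar permutations in which the first letter a of u and the first letter b of v share a cycle: dividing
this cycle by the transposition (a b) cuts the disc along a chord into two discs.\<close>

theorem disc_cut:
 assumes "distinct (u @ v)" "u ~= []" "v ~= []"
 shows "bij_betw (%(p, q). swp (hd u) (hd v) o (p o q)) (disc u \<times> disc v)
      {p \<in> disc (u @ v). hd v \<in> orbit p (hd u)}"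
proof -
 define a where "a = hd u"
 define b where "b = hd v"
 let ?S = "set u Un set v" and ?g = "cl u o cl v"
 have ab: "a \<in> ?S" "b \<in> ?S" "a ~= b" "a \<in> set u" "b \<in> set v" "b ~: set u"
  using assms by (auto simp: a_def b_def dest: hd_in_set)
 have dis: "set u Int set v = {}" using assms(1) by auto
 have g: "cl (u @ v) = swp a b o ?g" unfolding a_def b_def by (rule cl_append[OF assms])
 let ?f = "%(p, q). swp a b o (p o q)"
 have inj: "inj_on ?f (disc u \<times> disc v)"
 proof (rule inj_onI, clarify)
  fix p q p' q' assume m: "p \<in> disc u" "q \<in> disc v" "p' \<in> disc u" "q' \<in> disc v"
   and e: "swp a b o (p o q) = swp a b o (p' o q')"
  have "p o q = p' o q'" using arg_cong[OF e, of "%h. swp a b o h"] by simp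
  thus "p = p' \<and> q = q'"
   using perm_prod_inj[OF discD(1)[OF m(1)] discD(1)[OF m(2)] discD(1)[OF m(3)]
     discD(1)[OF m(4)] dis] by simp
 qed
 have to: "?f (p, q) \<in> {p \<in> disc (u @ v). b \<in> orbit p a}" if m: "p \<in> disc u" "q \<in> disc v" for p q
 proof -
  let ?q = "p o q"
  note t = two_disc_count[OF assms(1) m]
  have qp: "perm_on ?S ?q" using t(1) by (simp add: permutes_perm_on)
  have u: "perm_on (set u) ?q" using perm_on_subset[OF qp _ t(3)] by simp
  have nb: "b ~: orbit ?q a" using orbit_sub[OF u ab(4)] ab by blast
  have "Suc (ncyc ?S (swp a b o ?q)) = ncyc ?S ?q" by (rule ncyc_join[OF qp ab(1,2) nb])
  moreover have "inv (swp a b o ?q) o cl (u @ v) = inv ?q o ?g"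
   unfolding g kreweras_cut[OF perm_onD(2)[OF qp]] by simp
  moreover have "(swp a b o ?q) permutes ?S"
   by (rule permutes_compose[OF t(1) permutes_swap_id[OF ab(1,2)]])
  ultimately have "swp a b o ?q \<in> disc (u @ v)" using t(2) by (auto simp: disc_def)
  thus ?thesis using in_orbit_swp[OF qp ab(1,2) nb] by simp
 qed
 have onto: "p \<in> ?f ` (disc u \<times> disc v)" if m: "p \<in> disc (u @ v)" "b \<in> orbit p a" for p
 proof -
  note d = discD[OF m(1), simplified]
  let ?q = "swp a b o p"
  have n: "ncyc ?S ?q = Suc (ncyc ?S p)" by (rule ncyc_split(1)[OF d(2) ab(1,3) m(2)])
  have k: "inv ?q o ?g = inv p o cl (u @ v)" unfolding kreweras_cut[OF d(4)] g by simp
  have pq: "?q permutes ?S" by (rule permutes_compose[OF d(1) permutes_swap_id[OF ab(1,2)]])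
  obtain p1 p2 where "p1 \<in> disc u" "p2 \<in> disc v" "?q = p1 o p2"
   using two_disc_split[OF assms pq] n d(3) unfolding k by auto
  moreover have "p = swp a b o ?q" by simp
  ultimately show ?thesis by (metis (mono_tags, lifting) SigmaI case_prod_conv image_eqI)
 qed
 show ?thesis unfolding a_def[symmetric] b_def[symmetric]
  unfolding bij_betw_def using inj to onto by auto
qed

lemma annulus_disc_disjoint: "p \<in> annulus u v ==> distinct (u @ v) ==> p permutes set u ==> False"
 using annulusD(5)[of p u v] permutes_in_image[of p "set u"] by auto

text \<open>Cutting an annulus along a chord between two points of the outer circle leaves an annulus and a disc, and
there are two cases: the inner circle stays with the first or with the second part of the outer word. After the cut
the count exceeds the bound for a transitive pair, so some proper invariant set contains the cycle u of the
rotation; it is u alone, or u together with the inner circle.\<close>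

theorem annulus_cut:
 assumes "distinct (u @ w @ v)" "u ~= []" "w ~= []" "v ~= []"
 shows "bij_betw (%(p, q). swp (hd u) (hd w) o (p o q))
      (annulus u v \<times> disc w Un disc u \<times> annulus w v)
      {p \<in> annulus (u @ w) v. hd w \<in> orbit p (hd u)}"
proof -
 define a where "a = hd u"
 define b where "b = hd w"
 let ?U = "set u" and ?W = "set w" and ?V = "set v"
 let ?S = "set (u @ w) Un set v" and ?g = "cl (u @ w) o cl v"
 have dis: "?U Int ?W = {}" "?U Int ?V = {}" "?W Int ?V = {}" and d3: "distinct (u @ w)" "distinct (u @ v)" "distinct (w @ v)"
  using assms(1) by auto
 have ab: "a \<in> ?S" "b \<in> ?S" "a ~= b" "a \<in> ?U" "b \<in> ?W" "b ~: ?U"  "b ~: ?V" "a ~: ?V"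
  using assms by (auto simp: a_def b_def dest: hd_in_set)
 have comm: "cl w o cl v = cl v o cl w" using cycles_commute d3(3) dis by auto
 have g: "?g = swp a b o (cl u o (cl w o cl v))"
  unfolding a_def b_def by (simp add: cl_append[OF d3(1) assms(2,3)] comp_assoc)
 let ?h = "cl u o (cl w o cl v)"
 have h2: "?h = (cl u o cl v) o cl w" by (simp add: comm comp_assoc)
 have pv: "(cl u o cl v) permutes (?U Un ?V)" "(cl w o cl v) permutes (?W Un ?V)"
  using perm_prod_permutes cl_permutes by blast+
 have hp: "perm_on ?S ?h" by (intro perm_on_compose cl_perm_on) auto
 let ?f = "%(p, q). swp a b o (p o q)"
 have S1: "(?U Un ?V) Un ?W = ?S" "(?U Un ?V) Int ?W = {}" and S2: "?U Un (?W Un ?V) = ?S" "?U Int (?W Un ?V) = {}"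
  using dis by auto
 have len: "length (u @ w) + length v = length u + length w + length v" by simp
 have c1: "(p o q) permutes ?S \<and> ncyc ?S (p o q) + ncyc ?S (inv (p o q) o ?h) = Suc (length (u @ w) + length v)"
  "b ~: orbit (p o q) a" "\<exists>i\<in>?U. (p o q) i \<in> ?V"
  if m: "p \<in> annulus u v" "q \<in> disc w" for p q
 proof -
  note mp = annulusD[OF m(1)] and mq = discD[OF m(2)]
  note c = prod_count[OF mp(1) mq(1) pv(1) cl_permutes S1(2) finite_UnI[OF finite_set finite_set] finite_set]
  have pq: "(p o q) permutes ?S" using perm_prod_permutes[OF mp(1) mq(1)] S1(1) by simp
  thus "(p o q) permutes ?S \<and> ncyc ?S (p o q) + ncyc ?S (inv (p o q) o ?h) = Suc (length (u @ w) + length v)"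
   using c mp(3) mq(3) unfolding S1(1) h2 by simp
  note ap = perm_prod_apply[OF mp(1) mq(1) S1(2)]
  have "perm_on (?U Un ?V) (p o q)"
   using perm_on_of_image_subset[OF pq, of "?U Un ?V"] ap permutes_in_image[OF mp(1)] by auto
  hence "orbit (p o q) a <= ?U Un ?V" by (rule orbit_sub) (use ab in auto)
  thus "b ~: orbit (p o q) a" using ab by blast
  show "\<exists>i\<in>?U. (p o q) i \<in> ?V" using mp(5) ap(1) by (metis UnI1)
 qed
 have c2: "(p o q) permutes ?S \<and> ncyc ?S (p o q) + ncyc ?S (inv (p o q) o ?h) = Suc (length (u @ w) + length v)"
  "b ~: orbit (p o q) a" "\<exists>i\<in>?W. (p o q) i \<in> ?V" "\<forall>i\<in>?U. (p o q) i \<in> ?U"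
  if m: "p \<in> disc u" "q \<in> annulus w v" for p q
 proof -
  note mq = annulusD[OF m(2)] and mp = discD[OF m(1)]
  note c = prod_count[OF mp(1) mq(1) cl_permutes pv(2) S2(2) finite_set finite_UnI[OF finite_set finite_set]]
  have pq: "(p o q) permutes ?S" using perm_prod_permutes[OF mp(1) mq(1)] S2(1) by simp
  thus "(p o q) permutes ?S \<and> ncyc ?S (p o q) + ncyc ?S (inv (p o q) o ?h) = Suc (length (u @ w) + length v)"
   using c mp(3) mq(3) unfolding S2(1) by simp
  note ap = perm_prod_apply[OF mp(1) mq(1) S2(2)]
  show u: "\<forall>i\<in>?U. (p o q) i \<in> ?U" using ap(1) permutes_in_image[OF mp(1)] by metis
  have "perm_on ?U (p o q)"
   using perm_on_of_image_subset[OF pq, of "?U"] u by auto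
  hence "orbit (p o q) a <= ?U" by (rule orbit_sub) (use ab in auto)
  thus "b ~: orbit (p o q) a" using ab by blast
  show "\<exists>i\<in>?W. (p o q) i \<in> ?V" using mq(5) ap(2) by (metis UnI1)
 qed
 have inj: "inj_on ?f (annulus u v \<times> disc w Un disc u \<times> annulus w v)"
 proof (rule inj_onI)
  fix x y assume xy: "x \<in> annulus u v \<times> disc w Un disc u \<times> annulus w v"
   "y \<in> annulus u v \<times> disc w Un disc u \<times> annulus w v" and e: "?f x = ?f y"
  obtain p q p' q' where [simp]: "x = (p, q)" "y = (p', q')" by (cases x; cases y)
  have e: "p o q = p' o q'" using arg_cong[OF e, of "%h. swp a b o h"] by simp
  consider (1) "p \<in> annulus u v" "q \<in> disc w" "p' \<in> annulus u v" "q' \<in> disc w"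
   | (2) "p \<in> disc u" "q \<in> annulus w v" "p' \<in> disc u" "q' \<in> annulus w v"
   | (3) "p \<in> annulus u v" "q \<in> disc w" "p' \<in> disc u" "q' \<in> annulus w v"
   | (4) "p \<in> disc u" "q \<in> annulus w v" "p' \<in> annulus u v" "q' \<in> disc w"
   using xy by auto
  thus "x = y"
  proof cases
   case 1
   thus ?thesis using perm_prod_inj[OF annulusD(1) discD(1) annulusD(1) discD(1) S1(2) e] by simp
  next
   case 2
   thus ?thesis using perm_prod_inj[OF discD(1) annulusD(1) discD(1) annulusD(1) S2(2) e] by simp
  next
   case 3
   thus ?thesis using c1(3)[OF 3(1,2)] c2(4)[OF 3(3,4)] e dis by auto
  next
   case 4
   thus ?thesis using c1(3)[OF 4(3,4)] c2(4)[OF 4(1,2)] e dis by auto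
  qed
 qed
 have to: "swp a b o r \<in> {p \<in> annulus (u @ w) v. b \<in> orbit p a}"
  if m: "r permutes ?S" "ncyc ?S r + ncyc ?S (inv r o ?h) = Suc (length (u @ w) + length v)"
   "b ~: orbit r a" "\<exists>i\<in>?U Un ?W. r i \<in> ?V" for r
 proof -
  have rp: "perm_on ?S r" using m(1) by (simp add: permutes_perm_on)
  have "Suc (ncyc ?S (swp a b o r)) = ncyc ?S r" by (rule ncyc_join[OF rp ab(1,2) m(3)])
  moreover have "inv (swp a b o r) o ?g = inv r o ?h"
   unfolding g kreweras_cut[OF perm_onD(2)[OF rp]] by simp
  moreover have "(swp a b o r) permutes ?S"
   by (rule permutes_compose[OF m(1) permutes_swap_id[OF ab(1,2)]])
  moreover have "\<exists>i\<in>set (u @ w). (swp a b o r) i \<in> ?V"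
  proof -
   obtain i where i: "i \<in> ?U Un ?W" "r i \<in> ?V" using m(4) by auto
   hence "r i ~= a" "r i ~= b" using ab by auto
   hence "swp a b (r i) = r i" by simp
   hence "(swp a b o r) i \<in> ?V" using i by simp
   thus ?thesis using i(1) by (intro bexI[of _ i]) auto
  qed
  ultimately have "swp a b o r \<in> annulus (u @ w) v" using m(2) by (auto simp: annulus_def)
  thus ?thesis using in_orbit_swp[OF rp ab(1,2) m(3)] by simp
 qed
 have onto: "p \<in> ?f ` (annulus u v \<times> disc w Un disc u \<times> annulus w v)"
  if m: "p \<in> annulus (u @ w) v" "b \<in> orbit p a" for p
 proof -
  note d = annulusD[OF m(1)]
  let ?q = "swp a b o p"
  have n: "ncyc ?S ?q = Suc (ncyc ?S p)" by (rule ncyc_split(1)[OF d(2) ab(1,3) m(2)])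
  have k: "inv ?q o ?h = inv p o ?g" unfolding kreweras_cut[OF d(4)] g by simp
  have pq: "?q permutes ?S" by (rule permutes_compose[OF d(1) permutes_swap_id[OF ab(1,2)]])
  have qp: "perm_on ?S ?q" using pq by (simp add: permutes_perm_on)
  have sum: "ncyc ?S ?q + ncyc ?S (inv ?q o ?h) = length u + length w + length v + 1"
   unfolding k using n d(3) by simp
  have disc_ne: "\<not> (\<forall>i\<in>?U Un ?W. ?q i \<in> ?U Un ?W)"
  proof
   assume *: "\<forall>i\<in>?U Un ?W. ?q i \<in> ?U Un ?W"
   obtain i where i: "i \<in> ?U Un ?W" "p i \<in> ?V" using d(5) by auto
   hence "p i ~= a" "p i ~= b" using ab by auto
   hence "?q i = p i" by simp
   hence "?q i \<in> ?V" using i(2) by (simp only:)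
   moreover have "?q i \<in> ?U Un ?W" using * i(1) by blast
   ultimately show False using dis by blast
  qed
  have cu: "cycle_list ?h u" using cycle_list_g(1)[OF d3(2) assms(2)]
   by (subst cycle_list_cong[of u _ "cl u o cl v"]) (use dis in "auto simp: h2 cl_outside disjoint_iff")
  have hw: "cycle_list (cl w o cl v) w" "cycle_list (cl w o cl v) v"
   using cycle_list_g[OF d3(3)] assms by auto
  have *: "?h x = (cl w o cl v) x" if "x \<in> ?W Un ?V" for x
  proof -
   have "(cl w o cl v) x \<in> ?W Un ?V" using permutes_in_image[OF pv(2)] that by simp
   hence "(cl w o cl v) x ~: ?U" using dis by blast
   thus ?thesis using cl_outside[of "(cl w o cl v) x" u] by simp
  qed
  have cw: "cycle_list ?h w" "cycle_list ?h v"
   using hw cycle_list_cong[of w ?h "cl w o cl v"] cycle_list_cong[of v ?h "cl w o cl v"] * by auto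
  have n3: "ncyc ?S ?h = 3"
  proof -
   have "ncyc ?S ?h = Suc (ncyc (?S - ?U) ?h)" by (rule ncyc_remove_cycle[OF hp cu]) auto
   also have "?S - ?U = ?W Un ?V" using dis by auto
   also have "ncyc (?W Un ?V) ?h = ncyc ?W ?h + ncyc ?V ?h"
    by (rule ncyc_union[OF cycle_list_perm_on[OF perm_onD(2)[OF hp] cw(1)]
       cycle_list_perm_on[OF perm_onD(2)[OF hp] cw(2)] dis(3)])
   finally show ?thesis using ncyc_cycle_list[OF cw(1)] ncyc_cycle_list[OF cw(2)] by (simp add: comp_def)
  qed
  have card: "card ?S = length u + length w + length v"
  proof -
   have "card (set (u @ w @ v)) = length (u @ w @ v)" by (rule distinct_card[OF assms(1)])
   thus ?thesis by (simp add: Un_assoc)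
  qed
  have "\<not> transitive_on ?S ?q ?h"
   using genus_inequality[OF qp hp] sum n3 card ab by fastforce
  then obtain T0 where T0: "T0 <= ?S" "?q ` T0 = T0" "?h ` T0 = T0" "T0 ~= {}" "T0 ~= ?S"
   unfolding transitive_on_def by auto
  define T where "T = (if a \<in> T0 then T0 else ?S - T0)"
  have T0p: "perm_on T0 ?q" "perm_on T0 ?h" using perm_on_subset[OF qp T0(1,2)] perm_on_subset[OF hp T0(1,3)] by simp_all
  have T: "T <= ?S" "perm_on T ?q" "perm_on T ?h" "a \<in> T" "T ~= ?S"
   using T0 T0p ab perm_on_Diff[OF qp T0p(1)] perm_on_Diff[OF hp T0p(2)] by (auto simp: T_def)
  note inva = cycle_list_invariant_subset[OF _ perm_onD(1)[OF T(3)] perm_onD(2)[OF T(3)] perm_onD(3)[OF T(3)]]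
  have UT: "?U <= T" by (rule inva[OF cu T(4) ab(4)])
  have WT: "?W <= T \<or> ?W Int T = {}" using inva[OF cw(1)] by blast
  have VT: "?V <= T \<or> ?V Int T = {}" using inva[OF cw(2)] by blast
  have "T ~= ?U Un ?W" using disc_ne perm_onD(6)[OF T(2)] by blast
  then consider (1) "T = ?U Un ?V" | (2) "T = ?U" using UT WT VT T(1,5) by auto
  thus ?thesis
  proof cases
   case 1
   have im: "?q ` (?U Un ?V) = ?U Un ?V" using perm_onD(3)[OF T(2)] 1 by simp
   obtain p1 p2 where p: "p1 permutes (?U Un ?V)" "p2 permutes ?W" "?q = p1 o p2"
    and e: "!!x. x \<in> ?U Un ?V ==> ?q x = p1 x" "!!x. x \<in> ?W ==> ?q x = p2 x"
    using perm_split[OF pq[folded S1(1)] S1(2) im] by metis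
   have "\<exists>i\<in>?U. p1 i \<in> ?V"
   proof (rule ccontr)
    assume "\<not> ?thesis"
    hence "?q i \<in> ?U" if "i \<in> ?U" for i using e(1)[of i] permutes_in_image[OF p(1), of i] that by auto
    moreover have "?q i \<in> ?W" if "i \<in> ?W" for i using e(2)[OF that] permutes_in_image[OF p(2), of i] that by simp
    ultimately show False using disc_ne by blast
   qed
   then obtain i where i: "i \<in> ?U" "p1 i \<in> ?V" by auto
   note c = prod_count[OF p(1,2) pv(1) cl_permutes S1(2) finite_UnI[OF finite_set finite_set] finite_set, folded p(3) h2, unfolded S1(1)]
   have "ncyc (?U Un ?V) p1 + ncyc (?U Un ?V) (inv p1 o (cl u o cl v)) \<le> length u + length v"
    by (rule annulus_bound[of u v p1 i, OF d3(2) _ i]) (use p(1) in "simp add: permutes_perm_on")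
   moreover have "ncyc ?W p2 + ncyc ?W (inv p2 o cl w) \<le> Suc (length w)"
    by (rule disc_bound) (use assms p(2) in "auto simp: permutes_perm_on")
   ultimately have "p1 \<in> annulus u v" "p2 \<in> disc w"
    using c sum p i by (auto simp: disc_def annulus_def)
   moreover have "p = swp a b o ?q" by simp
   ultimately show ?thesis using p(3) by (metis (mono_tags, lifting) SigmaI UnI1 case_prod_conv image_eqI)
  next
   case 2
   have im: "?q ` ?U = ?U" using perm_onD(3)[OF T(2)] 2 by simp
   obtain p1 p2 where p: "p1 permutes ?U" "p2 permutes (?W Un ?V)" "?q = p1 o p2"
    and e: "!!x. x \<in> ?U ==> ?q x = p1 x" "!!x. x \<in> ?W Un ?V ==> ?q x = p2 x"
    using perm_split[OF pq[folded S2(1)] S2(2) im] by metis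
   have "\<exists>i\<in>?W. p2 i \<in> ?V"
   proof (rule ccontr)
    assume "\<not> ?thesis"
    hence "?q i \<in> ?W" if "i \<in> ?W" for i using e(2)[of i] permutes_in_image[OF p(2), of i] that by auto
    moreover have "?q i \<in> ?U" if "i \<in> ?U" for i using e(1)[OF that] permutes_in_image[OF p(1), of i] that by simp
    ultimately show False using disc_ne by blast
   qed
   then obtain i where i: "i \<in> ?W" "p2 i \<in> ?V" by auto
   note c = prod_count[OF p(1,2) cl_permutes pv(2) S2(2) finite_set finite_UnI[OF finite_set finite_set], folded p(3), unfolded S2(1)]
   have "ncyc (?W Un ?V) p2 + ncyc (?W Un ?V) (inv p2 o (cl w o cl v)) \<le> length w + length v"
    by (rule annulus_bound[of w v p2 i, OF d3(3) _ i]) (use p(2) in "simp add: permutes_perm_on")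
   moreover have "ncyc ?U p1 + ncyc ?U (inv p1 o cl u) \<le> Suc (length u)"
    by (rule disc_bound) (use assms p(1) in "auto simp: permutes_perm_on")
   ultimately have "p1 \<in> disc u" "p2 \<in> annulus w v"
    using c sum p i by (auto simp: disc_def annulus_def)
   moreover have "p = swp a b o ?q" by simp
   ultimately show ?thesis using p(3) by (metis (mono_tags, lifting) SigmaI UnI2 case_prod_conv image_eqI)
  qed
 qed
 have to': "?f x \<in> {p \<in> annulus (u @ w) v. b \<in> orbit p a}"
  if x: "x \<in> annulus u v \<times> disc w Un disc u \<times> annulus w v" for x
 proof -
  obtain p q where xx: "x = (p, q)" by (cases x)
  show ?thesis
  proof (cases "p \<in> annulus u v \<and> q \<in> disc w")
   case True
   thus ?thesis using to[of "p o q"] c1[of p q] xx by auto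
  next
   case False
   hence "p \<in> disc u" "q \<in> annulus w v" using x xx by auto
   thus ?thesis using to[of "p o q"] c2[of p q] xx by auto
  qed
 qed
 show ?thesis unfolding a_def[symmetric] b_def[symmetric]
  unfolding bij_betw_def using inj to' onto by blast
qed

text \<open>If a cycle joins the first letters of both circles, dividing it there slits the annulus along it, and the
two words become one. The two letters end in different cycles of a disc permutation.\<close>

theorem annulus_slit:
 assumes "distinct (u @ v)" "u ~= []" "v ~= []"
 shows "bij_betw (%p. swp (hd u) (hd v) o p) {p \<in> annulus u v. hd v \<in> orbit p (hd u)}
      {p \<in> disc (u @ v). hd v ~: orbit p (hd u)}"
proof -
 define a where "a = hd u"
 define b where "b = hd v"
 let ?S = "set u Un set v" and ?g = "cl u o cl v"
 have ab: "a \<in> ?S" "b \<in> ?S" "a ~= b" "a \<in> set u" "b \<in> set v" "b ~: set u"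
  using assms by (auto simp: a_def b_def dest: hd_in_set)
 have g: "cl (u @ v) = swp a b o ?g" unfolding a_def b_def by (rule cl_append[OF assms])
 have 1: "swp a b o p \<in> {p \<in> disc (u @ v). b ~: orbit p a}" if "p \<in> annulus u v" "b \<in> orbit p a" for p
 proof -
  note d = annulusD[OF that(1)]
  have n: "ncyc ?S (swp a b o p) = Suc (ncyc ?S p)" "b ~: orbit (swp a b o p) a"
   by (rule ncyc_split[OF d(2) ab(1,3) that(2)])+
  have k: "inv (swp a b o p) o cl (u @ v) = inv p o ?g" unfolding kreweras_cut[OF d(4)] g by simp
  have "(swp a b o p) permutes ?S" by (rule permutes_compose[OF d(1) permutes_swap_id[OF ab(1,2)]])
  thus ?thesis using n d(3) k by (auto simp: disc_def)
 qed
 have 2: "swp a b o p \<in> {p \<in> annulus u v. b \<in> orbit p a}" if "p \<in> disc (u @ v)" "b ~: orbit p a" for p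
 proof -
  note d = discD[OF that(1), simplified]
  let ?p = "swp a b o p"
  have n: "Suc (ncyc ?S ?p) = ncyc ?S p" by (rule ncyc_join[OF d(2) ab(1,2) that(2)])
  have k: "inv ?p o ?g = inv p o cl (u @ v)" unfolding kreweras_cut[OF d(4)] g by simp
  have pp: "?p permutes ?S" by (rule permutes_compose[OF d(1) permutes_swap_id[OF ab(1,2)]])
  have o: "b \<in> orbit ?p a" by (rule in_orbit_swp[OF d(2) ab(1,2) that(2)])
  have "\<exists>i\<in>set u. ?p i \<in> set v"
  proof (rule ccontr)
   assume *: "\<not> ?thesis"
   have "?p i \<in> set u" if "i \<in> set u" for i using * permutes_in_image[OF pp, of i] that by auto
   hence "perm_on (set u) ?p" using perm_on_of_image_subset[OF pp, of "set u"] by auto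
   hence "orbit ?p a <= set u" by (rule orbit_sub) (use ab in auto)
   thus False using o ab by blast
  qed
  thus ?thesis using n d(3) k pp o by (auto simp: annulus_def)
 qed
 show ?thesis unfolding a_def[symmetric] b_def[symmetric]
  by (rule bij_betwI[where g = "%p. swp a b o p"]) (use 1 2 in auto)
qed

lemma perm_on_insert_fixed: "perm_on S p ==> p e = e ==> perm_on (insert e S) p"
 unfolding perm_on_def by auto

lemma orbit_subset_insert:
 assumes "perm_on S p" "p e = e" "x \<in> S" "e ~: S"
 shows "e ~: orbit p x" "x ~: orbit p e"
 using orbit_sub[OF assms(1,3)] assms orbit_eq_singleton_iff[of p e] by auto

lemma ncyc_insert_point:
 assumes "perm_on S p" "p e = e" "x \<in> S" "e ~: S"
 shows "ncyc (insert e S) (swp x e o p) = ncyc S p" "ncyc (insert e S) (swp e x o p) = ncyc S p"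
proof -
 have p: "perm_on (insert e S) p" by (rule perm_on_insert_fixed[OF assms(1,2)])
 have n: "ncyc (insert e S) p = Suc (ncyc S p)" by (rule ncyc_insert_fixed[OF assms(1,2,4)])
 show "ncyc (insert e S) (swp x e o p) = ncyc S p"
  using ncyc_join[OF p _ _ orbit_subset_insert(1)[OF assms]] n assms(3) by simp
 thus "ncyc (insert e S) (swp e x o p) = ncyc S p" by (simp add: transpose_commute)
qed

lemma orbit_insert_point:
 assumes "perm_on S p" "p e = e" "x \<in> S" "e ~: S"
 shows "orbit (swp x e o p) x = insert e (orbit p x)"
proof -
 have perm: "permutation p" using assms perm_onD by metis
 obtain c where c: "cycle_list p c" "hd c = x" "set c = orbit p x" using exists_cycle_list[OF perm] .
 have "e ~: set c" using orbit_subset_insert(1)[OF assms] c by simp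
 hence "cycle_list (swp x e o p) (c @ [e])"
  using cycle_list_append_join[OF c(1) cycle_list_single[of p e, OF assms(2)]] c(2) by simp
 moreover have "x \<in> set (c @ [e])" using c perm permutation_self_in_orbit[of p x] by simp
 ultimately have "orbit (swp x e o p) x = set (c @ [e])" by (rule cycle_list_orbit)
 thus ?thesis using c by simp
qed

lemma insert_kreweras:
 assumes "perm_on S p" "p e = e" "e ~: S" "o' \<in> S" "w \<in> insert e S"
 shows "w = o' ==> inv (swp o' w o (swp o' e o p)) o (swp o' e o g) = inv p o g"
  "w ~= o' ==> \<exists>y\<in>S. inv (swp o' w o (swp o' e o p)) o (swp o' e o g) = swp e y o (inv p o g)"
proof -
 have perm: "permutation p" using assms perm_onD by metis
 have perm0: "permutation (swp o' e o p)" using perm by (simp add: permutation_compose permutation_swap_id)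
 have k: "inv (swp o' w o (swp o' e o p)) o (swp o' e o g) = inv p o (swp o' e o (swp o' w o (swp o' e o g)))"
  unfolding kreweras_cut[OF perm0] kreweras_cut[OF perm] ..
 have ie: "inv p e = e" using assms(2) perm_on_inv_f(1)[OF assms(1), of e] by simp
 show "w = o' ==> inv (swp o' w o (swp o' e o p)) o (swp o' e o g) = inv p o g"
  unfolding k by (simp add: fun_eq_iff)
 assume w: "w ~= o'"
 show "\<exists>y\<in>S. inv (swp o' w o (swp o' e o p)) o (swp o' e o g) = swp e y o (inv p o g)"
 proof (cases "w = e")
  case True
  have "inv p o (swp o' e o (swp o' w o (swp o' e o g))) = inv p o swp e o' o g"
   using True by (simp add: fun_eq_iff transpose_commute)
  also have "... = swp (inv p e) (inv p o') o inv p o g"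
   by (subst comp_swp) (use perm in "simp_all add: permutation_inverse")
  finally show ?thesis unfolding k using ie perm_on_inv_in[OF assms(1,4)] by (auto simp: comp_assoc)
 next
  case False
  have "swp o' e (swp o' w (swp o' e x)) = swp e w x" for x
   using w False assms by (auto simp: Transposition.transpose_def)
  hence "inv p o (swp o' e o (swp o' w o (swp o' e o g))) = inv p o swp e w o g"
   by (simp add: fun_eq_iff)
  also have "... = swp (inv p e) (inv p w) o inv p o g"
   by (subst comp_swp) (use perm in "simp_all add: permutation_inverse")
  finally show ?thesis unfolding k using ie perm_on_inv_in[OF assms(1), of w] assms(5) False by (auto simp: comp_assoc)
 qed
qed

lemma insert_count:
 assumes "perm_on S p" "p e = e" "perm_on S g" "g e = e" "e ~: S" "o' \<in> S" "w \<in> insert e S"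
 defines "q \<equiv> swp o' w o (swp o' e o p)"
 shows "w \<in> insert e (orbit p o') ==>
   ncyc (insert e S) q + ncyc (insert e S) (inv q o (swp o' e o g)) = Suc (ncyc S p + ncyc S (inv p o g))"
  "w ~: insert e (orbit p o') ==>
   Suc (ncyc (insert e S) q + ncyc (insert e S) (inv q o (swp o' e o g))) = ncyc S p + ncyc S (inv p o g)"
proof -
 let ?S = "insert e S" and ?K = "inv p o g"
 have pS: "perm_on ?S p" by (rule perm_on_insert_fixed[OF assms(1,2)])
 have pn: "ncyc ?S p = Suc (ncyc S p)" by (rule ncyc_insert_fixed[OF assms(1,2,5)])
 have K: "perm_on S ?K" by (rule perm_on_compose[OF perm_on_inv[OF assms(1)] assms(3)])
 have Ke: "?K e = e" using assms(2,4) perm_on_inv_f(1)[OF assms(1), of e] by simp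
 have Kn: "ncyc ?S ?K = Suc (ncyc S ?K)" by (rule ncyc_insert_fixed[OF K Ke assms(5)])
 define p0 where "p0 = swp o' e o p"
 have p0: "perm_on ?S p0" unfolding p0_def using assms(6) by (intro perm_on_swp_comp pS) auto
 have p0n: "ncyc ?S p0 = ncyc S p" unfolding p0_def by (rule ncyc_insert_point(1)[OF assms(1,2,6,5)])
 have o0: "orbit p0 o' = insert e (orbit p o')" unfolding p0_def by (rule orbit_insert_point[OF assms(1,2,6,5)])
 note k = insert_kreweras[OF assms(1,2,5,6,7), of g, folded q_def]
 have oo: "o' \<in> orbit p o'" by (rule in_own_orbit[OF assms(1)])
 have kn: "ncyc ?S (inv q o (swp o' e o g)) = (if w = o' then Suc (ncyc S ?K) else ncyc S ?K)"
 proof (cases "w = o'")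
  case True thus ?thesis using k(1) Kn by (simp only: if_True refl)
 next
  case False
  then obtain y where "y \<in> S" "inv q o (swp o' e o g) = swp e y o ?K" using k(2) by blast
  thus ?thesis using False ncyc_insert_point(2)[OF K Ke _ assms(5), of y] by (simp only: if_False)
 qed
 {
  assume w: "w \<in> insert e (orbit p o')"
  show "ncyc ?S q + ncyc ?S (inv q o (swp o' e o g)) = Suc (ncyc S p + ncyc S ?K)"
  proof (cases "w = o'")
   case True
   hence "q = p0" by (simp add: q_def p0_def fun_eq_iff)
   thus ?thesis using kn True p0n by simp
  next
   case False
   have "ncyc ?S q = Suc (ncyc S p)"
    unfolding q_def p0_def[symmetric] using ncyc_split(1)[OF p0 _ _ w[folded o0]] False assms(6) p0n by auto
   thus ?thesis using kn False by simp
  qed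
 next
  assume w: "w ~: insert e (orbit p o')"
  have "Suc (ncyc ?S q) = ncyc S p"
   unfolding q_def p0_def[symmetric] using ncyc_join[OF p0 _ assms(7) w[folded o0]] assms(6) p0n by auto
  thus "Suc (ncyc ?S q + ncyc ?S (inv q o (swp o' e o g))) = ncyc S p + ncyc S ?K"
   using kn w oo by auto
 }
qed

lemma insert_inverse:
 assumes "q permutes insert e S" "o' \<in> S" "e ~: S"
 defines "w \<equiv> q e"
 defines "p \<equiv> swp o' e o (swp o' w o q)"
 shows "p permutes S" "w \<in> insert e S" "q = swp o' w o (swp o' e o p)"
proof -
 show w: "w \<in> insert e S" using assms(1) permutes_in_image[of q "insert e S" e] by (simp add: w_def)
 have "(swp o' w) permutes insert e S" "(swp o' e) permutes insert e S"
  using w assms(2) by (auto intro: permutes_swap_id)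
 hence "p permutes insert e S" unfolding p_def using assms(1) by (intro permutes_compose)
 moreover have "p e = e" using assms(2,3) by (auto simp: p_def w_def)
 ultimately show "p permutes S" using permutes_superset[of p "insert e S" S] by auto
 show "q = swp o' w o (swp o' e o p)" by (simp add: p_def)
qed

lemma insert_forward:
 assumes "p permutes S" "o' \<in> S" "e ~: S" "w \<in> insert e S"
 defines "q \<equiv> swp o' w o (swp o' e o p)"
 shows "q permutes insert e S" "q e = w" "swp o' e o (swp o' w o q) = p"
proof -
 have "(swp o' w) permutes insert e S" "(swp o' e) permutes insert e S"
  using assms(2,4) by (auto intro: permutes_swap_id)
 moreover have "p permutes insert e S" using assms(1) permutes_subset by blast
 ultimately show "q permutes insert e S" unfolding q_def by (intro permutes_compose)
 have "p e = e" using assms(1,3) permutes_not_in by metis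
 thus "q e = w" by (simp add: q_def)
 show "swp o' e o (swp o' w o q) = p" by (simp add: q_def)
qed

text \<open>A last letter e is added by joining it to the cycle of the first letter and then splitting this cycle at
any of its elements w; the choice w = hd u leaves it unsplit, and w = e makes e a cycle of its own. This is the shape of
the recursion, where e is the letter that carries the identity matrix.\<close>

theorem disc_insert:
 assumes "distinct (u @ [e])" "u ~= []"
 shows "bij_betw (%(p, w). swp (hd u) w o (swp (hd u) e o p)) (SIGMA p:disc u. insert e (orbit p (hd u)))
      (disc (u @ [e]))"
proof -
 define a where "a = hd u"
 let ?S = "set u"
 have a: "a \<in> ?S" and e: "e ~: ?S" using assms by (auto simp: a_def)
 have g: "cl (u @ [e]) = swp a e o cl u" unfolding a_def by (rule cl_snoc[OF assms])
 have gp: "perm_on ?S (cl u)" "cl u e = e" using e by (auto simp: cl_perm_on cl_outside)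
 have S: "set (u @ [e]) = insert e ?S" by simp
 have key: "swp a w o (swp a e o p) \<in> disc (u @ [e]) \<longleftrightarrow> p \<in> disc u \<and> w \<in> insert e (orbit p a)"
  if p: "p permutes ?S" and w: "w \<in> insert e ?S" for p w
 proof -
  have pp: "perm_on ?S p" "p e = e" using p permutes_not_in[OF p e] by (simp_all add: permutes_perm_on)
  note c = insert_count[OF pp gp e a w]
  have b: "ncyc ?S p + ncyc ?S (inv p o cl u) \<le> Suc (length u)"
   by (rule disc_bound) (use assms pp in auto)
  show ?thesis
   using c b insert_forward(1)[OF p a e w] p
   by (cases "w \<in> insert e (orbit p a)") (auto simp: disc_def g)
 qed
 show ?thesis unfolding a_def[symmetric]
 proof (rule bij_betwI[where g = "%q. (swp a e o (swp a (q e) o q), q e)"])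
  show "(%(p, w). swp a w o (swp a e o p)) \<in> (SIGMA p:disc u. insert e (orbit p a)) \<rightarrow> disc (u @ [e])"
  proof (clarify)
   fix p w assume m: "p \<in> disc u" "w \<in> insert e (orbit p a)"
   have "w \<in> insert e ?S" using m orbit_sub[OF discD(2)[OF m(1)] a] by auto
   thus "swp a w o (swp a e o p) \<in> disc (u @ [e])" using key[OF discD(1)[OF m(1)]] m by simp
  qed
  show "(%q. (swp a e o (swp a (q e) o q), q e)) \<in> disc (u @ [e]) \<rightarrow> (SIGMA p:disc u. insert e (orbit p a))"
  proof
   fix q assume m: "q \<in> disc (u @ [e])"
   note i = insert_inverse[OF discD(1)[OF m, unfolded S] a e]
   show "(swp a e o (swp a (q e) o q), q e) \<in> (SIGMA p:disc u. insert e (orbit p a))"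
    using key[OF i(1,2)] m i(3) by simp
  qed
 next
  fix x assume x: "x \<in> (SIGMA p:disc u. insert e (orbit p a))"
  obtain p w where [simp]: "x = (p, w)" by (cases x)
  have "p \<in> disc u" "w \<in> insert e (orbit p a)" using x by auto
  hence "p permutes ?S" "w \<in> insert e ?S" using orbit_sub[OF discD(2) a] discD(1) by auto
  from insert_forward(2,3)[OF this(1) a e this(2)]
  show "(swp a e o (swp a ((case x of (p, w) => swp a w o (swp a e o p)) e) o (case x of (p, w) => swp a w o (swp a e o p))),
    (case x of (p, w) => swp a w o (swp a e o p)) e) = x" by simp
 qed simp
qed

text \<open>Besides the splittings as in the disc there is a second family: p preserves both circles, and the
two transpositions join the cycle of the first letter, the new letter and a cycle of the inner circle.\<close>

theorem annulus_insert:
 assumes "distinct (u @ e # v)" "u ~= []" "v ~= []"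
 shows "bij_betw (%(p, w). swp (hd u) w o (swp (hd u) e o p))
      ((SIGMA p:annulus u v. insert e (orbit p (hd u))) Un (%(p, q). p o q) ` (disc u \<times> disc v) \<times> set v)
      (annulus (u @ [e]) v)"
proof -
 define a where "a = hd u"
 let ?S = "set u Un set v" and ?g = "cl u o cl v"
 let ?P = "(%(p, q). p o q) ` (disc u \<times> disc v)"
 have d: "distinct (u @ v)" "distinct (u @ [e])" and dis: "set u Int set v = {}" using assms by auto
 have a: "a \<in> ?S" "a \<in> set u" and e: "e ~: ?S" using assms by (auto simp: a_def)
 have ne: "e ~: set v" "a ~: set v" using e a dis by auto
 have g: "cl (u @ [e]) o cl v = swp a e o ?g" unfolding a_def cl_snoc[OF d(2) assms(2)] by (simp add: comp_assoc)
 have gp: "perm_on ?S ?g" "?g e = e" using e by (auto simp: perm_on_comp_cl cl_outside)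
 have S: "set (u @ [e]) Un set v = insert e ?S" by simp
 have key: "swp a w o (swp a e o p) \<in> annulus (u @ [e]) v \<longleftrightarrow>
   p \<in> annulus u v \<and> w \<in> insert e (orbit p a) \<or> p \<in> ?P \<and> w \<in> set v"
  if p: "p permutes ?S" and w: "w \<in> insert e ?S" for p w
 proof -
  have pp: "perm_on ?S p" "p e = e" using p permutes_not_in[OF p e] by (simp_all add: permutes_perm_on)
  note c = insert_count[of ?S p e ?g a w, OF pp gp e a(1) w]
  let ?q = "swp a w o (swp a e o p)"
  have qp: "?q permutes insert e ?S" by (rule insert_forward(1)[OF p a(1) e w])
  show ?thesis
  proof (cases "\<exists>i\<in>set u. p i \<in> set v")
   case True
   then obtain i where i: "i \<in> set u" "p i \<in> set v" by auto
   have b: "ncyc ?S p + ncyc ?S (inv p o ?g) \<le> length u + length v"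
    by (rule annulus_bound[OF d(1) pp(1) i])
   have P: "p ~: ?P"
   proof
    assume "p \<in> ?P"
    then obtain p1 p2 where "p1 \<in> disc u" "p2 \<in> disc v" "p = p1 o p2" by auto
    hence "p ` set u = set u" using two_disc_count(3)[OF d(1)] by simp
    thus False using i dis by blast
   qed
   have conn: "\<exists>i\<in>set (u @ [e]). ?q i \<in> set v" if "w \<in> insert e (orbit p a)"
   proof (cases "p i = w")
    case True
    have "p i ~= e" "p i ~= a" using i ne by auto
    hence "?q e = w" "w \<in> set v" using insert_forward(2)[OF p a(1) e w] True i by auto
    thus ?thesis by auto
   next
    case False
    have "p i ~= e" "p i ~= a" using i ne by auto
    hence "?q i = p i" using False by simp
    thus ?thesis using i by (intro bexI[of _ i]) auto
   qed
   show ?thesis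
    using c b qp p P conn True
    by (cases "w \<in> insert e (orbit p a)") (auto simp: annulus_def g)
  next
   case False
   have im: "p i \<in> set u" if "i \<in> set u" for i using False permutes_in_image[OF p, of i] that by auto
   have pu: "perm_on (set u) p" by (rule perm_on_of_image_subset[OF p]) (use im in auto)
   have orb: "orbit p a <= set u" by (rule orbit_sub[OF pu a(2)])
   have na: "p ~: annulus u v" using False annulusD(5) by blast
   show ?thesis
   proof (cases "w \<in> set v")
    case True
    hence w': "w ~: insert e (orbit p a)" using orb dis ne by auto
    have "?q e = w" by (rule insert_forward(2)[OF p a(1) e w])
    hence conn: "\<exists>i\<in>set (u @ [e]). ?q i \<in> set v" using True by auto
    have 1: "?q \<in> annulus (u @ [e]) v \<longleftrightarrow> ncyc ?S p + ncyc ?S (inv p o ?g) = length u + length v + 2"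
     using c(2)[OF w'] qp conn by (auto simp: annulus_def g)
    have "p \<in> ?P \<longleftrightarrow> ncyc ?S p + ncyc ?S (inv p o ?g) = length u + length v + 2"
    proof
     assume "p \<in> ?P" thus "ncyc ?S p + ncyc ?S (inv p o ?g) = length u + length v + 2"
      using two_disc_count(2)[OF d(1)] by auto
    next
     assume "ncyc ?S p + ncyc ?S (inv p o ?g) = length u + length v + 2"
     from two_disc_split[OF d(1) assms(2,3) p this] show "p \<in> ?P" by (metis SigmaI case_prod_conv image_eqI)
    qed
    thus ?thesis using 1 na True by auto
   next
    case False
    have closed: "?q i \<in> insert e (set u)" if "i \<in> insert e (set u)" for i
    proof -
     have "p i \<in> insert e (set u)" using im[of i] that pp(2) by auto
     moreover have "w \<in> insert e (set u)" using w False by auto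
     ultimately show ?thesis using a by (auto simp: Transposition.transpose_def)
    qed
    hence "?q ~: annulus (u @ [e]) v"
     using annulusD(5)[of ?q "u @ [e]" v] dis ne(1) closed
     by (metis (no_types, lifting) Un_insert_right append_Nil2 disjoint_insert(2) disjoint_iff list.simps(15) set_append)
    thus ?thesis using na False by auto
   qed
  qed
 qed
 have Pperm: "p permutes ?S" if "p \<in> ?P" for p using that two_disc_count(1)[OF d(1)] by auto
 let ?D = "(SIGMA p:annulus u v. insert e (orbit p a)) Un ?P \<times> set v"
 have mem: "p permutes ?S \<and> w \<in> insert e ?S" if "(p, w) \<in> ?D" for p w
 proof (cases "p \<in> annulus u v \<and> w \<in> insert e (orbit p a)")
  case True
  thus ?thesis using annulusD(1)[of p u v] orbit_sub[OF annulusD(2) a(1)] by auto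
 next
  case False
  hence "p \<in> ?P" "w \<in> set v" using that by auto
  thus ?thesis using Pperm by auto
 qed
 show ?thesis unfolding a_def[symmetric]
 proof (rule bij_betwI[where g = "%q. (swp a e o (swp a (q e) o q), q e)"])
  show "(%(p, w). swp a w o (swp a e o p)) \<in> ?D \<rightarrow> annulus (u @ [e]) v"
  proof
   fix x assume x: "x \<in> ?D"
   obtain p w where xx: "x = (p, w)" by (cases x)
   have "p \<in> annulus u v \<and> w \<in> insert e (orbit p a) \<or> p \<in> ?P \<and> w \<in> set v" using x unfolding xx by blast
   thus "(case x of (p, w) => swp a w o (swp a e o p)) \<in> annulus (u @ [e]) v"
    using key[of p w] mem[of p w] x unfolding xx by simp
  qed
  show "(%q. (swp a e o (swp a (q e) o q), q e)) \<in> annulus (u @ [e]) v \<rightarrow> ?D"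
  proof
   fix q assume m: "q \<in> annulus (u @ [e]) v"
   note i = insert_inverse[OF annulusD(1)[OF m, unfolded S] a(1) e]
   have "swp a e o (swp a (q e) o q) \<in> annulus u v \<and> q e \<in> insert e (orbit (swp a e o (swp a (q e) o q)) a)
    \<or> swp a e o (swp a (q e) o q) \<in> ?P \<and> q e \<in> set v"
    using key[OF i(1,2)] m unfolding i(3)[symmetric] by blast
   thus "(swp a e o (swp a (q e) o q), q e) \<in> ?D" by blast
  qed
 next
  fix x assume x: "x \<in> ?D"
  obtain p w where xx: "x = (p, w)" by (cases x)
  have "p permutes ?S" "w \<in> insert e ?S" using mem[of p w] x xx by blast+
  from insert_forward(2,3)[OF this(1) a(1) e this(2)]
  show "(swp a e o (swp a ((case x of (p, w) => swp a w o (swp a e o p)) e) o (case x of (p, w) => swp a w o (swp a e o p))),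
    (case x of (p, w) => swp a w o (swp a e o p)) e) = x" by (simp add: xx)
 qed simp
qed

theorem annulus_single:
 assumes "distinct (e # v)" "v ~= []"
 shows "bij_betw (%(q, w). swp e w o q) (disc v \<times> set v) (annulus [e] v)"
proof -
 let ?S = "set v"
 have e: "e ~: ?S" using assms by simp
 have S: "set [e] Un set v = insert e ?S" by simp
 have key: "swp e w o p \<in> annulus [e] v \<longleftrightarrow> p \<in> disc v"
  if p: "p permutes ?S" and w: "w \<in> ?S" for p w
 proof -
  have pp: "perm_on ?S p" "p e = e" using p permutes_not_in[OF p e] by (simp_all add: permutes_perm_on)
  let ?q = "swp e w o p" and ?K = "inv p o cl v"
  have K: "perm_on ?S ?K" "?K e = e" using perm_on_compose[OF perm_on_inv[OF pp(1)] cl_perm_on] e pp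
    perm_on_inv_f(1)[OF pp(1), of e] by (auto simp: cl_outside)
  have ie: "inv p e = e" using pp(2) perm_on_inv_f(1)[OF pp(1), of e] by simp
  have k: "inv ?q o cl v = swp e (inv p w) o ?K" using kreweras_swp[OF pp(1), of e w "cl v"] ie by simp
  have 1: "ncyc (insert e ?S) ?q = ncyc ?S p" by (rule ncyc_insert_point(2)[OF pp w e])
  have 2: "ncyc (insert e ?S) (inv ?q o cl v) = ncyc ?S ?K"
   unfolding k by (rule ncyc_insert_point(2)[OF K perm_on_inv_in[OF pp(1) w] e])
  have "?q permutes insert e ?S"
   using p w by (intro permutes_compose[OF permutes_subset[OF p]] permutes_swap_id) auto
  moreover have "?q e \<in> set v" using pp w by simp
  ultimately show ?thesis using 1 2 p by (auto simp: annulus_def disc_def)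
 qed
 show ?thesis
 proof (rule bij_betwI[where g = "%q. (swp e (q e) o q, q e)"])
  show "(%(q, w). swp e w o q) \<in> disc v \<times> set v \<rightarrow> annulus [e] v"
   using key discD(1) by auto
  show "(%q. (swp e (q e) o q, q e)) \<in> annulus [e] v \<rightarrow> disc v \<times> set v"
  proof
   fix q assume m: "q \<in> annulus [e] v"
   note d = annulusD[OF m, unfolded S]
   have w: "q e \<in> set v" using d(5) by simp
   have "(swp e (q e) o q) permutes insert e ?S"
    using w by (intro permutes_compose[OF d(1)] permutes_swap_id) auto
   moreover have "(swp e (q e) o q) e = e" by simp
   ultimately have p: "(swp e (q e) o q) permutes ?S" using permutes_superset[of "swp e (q e) o q" "insert e ?S" ?S] by blast
   show "(swp e (q e) o q, q e) \<in> disc v \<times> set v" using key[OF p w] m w by simp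
  qed
 next
  fix x assume x: "x \<in> disc v \<times> set v"
  obtain p w where xx: "x = (p, w)" by (cases x)
  have "p e = e" using discD(1)[of p v] x xx e permutes_not_in[of p "set v" e] by auto
  thus "(swp e ((case x of (q, w) => swp e w o q) e) o (case x of (q, w) => swp e w o q),
   (case x of (q, w) => swp e w o q) e) = x" by (simp add: xx)
 qed simp
qed

lemma fixed_kreweras:
 assumes "perm_on S p" "p x = x"
 shows "inv p o (swp x h o g) = swp x (inv p h) o (inv p o g)"
proof -
 have "inv p x = x" using assms(2) perm_on_inv_f(1)[OF assms(1), of x] by simp
 moreover have "permutation (inv p)" by (rule permutation_inverse[OF perm_onD(2)[OF assms(1)]])
 ultimately show ?thesis using comp_swp[of "inv p" x h] by (simp add: comp_assoc[symmetric])
qed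

lemma fixed_count:
 assumes "perm_on S p" "p x = x" "perm_on S g" "g x = x" "x ~: S" "h \<in> S"
 shows "ncyc (insert x S) p = Suc (ncyc S p)"
  "ncyc (insert x S) (inv p o (swp x h o g)) = ncyc S (inv p o g)"
proof -
 show "ncyc (insert x S) p = Suc (ncyc S p)" by (rule ncyc_insert_fixed[OF assms(1,2,5)])
 have K: "perm_on S (inv p o g)" by (rule perm_on_compose[OF perm_on_inv[OF assms(1)] assms(3)])
 have Kx: "(inv p o g) x = x" using assms(2,4) perm_on_inv_f(1)[OF assms(1), of x] by simp
 show "ncyc (insert x S) (inv p o (swp x h o g)) = ncyc S (inv p o g)"
  unfolding fixed_kreweras[OF assms(1,2)]
  by (rule ncyc_insert_point(2)[OF K Kx perm_on_inv_in[OF assms(1,6)] assms(5)])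
qed

theorem disc_fixed:
 assumes "distinct (x # w)" "w ~= []"
 shows "{p \<in> disc (x # w). p x = x} = disc w"
proof -
 have x: "x ~: set w" "hd w \<in> set w" and c: "cl (x # w) = swp x (hd w) o cl w"
  using assms cl_Cons[of x w] by auto
 have g: "perm_on (set w) (cl w)" "cl w x = x" using x by (auto simp: cl_perm_on cl_outside)
 have "p \<in> disc (x # w) \<longleftrightarrow> p \<in> disc w" if p: "p permutes set w" for p
 proof -
  have pp: "perm_on (set w) p" "p x = x" using p x permutes_not_in by (auto simp: permutes_perm_on)
  have "p permutes insert x (set w)" using p permutes_subset by blast
  thus ?thesis using fixed_count[OF pp g x] p by (auto simp: disc_def c)
 qed
 moreover have "p permutes set w" if "p \<in> disc (x # w)" "p x = x" for p
  using permutes_superset[OF discD(1)[OF that(1)], of "set w"] that(2) by auto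
 moreover have "p x = x" if "p \<in> disc w" for p using permutes_not_in[OF discD(1)[OF that] x(1)] .
 moreover have "p permutes set w" if "p \<in> disc w" for p using discD(1)[OF that] .
 ultimately show ?thesis by blast
qed

theorem annulus_fixed:
 assumes "distinct (x # u @ v)" "u ~= []"
 shows "{p \<in> annulus (x # u) v. p x = x} = annulus u v"
proof -
 let ?S = "set u Un set v"
 have x: "x ~: ?S" "hd u \<in> ?S" and c: "cl (x # u) o cl v = swp x (hd u) o (cl u o cl v)"
  using assms cl_Cons[of x u] by (auto simp: comp_assoc)
 have g: "perm_on ?S (cl u o cl v)" "(cl u o cl v) x = x" using x by (auto simp: perm_on_comp_cl cl_outside)
 have "p \<in> annulus (x # u) v \<longleftrightarrow> p \<in> annulus u v" if p: "p permutes ?S" for p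
 proof -
  have pp: "perm_on ?S p" "p x = x" using p permutes_not_in[OF p x(1)] by (simp_all add: permutes_perm_on)
  have "p permutes insert x ?S" using p permutes_subset by blast
  thus ?thesis using fixed_count[of ?S p x "cl u o cl v" "hd u", OF pp g x] p pp(2) x by (simp add: annulus_def c)
 qed
 moreover have "p permutes ?S" if "p \<in> annulus (x # u) v" "p x = x" for p
  using permutes_superset[OF annulusD(1)[OF that(1)], of ?S] that(2) by auto
 moreover have "p x = x" if "p \<in> annulus u v" for p using permutes_not_in[OF annulusD(1)[OF that] x(1)] .
 moreover have "p permutes ?S" if "p \<in> annulus u v" for p using annulusD(1)[OF that] .
 ultimately show ?thesis by blast
qed

section \<open>Relabelling and the order of the cycles\<close>

lemma relabel_cycle_list:
 assumes "inj_on h T" "!!x. x \<in> T ==> q (h x) = h (p x)" "cycle_list p c" "set c <= T"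
 shows "cycle_list q (map h c)"
proof -
 have "map q (map h c) = map h (map p c)" using assms(2,4) by (auto simp: subset_iff)
 also have "... = rotate1 (map h c)" using assms(3) by (simp add: cycle_list_def rotate1_map)
 finally show ?thesis
  using assms(1,3,4) inj_on_subset[OF assms(1,4)] by (auto simp: cycle_list_def distinct_map)
qed

lemma relabel_orbit:
 assumes "perm_on T p" "inj_on h T" "!!x. x \<in> T ==> q (h x) = h (p x)" "x \<in> T"
 shows "orbit q (h x) = h ` orbit p x"
proof -
 obtain c where c: "cycle_list p c" "hd c = x" "set c = orbit p x"
  using exists_cycle_list[OF perm_onD(2)[OF assms(1)]] .
 have s: "set c <= T" using c orbit_sub[OF assms(1,4)] by simp
 have "x \<in> set c" using c in_own_orbit[OF assms(1)] by simp
 thus ?thesis using cycle_list_orbit[OF relabel_cycle_list[OF assms(2,3) c(1) s], of "h x"] c(3) by auto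
qed

lemma relabel_orbs:
 assumes "perm_on T p" "inj_on h T" "!!x. x \<in> T ==> q (h x) = h (p x)"
 shows "orbs (h ` T) q = (`) h ` orbs T p" "inj_on ((`) h) (orbs T p)"
proof -
 show "orbs (h ` T) q = (`) h ` orbs T p"
  unfolding orbs_def using relabel_orbit[OF assms] by (auto simp: image_image)
 show "inj_on ((`) h) (orbs T p)"
 proof (rule inj_onI)
  fix X Y assume "X \<in> orbs T p" "Y \<in> orbs T p" and e: "h ` X = h ` Y"
  hence "X <= T" "Y <= T" using orbit_sub[OF assms(1)] by (auto simp: orbs_def)
  thus "X = Y" using inj_on_image_eq_iff[OF assms(2)] e by blast
 qed
qed

lemma relabel_ncyc:
 assumes "perm_on T p" "inj_on h T" "!!x. x \<in> T ==> q (h x) = h (p x)"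
 shows "ncyc (h ` T) q = ncyc T p"
 using card_image[OF relabel_orbs(2)[of T p h q, OF assms]] relabel_orbs(1)[of T p h q, OF assms]
 by (simp add: ncyc_def)

lemma cprod_choice:
 assumes "perm_on T p" "rot_inv f" "!!X. X \<in> orbs T p ==> cycle_list p (r X) \<and> set (r X) = X"
 shows "cprod T f p = (\<Prod>X\<in>orbs T p. f (r X))"
 unfolding cprod_def
proof (rule prod.cong[OF refl])
 fix X assume X: "X \<in> orbs T p"
 then obtain x where x: "x \<in> T" "X = orbit p x" by (auto simp: orbs_def)
 define i where "i = (SOME i. i \<in> X)"
 have "i \<in> X" unfolding i_def using in_own_orbit[OF assms(1), of x] x by (auto intro: someI)
 hence "orbit p i = X" using x orbit_eq_iff[OF perm_onD(2)[OF assms(1)]] by simp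
 hence "set (support p i) = set (r X)" using set_support[OF perm_onD(2)[OF assms(1)], of i] assms(3)[OF X] by simp
 hence "f (support p i) = f (r X)"
  using rot_inv_cycle_list[OF assms(2) cycle_support(1)[OF perm_onD(2)[OF assms(1)]]] assms(3)[OF X] by blast
 thus "f (support p (SOME i. i \<in> X)) = f (r X)" by (simp add: i_def)
qed

lemma rot_inv_map: "rot_inv f ==> rot_inv (%c. f (map h c))"
 by (simp add: rot_inv_def rotate1_map[symmetric])

lemma orbs_choice_support:
 assumes "perm_on T p" "X \<in> orbs T p"
 defines "c \<equiv> support p (SOME i. i \<in> X)"
 shows "cycle_list p c" "set c = X" "X <= T"
proof -
 obtain x where x: "x \<in> T" "X = orbit p x" using assms(2) by (auto simp: orbs_def)
 have "(SOME i. i \<in> X) \<in> X" using in_own_orbit[OF assms(1), of x] x by (auto intro: someI)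
 hence "orbit p (SOME i. i \<in> X) = X" using x orbit_eq_iff[OF perm_onD(2)[OF assms(1)]] by simp
 thus "cycle_list p c" "set c = X"
  using set_support[OF perm_onD(2)[OF assms(1)]] cycle_support(1)[OF perm_onD(2)[OF assms(1)]] by (simp_all add: c_def)
 show "X <= T" using orbit_sub[OF assms(1) x(1)] x(2) by simp
qed

lemma relabel_cprod:
 assumes "perm_on T p" "inj_on h T" "!!x. x \<in> T ==> q (h x) = h (p x)" "perm_on (h ` T) q" "rot_inv f"
 shows "cprod (h ` T) f q = cprod T (%c. f (map h c)) p"
proof -
 define s where "s = (%X. support p (SOME i. i \<in> X))"
 note sup = orbs_choice_support[OF assms(1), folded s_def]
 have s: "cycle_list p (s X) \<and> set (s X) = X" if "X \<in> orbs T p" for X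
  using orbs_choice_support(1,2)[OF assms(1) that] by (simp add: s_def del: set_map)
 define r where "r = (%Y. map h (s (the_inv_into (orbs T p) ((`) h) Y)))"
 have r1: "r (h ` X) = map h (s X)" if "X \<in> orbs T p" for X
  using the_inv_into_f_f[OF relabel_orbs(2)[of T p h q, OF assms(1-3)] that] by (simp add: r_def)
 have r: "cycle_list q (r Y) \<and> set (r Y) = Y" if Y: "Y \<in> orbs (h ` T) q" for Y
 proof -
  obtain X where X: "X \<in> orbs T p" "Y = h ` X" using Y relabel_orbs(1)[of T p h q, OF assms(1-3)] by auto
  have "set (s X) <= T" using s[OF X(1)] orbs_choice_support(3)[OF assms(1) X(1)] by simp
  thus ?thesis using relabel_cycle_list[of h T q p "s X", OF assms(2,3)] s[OF X(1)] r1[OF X(1)] X(2) by simp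
 qed
 have "cprod (h ` T) f q = (\<Prod>Y\<in>orbs (h ` T) q. f (r Y))" by (rule cprod_choice[OF assms(4,5) r])
 also have "... = (\<Prod>X\<in>orbs T p. f (r (h ` X)))"
  using prod.reindex[OF relabel_orbs(2)[of T p h q, OF assms(1-3)], of "%Y. f (r Y)"]
   relabel_orbs(1)[of T p h q, OF assms(1-3)] by simp
 also have "... = (\<Prod>X\<in>orbs T p. f (map h (s X)))" by (rule prod.cong) (simp_all add: r1)
 also have "... = cprod T (%c. f (map h c)) p"
  by (rule cprod_choice[symmetric, OF assms(1) rot_inv_map[OF assms(5)] s])
 finally show ?thesis .
qed

lemma ncyc_conj:
 assumes "perm_on T p" "perm_on T g" shows "ncyc T (inv g o p o g) = ncyc T p"
proof -
 have i: "inj_on (inv g) T" using perm_onD(5)[OF perm_on_inv[OF assms(2)]] inj_on_subset by blast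
 have "ncyc (inv g ` T) (inv g o p o g) = ncyc T p"
  by (rule relabel_ncyc[OF assms(1) i]) (simp add: perm_on_inv_f[OF assms(2)])
 thus ?thesis using perm_onD(3)[OF perm_on_inv[OF assms(2)]] by simp
qed

lemma inv_kreweras:
 assumes "perm_on T p" "perm_on T g"
 shows "inv (inv p o g) o g = inv g o p o g"
proof -
 have "bij p" "bij g" using assms perm_onD(4) by auto
 thus ?thesis by (simp add: o_inv_distrib bij_imp_bij_inv inv_inv_eq)
qed

lemma kreweras_disc:
 assumes "p \<in> disc w" shows "inv p o cl w \<in> disc w"
proof -
 note d = discD[OF assms]
 have c: "perm_on (set w) (cl w)" by (simp add: cl_perm_on)
 have "(inv p o cl w) permutes set w" using permutes_compose[OF cl_permutes permutes_inv[OF d(1)]] .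
 thus ?thesis
  using d(3) unfolding disc_def by (simp add: inv_kreweras[OF d(2) c] ncyc_conj[OF d(2) c])
qed

lemma disc_rotate: "distinct w ==> disc (rotate n w) = disc w"
 by (simp add: disc_def cl_rotate)

lemma annulus_rotate: "distinct v ==> annulus u (rotate n v) = annulus u v"
 by (simp add: annulus_def cl_rotate)

lemma disc_Nil [simp]: "disc [] = {}" by (auto simp: disc_def)

lemma annulus_Nil [simp]: "annulus [] v = {}" "annulus u [] = {}" by (auto simp: annulus_def)

lemma disc_single [simp]: "disc [x] = {id}"
proof -
 have "orbs {x} id = {{x}}" by (simp add: orbs_def orbit_eq_singleton_iff)
 hence "ncyc {x} id = 1" by (simp add: ncyc_def)
 thus ?thesis by (auto simp: disc_def permutes_id)
qed

lemma cl_in_disc: "distinct w ==> w ~= [] ==> cl w \<in> disc w"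
proof -
 assume w: "distinct w" "w ~= []"
 have c: "perm_on (set w) (cl w)" by (simp add: cl_perm_on)
 have "inv (cl w) o cl w = id" using perm_onD(5)[OF c] by simp
 moreover have "ncyc (set w) id = length w"
 proof -
  have "orbs (set w) id = (%x. {x}) ` set w" by (auto simp: orbs_def orbit_eq_singleton_iff[THEN iffD2])
  thus ?thesis using w by (simp add: ncyc_def card_image distinct_card)
 qed
 ultimately show ?thesis
  using cl_permutes[of w] ncyc_cycle_list[OF cycle_list_cl[OF w]] by (auto simp: disc_def)
qed

lemma filter_set_eq_Nil: "set u Int X = {} ==> filter (%j. j \<in> X) u = []"
 by (auto simp: filter_empty_conv)

text \<open>Cut at the successor x of the first letter a. The permutation of the first part fixes a, so the cycle of a is
a followed by the cycle of x in the second part; the parts are shorter words.\<close>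

theorem disc_sorted:
 assumes "distinct u" "p \<in> disc u" "i \<in> set u"
 shows "cycle_list p (filter (%j. j \<in> orbit p i) u)"
 using assms
proof (induction "length u" arbitrary: u p i rule: less_induct)
 case less
 note d = discD[OF less.prems(2)]
 obtain a t where u: "u = a # t" using less.prems(3) by (cases u) auto
 show ?case
 proof (cases "p a = a")
  case True
  show ?thesis
  proof (cases "i = a")
   case True
   have "orbit p a = {a}" using \<open>p a = a\<close> by (simp add: orbit_eq_singleton_iff)
   moreover have "filter (%j. j \<in> {a}) u = [a]"
    using less.prems(1) by (auto simp: u filter_empty_conv)
   ultimately show ?thesis using True \<open>p a = a\<close> by (simp add: cycle_list_single)
  next
   case False
   hence i: "i \<in> set t" and t: "t ~= []" using less.prems(3) u by auto
   have pt: "p \<in> disc t" using disc_fixed[of a t] less.prems(1,2) u t True by blast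
   have "cycle_list p (filter (%j. j \<in> orbit p i) t)" by (rule less.hyps) (use u less.prems pt i in auto)
   moreover have "a ~: orbit p i"
    using orbit_sub[OF discD(2)[OF pt] i] less.prems(1) u by auto
   ultimately show ?thesis by (simp add: u)
  qed
 next
  case False
  define x where "x = p a"
  have xu: "x \<in> set u" "x ~= a" using False perm_onD(6)[OF d(2), of a] by (auto simp: x_def u)
  hence "x \<in> set t" using u by auto
  then obtain t1 t2 where t: "t = t1 @ x # t2" by (metis split_list)
  define u1 where "u1 = a # t1"
  define u2 where "u2 = x # t2"
  have uu: "u = u1 @ u2" "u1 ~= []" "u2 ~= []" "hd u1 = a" "hd u2 = x" by (auto simp: u1_def u2_def u t)
  have dd: "distinct (u1 @ u2)" using less.prems(1) uu by simp
  have dis: "set u1 Int set u2 = {}" using dd by auto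
  have ax: "a \<in> set u1" "x \<in> set u2" "a ~: set u2" "x ~: set u1" using dd by (auto simp: u1_def u2_def)
  have "p \<in> (%(p, q). swp (hd u1) (hd u2) o (p o q)) ` (disc u1 \<times> disc u2)"
   using bij_betw_imp_surj_on[OF disc_cut[OF dd uu(2,3)]] less.prems(2) uu
   by (simp add: x_def orbit.base)
  then obtain p1 p2 where p12: "p1 \<in> disc u1" "p2 \<in> disc u2" "p = swp a x o (p1 o p2)" using uu by auto
  note ap = perm_prod_apply[OF discD(1)[OF p12(1)] discD(1)[OF p12(2)] dis]
  have p1in: "p1 y \<in> set u1" if "y \<in> set u1" for y using perm_onD(6)[OF discD(2)[OF p12(1)] that] .
  have p2in: "p2 y \<in> set u2" if "y \<in> set u2" for y using perm_onD(6)[OF discD(2)[OF p12(2)] that] .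
  have p1a: "p1 a = a"
  proof -
   have "p a = swp a x (p1 a)" using ap(1)[OF ax(1)] fun_cong[OF p12(3), of a] by simp
   hence "swp a x (p1 a) = x" by (simp add: x_def)
   thus ?thesis using p1in[OF ax(1)] ax by (auto simp: Transposition.transpose_def split: if_splits)
  qed
  have IH1: "cycle_list p1 (filter (%j. j \<in> orbit p1 y) u1)" if "y \<in> set u1" for y
   by (rule less.hyps) (use uu dd p12 that in auto)
  have IH2: "cycle_list p2 (filter (%j. j \<in> orbit p2 y) u2)" if "y \<in> set u2" for y
   by (rule less.hyps) (use uu dd p12 that in auto)
  define c2 where "c2 = filter (%j. j \<in> orbit p2 x) u2"
  have sub2: "orbit p2 y <= set u2" if "y \<in> set u2" for y using orbit_sub[OF discD(2)[OF p12(2)] that] .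
  have sub1: "orbit p1 y <= set u1" if "y \<in> set u1" for y using orbit_sub[OF discD(2)[OF p12(1)] that] .
  have c2: "cycle_list (p1 o p2) c2" "hd c2 = x" "set c2 = orbit p2 x"
  proof -
   show "cycle_list (p1 o p2) c2"
    using IH2[OF ax(2)] cycle_list_cong[of c2 "p1 o p2" p2] ap(2) by (auto simp: c2_def)
   have "x \<in> orbit p2 x" by (rule in_own_orbit[OF discD(2)[OF p12(2)]])
   thus "hd c2 = x" "set c2 = orbit p2 x" using sub2[OF ax(2)] by (auto simp: c2_def u2_def)
  qed
  have ca: "cycle_list (p1 o p2) [a]" using ap(1)[OF ax(1)] p1a by (intro cycle_list_single) simp
  have c: "cycle_list p (a # c2)"
   using cycle_list_append_join[OF ca c2(1)] c2 sub2[OF ax(2)] ax p12(3) by auto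
  have orba: "orbit p a = insert a (orbit p2 x)" using cycle_list_orbit[OF c, of a] c2(3) by simp
  have filt: "filter (%j. j \<in> orbit p a) u = a # c2"
  proof -
   have "filter (%j. j \<in> orbit p a) t1 = []"
    unfolding orba using sub2[OF ax(2)] dd by (intro filter_set_eq_Nil) (auto simp: u1_def)
   moreover have "filter (%j. j \<in> orbit p a) u2 = c2"
    unfolding orba c2_def by (rule filter_cong) (use ax in auto)
   ultimately show ?thesis unfolding uu(1) u1_def using orba by simp
  qed
  show ?thesis
  proof (cases "i \<in> orbit p a")
   case True
   hence "orbit p i = orbit p a" using orbit_eq_iff[OF d(4)] by blast
   thus ?thesis using filt c by simp
  next
   case False
   have gen: "?thesis" if r: "r \<in> {p1, p2}" "cycle_list r (filter (%j. j \<in> orbit r i) w)" "w \<in> {u1, u2}" "i \<in> set w"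
    "orbit r i <= set w" "!!y. y \<in> set w ==> (p1 o p2) y = r y" "a ~: orbit r i" "x ~: orbit r i" for r w
   proof -
    let ?c = "filter (%j. j \<in> orbit r i) w"
    have sc: "set ?c = orbit r i" using r(5) by auto
    have "p y = r y" if y: "y \<in> set ?c" for y
    proof -
     have "r y \<in> orbit r i" using y sc by (metis orbit.step)
     hence "r y ~= a" "r y ~= x" using r(7,8) by auto
     moreover have "(p1 o p2) y = r y" using r(6)[of y] y by simp
     ultimately show ?thesis unfolding p12(3) comp_apply[of "swp a x"] by simp
    qed
    hence cp: "cycle_list p ?c" using r(2) cycle_list_cong[of ?c p r] by blast
    have "permutation r" using r(1) discD(4)[OF p12(1)] discD(4)[OF p12(2)] by auto
    hence "i \<in> set ?c" using r(4) permutation_self_in_orbit[of r i] by simp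
    hence oi: "orbit p i = orbit r i" using cycle_list_orbit[OF cp] sc by simp
    have "filter (%j. j \<in> orbit p i) u = ?c"
    proof (cases "w = u1")
     case True
     hence "filter (%j. j \<in> orbit r i) u2 = []" using r(5) dis by (intro filter_set_eq_Nil) auto
     thus ?thesis using oi uu(1) True by simp
    next
     case False
     hence "w = u2" using r(3) by simp
     hence "filter (%j. j \<in> orbit r i) u1 = []" using r(5) dis by (intro filter_set_eq_Nil) auto
     thus ?thesis using oi uu(1) \<open>w = u2\<close> by simp
    qed
    thus ?thesis using cp by simp
   qed
   have ia: "i ~= a" using False orba by auto
   show ?thesis
   proof (cases "i \<in> set u1")
    case True
    have "a ~: orbit p1 i"
    proof
     assume "a \<in> orbit p1 i"
     hence "i \<in> orbit p1 a" using orbit_sym[OF discD(4)[OF p12(1)]] by blast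
     thus False using p1a ia orbit_eq_singleton_iff[of p1 a] by simp
    qed
    thus ?thesis using gen[of p1 u1] IH1[OF True] True sub1[OF True] ap(1) ax by auto
   next
    case F: False
    hence i2: "i \<in> set u2" using less.prems(3) uu(1) by simp
    have "x ~: orbit p2 i"
    proof
     assume "x \<in> orbit p2 i"
     hence "i \<in> orbit p2 x" using orbit_sym[OF discD(4)[OF p12(2)]] by blast
     thus False using False orba by simp
    qed
    thus ?thesis using gen[of p2 u2] IH2[OF i2] i2 sub2[OF i2] ap(2) ax by auto
   qed
  qed
 qed
qed

theorem disc_noncrossing:
 assumes "distinct u" "p \<in> disc u" "u = us @ a # ys @ b # zs" "c \<in> set ys" "d \<in> set zs Un set us"
  "b \<in> orbit p a" "d \<in> orbit p c"
 shows "c \<in> orbit p a"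
proof (rule ccontr)
 assume na: "c ~: orbit p a"
 let ?u1 = "a # ys" and ?u2 = "b # zs @ us"
 have "rotate (length us) u = ?u1 @ ?u2" unfolding assms(3) by (simp add: rotate_append)
 hence pu: "p \<in> disc (?u1 @ ?u2)" and dd: "distinct (?u1 @ ?u2)"
  using disc_rotate[OF assms(1), of "length us"] assms(1,2) distinct_rotate[of "length us" u] by auto
 have "p \<in> (%(p, q). swp (hd ?u1) (hd ?u2) o (p o q)) ` (disc ?u1 \<times> disc ?u2)"
  using bij_betw_imp_surj_on[OF disc_cut[OF dd]] pu assms(6) by simp
 then obtain p1 p2 where p12: "p1 \<in> disc ?u1" "p2 \<in> disc ?u2" "p = swp a b o (p1 o p2)" by auto
 let ?q = "p1 o p2"
 note t = two_disc_count[OF dd p12(1,2)]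
 have "perm_on (set ?u1 Un set ?u2) ?q" using t(1) by (simp add: permutes_perm_on)
 hence q: "perm_on (set ?u1) ?q" using perm_on_subset t(3) by blast
 have perm: "permutation p" by (rule discD(4)[OF pu])
 obtain cc where cc: "cycle_list p cc" "hd cc = c" "set cc = orbit p c" using exists_cycle_list[OF perm] .
 have qp: "?q = swp a b o p" using p12(3) by simp
 have nin: "a ~: orbit p c" "b ~: orbit p c"
  using na assms(6) orbit_sym[OF perm] orbit_eq_iff[OF perm] by metis+
 have "?q y = p y" if y: "y \<in> set cc" for y
 proof -
  have "p y \<in> orbit p c" using y cc(3) by (metis orbit.step)
  hence "p y ~= a" "p y ~= b" using nin by auto
  thus ?thesis unfolding qp by simp
 qed
 hence cq: "cycle_list ?q cc" using cc(1) cycle_list_cong[of cc ?q p] by blast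
 have "c \<in> set cc" using cc(3) perm by (simp add: permutation_self_in_orbit)
 hence "orbit ?q c = orbit p c" using cycle_list_orbit[OF cq] cc(3) by simp
 moreover have "orbit ?q c <= set ?u1" by (rule orbit_sub[OF q]) (use assms(4) in simp)
 ultimately show False using assms(5,7) dd by auto
qed

section \<open>Products over cycles after cutting and inserting\<close>

text \<open>The total weight of the cycle V once a letter e has been added at its end and the cycle has been split in all
possible ways, as in \<open>disc_insert\<close>.\<close>

definition J :: "('a list => 'r::comm_ring_1) => 'a list => 'a => 'r" where
 "J f V e = f (V @ [e]) + (\<Sum>t = 1..length V. f (take t V) * f (drop t V @ [e]))"

lemma support_join:
 assumes "permutation q" "b ~: orbit q a"
 shows "cycle_list (swp a b o q) (support q a @ support q b)"
  "support (swp a b o q) a = support q a @ support q b"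
  "orbit (swp a b o q) a = orbit q a Un orbit q b"
proof -
 have dis: "set (support q a) Int set (support q b) = {}"
  using assms set_support[OF assms(1)] orbit_eq_iff[OF assms(1)] by (metis disjoint_iff)
 show c: "cycle_list (swp a b o q) (support q a @ support q b)"
  using cycle_list_append_join[OF cycle_support(1)[OF assms(1)] cycle_support(1)[OF assms(1)] dis]
  by (simp add: cycle_support(2)[OF assms(1)] del: map_map)
 have ne: "support q a ~= []" using cycle_support(1)[OF assms(1)] cycle_list_def by blast
 have perm: "permutation (swp a b o q)" using assms(1) by (simp add: permutation_compose permutation_swap_id)
 have h: "hd (support q a @ support q b) = a" using ne cycle_support(2)[OF assms(1), of a] by simp
 show s: "support (swp a b o q) a = support q a @ support q b"
  using support_eqI[OF perm c] h by simp
 show "orbit (swp a b o q) a = orbit q a Un orbit q b"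
  using set_support[OF perm, of a] set_support[OF assms(1)] unfolding s set_append by simp
qed

lemma perm_on_orbit: "permutation q ==> perm_on (orbit q x) q"
 by (metis cycle_list_perm_on exists_cycle_list)

lemma cprod_join:
 assumes "perm_on S q" "a \<in> S" "b \<in> S" "b ~: orbit q a"
 shows "cprod (S - orbit (swp a b o q) a) f (swp a b o q) = cprod (S - orbit q a - orbit q b) f q"
proof -
 have perm: "permutation q" using assms perm_onD by metis
 have o: "orbit (swp a b o q) a = orbit q a Un orbit q b" by (rule support_join(3)[OF perm assms(4)])
 have po: "perm_on (orbit q x) q" if "x \<in> S" for x by (rule perm_on_orbit[OF perm])
 let ?T = "S - orbit q a - orbit q b"
 have T: "perm_on ?T q" by (intro perm_on_Diff assms(1) po assms(2,3))
 have "cprod ?T f q = cprod ?T f (swp a b o q)"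
 proof (rule cprod_cong_perm[OF T])
  show "permutation (swp a b o q)" using perm by (simp add: permutation_compose permutation_swap_id)
  fix x assume "x \<in> ?T"
  hence "q x \<in> ?T" using perm_onD(6)[OF T] by blast
  hence "q x ~= a" "q x ~= b" using permutation_self_in_orbit[OF perm] by auto
  thus "q x = (swp a b o q) x" by simp
 qed
 moreover have "S - (orbit q a Un orbit q b) = ?T" by auto
 ultimately show ?thesis unfolding o by simp
qed

lemma support_ne: "permutation p ==> support p a ~= []"
 using cycle_support(1) cycle_list_def by metis

lemma cprod_remove2:
 assumes "perm_on S q" "rot_inv f" "cycle_list q c1" "cycle_list q c2" "set c1 <= S" "set c2 <= S" "set c1 Int set c2 = {}"
 shows "cprod S f q = f c1 * (f c2 * cprod (S - (set c1 Un set c2)) f q)"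
proof -
 have perm: "permutation q" using assms perm_onD by metis
 have "cprod S f q = f c1 * cprod (S - set c1) f q" by (rule cprod_remove_cycle[OF assms(1,2,3,5)])
 also have "cprod (S - set c1) f q = f c2 * cprod (S - set c1 - set c2) f q"
  by (rule cprod_remove_cycle[OF perm_on_Diff[OF assms(1) cycle_list_perm_on[OF perm assms(3)]] assms(2,4)])
   (use assms in auto)
 also have "S - set c1 - set c2 = S - (set c1 Un set c2)" by auto
 finally show ?thesis .
qed

lemma perm_on_rest: "perm_on S p ==> perm_on (S - orbit p a) p"
 using perm_on_Diff perm_on_orbit perm_onD(2) by metis

lemma cprod_cong_swp:
 assumes "perm_on T p" "a ~: T" "w ~: T" "!!x. x \<in> T ==> q x = p x" "permutation q"
 shows "cprod T f (swp a w o q) = cprod T f p"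
proof (rule cprod_cong_perm[symmetric, OF assms(1)])
 show "permutation (swp a w o q)" using assms(5) by (simp add: permutation_compose permutation_swap_id)
 fix x assume x: "x \<in> T"
 hence "p x \<in> T" using perm_onD(6)[OF assms(1)] by blast
 hence "p x ~= a" "p x ~= w" using assms by auto
 thus "p x = (swp a w o q) x" using assms(4)[OF x] by simp
qed

lemma sum_cprod_insert:
 assumes "perm_on S p" "p e = e" "e ~: S" "a \<in> S" "rot_inv f"
 shows "(\<Sum>w\<in>insert e (orbit p a). cprod (insert e S) f (swp a w o (swp a e o p)))
    = cprod (S - orbit p a) f p * J f (support p a) e"
proof -
 have perm: "permutation p" using assms perm_onD by metis
 define V where "V = support p a"
 define n where "n = length V"
 let ?V = "V @ [e]" and ?S = "insert e S" and ?p0 = "swp a e o p" and ?R = "S - orbit p a"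
 have V: "set V = orbit p a" "cycle_list p V" "hd V = a" "V ~= []"
  unfolding V_def by (rule set_support[OF perm] cycle_support[OF perm] support_ne[OF perm])+
 have eV: "e ~: set V" using orbit_subset_insert(1)[OF assms(1,2,4,3)] V by simp
 have c0: "cycle_list ?p0 ?V"
  using cycle_list_append_join[OF V(2) cycle_list_single[of p e, OF assms(2)]] V(3) eV by simp
 have dV: "distinct ?V" using c0 by (simp add: cycle_list_def)
 have sub: "set V <= S" using V(1) orbit_sub[OF assms(1,4)] by simp
 have p0: "perm_on ?S ?p0" using assms by (intro perm_on_swp_comp perm_on_insert_fixed) auto
 have RS: "?S - set ?V = ?R" using assms(3) V(1) by auto
 have R: "perm_on ?R p" by (rule perm_on_rest[OF assms(1)])
 have Rp0: "?p0 x = p x" if "x \<in> ?R" for x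
 proof -
  have "p x \<in> ?R" using perm_onD(6)[OF R that] .
  hence "p x ~= a" "p x ~= e" using assms(3) permutation_self_in_orbit[OF perm] by auto
  thus ?thesis by simp
 qed
 have Rq: "cprod ?R f (swp a w o ?p0) = cprod ?R f p" if "w \<in> set ?V" for w
  by (rule cprod_cong_swp[OF R])
   (use that V Rp0 assms(3) perm_onD(2)[OF p0] permutation_self_in_orbit[OF perm] in auto)
 have nth: "cprod ?S f (swp a (?V ! t) o ?p0) = f (take t V) * f (drop t V @ [e]) * cprod ?R f p"
  if t: "t \<in> {1..n}" for t
 proof -
  let ?q = "swp a (?V ! t) o ?p0"
  have tt: "take t ?V = take t V" "drop t ?V = drop t V @ [e]" using t by (auto simp: n_def)
  have h: "hd (take t V) = a" using V t by (auto simp: n_def)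
  have h2: "hd (drop t V @ [e]) = ?V ! t" using t by (simp add: tt(2)[symmetric] hd_drop_conv_nth n_def del: drop_append)
  have "take t V @ (drop t V @ [e]) = ?V" by (metis append_assoc append_take_drop_id)
  hence c: "cycle_list ?p0 (take t V @ (drop t V @ [e]))" using c0 by (simp only:)
  have ne: "take t V ~= []" "drop t V @ [e] ~= []" using t V by auto
  note cc = cycle_list_append_split[OF c ne, unfolded h h2]
  have in': "?V ! t \<in> set ?V" using t by (intro nth_mem) (simp add: n_def)
  have un: "set (take t V) Un set (drop t V @ [e]) = set ?V"
   by (metis Un_insert_right append_take_drop_id list.simps(15) set_append append_assoc)
  have q: "perm_on ?S ?q" by (rule perm_on_swp_comp[OF p0]) (use assms in' sub in auto)
  have "cprod ?S f ?q = f (take t V) * (f (drop t V @ [e]) * cprod (?S - (set (take t V) Un set (drop t V @ [e]))) f ?q)"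
   by (rule cprod_remove2[OF q assms(5) cc])
    (use un sub dV tt in "auto simp: distinct_append dest: set_take_disj_set_drop_if_distinct in_set_takeD in_set_dropD")
  thus ?thesis unfolding un RS Rq[OF in'] by (simp add: mult.assoc)
 qed
 have z: "cprod ?S f (swp a (?V ! 0) o ?p0) = f ?V * cprod ?R f p"
 proof -
  have v0: "?V ! 0 = a" using V(3,4) by (simp add: hd_conv_nth nth_append)
  have "cprod ?S f ?p0 = f ?V * cprod (?S - set ?V) f ?p0"
   by (rule cprod_remove_cycle[OF p0 assms(5) c0]) (use sub in auto)
  also have "cprod (?S - set ?V) f ?p0 = cprod ?R f p"
   using Rq[of a] V permutation_self_in_orbit[OF perm, of a] unfolding RS by (simp add: comp_def)
  finally show ?thesis unfolding v0 by (simp add: comp_def)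
 qed
 have set: "insert e (orbit p a) = set ?V" using V by auto
 have bij: "bij_betw ((!) ?V) {..<Suc n} (set ?V)" using bij_betw_nth[OF dV, of "{..<Suc n}"] by (simp add: n_def)
 have "(\<Sum>w\<in>insert e (orbit p a). cprod ?S f (swp a w o ?p0)) = (\<Sum>t<Suc n. cprod ?S f (swp a (?V ! t) o ?p0))"
  unfolding set by (rule sum.reindex_bij_betw[OF bij, symmetric])
 also have "{..<Suc n} = insert 0 {1..n}" by auto
 also have "(\<Sum>t\<in>insert 0 {1..n}. cprod ?S f (swp a (?V ! t) o ?p0)) =
   f ?V * cprod ?R f p + (\<Sum>t=1..n. f (take t V) * f (drop t V @ [e]) * cprod ?R f p)"
  using z nth by (subst sum.insert) auto
 also have "... = cprod ?R f p * J f V e" by (simp add: J_def n_def sum_distrib_left algebra_simps)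
 finally show ?thesis by (simp add: V_def comp_def)
qed

lemma support_single: "p e = e ==> permutation p ==> support p e = [e]"
 using support_eqI[OF _ cycle_list_single[of p e]] by simp

lemma cprod_insert_join:
 assumes "perm_on S p" "p e = e" "e ~: S" "a \<in> S" "rot_inv f" "w \<in> S" "w ~: orbit p a"
 shows "cprod (insert e S) f (swp a w o (swp a e o p))
    = f (support p a @ e # support p w) * cprod (S - orbit p a - orbit p w) f p"
proof -
 have perm: "permutation p" using assms perm_onD by metis
 let ?S = "insert e S" and ?p0 = "swp a e o p" and ?q = "swp a w o (swp a e o p)"
 let ?A = "orbit p a" and ?W = "orbit p w"
 have p0: "perm_on ?S ?p0" using assms by (intro perm_on_swp_comp perm_on_insert_fixed) auto
 have q: "perm_on ?S ?q" using assms by (intro perm_on_swp_comp[OF p0]) auto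
 note ea = orbit_subset_insert[OF assms(1,2,4,3)] and ew = orbit_subset_insert[OF assms(1,2,6,3)]
 have s0: "support ?p0 a = support p a @ [e]" "orbit ?p0 a = ?A Un {e}"
  using support_join(2,3)[OF perm ea(1)] support_single[OF assms(2) perm] orbit_eq_singleton_iff[of p e] assms(2) by auto
 have aw: "a ~: ?W" using assms(7) orbit_sym[OF perm] by blast
 have cw: "cycle_list ?p0 (support p w)"
 proof (subst cycle_list_cong[of _ _ p])
  fix x assume "x \<in> set (support p w)"
  hence "x \<in> ?W" using set_support[OF perm] by blast
  hence "p x \<in> ?W" by (rule orbit.step)
  hence "p x ~= a" "p x ~= e" using aw ew by auto
  thus "?p0 x = p x" by simp
 qed (rule cycle_support(1)[OF perm])
 have sw: "support ?p0 w = support p w"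
  using support_eqI[OF perm_onD(2)[OF p0] cw] cycle_support(2)[OF perm, of w] by (simp only:)
 have "w ~= e" using assms by auto
 hence nw: "w ~: orbit ?p0 a" using s0(2) assms(7) by simp
 have c: "cycle_list ?q (support p a @ e # support p w)"
  using support_join(1)[OF perm_onD(2)[OF p0] nw] unfolding s0(1) sw by simp
 have set: "set (support p a @ e # support p w) = insert e (?A Un ?W)" using set_support[OF perm] by simp
 have sub: "?A <= S" "?W <= S" using orbit_sub[OF assms(1)] assms by blast+
 have "cprod ?S f ?q = f (support p a @ e # support p w) * cprod (?S - set (support p a @ e # support p w)) f ?q"
  by (rule cprod_remove_cycle[OF q assms(5) c]) (use set sub in auto)
 also have "?S - set (support p a @ e # support p w) = S - ?A - ?W" using set assms(3) by auto
 also have "cprod (S - ?A - ?W) f ?q = cprod (S - ?A - ?W) f p"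
 proof (rule cprod_cong_swp)
  have R: "perm_on (S - ?A - ?W) p" by (intro perm_on_Diff assms(1) perm_on_orbit perm)
  show "perm_on (S - ?A - ?W) p" by (rule R)
  show "a ~: S - ?A - ?W" "w ~: S - ?A - ?W" using permutation_self_in_orbit[OF perm] by auto
  fix x assume "x \<in> S - ?A - ?W"
  hence "p x \<in> S - ?A - ?W" using perm_onD(6)[OF R] by blast
  hence "p x ~= a" "p x ~= e" using assms(3) permutation_self_in_orbit[OF perm] by auto
  thus "?p0 x = p x" by simp
 qed (rule perm_onD(2)[OF p0])
 finally show ?thesis .
qed

lemma cprod_insert_point:
 assumes "perm_on S K" "K e = e" "e ~: S" "y \<in> S" "rot_inv f" "rot_inv g"
  "!!c. cycle_list K c ==> set c <= S ==> y ~: set c ==> f c = g c"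
  "!!c. cycle_list K c ==> set c <= S ==> hd c = y ==> f (c @ [e]) = g c"
 shows "cprod (insert e S) f (swp e y o K) = cprod S g K"
proof -
 have perm: "permutation K" using assms perm_onD by metis
 obtain c where c: "cycle_list K c" "hd c = y" "set c = orbit K y" using exists_cycle_list[OF perm] .
 have sub: "set c <= S" using orbit_sub[OF assms(1,4)] c(3) by simp
 have K': "perm_on (insert e S) (swp e y o K)"
  using assms by (intro perm_on_swp_comp perm_on_insert_fixed) auto
 have c': "cycle_list (swp e y o K) (c @ [e])"
  using cycle_list_append_join[OF c(1) cycle_list_single[of K e, OF assms(2)]] sub assms(3) c(2)
  by (auto simp: transpose_commute)
 have R: "perm_on (S - set c) K" by (rule perm_on_Diff[OF assms(1) cycle_list_perm_on[OF perm c(1)]])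
 have yc: "y \<in> set c" using c perm by (simp add: permutation_self_in_orbit)
 have "cprod (insert e S) f (swp e y o K) = f (c @ [e]) * cprod (insert e S - set (c @ [e])) f (swp e y o K)"
  by (rule cprod_remove_cycle[OF K' assms(5) c']) (use sub in auto)
 also have "insert e S - set (c @ [e]) = S - set c" using assms(3) by auto
 also have "cprod (S - set c) f (swp e y o K) = cprod (S - set c) f K"
  by (rule cprod_cong_swp[OF R]) (use assms(3) yc perm in auto)
 also have "... = cprod (S - set c) g K"
  by (rule cprod_cong_fun[OF R]) (use assms(7) yc in blast)
 also have "f (c @ [e]) = g c" by (rule assms(8)[OF c(1) sub c(2)])
 also have "g c * cprod (S - set c) g K = cprod S g K"
  by (rule cprod_remove_cycle[symmetric, OF assms(1,6) c(1) sub])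
 finally show ?thesis .
qed

text \<open>The letter e carries the identity for f, and f agrees with g on all other letters.\<close>

definition ignores :: "'a => ('a list => 'r::comm_ring_1) => ('a list => 'r) => bool" where
 "ignores e f g \<longleftrightarrow> rot_inv f \<and> rot_inv g \<and> f [e] = 1 \<and> (\<forall>c. e ~: set c \<longrightarrow> f c = g c) \<and>
   (\<forall>c. c ~= [] \<longrightarrow> e ~: set c \<longrightarrow> f (c @ [e]) = g c)"

lemma cprod_ignores:
 assumes "perm_on S p" "p e = e" "perm_on S g" "g e = e" "e ~: S" "a \<in> S" "w \<in> insert e S" "ignores e \<tau>' \<tau>"
 shows "cprod (insert e S) \<tau>' (inv (swp a w o (swp a e o p)) o (swp a e o g)) = cprod S \<tau> (inv p o g)"
proof -
 have K: "perm_on S (inv p o g)" by (rule perm_on_compose[OF perm_on_inv[OF assms(1)] assms(3)])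
 have Ke: "(inv p o g) e = e" using assms(2,4) perm_on_inv_f(1)[OF assms(1), of e] by simp
 note ig = assms(8)[unfolded ignores_def]
 note k = insert_kreweras[OF assms(1,2,5,6,7), of g]
 show ?thesis
 proof (cases "w = a")
  case True
  have "cprod (insert e S) \<tau>' (inv p o g) = \<tau>' [e] * cprod S \<tau>' (inv p o g)"
   by (rule cprod_insert_fixed[OF K Ke assms(5)]) (use ig in simp)
  also have "cprod S \<tau>' (inv p o g) = cprod S \<tau> (inv p o g)"
   by (rule cprod_cong_fun[OF K]) (use ig assms(5) in blast)
  finally show ?thesis using k(1)[OF True] ig by (simp add: comp_def)
 next
  case False
  obtain y where y: "y \<in> S" "inv (swp a w o (swp a e o p)) o (swp a e o g) = swp e y o (inv p o g)"
   using k(2)[OF False] by blast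
  show ?thesis unfolding y(2)
   by (rule cprod_insert_point[OF K Ke assms(5) y(1)]) (use ig assms(5) in "auto simp: cycle_list_def")
 qed
qed

section \<open>Sums over planar permutations\<close>

definition disc_sum :: "('a list => 'r::comm_ring_1) => ('a list => 'r) => 'a list => 'r" where
 "disc_sum \<tau> \<kappa> u = (\<Sum>p\<in>disc u. dwt \<tau> u p * cprod (set u) \<kappa> p)"

definition annulus_sum :: "('a list => 'r::comm_ring_1) => ('a list => 'r) => 'a list => 'a list => 'r" where
 "annulus_sum \<tau> \<kappa> u v = (\<Sum>p\<in>annulus u v.
   awt \<tau> u v p * cprod (set u Un set v) \<kappa> p)"

lemma insert_sum:
 assumes "finite X" "!!p. p \<in> X ==> p permutes S" "finite S" "perm_on S g" "g e = e" "e ~: S" "a \<in> S" "ignores e \<tau>' \<tau>" "rot_inv \<kappa>"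
 shows "(\<Sum>(p, w)\<in>(SIGMA p:X. insert e (orbit p a)).
   cprod (insert e S) \<tau>' (inv (swp a w o (swp a e o p)) o (swp a e o g)) * cprod (insert e S) \<kappa> (swp a w o (swp a e o p))) =
  (\<Sum>p\<in>X. cprod S \<tau> (inv p o g) * (cprod (S - orbit p a) \<kappa> p * J \<kappa> (support p a) e))"
proof -
 have P: "perm_on S p" "orbit p a <= S" "p e = e" if "p \<in> X" for p
  using permutes_perm_on[OF assms(2)[OF that] assms(3)] orbit_sub[of S p a] assms(7)
   permutes_not_in[OF assms(2)[OF that] assms(6)] by auto
 have "(\<Sum>(p, w)\<in>(SIGMA p:X. insert e (orbit p a)).
   cprod (insert e S) \<tau>' (inv (swp a w o (swp a e o p)) o (swp a e o g)) * cprod (insert e S) \<kappa> (swp a w o (swp a e o p))) =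
  (\<Sum>(p, w)\<in>(SIGMA p:X. insert e (orbit p a)). cprod S \<tau> (inv p o g) * cprod (insert e S) \<kappa> (swp a w o (swp a e o p)))"
 proof (rule sum_congI, clarify)
  fix p w assume "p \<in> X" "w \<in> insert e (orbit p a)"
  note p = P[OF this(1)]
  have "w \<in> insert e S" using p(2) \<open>w \<in> _\<close> by auto
  thus "cprod (insert e S) \<tau>' (inv (swp a w o (swp a e o p)) o (swp a e o g)) * cprod (insert e S) \<kappa> (swp a w o (swp a e o p))
   = cprod S \<tau> (inv p o g) * cprod (insert e S) \<kappa> (swp a w o (swp a e o p))"
   by (simp only: cprod_ignores[OF p(1,3) assms(4-7) _ assms(8)])
 qed
 also have "... = (\<Sum>p\<in>X. \<Sum>w\<in>insert e (orbit p a). cprod S \<tau> (inv p o g) * cprod (insert e S) \<kappa> (swp a w o (swp a e o p)))"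
  by (rule sum.Sigma[symmetric]) (use assms(1) finite_subset[OF P(2) assms(3)] in auto)
 also have "... = (\<Sum>p\<in>X. cprod S \<tau> (inv p o g) * (cprod (S - orbit p a) \<kappa> p * J \<kappa> (support p a) e))"
  unfolding sum_distrib_left[symmetric]
  by (rule sum_congI) (simp only: sum_cprod_insert[OF P(1,3) assms(6,7,9)])
 finally show ?thesis .
qed

lemma disc_sum_insert:
 assumes "distinct (u @ [e])" "u ~= []" "ignores e \<tau>' \<tau>" "rot_inv \<kappa>"
 shows "disc_sum \<tau>' \<kappa> (u @ [e]) = (\<Sum>p\<in>disc u. dwt \<tau> u p *
   (cprod (set u - orbit p (hd u)) \<kappa> p * J \<kappa> (support p (hd u)) e))"
proof -
 define a where "a = hd u"
 have a: "a \<in> set u" and e: "e ~: set u" using assms by (auto simp: a_def)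
 have g: "cl (u @ [e]) = swp a e o cl u" unfolding a_def by (rule cl_snoc[OF assms(1,2)])
 have gp: "perm_on (set u) (cl u)" "cl u e = e" using e by (auto simp: cl_perm_on cl_outside)
 have S: "set (u @ [e]) = insert e (set u)" by simp
 have bij: "bij_betw (%(p, w). swp a w o (swp a e o p)) (SIGMA p:disc u. insert e (orbit p a)) (disc (u @ [e]))"
  unfolding a_def by (rule disc_insert[OF assms(1,2)])
 show ?thesis
  unfolding disc_sum_def S g a_def[symmetric]
  by (subst sum.reindex_bij_betw[OF bij, symmetric],
    rule trans[OF _ insert_sum[OF finite_disc discD(1) finite_set gp e a assms(3,4)]]) (rule sum.cong, auto)
qed

lemma prod_support:
 assumes "p permutes A" "q permutes B" "A Int B = {}" "finite A" "finite B"
 shows "x \<in> A ==> support (p o q) x = support p x" "x \<in> A ==> orbit (p o q) x = orbit p x"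
  "x \<in> B ==> support (p o q) x = support q x" "x \<in> B ==> orbit (p o q) x = orbit q x"
proof -
 note ap = perm_prod_apply[OF assms(1-3)]
 have pA: "perm_on A p" and qB: "perm_on B q" using assms by (simp_all add: permutes_perm_on)
 have perm: "permutation (p o q)" using perm_onD(2)[OF pA] perm_onD(2)[OF qB] by (rule permutation_compose)
 have *: "support (p o q) x = support r x \<and> orbit (p o q) x = orbit r x"
  if r: "perm_on T r" "!!y. y \<in> T ==> (p o q) y = r y" "x \<in> T" for r T x
 proof
  have s: "set (support r x) <= T" using set_support[OF perm_onD(2)[OF r(1)]] orbit_sub[OF r(1,3)] by blast
  have c: "cycle_list (p o q) (support r x)"
   by (subst cycle_list_cong[of _ _ r]) (use r(2) s cycle_support(1)[OF perm_onD(2)[OF r(1)]] in blast)+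
  thus e: "support (p o q) x = support r x"
   using support_eqI[OF perm c] cycle_support(2)[OF perm_onD(2)[OF r(1)], of x] by (simp only:)
  show "orbit (p o q) x = orbit r x"
   using set_support[OF perm, of x] set_support[OF perm_onD(2)[OF r(1)], of x] by (simp only: e)
 qed
 show "x \<in> A ==> support (p o q) x = support p x" "x \<in> A ==> orbit (p o q) x = orbit p x"
  using *[OF pA ap(1)] by blast+
 show "x \<in> B ==> support (p o q) x = support q x" "x \<in> B ==> orbit (p o q) x = orbit q x"
  using *[OF qB ap(2)] by blast+
qed

lemma prod_cprod:
 assumes "p permutes A" "q permutes B" "A Int B = {}" "finite A" "finite B"
  "perm_on X p" "X <= A" "perm_on Y q" "Y <= B"
 shows "cprod (X Un Y) f (p o q) = cprod X f p * cprod Y f q"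
proof -
 note ap = perm_prod_apply[OF assms(1-3)]
 have pA: "perm_on A p" and qB: "perm_on B q" using assms by (simp_all add: permutes_perm_on)
 have perm: "permutation (p o q)" using perm_onD(2)[OF pA] perm_onD(2)[OF qB] by (rule permutation_compose)
 have eX: "(p o q) x = p x" if "x \<in> X" for x using ap(1) assms(7) that by blast
 have eY: "(p o q) x = q x" if "x \<in> Y" for x using ap(2) assms(9) that by blast
 have "(p o q) ` X = p ` X" by (rule image_cong[OF refl eX])
 hence X: "perm_on X (p o q)" using assms(6) perm by (simp add: perm_on_def)
 have "(p o q) ` Y = q ` Y" by (rule image_cong[OF refl eY])
 hence Y: "perm_on Y (p o q)" using assms(8) perm by (simp add: perm_on_def)
 have "cprod (X Un Y) f (p o q) = cprod X f (p o q) * cprod Y f (p o q)"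
  by (rule cprod_union[OF X Y]) (use assms in auto)
 also have "cprod X f (p o q) = cprod X f p"
  using cprod_cong_perm[OF assms(6) perm, of f] eX by simp
 also have "cprod Y f (p o q) = cprod Y f q"
  using cprod_cong_perm[OF assms(8) perm, of f] eY by simp
 finally show ?thesis .
qed

lemma prod_kreweras_cprod:
 assumes "p permutes A" "q permutes B" "g permutes A" "h permutes B" "A Int B = {}" "finite A" "finite B"
 shows "cprod (A Un B) f (inv (p o q) o (g o h)) = cprod A f (inv p o g) * cprod B f (inv q o h)"
proof -
 have pA: "perm_on A p" "perm_on A g" and qB: "perm_on B q" "perm_on B h" using assms by (simp_all add: permutes_perm_on)
 have "inv q o (inv p o (g o h)) = (inv p o g) o (inv q o h)"
 proof -
  have "(inv p o g) permutes A" by (rule permutes_compose[OF assms(3) permutes_inv[OF assms(1)]])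
  have c: "inv q (y) = y" if "y \<in> A" for y using permutes_not_in[OF permutes_inv[OF assms(2)]] assms(5) that by blast
  show ?thesis
  proof
   fix x
   have r: "(inv p o g) permutes A" by (rule permutes_compose[OF assms(3) permutes_inv[OF assms(1)]])
   have s: "inv q permutes B" by (rule permutes_inv[OF assms(2)])
   have "inv q ((inv p o g) y) = (inv p o g) (inv q y)" for y
   proof (cases "y \<in> A")
    case True
    hence "(inv p o g) y \<in> A" using permutes_in_image[OF r] by blast
    thus ?thesis using c[OF True] c by metis
   next
    case False
    hence "(inv p o g) y = y" using permutes_not_in[OF r] by blast
    moreover have "inv q y ~: A"
     using False permutes_in_image[OF s, of y] permutes_not_in[OF s, of y] assms(5) by (cases "y \<in> B") auto
    ultimately show ?thesis using permutes_not_in[OF r, of "inv q y"] by metis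
   qed
   thus "(inv q o (inv p o (g o h))) x = ((inv p o g) o (inv q o h)) x" by simp
  qed
 qed
 moreover have "inv (p o q) = inv q o inv p"
  using perm_onD(4)[OF pA(1)] perm_onD(4)[OF qB(1)] by (rule o_inv_distrib)
 ultimately have e: "inv (p o q) o (g o h) = (inv p o g) o (inv q o h)" by (simp add: comp_assoc)
 have A': "(inv p o g) permutes A" by (rule permutes_compose[OF assms(3) permutes_inv[OF assms(1)]])
 have B': "(inv q o h) permutes B" by (rule permutes_compose[OF assms(4) permutes_inv[OF assms(2)]])
 show ?thesis unfolding e
  by (rule prod_cprod[OF A' B' assms(5-7)]) (use A' B' assms in "auto simp: permutes_perm_on")
qed

text \<open>The contribution of the cycle V to a cut at x, when the part before x receives x as an added last letter.\<close>

definition cut_term :: "('a list => 'r::comm_ring_1) => 'a list => 'a => 'r" where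
 "cut_term \<kappa> V x = J \<kappa> (takeWhile (%y. y ~= x) V) x * \<kappa> (dropWhile (%y. y ~= x) V)"

lemma cut_term_append:
 assumes "x ~: set V1" "V2 ~= []" "hd V2 = x"
 shows "cut_term \<kappa> (V1 @ V2) x = J \<kappa> V1 x * \<kappa> V2"
proof -
 obtain t where "V2 = x # t" using assms by (cases V2) auto
 moreover have "\<forall>y\<in>set V1. y ~= x" using assms(1) by auto
 ultimately show ?thesis by (simp add: cut_term_def takeWhile_append2 dropWhile_append2)
qed

lemma sum_cut_term:
 assumes "distinct V" "V ~= []"
 shows "(\<Sum>x\<in>set V - {hd V}. cut_term \<kappa> V x) = (\<Sum>i=1..<length V. J \<kappa> (take i V) (V ! i) * \<kappa> (drop i V))"
proof -
 have bij: "bij_betw ((!) V) {1..<length V} (set V - {hd V})"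
 proof -
  have "bij_betw ((!) V) ({..<length V} - {0}) (set V - {V ! 0})"
   by (rule bij_betw_DiffI[OF bij_betw_nth[OF assms(1)]]) (use assms in "auto simp: bij_betw_def")
  moreover have "{..<length V} - {0} = {1..<length V}" by auto
  ultimately show ?thesis using assms(2) by (simp add: hd_conv_nth)
 qed
 have "(\<Sum>x\<in>set V - {hd V}. cut_term \<kappa> V x) = (\<Sum>i=1..<length V. cut_term \<kappa> V (V ! i))"
  by (rule sum.reindex_bij_betw[OF bij, symmetric])
 also have "... = (\<Sum>i=1..<length V. J \<kappa> (take i V) (V ! i) * \<kappa> (drop i V))"
 proof (rule sum_congI)
  fix i assume i: "i \<in> {1..<length V}"
  have "V ! i ~: set (take i V)"
   using assms(1) i by (auto simp: in_set_conv_nth nth_eq_iff_index_eq)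
  hence "cut_term \<kappa> (take i V @ drop i V) (V ! i) = J \<kappa> (take i V) (V ! i) * \<kappa> (drop i V)"
   by (rule cut_term_append) (use i in "auto simp: hd_drop_conv_nth")
  thus "cut_term \<kappa> V (V ! i) = J \<kappa> (take i V) (V ! i) * \<kappa> (drop i V)" by simp
 qed
 finally show ?thesis .
qed

lemma perm_comp_permutation: "p permutes A ==> q permutes B ==> finite A ==> finite B ==> permutation (p o q)"
 using permutation_compose permutation_permutes by blast

text \<open>Along a cut the cycle of the first letter is the concatenation of two cycles, so that all weights factorize.\<close>

lemma cut_weights:
 assumes "p permutes A" "q permutes B" "A Int B = {}" "finite A" "finite B" "a \<in> A" "x \<in> B"
 defines "r \<equiv> swp a x o (p o q)"
 shows "support r a = support p a @ support q x"
  "cprod (A Un B - orbit r a) f r = cprod (A - orbit p a) f p * cprod (B - orbit q x) f q"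
  "cut_term f (support r a) x = J f (support p a) x * f (support q x)"
  "rot_inv f ==> cprod A f p = f (support p a) * cprod (A - orbit p a) f p"
  "rot_inv f ==> cprod B f q = f (support q x) * cprod (B - orbit q x) f q"
proof -
 let ?q = "p o q"
 have pA: "perm_on A p" and qB: "perm_on B q" using assms by (simp_all add: permutes_perm_on)
 have perm: "permutation ?q" using perm_comp_permutation assms by blast
 have pq: "perm_on (A Un B) ?q" using perm_prod_permutes[OF assms(1,2)] assms(4,5) by (intro permutes_perm_on) auto
 note ps = prod_support[OF assms(1-5)]
 have oA: "orbit p a <= A" by (rule orbit_sub[OF pA assms(6)])
 have oB: "orbit q x <= B" by (rule orbit_sub[OF qB assms(7)])
 have nx: "x ~: orbit ?q a" using ps(2)[OF assms(6)] oA assms(3,7) by auto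
 show s: "support r a = support p a @ support q x"
  unfolding r_def support_join(2)[OF perm nx] ps(1)[OF assms(6)] ps(3)[OF assms(7)] ..
 have "cprod (A Un B - orbit r a) f r = cprod (A Un B - orbit p a - orbit q x) f ?q"
  unfolding r_def using cprod_join[OF pq _ _ nx, of f] ps(2)[OF assms(6)] ps(4)[OF assms(7)] assms(6,7) by simp
 also have "A Un B - orbit p a - orbit q x = (A - orbit p a) Un (B - orbit q x)" using oA oB assms(3) by auto
 also have "cprod ... f ?q = cprod (A - orbit p a) f p * cprod (B - orbit q x) f q"
  by (rule prod_cprod[OF assms(1-5) perm_on_rest[OF pA] _ perm_on_rest[OF qB]]) auto
 finally show "cprod (A Un B - orbit r a) f r = cprod (A - orbit p a) f p * cprod (B - orbit q x) f q" .
 have "x ~: set (support p a)" using set_support[OF perm_onD(2)[OF pA]] oA assms(3,7) by blast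
 thus "cut_term f (support r a) x = J f (support p a) x * f (support q x)"
  unfolding s using support_ne[OF perm_onD(2)[OF qB]] cycle_support(2)[OF perm_onD(2)[OF qB]]
  by (intro cut_term_append)
 show "rot_inv f ==> cprod A f p = f (support p a) * cprod (A - orbit p a) f p"
  using cprod_remove_cycle[OF pA _ cycle_support(1)[OF perm_onD(2)[OF pA], of a], of f]
   set_support[OF perm_onD(2)[OF pA], of a] oA by (simp only:)
 show "rot_inv f ==> cprod B f q = f (support q x) * cprod (B - orbit q x) f q"
  using cprod_remove_cycle[OF qB _ cycle_support(1)[OF perm_onD(2)[OF qB], of x], of f]
   set_support[OF perm_onD(2)[OF qB], of x] oB by (simp only:)
qed

lemma kreweras_cut_append:
 assumes "distinct (u @ v)" "u ~= []" "v ~= []" "permutation q"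
 shows "inv (swp (hd u) (hd v) o q) o cl (u @ v) = inv q o (cl u o cl v)"
 unfolding kreweras_cut[OF assms(4)] cl_append[OF assms(1-3)] by simp

lemma takeWhile_neq_append:
 assumes "x ~: set V1" "V2 ~= []" "hd V2 = x"
 shows "takeWhile (%y. y ~= x) (V1 @ V2) = V1" "dropWhile (%y. y ~= x) (V1 @ V2) = V2"
proof -
 obtain t where "V2 = x # t" using assms by (cases V2) auto
 moreover have "\<forall>y\<in>set V1. y ~= x" using assms(1) by auto
 ultimately show "takeWhile (%y. y ~= x) (V1 @ V2) = V1" "dropWhile (%y. y ~= x) (V1 @ V2) = V2"
  by (simp_all add: takeWhile_append2 dropWhile_append2)
qed

lemma cut_product:
 assumes "!!p. p \<in> X ==> p permutes A" "!!q. q \<in> Y ==> q permutes B" "g permutes A" "h permutes B" "A Int B = {}"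
  "finite A" "finite B" "a \<in> A" "x \<in> B" "rot_inv \<kappa>"
 shows "(\<Sum>p\<in>X. cprod A \<tau> (inv p o g) * (cprod (A - orbit p a) \<kappa> p * \<Phi> (support p a))) *
   (\<Sum>q\<in>Y. cprod B \<tau> (inv q o h) * cprod B \<kappa> q) =
  (\<Sum>(p, q)\<in>X \<times> Y. cprod (A Un B) \<tau> (inv (swp a x o (p o q)) o (swp a x o (g o h))) *
   (cprod (A Un B - orbit (swp a x o (p o q)) a) \<kappa> (swp a x o (p o q)) *
    (\<Phi> (takeWhile (%y. y ~= x) (support (swp a x o (p o q)) a)) * \<kappa> (dropWhile (%y. y ~= x) (support (swp a x o (p o q)) a)))))"
 unfolding sum_product sum.cartesian_product
proof (rule sum_congI, clarify)
 fix p q assume "p \<in> X" "q \<in> Y"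
 hence pp: "p permutes A" and qq: "q permutes B" using assms(1,2) by auto
 have P: "perm_on A p" "perm_on B q" using pp qq assms(6,7) by (simp_all add: permutes_perm_on)
 note wt = cut_weights[OF pp qq assms(5-9)]
 have perm: "permutation (p o q)" by (rule perm_comp_permutation[OF pp qq assms(6,7)])
 have k: "inv (swp a x o (p o q)) o (swp a x o (g o h)) = inv (p o q) o (g o h)"
  unfolding kreweras_cut[OF perm] by simp
 have "x ~: set (support p a)"
  using set_support[OF perm_onD(2)[OF P(1)], of a] orbit_sub[OF P(1) assms(8)] assms(5,9) by blast
 note tw = takeWhile_neq_append[OF this support_ne[OF perm_onD(2)[OF P(2)]] cycle_support(2)[OF perm_onD(2)[OF P(2)]]]
 show "(cprod A \<tau> (inv p o g) * (cprod (A - orbit p a) \<kappa> p * \<Phi> (support p a))) * (cprod B \<tau> (inv q o h) * cprod B \<kappa> q) =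
  cprod (A Un B) \<tau> (inv (swp a x o (p o q)) o (swp a x o (g o h))) *
   (cprod (A Un B - orbit (swp a x o (p o q)) a) \<kappa> (swp a x o (p o q)) *
    (\<Phi> (takeWhile (%y. y ~= x) (support (swp a x o (p o q)) a)) * \<kappa> (dropWhile (%y. y ~= x) (support (swp a x o (p o q)) a))))"
  unfolding k wt(2) wt(1) tw wt(5)[OF assms(10)] prod_kreweras_cprod[OF pp qq assms(3-7)] by (simp only: mult_ac)
qed

lemma disc_cut_weighted:
 assumes "distinct (u @ v)" "u ~= []" "v ~= []" "rot_inv \<kappa>"
 shows "(\<Sum>p\<in>disc u. dwt \<tau> u p * (cprod (set u - orbit p (hd u)) \<kappa> p * \<Phi> (support p (hd u))))
   * disc_sum \<tau> \<kappa> v =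
  (\<Sum>p\<in>{p \<in> disc (u @ v). hd v \<in> orbit p (hd u)}. dwt \<tau> (u @ v) p *
    (cprod (set (u @ v) - orbit p (hd u)) \<kappa> p * (\<Phi> (takeWhile (%y. y ~= hd v) (support p (hd u))) *
     \<kappa> (dropWhile (%y. y ~= hd v) (support p (hd u))))))"
proof -
 define a where "a = hd u"
 define x where "x = hd v"
 have dis: "set u Int set v = {}" and ax: "a \<in> set u" "x \<in> set v"
  using assms(1-3) by (auto simp: a_def x_def dest: hd_in_set)
 have bij: "bij_betw (%(p, q). swp a x o (p o q)) (disc u \<times> disc v) {p \<in> disc (u @ v). x \<in> orbit p a}"
  unfolding a_def x_def by (rule disc_cut[OF assms(1-3)])
 have g: "cl (u @ v) = swp a x o (cl u o cl v)" unfolding a_def x_def by (rule cl_append[OF assms(1-3)])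
 show ?thesis
  unfolding a_def[symmetric] x_def[symmetric] disc_sum_def g set_append sum.reindex_bij_betw[OF bij, symmetric]
  by (rule trans[OF cut_product[OF discD(1) discD(1) cl_permutes cl_permutes dis finite_set finite_set ax assms(4)]])
   (assumption, assumption, rule sum.cong, auto)
qed

lemma disc_sum_cut:
 assumes "distinct (u @ v)" "u ~= []" "v ~= []" "ignores (hd v) \<tau>' \<tau>" "rot_inv \<kappa>"
 shows "disc_sum \<tau>' \<kappa> (u @ [hd v]) * disc_sum \<tau> \<kappa> v =
  (\<Sum>p\<in>{p \<in> disc (u @ v). hd v \<in> orbit p (hd u)}. dwt \<tau> (u @ v) p *
    (cprod (set (u @ v) - orbit p (hd u)) \<kappa> p * cut_term \<kappa> (support p (hd u)) (hd v)))"
proof -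
 have d: "distinct (u @ [hd v])" using assms(1,3) by (auto dest: hd_in_set)
 show ?thesis
  unfolding cut_term_def disc_sum_insert[OF d assms(2,4,5)]
  by (rule disc_cut_weighted[OF assms(1-3,5)])
qed

text \<open>For g the letter l stands for the product of the matrices of l and a; this is how A_k A_1 enters the
recursion.\<close>

definition merges :: "'a => 'a => ('a list => 'r::comm_ring_1) => ('a list => 'r) => bool" where
 "merges a l f g \<longleftrightarrow> rot_inv f \<and> rot_inv g \<and> (\<forall>c. a ~: set c \<longrightarrow> l ~: set c \<longrightarrow> f c = g c) \<and>
   (\<forall>c. c ~= [] \<longrightarrow> distinct c \<longrightarrow> last c = l \<longrightarrow> a ~: set c \<longrightarrow> f (c @ [a]) = g c)"

lemma cycle_list_last: "cycle_list p c ==> p (last c) = hd c"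
 using cycle_list_nth[of p c "length c - 1"] by (cases "c = []") (auto simp: cycle_list_def last_conv_nth hd_conv_nth)

lemma cprod_merges:
 assumes "perm_on S p" "p a = a" "perm_on S g" "g a = a" "a ~: S" "l \<in> S" "g l = h" "merges a l \<tau> \<tau>0"
 shows "cprod (insert a S) \<tau> (inv p o (swp a h o g)) = cprod S \<tau>0 (inv p o g)"
proof -
 have K: "perm_on S (inv p o g)" by (rule perm_on_compose[OF perm_on_inv[OF assms(1)] assms(3)])
 have Ka: "(inv p o g) a = a" using assms(2,4) perm_on_inv_f(1)[OF assms(1), of a] by simp
 have h: "h \<in> S" using perm_onD(6)[OF assms(3,6)] assms(7) by simp
 note m = assms(8)[unfolded merges_def]
 have Kl: "(inv p o g) l = inv p h" using assms(7) by simp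
 show ?thesis
  unfolding fixed_kreweras[OF assms(1,2)]
 proof (rule cprod_insert_point[OF K Ka assms(5) perm_on_inv_in[OF assms(1) h]])
  fix c assume c: "cycle_list (inv p o g) c" "set c <= S"
  {
   assume "inv p h ~: set c"
   moreover have "inv p h \<in> set c" if "l \<in> set c"
    using imageI[OF that, of "inv p o g"] unfolding cycle_list_closed[OF c(1)] Kl .
   ultimately have "l ~: set c" by blast
   thus "\<tau> c = \<tau>0 c" using m c(2) assms(5) by blast
  next
   assume "hd c = inv p h"
   hence "(inv p o g) (last c) = (inv p o g) l" using cycle_list_last[OF c(1)] Kl by simp
   hence "last c = l" using perm_onD(5)[OF K] by (metis injD)
   moreover have "c ~= []" "distinct c" using c(1) by (simp_all add: cycle_list_def)
   moreover have "a ~: set c" using c(2) assms(5) by auto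
   ultimately show "\<tau> (c @ [a]) = \<tau>0 c" using m by simp
  }
 qed (use m in auto)
qed

lemma cl_last: "distinct w ==> w ~= [] ==> cl w (last w) = hd w"
 by (rule cycle_list_last[OF cycle_list_cl])

lemma disc_sum_fixed:
 assumes "distinct (a # w)" "w ~= []" "merges a (last w) \<tau> \<tau>0"
 shows "(\<Sum>p\<in>{p \<in> disc (a # w). p a = a}. dwt \<tau> (a # w) p * cprod (set (a # w) - {a}) \<kappa> p)
   = disc_sum \<tau>0 \<kappa> w"
 unfolding disc_fixed[OF assms(1,2)] disc_sum_def
proof (rule sum_congI)
 fix p assume p: "p \<in> disc w"
 have a: "a ~: set w" and c: "cl (a # w) = swp a (hd w) o cl w" using assms cl_Cons[of a w] by auto
 have pa: "p a = a" using permutes_not_in[OF discD(1)[OF p] a] .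
 have "cprod (insert a (set w)) \<tau> (inv p o (swp a (hd w) o cl w)) = dwt \<tau>0 w p"
  by (rule cprod_merges[OF discD(2)[OF p] pa cl_perm_on _ a _ cl_last assms(3)])
   (use assms a in "auto simp: cl_outside")
 moreover have "set (a # w) - {a} = set w" using a by auto
 ultimately show "dwt \<tau> (a # w) p * cprod (set (a # w) - {a}) \<kappa> p
   = dwt \<tau>0 w p * cprod (set w) \<kappa> p" by (simp add: c)
qed

text \<open>The amount by which \<open>\<kappa>\<close> fails the recursion at the single cycle V.\<close>

definition defect :: "('a list => 'r::comm_ring_1) => 'r => 'a list => 'r" where
 "defect \<kappa> c V = \<kappa> V - (if length V = 1 then c else 0)
   - c * (\<Sum>i = 1..<length V. J \<kappa> (take i V) (V ! i) * \<kappa> (drop i V))"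

lemma support_facts:
 assumes "permutation p"
 shows "set (support p a) = orbit p a" "distinct (support p a)" "support p a ~= []" "hd (support p a) = a"
  "length (support p a) = 1 \<longleftrightarrow> p a = a"
proof -
 show 1: "set (support p a) = orbit p a" by (rule set_support[OF assms])
 show 2: "distinct (support p a)" using cycle_support(1)[OF assms] cycle_list_def by blast
 show "support p a ~= []" by (rule support_ne[OF assms])
 show "hd (support p a) = a" by (rule cycle_support(2)[OF assms])
 have "length (support p a) = card (orbit p a)" using distinct_card[OF 2] 1 by simp
 also have "... = 1 \<longleftrightarrow> orbit p a = {a}"
  using permutation_self_in_orbit[OF assms, of a] by (auto simp: card_1_singleton_iff)
 finally show "length (support p a) = 1 \<longleftrightarrow> p a = a" by (simp add: orbit_eq_singleton_iff)
qed

lemma defect_cut: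
 assumes "permutation p"
 shows "defect \<kappa> c (support p a) = \<kappa> (support p a) - (if p a = a then c else 0)
  - c * (\<Sum>x\<in>orbit p a - {a}. cut_term \<kappa> (support p a) x)"
 using sum_cut_term[where V = "support p a" and \<kappa> = \<kappa>, OF support_facts(2,3)[OF assms]] support_facts[OF assms, of a]
 unfolding defect_def by (simp only:)

lemma cprod_orbit:
 assumes "perm_on S p" "rot_inv f" "a \<in> S"
 shows "cprod S f p = f (support p a) * cprod (S - orbit p a) f p"
 using cprod_remove_cycle[OF assms(1,2) cycle_support(1)[OF perm_onD(2)[OF assms(1)], of a]]
  orbit_sub[OF assms(1,3)] set_support[OF perm_onD(2)[OF assms(1)], of a] by (simp only:)

lemma sum_nth_tl:
 assumes "distinct u" "u ~= []"
 shows "(\<Sum>s=1..<length u. f (u ! s)) = (\<Sum>x\<in>set u - {hd u}. f x)"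
proof -
 have "bij_betw ((!) u) ({..<length u} - {0}) (set u - {u ! 0})"
  by (rule bij_betw_DiffI[OF bij_betw_nth[OF assms(1)]]) (use assms in "auto simp: bij_betw_def")
 moreover have "{..<length u} - {0} = {1..<length u}" by auto
 ultimately have bij: "bij_betw ((!) u) {1..<length u} (set u - {hd u})"
  using assms(2) by (simp add: hd_conv_nth)
 show ?thesis by (rule sum.reindex_bij_betw[OF bij])
qed

lemma sum_swap_filter:
 assumes "finite P" "finite X"
 shows "(\<Sum>x\<in>X. \<Sum>p\<in>{p \<in> P. x \<in> R p}. f p x) = (\<Sum>p\<in>P. \<Sum>x\<in>X Int R p. f p x)"
proof -
 have "(\<Sum>x\<in>X. \<Sum>p\<in>{p \<in> P. x \<in> R p}. f p x) = (\<Sum>x\<in>X. \<Sum>p\<in>P. if x \<in> R p then f p x else 0)"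
  by (intro sum.cong refl sum.inter_filter assms)
 also have "... = (\<Sum>p\<in>P. \<Sum>x\<in>X. if x \<in> R p then f p x else 0)" by (rule sum.swap)
 also have "... = (\<Sum>p\<in>P. \<Sum>x\<in>X Int R p. f p x)"
  by (intro sum.cong refl sum.inter_restrict[symmetric] assms)
 finally show ?thesis .
qed

text \<open>The defect collects, for one permutation, what it contributes to each term of the recursion: fixing the first
letter gives the shortened word, and each further letter x of its cycle gives a cut at x.\<close>

lemma orbit_expansion:
 fixes \<kappa> :: "'a list => 'r::comm_ring_1"
 assumes "finite X" "finite S" "!!p. p \<in> X ==> perm_on S p" "a \<in> S" "rot_inv \<kappa>"
 shows "(\<Sum>p\<in>X. T p * (cprod (S - orbit p a) \<kappa> p * defect \<kappa> c (support p a))) =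
  (\<Sum>p\<in>X. T p * cprod S \<kappa> p) - c * (\<Sum>p\<in>{p \<in> X. p a = a}. T p * cprod (S - {a}) \<kappa> p)
  - c * (\<Sum>x\<in>S - {a}. \<Sum>p\<in>{p \<in> X. x \<in> orbit p a}. T p * (cprod (S - orbit p a) \<kappa> p * cut_term \<kappa> (support p a) x))"
proof -
 let ?W = "%p. cprod (S - orbit p a) \<kappa> p" and ?C = "%p x. cut_term \<kappa> (support p a) x"
 have fixed: "(\<Sum>p\<in>{p \<in> X. p a = a}. T p * cprod (S - {a}) \<kappa> p) = (\<Sum>p\<in>X. if p a = a then T p * ?W p else 0)"
  unfolding sum.inter_filter[OF assms(1), symmetric]
  by (rule sum_congI) (simp add: orbit_eq_singleton_iff[THEN iffD2])
 have cut: "(\<Sum>x\<in>S - {a}. \<Sum>p\<in>{p \<in> X. x \<in> orbit p a}. T p * (?W p * ?C p x)) = (\<Sum>p\<in>X. \<Sum>x\<in>orbit p a - {a}. T p * (?W p * ?C p x))"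
 proof -
  have "(\<Sum>x\<in>S - {a}. \<Sum>p\<in>{p \<in> X. x \<in> orbit p a}. T p * (?W p * ?C p x)) = (\<Sum>p\<in>X. \<Sum>x\<in>(S - {a}) Int orbit p a. T p * (?W p * ?C p x))"
   by (rule sum_swap_filter) (simp_all add: assms)
  also have "... = (\<Sum>p\<in>X. \<Sum>x\<in>orbit p a - {a}. T p * (?W p * ?C p x))"
   by (rule sum_congI, rule sum.cong) (use orbit_sub[OF assms(3,4)] in auto)
  finally show ?thesis .
 qed
 have "(\<Sum>p\<in>X. T p * (?W p * defect \<kappa> c (support p a))) =
  (\<Sum>p\<in>X. T p * cprod S \<kappa> p - c * (if p a = a then T p * ?W p else 0) - c * (\<Sum>x\<in>orbit p a - {a}. T p * (?W p * ?C p x)))"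
 proof (rule sum_congI)
  fix p assume "p \<in> X"
  note p = assms(3)[OF this]
  show "T p * (?W p * defect \<kappa> c (support p a)) = T p * cprod S \<kappa> p - c * (if p a = a then T p * ?W p else 0)
   - c * (\<Sum>x\<in>orbit p a - {a}. T p * (?W p * ?C p x))"
   unfolding defect_cut[OF perm_onD(2)[OF p]] cprod_orbit[OF p assms(5,4)] sum_distrib_left[symmetric]
   by (simp add: algebra_simps)
 qed
 thus ?thesis by (simp only: fixed cut sum_subtractf sum_distrib_left)
qed

text \<open>Inserted into the one-circle recursion, \<open>disc_sum\<close> leaves the sum of the defects of the cycle of the first
letter, weighted by everything else.\<close>

theorem disc_expansion:
 fixes \<tau> \<tau>0 \<kappa> :: "'a list => 'r::comm_ring_1"
 assumes "distinct u" "u ~= []" "rot_inv \<tau>" "rot_inv \<kappa>" "tl u ~= [] ==> merges (hd u) (last u) \<tau> \<tau>0"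
  "!!x. x \<in> set (tl u) ==> ignores x (\<tau>x x) \<tau>"
 shows "disc_sum \<tau> \<kappa> u - c * (if tl u = [] then \<tau> u else disc_sum \<tau>0 \<kappa> (tl u))
   - c * (\<Sum>s=1..<length u. disc_sum (\<tau>x (u ! s)) \<kappa> (take (Suc s) u) * disc_sum \<tau> \<kappa> (drop s u))
  = (\<Sum>p\<in>disc u. dwt \<tau> u p * (cprod (set u - orbit p (hd u)) \<kappa> p * defect \<kappa> c (support p (hd u))))"
proof -
 define a where "a = hd u"
 have a: "a \<in> set u" using assms(2) by (simp add: a_def)
 let ?T = "%p. dwt \<tau> u p"
 let ?C = "%p x. cprod (set u - orbit p a) \<kappa> p * cut_term \<kappa> (support p a) x"
 have 2: "(\<Sum>p\<in>{p \<in> disc u. p a = a}. ?T p * cprod (set u - {a}) \<kappa> p) = (if tl u = [] then \<tau> u else disc_sum \<tau>0 \<kappa> (tl u))"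
 proof (cases "tl u = []")
  case True
  hence u: "u = [a]" using assms(2) by (cases u) (auto simp: a_def)
  have "perm_on {a} id" "cycle_list id [a]" by (auto simp: perm_on_def cycle_list_def)
  hence "cprod {a} \<tau> id = \<tau> [a]" using cprod_cycle_list[OF _ assms(3), of id "[a]"] by (simp add: perm_on_def)
  moreover have "{p \<in> disc [a]. p a = a} = {id}" by auto
  ultimately show ?thesis using True u by simp
 next
  case False
  then obtain w where u: "u = a # w" "w ~= []" using assms(2) by (cases u) (auto simp: a_def)
  have "(\<Sum>p\<in>{p \<in> disc u. p a = a}. ?T p * cprod (set u - {a}) \<kappa> p) = disc_sum \<tau>0 \<kappa> w"
   unfolding u(1) by (rule disc_sum_fixed) (use assms(1,5) u in auto)
  thus ?thesis using u by simp
 qed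
 have 3: "(\<Sum>s=1..<length u. disc_sum (\<tau>x (u ! s)) \<kappa> (take (Suc s) u) * disc_sum \<tau> \<kappa> (drop s u))
   = (\<Sum>x\<in>set u - {a}. \<Sum>p\<in>{p \<in> disc u. x \<in> orbit p a}. ?T p * ?C p x)"
 proof -
  have "(\<Sum>s=1..<length u. disc_sum (\<tau>x (u ! s)) \<kappa> (take (Suc s) u) * disc_sum \<tau> \<kappa> (drop s u))
   = (\<Sum>s=1..<length u. \<Sum>p\<in>{p \<in> disc u. u ! s \<in> orbit p a}. ?T p * ?C p (u ! s))"
  proof (rule sum_congI)
   fix s assume s: "s \<in> {1..<length u}"
   have td: "take s u @ drop s u = u" "take s u ~= []" "drop s u ~= []" "hd (drop s u) = u ! s" "hd (take s u) = a"
    "take (Suc s) u = take s u @ [u ! s]"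
    using s assms(2) by (auto simp: hd_drop_conv_nth a_def take_Suc_conv_app_nth)
   have "u ! s \<in> set (tl u)" using s assms(2) by (cases u) (auto simp: nth_Cons')
   from disc_sum_cut[of "take s u" "drop s u", unfolded td(1,4,5), OF assms(1) td(2,3) assms(6)[OF this] assms(4)]
   show "disc_sum (\<tau>x (u ! s)) \<kappa> (take (Suc s) u) * disc_sum \<tau> \<kappa> (drop s u)
    = (\<Sum>p\<in>{p \<in> disc u. u ! s \<in> orbit p a}. ?T p * ?C p (u ! s))"
    by (simp only: td(6))
  qed
  thus ?thesis
   using sum_nth_tl[OF assms(1,2), of "%x. \<Sum>p\<in>{p \<in> disc u. x \<in> orbit p a}. ?T p * ?C p x"] by (simp add: a_def)
 qed
 show ?thesis unfolding disc_sum_def[of \<tau> \<kappa> u] 2[symmetric] 3 a_def[symmetric]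
  by (rule orbit_expansion[OF finite_disc finite_set discD(2) a assms(4), symmetric])
qed

definition annulus_insert_sum where
 "annulus_insert_sum \<tau> \<kappa> u v e = (\<Sum>p\<in>annulus u v. awt \<tau> u v p *
   (cprod (set u Un set v - orbit p (hd u)) \<kappa> p * J \<kappa> (support p (hd u)) e))"

text \<open>The part of an insertion into the annulus that comes from pairs of disc permutations.\<close>

definition join_sum where
 "join_sum \<tau> \<kappa> u v e = (\<Sum>p\<in>disc u. \<Sum>q\<in>disc v. dwt \<tau> u p * dwt \<tau> v q *
   (cprod (set u - orbit p (hd u)) \<kappa> p *
    (\<Sum>w\<in>set v. cprod (set v - orbit q w) \<kappa> q * \<kappa> (support p (hd u) @ e # support q w))))"

lemma annulus_sum_insert:
 assumes "distinct (u @ e # v)" "u ~= []" "v ~= []" "ignores e \<tau>' \<tau>" "rot_inv \<kappa>"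
 shows "annulus_sum \<tau>' \<kappa> (u @ [e]) v = annulus_insert_sum \<tau> \<kappa> u v e + join_sum \<tau> \<kappa> u v e"
proof -
 define a where "a = hd u"
 let ?S = "set u Un set v" and ?g = "cl u o cl v"
 have d: "distinct (u @ v)" "distinct (u @ [e])" and dis: "set u Int set v = {}" using assms by auto
 have a: "a \<in> ?S" "a \<in> set u" "a ~: set v" and e: "e ~: ?S" using assms dis by (auto simp: a_def dest: hd_in_set)
 have g: "cl (u @ [e]) o cl v = swp a e o ?g" unfolding a_def cl_snoc[OF d(2) assms(2)] by (simp add: comp_assoc)
 have gp: "perm_on ?S ?g" "?g e = e" using e by (auto simp: perm_on_comp_cl cl_outside)
 have S: "set (u @ [e]) Un set v = insert e ?S" by simp
 let ?P = "(%(p, q). p o q) ` (disc u \<times> disc v)"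
 let ?D1 = "SIGMA p:annulus u v. insert e (orbit p a)" and ?D2 = "?P \<times> set v"
 let ?f = "%(p, w). swp a w o (swp a e o p)"
 have bij: "bij_betw ?f (?D1 Un ?D2) (annulus (u @ [e]) v)"
  unfolding a_def by (rule annulus_insert[OF assms(1-3)])
 define F where "F = (%p. cprod (insert e ?S) \<tau>' (inv p o (swp a e o ?g)) * cprod (insert e ?S) \<kappa> p)"
 have fin: "finite (insert e (orbit p a))" if "p \<in> annulus u v" for p
  using orbit_sub[OF annulusD(2)[OF that] a(1)] finite_subset by auto
 have finD1: "finite ?D1" using fin finite_annulus by auto
 have finD2: "finite ?D2" using finite_disc by auto
 have disj: "?D1 Int ?D2 = {}"
 proof -
  have "p ~: ?P" if "p \<in> annulus u v" for p
  proof
   assume "p \<in> ?P"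
   then obtain p1 p2 where "p1 \<in> disc u" "p2 \<in> disc v" "p = p1 o p2" by auto
   hence "p ` set u = set u" using two_disc_count(3)[OF d(1)] by simp
   thus False using annulusD(5)[OF that] dis by blast
  qed
  thus ?thesis by blast
 qed
 have key: "F (swp a w o (swp a e o p)) = cprod ?S \<tau> (inv p o ?g) * cprod (insert e ?S) \<kappa> (swp a w o (swp a e o p))"
  if "p permutes ?S" "w \<in> insert e ?S" for p w
 proof -
  have pp: "perm_on ?S p" "p e = e" using permutes_not_in[OF that(1) e] that(1) by (simp_all add: permutes_perm_on)
  show ?thesis unfolding F_def by (simp only: cprod_ignores[of ?S p e ?g a w, OF pp gp e a(1) that(2) assms(4)])
 qed
 have 0: "annulus_sum \<tau>' \<kappa> (u @ [e]) v = (\<Sum>y\<in>?D1 Un ?D2. F (?f y))"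
  unfolding annulus_sum_def S g F_def
  by (rule sum.reindex_bij_betw[OF bij, symmetric])
 have 1: "(\<Sum>y\<in>?D1. F (?f y)) = annulus_insert_sum \<tau> \<kappa> u v e"
 proof -
  have "(\<Sum>y\<in>?D1. F (?f y)) = (\<Sum>(p, w)\<in>?D1. F (swp a w o (swp a e o p)))"
   by (rule sum.cong) auto
  also have "... = annulus_insert_sum \<tau> \<kappa> u v e"
   unfolding annulus_insert_sum_def a_def[symmetric] F_def
   by (rule insert_sum[OF finite_annulus annulusD(1) finite_UnI[OF finite_set finite_set] gp e a(1) assms(4,5)])
  finally show ?thesis .
 qed
 have injP: "inj_on (%(p, q). p o q) (disc u \<times> disc v)"
 proof (rule inj_onI, clarify)
  fix p q p' q' assume m: "p \<in> disc u" "q \<in> disc v" "p' \<in> disc u" "q' \<in> disc v" and e: "p o q = p' o q'"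
  show "p = p' \<and> q = q'"
   using perm_prod_inj[OF discD(1)[OF m(1)] discD(1)[OF m(2)] discD(1)[OF m(3)]
     discD(1)[OF m(4)] dis e] by simp
 qed
 have 2: "(\<Sum>y\<in>?D2. F (?f y)) = join_sum \<tau> \<kappa> u v e"
 proof -
  have "(\<Sum>y\<in>?D2. F (?f y)) = (\<Sum>(r, w)\<in>?D2. F (swp a w o (swp a e o r)))"
   by (rule sum.cong) auto
  also have "... = (\<Sum>r\<in>?P. \<Sum>w\<in>set v. F (swp a w o (swp a e o r)))"
   by (rule sum.cartesian_product[symmetric])
  also have "... = (\<Sum>y\<in>disc u \<times> disc v. \<Sum>w\<in>set v. F (swp a w o (swp a e o (case y of (p, q) => p o q))))"
   using sum.reindex[OF injP, of "%r. \<Sum>w\<in>set v. F (swp a w o (swp a e o r))"] by (simp add: comp_def)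
  also have "... = (\<Sum>(p, q)\<in>disc u \<times> disc v. \<Sum>w\<in>set v. F (swp a w o (swp a e o (p o q))))"
   by (rule sum.cong) auto
  also have "... = (\<Sum>p\<in>disc u. \<Sum>q\<in>disc v. \<Sum>w\<in>set v. F (swp a w o (swp a e o (p o q))))"
   by (rule sum.cartesian_product[symmetric])
  also have "... = join_sum \<tau> \<kappa> u v e"
   unfolding join_sum_def a_def[symmetric]
  proof (intro sum.cong refl)
   fix p q assume p: "p \<in> disc u" and q: "q \<in> disc v"
   note pp = discD(1)[OF p] and qq = discD(1)[OF q]
   note ps = prod_support[OF pp qq dis finite_set finite_set]
   have pq: "(p o q) permutes ?S" by (rule perm_prod_permutes[OF pp qq])
   have pqp: "perm_on ?S (p o q)" using pq by (simp add: permutes_perm_on)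
   have pe: "(p o q) e = e" by (rule permutes_not_in[OF pq e])
   have oA: "orbit p a <= set u" by (rule orbit_sub[OF discD(2)[OF p] a(2)])
   have "F (swp a w o (swp a e o (p o q))) = dwt \<tau> u p * dwt \<tau> v q *
     (cprod (set u - orbit p a) \<kappa> p * (cprod (set v - orbit q w) \<kappa> q * \<kappa> (support p a @ e # support q w)))"
    if w: "w \<in> set v" for w
   proof -
    have wS: "w \<in> ?S" "w \<in> insert e ?S" using w by auto
    have oB: "orbit q w <= set v" by (rule orbit_sub[OF discD(2)[OF q] w])
    have wo: "w ~: orbit (p o q) a" unfolding ps(2)[OF a(2)] using oA w dis by auto
    have R: "?S - orbit p a - orbit q w = (set u - orbit p a) Un (set v - orbit q w)" using oA oB dis by auto
    have "cprod (insert e ?S) \<kappa> (swp a w o (swp a e o (p o q)))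
     = \<kappa> (support p a @ e # support q w) * cprod ((set u - orbit p a) Un (set v - orbit q w)) \<kappa> (p o q)"
     unfolding cprod_insert_join[OF pqp pe e a(1) assms(5) wS(1) wo] ps(1)[OF a(2)] ps(3)[OF w] ps(2)[OF a(2)] ps(4)[OF w] R ..
    also have "cprod ((set u - orbit p a) Un (set v - orbit q w)) \<kappa> (p o q) = cprod (set u - orbit p a) \<kappa> p * cprod (set v - orbit q w) \<kappa> q"
     by (rule prod_cprod[OF pp qq dis finite_set finite_set perm_on_rest[OF discD(2)[OF p]] _ perm_on_rest[OF discD(2)[OF q]]]) auto
    finally show ?thesis unfolding key[OF pq wS(2)]
     prod_kreweras_cprod[OF pp qq cl_permutes cl_permutes dis finite_set finite_set] by (simp only: mult_ac)
   qed
   hence "(\<Sum>w\<in>set v. F (swp a w o (swp a e o (p o q)))) = (\<Sum>w\<in>set v. dwt \<tau> u p * dwt \<tau> v q *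
     (cprod (set u - orbit p a) \<kappa> p * (cprod (set v - orbit q w) \<kappa> q * \<kappa> (support p a @ e # support q w))))"
    by (rule sum_congI)
   thus "(\<Sum>w\<in>set v. F (swp a w o (swp a e o (p o q)))) = dwt \<tau> u p * dwt \<tau> v q *
     (cprod (set u - orbit p a) \<kappa> p * (\<Sum>w\<in>set v. cprod (set v - orbit q w) \<kappa> q * \<kappa> (support p a @ e # support q w)))"
    by (simp only: sum_distrib_left)
  qed
  finally show ?thesis .
 qed
 show ?thesis unfolding 0 sum.union_disjoint[OF finD1 finD2 disj] 1 2 ..
qed

lemma annulus_sum_single:
 assumes "distinct (e # v)" "v ~= []" "ignores e \<tau>' \<tau>" "rot_inv \<kappa>"
 shows "annulus_sum \<tau>' \<kappa> [e] v = (\<Sum>q\<in>disc v. dwt \<tau> v q *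
   (\<Sum>w\<in>set v. cprod (set v - orbit q w) \<kappa> q * \<kappa> (e # support q w)))"
proof -
 let ?S = "set v"
 have e: "e ~: ?S" using assms by simp
 have bij: "bij_betw (%(q, w). swp e w o q) (disc v \<times> set v) (annulus [e] v)"
  by (rule annulus_single[OF assms(1,2)])
 have "annulus_sum \<tau>' \<kappa> [e] v = (\<Sum>y\<in>disc v \<times> set v. let p = (case y of (q, w) => swp e w o q) in
   cprod (insert e ?S) \<tau>' (inv p o cl v) * cprod (insert e ?S) \<kappa> p)"
  unfolding annulus_sum_def Let_def by (subst sum.reindex_bij_betw[OF bij]) simp
 also have "... = (\<Sum>(q, w)\<in>disc v \<times> set v. cprod ?S \<tau> (inv q o cl v) * (cprod (?S - orbit q w) \<kappa> q * \<kappa> (e # support q w)))"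
 proof (rule sum_congI)
  fix y assume y: "y \<in> disc v \<times> set v"
  obtain q w where yy: "y = (q, w)" by (cases y)
  have q: "q \<in> disc v" and w: "w \<in> set v" using y yy by auto
  note d = discD[OF q]
  have qe: "q e = e" by (rule permutes_not_in[OF d(1) e])
  have K: "perm_on ?S (inv q o cl v)" by (intro perm_on_compose perm_on_inv d(2) cl_perm_on) auto
  have ie: "inv q e = e" using qe perm_on_inv_f(1)[OF d(2), of e] by simp
  have Ke: "(inv q o cl v) e = e" using ie e by (simp add: cl_outside)
  have k: "inv (swp e w o q) o cl v = swp e (inv q w) o (inv q o cl v)"
   using kreweras_swp[OF d(2), of e w "cl v"] ie by simp
  have 1: "cprod (insert e ?S) \<tau>' (inv (swp e w o q) o cl v) = cprod ?S \<tau> (inv q o cl v)"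
   unfolding k by (rule cprod_insert_point[OF K Ke e perm_on_inv_in[OF d(2) w]])
    (use assms(3) e in "auto simp: cycle_list_def ignores_def")
  have ew: "w ~: orbit q e" by (rule orbit_subset_insert(2)[OF d(2) qe w e])
  have c: "cycle_list (swp e w o q) (e # support q w)"
   using support_join(1)[OF d(4) ew] support_single[OF qe d(4)] by simp
  have st: "set (e # support q w) = insert e (orbit q w)" using set_support[OF d(4)] by simp
  have sub: "orbit q w <= ?S" by (rule orbit_sub[OF d(2) w])
  have perm: "perm_on (insert e ?S) (swp e w o q)" using w by (intro perm_on_swp_comp perm_on_insert_fixed[OF d(2) qe]) auto
  have "cprod (insert e ?S) \<kappa> (swp e w o q) = \<kappa> (e # support q w) * cprod (insert e ?S - set (e # support q w)) \<kappa> (swp e w o q)"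
   by (rule cprod_remove_cycle[OF perm assms(4) c]) (use st sub in auto)
  also have "insert e ?S - set (e # support q w) = ?S - orbit q w" unfolding st using e by auto
  also have "cprod (?S - orbit q w) \<kappa> (swp e w o q) = cprod (?S - orbit q w) \<kappa> q"
   by (rule cprod_cong_swp[OF perm_on_rest[OF d(2)]]) (use e d(4) permutation_self_in_orbit[OF d(4)] in auto)
  finally show "(let p = (case y of (q, w) => swp e w o q) in
   cprod (insert e ?S) \<tau>' (inv p o cl v) * cprod (insert e ?S) \<kappa> p) =
   (case y of (q, w) => cprod ?S \<tau> (inv q o cl v) * (cprod (?S - orbit q w) \<kappa> q * \<kappa> (e # support q w)))"
   unfolding yy Let_def case_prod_conv 1 by (simp only: mult_ac)
 qed
 also have "... = (\<Sum>q\<in>disc v. \<Sum>w\<in>set v. cprod ?S \<tau> (inv q o cl v) * (cprod (?S - orbit q w) \<kappa> q * \<kappa> (e # support q w)))"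
  by (rule sum.cartesian_product[symmetric])
 finally show ?thesis by (simp only: sum_distrib_left)
qed

lemma annulus_sum_cut:
 assumes "distinct (u @ w @ v)" "u ~= []" "w ~= []" "v ~= []" "ignores (hd w) \<tau>' \<tau>" "rot_inv \<kappa>"
 shows "annulus_insert_sum \<tau> \<kappa> u v (hd w) * disc_sum \<tau> \<kappa> w + disc_sum \<tau>' \<kappa> (u @ [hd w]) * annulus_sum \<tau> \<kappa> w v =
  (\<Sum>p\<in>{p \<in> annulus (u @ w) v. hd w \<in> orbit p (hd u)}.
    awt \<tau> (u @ w) v p *
    (cprod (set (u @ w) Un set v - orbit p (hd u)) \<kappa> p * cut_term \<kappa> (support p (hd u)) (hd w)))"
proof -
 define a where "a = hd u"
 define x where "x = hd w"
 let ?U = "set u" and ?W = "set w" and ?V = "set v"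
 have dis: "?U Int ?W = {}" "?U Int ?V = {}" "?W Int ?V = {}" and d3: "distinct (u @ w)" "distinct (u @ v)" "distinct (w @ v)" "distinct (u @ [hd w])"
  using assms(1-3) by (auto dest: hd_in_set)
 have ax: "a \<in> ?U" "x \<in> ?W" "a \<in> ?U Un ?V" "x \<in> ?W Un ?V" using assms(2,3) by (auto simp: a_def x_def)
 have comm: "cl w o cl v = cl v o cl w" using cycles_commute d3(3) dis by auto
 have g: "cl (u @ w) o cl v = swp a x o (cl u o (cl w o cl v))"
  unfolding a_def x_def by (simp add: cl_append[OF d3(1) assms(2,3)] comp_assoc)
 have h2: "cl u o (cl w o cl v) = (cl u o cl v) o cl w" by (simp add: comm comp_assoc)
 have pv: "(cl u o cl v) permutes (?U Un ?V)" "(cl w o cl v) permutes (?W Un ?V)"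
  by (rule perm_prod_permutes[OF cl_permutes cl_permutes])+
 have S1: "(?U Un ?V) Un ?W = set (u @ w) Un ?V" "(?U Un ?V) Int ?W = {}"
  and S2: "?U Un (?W Un ?V) = set (u @ w) Un ?V" "?U Int (?W Un ?V) = {}" using dis by auto
 have finUV: "finite (?U Un ?V)" "finite (?W Un ?V)" by auto
 let ?f = "%(p, q). swp a x o (p o q)"
 have bij: "bij_betw ?f (annulus u v \<times> disc w Un disc u \<times> annulus w v) {p \<in> annulus (u @ w) v. x \<in> orbit p a}"
  unfolding a_def x_def by (rule annulus_cut[OF assms(1-4)])
 define G where "G = (%p. awt \<tau> (u @ w) v p *
    (cprod (set (u @ w) Un set v - orbit p a) \<kappa> p * cut_term \<kappa> (support p a) x))"
 have disj: "(annulus u v \<times> disc w) Int (disc u \<times> annulus w v) = {}"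
  using annulus_disc_disjoint[OF _ d3(2)] discD(1) by auto
 have 0: "(\<Sum>p\<in>{p \<in> annulus (u @ w) v. x \<in> orbit p a}. G p) =
   (\<Sum>y\<in>annulus u v \<times> disc w. G (?f y)) + (\<Sum>y\<in>disc u \<times> annulus w v. G (?f y))"
  by (subst sum.reindex_bij_betw[OF bij, symmetric], rule sum.union_disjoint[OF _ _ disj])
    (simp_all add: finite_disc finite_annulus)
 have 1: "annulus_insert_sum \<tau> \<kappa> u v x * disc_sum \<tau> \<kappa> w = (\<Sum>y\<in>annulus u v \<times> disc w. G (?f y))"
  unfolding G_def g h2 S1(1)[symmetric] annulus_insert_sum_def a_def[symmetric] disc_sum_def cut_term_def
  by (rule trans[OF cut_product[OF annulusD(1) discD(1) pv(1) cl_permutes S1(2) finUV(1) finite_set ax(3,2) assms(6)]])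
   (assumption, assumption, rule sum.cong, auto)
 have 2: "disc_sum \<tau>' \<kappa> (u @ [x]) * annulus_sum \<tau> \<kappa> w v = (\<Sum>y\<in>disc u \<times> annulus w v. G (?f y))"
  unfolding G_def g S2(1)[symmetric] disc_sum_insert[OF d3(4) assms(2,5,6), folded a_def x_def] annulus_sum_def cut_term_def
  by (rule trans[OF cut_product[OF discD(1) annulusD(1) cl_permutes pv(2) S2(2) finite_set finUV(2) ax(1,4) assms(6)]])
   (assumption, assumption, rule sum.cong, auto)
 show ?thesis using 0 1 2 by (simp only: G_def a_def x_def)
qed

text \<open>Reading the second circle as part of the first word: disc permutations of the joined word come from an annular
permutation that joins the first letters (slit), or from a pair of disc permutations (cut).\<close>

lemma slit_sum:
 assumes "distinct (u @ v @ [e])" "u ~= []" "v ~= []" "ignores e \<tau>' \<tau>" "rot_inv \<kappa>" "!!c. \<kappa> (c @ [e]) = \<kappa> (c @ [hd v])"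
 shows "disc_sum \<tau>' \<kappa> (u @ v @ [e]) =
  (\<Sum>p\<in>{p \<in> annulus u v. hd v \<in> orbit p (hd u)}. awt \<tau> u v p *
    (cprod (set u Un set v - orbit p (hd u)) \<kappa> p * cut_term \<kappa> (support p (hd u)) (hd v))) +
  (\<Sum>p\<in>disc u. \<Sum>q\<in>disc v. dwt \<tau> u p * dwt \<tau> v q *
    (cprod (set u - orbit p (hd u)) \<kappa> p * (cprod (set v - orbit q (hd v)) \<kappa> q *
     J \<kappa> (support p (hd u) @ support q (hd v)) (hd v))))"
proof -
 define a where "a = hd u"
 define x where "x = hd v"
 have d: "distinct (u @ v)" "distinct ((u @ v) @ [e])" and dis: "set u Int set v = {}" using assms(1) by auto
 let ?S = "set u Un set v" and ?g = "cl u o cl v"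
 have ax: "a \<in> set u" "x \<in> set v" "a \<in> ?S" "x \<in> ?S" using assms(2,3) by (auto simp: a_def x_def)
 have Je: "J \<kappa> V e = J \<kappa> V x" for V unfolding J_def x_def assms(6) ..
 define F where "F = (%p. cprod ?S \<tau> (inv p o cl (u @ v)) * (cprod (?S - orbit p a) \<kappa> p * J \<kappa> (support p a) x))"
 have "disc_sum \<tau>' \<kappa> (u @ v @ [e]) = (\<Sum>p\<in>disc (u @ v). F p)"
  using disc_sum_insert[OF d(2) _ assms(4,5)] assms(2) by (simp add: F_def a_def Je hd_append)
 also have "disc (u @ v) = {p \<in> disc (u @ v). x ~: orbit p a} Un {p \<in> disc (u @ v). x \<in> orbit p a}" by auto
 also have "(\<Sum>p\<in>.... F p) = (\<Sum>p\<in>{p \<in> disc (u @ v). x ~: orbit p a}. F p) + (\<Sum>p\<in>{p \<in> disc (u @ v). x \<in> orbit p a}. F p)"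
  by (rule sum.union_disjoint) (auto simp: finite_disc)
 also have "(\<Sum>p\<in>{p \<in> disc (u @ v). x ~: orbit p a}. F p) =
  (\<Sum>p\<in>{p \<in> annulus u v. x \<in> orbit p a}. cprod ?S \<tau> (inv p o ?g) *
    (cprod (?S - orbit p a) \<kappa> p * cut_term \<kappa> (support p a) x))"
 proof -
  have bij: "bij_betw (%p. swp a x o p) {p \<in> annulus u v. x \<in> orbit p a} {p \<in> disc (u @ v). x ~: orbit p a}"
   unfolding a_def x_def by (rule annulus_slit[OF d(1) assms(2,3)])
  show ?thesis
  proof (subst sum.reindex_bij_betw[OF bij, symmetric], rule sum_congI)
   fix p assume p: "p \<in> {p \<in> annulus u v. x \<in> orbit p a}"
   let ?q = "swp a x o p"
   have q: "?q \<in> disc (u @ v)" "x ~: orbit ?q a" using bij_betwE[OF bij] p by auto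
   note dq = discD[OF q(1), simplified]
   have pq: "p = swp a x o ?q" by simp
   have k: "inv ?q o cl (u @ v) = inv p o ?g"
    unfolding a_def x_def using p by (intro kreweras_cut_append[OF d(1) assms(2,3)]) (auto dest: annulusD(4))
   have s: "support p a = support ?q a @ support ?q x"
    using support_join(2)[OF dq(4) q(2)] by simp
   have c: "cprod (?S - orbit p a) \<kappa> p = cprod (?S - orbit ?q a - orbit ?q x) \<kappa> ?q"
    using cprod_join[OF dq(2) ax(3,4) q(2), of \<kappa>] by simp
   have xq: "x \<in> ?S - orbit ?q a" using q(2) ax by simp
   have c2: "cprod (?S - orbit ?q a) \<kappa> ?q = \<kappa> (support ?q x) * cprod (?S - orbit ?q a - orbit ?q x) \<kappa> ?q"
    by (rule cprod_orbit[OF perm_on_rest[OF dq(2)] assms(5) xq])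
   have "x ~: set (support ?q a)" using set_support[OF dq(4)] q(2) by blast
   hence ct: "cut_term \<kappa> (support p a) x = J \<kappa> (support ?q a) x * \<kappa> (support ?q x)"
    unfolding s by (intro cut_term_append support_ne[OF dq(4)] cycle_support(2)[OF dq(4)])
   show "F ?q = cprod ?S \<tau> (inv p o ?g) * (cprod (?S - orbit p a) \<kappa> p * cut_term \<kappa> (support p a) x)"
    unfolding F_def k c c2 ct by (simp only: mult_ac)
  qed
 qed
 also have "(\<Sum>p\<in>{p \<in> disc (u @ v). x \<in> orbit p a}. F p) =
  (\<Sum>p\<in>disc u. \<Sum>q\<in>disc v. dwt \<tau> u p * dwt \<tau> v q *
    (cprod (set u - orbit p a) \<kappa> p * (cprod (set v - orbit q x) \<kappa> q * J \<kappa> (support p a @ support q x) x)))"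
 proof -
  have bij: "bij_betw (%(p, q). swp a x o (p o q)) (disc u \<times> disc v) {p \<in> disc (u @ v). x \<in> orbit p a}"
   unfolding a_def x_def by (rule disc_cut[OF d(1) assms(2,3)])
  have "(\<Sum>p\<in>{p \<in> disc (u @ v). x \<in> orbit p a}. F p) = (\<Sum>(p, q)\<in>disc u \<times> disc v. F (swp a x o (p o q)))"
   by (subst sum.reindex_bij_betw[OF bij, symmetric]) (rule sum.cong, auto)
  also have "... = (\<Sum>p\<in>disc u. \<Sum>q\<in>disc v. F (swp a x o (p o q)))" by (rule sum.cartesian_product[symmetric])
  also have "... = (\<Sum>p\<in>disc u. \<Sum>q\<in>disc v. dwt \<tau> u p * dwt \<tau> v q *
    (cprod (set u - orbit p a) \<kappa> p * (cprod (set v - orbit q x) \<kappa> q * J \<kappa> (support p a @ support q x) x)))"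
  proof (intro sum.cong refl)
   fix p q assume p: "p \<in> disc u" and q: "q \<in> disc v"
   note pp = discD(1)[OF p] and qq = discD(1)[OF q]
   note w = cut_weights[OF pp qq dis finite_set finite_set ax(1,2)]
   have perm: "permutation (p o q)" by (rule perm_comp_permutation[OF pp qq finite_set finite_set])
   have k: "inv (swp a x o (p o q)) o cl (u @ v) = inv (p o q) o ?g"
    unfolding a_def x_def by (rule kreweras_cut_append[OF d(1) assms(2,3) perm])
   show "F (swp a x o (p o q)) = dwt \<tau> u p * dwt \<tau> v q *
    (cprod (set u - orbit p a) \<kappa> p * (cprod (set v - orbit q x) \<kappa> q * J \<kappa> (support p a @ support q x) x))"
    unfolding F_def k w(1) w(2) prod_kreweras_cprod[OF pp qq cl_permutes cl_permutes dis finite_set finite_set]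
    by (simp only: mult_ac)
  qed
  finally show ?thesis .
 qed
 finally show ?thesis by (simp only: a_def x_def)
qed

lemma annulus_sum_fixed:
 assumes "distinct (a # u @ v)" "u ~= []" "merges a (last u) \<tau> \<tau>0"
 shows "(\<Sum>p\<in>{p \<in> annulus (a # u) v. p a = a}. awt \<tau> (a # u) v p *
   cprod (set (a # u) Un set v - {a}) \<kappa> p) = annulus_sum \<tau>0 \<kappa> u v"
 unfolding annulus_fixed[OF assms(1,2)] annulus_sum_def
proof (rule sum_congI)
 fix p assume p: "p \<in> annulus u v"
 let ?S = "set u Un set v"
 have a: "a ~: ?S" and dis: "set u Int set v = {}" using assms(1) by auto
 have c: "cl (a # u) o cl v = swp a (hd u) o (cl u o cl v)" using assms cl_Cons[of a u] by (auto simp: comp_assoc)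
 have pa: "p a = a" using permutes_not_in[OF annulusD(1)[OF p] a] .
 have l: "last u \<in> set u" using assms(2) by simp
 have gl: "(cl u o cl v) (last u) = hd u" using cl_comp_apply(1)[OF dis l] cl_last[of u] assms by simp
 have "cprod (insert a ?S) \<tau> (inv p o (swp a (hd u) o (cl u o cl v))) = cprod ?S \<tau>0 (inv p o (cl u o cl v))"
  by (rule cprod_merges[where l = "last u", OF annulusD(2)[OF p] pa perm_on_comp_cl _ a _ gl assms(3)])
   (use a l in "auto simp: cl_outside")
 moreover have "set (a # u) Un set v - {a} = ?S" "set (a # u) Un set v = insert a ?S" using a by auto
 ultimately show "awt \<tau> (a # u) v p *
   cprod (set (a # u) Un set v - {a}) \<kappa> p = cprod ?S \<tau>0 (inv p o (cl u o cl v)) * cprod ?S \<kappa> p" by (simp only: c)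
qed

text \<open>As on one circle, but a cut leaves an annulus on either side, and cuts at letters of the other circle appear
as an extra sum. It will be matched by the sums over the joined words.\<close>

theorem annulus_expansion:
 fixes \<tau> \<tau>0 \<kappa> :: "'a list => 'r::comm_ring_1"
 assumes "distinct (u @ v)" "u ~= []" "v ~= []" "rot_inv \<tau>" "rot_inv \<kappa>" "tl u ~= [] ==> merges (hd u) (last u) \<tau> \<tau>0"
  "!!x. x \<in> set (tl u) ==> ignores x (\<tau>x x) \<tau>"
 shows "annulus_sum \<tau> \<kappa> u v - c * annulus_sum \<tau>0 \<kappa> (tl u) v
   - c * (\<Sum>s=1..<length u. annulus_insert_sum \<tau> \<kappa> (take s u) v (u ! s) * disc_sum \<tau> \<kappa> (drop s u)
      + disc_sum (\<tau>x (u ! s)) \<kappa> (take (Suc s) u) * annulus_sum \<tau> \<kappa> (drop s u) v)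
   - c * (\<Sum>x\<in>set v. \<Sum>p\<in>{p \<in> annulus u v. x \<in> orbit p (hd u)}.
      awt \<tau> u v p *
      (cprod (set u Un set v - orbit p (hd u)) \<kappa> p * cut_term \<kappa> (support p (hd u)) x))
  = (\<Sum>p\<in>annulus u v. awt \<tau> u v p *
    (cprod (set u Un set v - orbit p (hd u)) \<kappa> p * defect \<kappa> c (support p (hd u))))"
proof -
 define a where "a = hd u"
 let ?S = "set u Un set v"
 have a: "a \<in> ?S" "a \<in> set u" "a ~: set v" using assms(1,2) by (auto simp: a_def dest: hd_in_set)
 let ?T = "%p. cprod ?S \<tau> (inv p o (cl u o cl v))"
 let ?C = "%x. \<Sum>p\<in>{p \<in> annulus u v. x \<in> orbit p a}. ?T p * (cprod (?S - orbit p a) \<kappa> p * cut_term \<kappa> (support p a) x)"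
 have 2: "(\<Sum>p\<in>{p \<in> annulus u v. p a = a}. ?T p * cprod (?S - {a}) \<kappa> p) = annulus_sum \<tau>0 \<kappa> (tl u) v"
 proof (cases "tl u = []")
  case True
  hence u: "u = [a]" using assms(2) by (cases u) (auto simp: a_def)
  have e: "{p \<in> annulus u v. p a = a} = {}" using annulusD(5) u a(3) by fastforce
  show ?thesis unfolding e using True by (simp add: annulus_sum_def)
 next
  case False
  then obtain w where u: "u = a # w" "w ~= []" using assms(2) by (cases u) (auto simp: a_def)
  have "(\<Sum>p\<in>{p \<in> annulus u v. p a = a}. ?T p * cprod (?S - {a}) \<kappa> p) = annulus_sum \<tau>0 \<kappa> w v"
   unfolding u(1) by (rule annulus_sum_fixed) (use assms(1,6) u in auto)
  thus ?thesis using u by simp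
 qed
 have 3: "(\<Sum>s=1..<length u. annulus_insert_sum \<tau> \<kappa> (take s u) v (u ! s) * disc_sum \<tau> \<kappa> (drop s u)
      + disc_sum (\<tau>x (u ! s)) \<kappa> (take (Suc s) u) * annulus_sum \<tau> \<kappa> (drop s u) v) = (\<Sum>x\<in>set u - {a}. ?C x)"
 proof -
  have "(\<Sum>s=1..<length u. annulus_insert_sum \<tau> \<kappa> (take s u) v (u ! s) * disc_sum \<tau> \<kappa> (drop s u)
      + disc_sum (\<tau>x (u ! s)) \<kappa> (take (Suc s) u) * annulus_sum \<tau> \<kappa> (drop s u) v) = (\<Sum>s=1..<length u. ?C (u ! s))"
  proof (rule sum_congI)
   fix s assume s: "s \<in> {1..<length u}"
   have td: "take s u @ drop s u = u" "take s u ~= []" "drop s u ~= []" "hd (drop s u) = u ! s" "hd (take s u) = a"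
    "take (Suc s) u = take s u @ [u ! s]"
    using s assms(2) by (auto simp: hd_drop_conv_nth a_def take_Suc_conv_app_nth)
   have dd: "distinct (take s u @ drop s u @ v)" using assms(1) unfolding append_assoc[symmetric] td(1) .
   have "u ! s \<in> set (tl u)" using s assms(2) by (cases u) (auto simp: nth_Cons')
   from annulus_sum_cut[OF dd td(2,3) assms(3), unfolded td(1,4,5), OF assms(7)[OF this] assms(5)]
   show "annulus_insert_sum \<tau> \<kappa> (take s u) v (u ! s) * disc_sum \<tau> \<kappa> (drop s u)
      + disc_sum (\<tau>x (u ! s)) \<kappa> (take (Suc s) u) * annulus_sum \<tau> \<kappa> (drop s u) v = ?C (u ! s)"
    by (simp only: td(6))
  qed
  thus ?thesis using sum_nth_tl[of u ?C] assms(1,2) by (simp add: a_def)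
 qed
 have 4: "(\<Sum>x\<in>?S - {a}. ?C x) = (\<Sum>x\<in>set u - {a}. ?C x) + (\<Sum>x\<in>set v. ?C x)"
 proof -
  have "?S - {a} = (set u - {a}) Un set v" using a by auto
  thus ?thesis by (simp only:) (rule sum.union_disjoint; use assms(1) in auto)
 qed
 note E = orbit_expansion[where T = ?T and c = c, OF finite_annulus finite_UnI[OF finite_set finite_set] annulusD(2) a(1) assms(5)]
 show ?thesis
  unfolding a_def[symmetric] 3 by (simp only: E 2 4 annulus_sum_def[of \<tau> \<kappa> u] distrib_left diff_diff_eq add.assoc)
qed

section \<open>Marked sums as derivatives\<close>

text \<open>Marking one cycle and giving it another weight is differentiation of a product over cycles. With weights in
polynomials, the marked sum is the coefficient of the first power of the variable, so that the identities of the
previous section apply to marked sums without a second proof.\<close>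

definition dual :: "('a list => 'r::comm_ring_1) => ('a list => 'r) => 'a list => 'r poly" where
 "dual f g c = [:f c, g c:]"

definition mprod :: "'a set => ('a list => 'r::comm_ring_1) => ('a list => 'r) => ('a => 'a) => 'r" where
 "mprod S f g p = (\<Sum>X\<in>orbs S p. g (support p (SOME i. i \<in> X)) * cprod (S - X) f p)"

definition marked_sum :: "('a list => 'r::comm_ring_1) => ('a list => 'r) => ('a list => 'r) => 'a list => 'r" where
 "marked_sum \<tau> f g u = (\<Sum>p\<in>disc u. dwt \<tau> u p * mprod (set u) f g p)"

lemma coeff_mult_1: "coeff (p * q) (Suc 0) = coeff p 0 * coeff q (Suc 0) + coeff p (Suc 0) * coeff q 0"
 by (simp add: coeff_mult)

lemma coeff_prod_dual:
 assumes "finite A"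
 shows "coeff (\<Prod>X\<in>A. [:f X, g X:]) 0 = (\<Prod>X\<in>A. f X)"
  "coeff (\<Prod>X\<in>A. [:f X, g X:]) (Suc 0) = (\<Sum>X\<in>A. g X * (\<Prod>Y\<in>A - {X}. f Y :: 'r::comm_ring_1))"
 using assms
proof (induction A rule: finite_induct)
 case (insert x A)
 show 0: "coeff (\<Prod>X\<in>insert x A. [:f X, g X:]) 0 = (\<Prod>X\<in>insert x A. f X)"
  using insert by (simp add: coeff_mult)
 have "(\<Sum>X\<in>insert x A. g X * (\<Prod>Y\<in>insert x A - {X}. f Y)) = g x * (\<Prod>Y\<in>A. f Y) + (\<Sum>X\<in>A. g X * (\<Prod>Y\<in>insert x A - {X}. f Y))"
  using insert.hyps by (simp add: insert_Diff_if)
 also have "(\<Sum>X\<in>A. g X * (\<Prod>Y\<in>insert x A - {X}. f Y)) = (\<Sum>X\<in>A. f x * (g X * (\<Prod>Y\<in>A - {X}. f Y)))"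
 proof (rule sum_congI)
  fix X assume X: "X \<in> A"
  hence "insert x A - {X} = insert x (A - {X})" using insert.hyps by auto
  thus "g X * (\<Prod>Y\<in>insert x A - {X}. f Y) = f x * (g X * (\<Prod>Y\<in>A - {X}. f Y))"
   using insert.hyps by (simp add: mult_ac)
 qed
 finally show "coeff (\<Prod>X\<in>insert x A. [:f X, g X:]) (Suc 0) = (\<Sum>X\<in>insert x A. g X * (\<Prod>Y\<in>insert x A - {X}. f Y))"
  using insert by (simp add: coeff_mult_1 sum_distrib_left del: mult_pCons_left)
qed simp_all

lemma orbs_Diff:
 assumes "perm_on S p" "X \<in> orbs S p"
 shows "orbs (S - X) p = orbs S p - {X}"
proof -
 obtain x where x: "x \<in> S" "X = orbit p x" using assms(2) by (auto simp: orbs_def)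
 have *: "orbit p y = X \<longleftrightarrow> y \<in> X" for y using orbit_eq_iff[OF perm_onD(2)[OF assms(1)], of y x] x by simp
 show ?thesis unfolding orbs_def using * by auto
qed

lemma coeff_cprod_dual:
 assumes "perm_on S p"
 shows "coeff (cprod S (dual f g) p) 0 = cprod S f p" "coeff (cprod S (dual f g) p) (Suc 0) = mprod S f g p"
proof -
 note c = coeff_prod_dual[OF finite_orbs[OF perm_onD(1)[OF assms], of p],
   of "%X. f (support p (SOME i. i \<in> X))" "%X. g (support p (SOME i. i \<in> X))"]
 show "coeff (cprod S (dual f g) p) 0 = cprod S f p" using c(1) by (simp only: cprod_def dual_def)
 show "coeff (cprod S (dual f g) p) (Suc 0) = mprod S f g p"
  unfolding cprod_def dual_def mprod_def c(2) by (rule sum_congI) (simp only: orbs_Diff[OF assms])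
qed

lemma prod_const_poly: "(\<Prod>X\<in>A. [:f X:]) = [:\<Prod>X\<in>A. f X :: 'r::comm_ring_1:]"
 by (induction A rule: infinite_finite_induct) (simp_all add: one_pCons mult.commute)

lemma cprod_const_poly: "cprod S (%c. [:f c:]) p = [:cprod S f p:]"
 unfolding cprod_def by (rule prod_const_poly)

lemma coeff_disc_sum_dual:
 shows "coeff (disc_sum (%c. [:\<tau> c:]) (dual f g) u) 0 = disc_sum \<tau> f u"
  "coeff (disc_sum (%c. [:\<tau> c:]) (dual f g) u) (Suc 0) = marked_sum \<tau> f g u"
proof -
 show "coeff (disc_sum (%c. [:\<tau> c:]) (dual f g) u) 0 = disc_sum \<tau> f u"
  unfolding disc_sum_def coeff_sum cprod_const_poly
  by (rule sum_congI) (simp add: coeff_cprod_dual(1)[OF discD(2)])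
 show "coeff (disc_sum (%c. [:\<tau> c:]) (dual f g) u) (Suc 0) = marked_sum \<tau> f g u"
  unfolding disc_sum_def marked_sum_def coeff_sum cprod_const_poly
  by (rule sum_congI) (simp add: coeff_cprod_dual(2)[OF discD(2)])
qed

text \<open>\<open>J1\<close> and \<open>defect1\<close> are the derivatives of \<open>J\<close> and \<open>defect\<close> in the direction g.\<close>

definition J1 :: "('a list => 'r::comm_ring_1) => ('a list => 'r) => 'a list => 'a => 'r" where
 "J1 f g V e = g (V @ [e]) + (\<Sum>t = 1..length V. f (take t V) * g (drop t V @ [e]) + g (take t V) * f (drop t V @ [e]))"

definition defect1 :: "('a list => 'r::comm_ring_1) => ('a list => 'r) => 'r => 'a list => 'r" where
 "defect1 f g c V = g V
   - c * (\<Sum>i = 1..<length V. J f (take i V) (V ! i) * g (drop i V) + J1 f g (take i V) (V ! i) * f (drop i V))"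

lemma coeff_J_dual:
 "coeff (J (dual f g) V e) 0 = J f V e" "coeff (J (dual f g) V e) (Suc 0) = J1 f g V e"
 unfolding J_def J1_def by (simp_all add: coeff_sum coeff_mult coeff_mult_1 dual_def del: mult_pCons_left mult_pCons_right)

lemma coeff_defect_dual:
 "coeff (defect (dual f g) [:c:] V) 0 = defect f c V" "coeff (defect (dual f g) [:c:] V) (Suc 0) = defect1 f g c V"
 unfolding defect_def defect1_def
 by (auto simp: coeff_sum coeff_mult coeff_mult_1 coeff_J_dual dual_def simp del: mult_pCons_left mult_pCons_right)

lemma rot_inv_dual: "rot_inv f ==> rot_inv g ==> rot_inv (dual f g)"
 by (simp add: rot_inv_def dual_def)

lemma rot_inv_const: "rot_inv \<tau> ==> rot_inv (%c. [:\<tau> c:])" by (simp add: rot_inv_def)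

lemma merges_const: "merges a l f g ==> merges a l (%c. [:f c:]) (%c. [:g c:])"
 by (simp add: merges_def rot_inv_def)

lemma ignores_const: "ignores e f g ==> ignores e (%c. [:f c:]) (%c. [:g c:])"
 by (simp add: ignores_def rot_inv_def one_pCons)

theorem disc_expansion_marked:
 fixes \<tau> \<tau>0 \<kappa> \<gamma> :: "'a list => 'r::comm_ring_1"
 assumes "distinct u" "u ~= []" "rot_inv \<tau>" "rot_inv \<kappa>" "tl u ~= [] ==> merges (hd u) (last u) \<tau> \<tau>0"
  "!!x. x \<in> set (tl u) ==> ignores x (\<tau>x x) \<tau>" "rot_inv \<gamma>"
  "!!p. p \<in> disc u ==> defect \<kappa> c (support p (hd u)) = 0"
 shows "marked_sum \<tau> \<kappa> \<gamma> u - c * marked_sum \<tau>0 \<kappa> \<gamma> (tl u)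
   - c * (\<Sum>s=1..<length u. disc_sum (\<tau>x (u ! s)) \<kappa> (take (Suc s) u) * marked_sum \<tau> \<kappa> \<gamma> (drop s u)
     + marked_sum (\<tau>x (u ! s)) \<kappa> \<gamma> (take (Suc s) u) * disc_sum \<tau> \<kappa> (drop s u))
  = (\<Sum>p\<in>disc u. dwt \<tau> u p * (cprod (set u - orbit p (hd u)) \<kappa> p * defect1 \<kappa> \<gamma> c (support p (hd u))))"
proof -
 let ?K = "dual \<kappa> \<gamma>"
 have e: "disc_sum (%c. [:\<tau> c:]) ?K u - [:c:] * (if tl u = [] then [:\<tau> u:] else disc_sum (%c. [:\<tau>0 c:]) ?K (tl u))
   - [:c:] * (\<Sum>s=1..<length u. disc_sum (%c. [:\<tau>x (u ! s) c:]) ?K (take (Suc s) u) * disc_sum (%c. [:\<tau> c:]) ?K (drop s u))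
  = (\<Sum>p\<in>disc u. dwt (%c. [:\<tau> c:]) u p * (cprod (set u - orbit p (hd u)) ?K p * defect ?K [:c:] (support p (hd u))))"
  by (rule disc_expansion[OF assms(1,2) rot_inv_const[OF assms(3)] rot_inv_dual[OF assms(4,7)] merges_const[OF assms(5)]
     ignores_const[OF assms(6)]])
 have "coeff (disc_sum (%c. [:\<tau> c:]) ?K u - [:c:] * (if tl u = [] then [:\<tau> u:] else disc_sum (%c. [:\<tau>0 c:]) ?K (tl u))
   - [:c:] * (\<Sum>s=1..<length u. disc_sum (%c. [:\<tau>x (u ! s) c:]) ?K (take (Suc s) u) * disc_sum (%c. [:\<tau> c:]) ?K (drop s u))) (Suc 0)
  = marked_sum \<tau> \<kappa> \<gamma> u - c * (if tl u = [] then 0 else marked_sum \<tau>0 \<kappa> \<gamma> (tl u))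
   - c * (\<Sum>s=1..<length u. disc_sum (\<tau>x (u ! s)) \<kappa> (take (Suc s) u) * marked_sum \<tau> \<kappa> \<gamma> (drop s u)
     + marked_sum (\<tau>x (u ! s)) \<kappa> \<gamma> (take (Suc s) u) * disc_sum \<tau> \<kappa> (drop s u))"
  by (simp add: coeff_sum coeff_mult_1 coeff_disc_sum_dual del: mult_pCons_left mult_pCons_right)
 moreover have "(if tl u = [] then 0 else marked_sum \<tau>0 \<kappa> \<gamma> (tl u)) = marked_sum \<tau>0 \<kappa> \<gamma> (tl u)"
  by (simp add: marked_sum_def)
 moreover have "coeff (\<Sum>p\<in>disc u. dwt (%c. [:\<tau> c:]) u p * (cprod (set u - orbit p (hd u)) ?K p * defect ?K [:c:] (support p (hd u)))) (Suc 0)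
  = (\<Sum>p\<in>disc u. dwt \<tau> u p * (cprod (set u - orbit p (hd u)) \<kappa> p * defect1 \<kappa> \<gamma> c (support p (hd u))))"
  unfolding coeff_sum
 proof (rule sum_congI)
  fix p assume p: "p \<in> disc u"
  have z: "coeff (defect ?K [:c:] (support p (hd u))) 0 = 0" unfolding coeff_defect_dual by (rule assms(8)[OF p])
  show "coeff (dwt (%c. [:\<tau> c:]) u p * (cprod (set u - orbit p (hd u)) ?K p * defect ?K [:c:] (support p (hd u)))) (Suc 0)
   = dwt \<tau> u p * (cprod (set u - orbit p (hd u)) \<kappa> p * defect1 \<kappa> \<gamma> c (support p (hd u)))"
   unfolding coeff_mult_1 cprod_const_poly z coeff_defect_dual(2) coeff_cprod_dual(1)[OF perm_on_rest[OF discD(2)[OF p]]]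
   by simp
 qed
 ultimately show ?thesis using arg_cong[OF e, of "%p. coeff p (Suc 0)"] by (simp only:)
qed

section \<open>The two-circle expansion\<close>

definition block :: "'a list => 'a set => 'a list" where
 "block u X = filter (%j. j \<in> X) u"

text \<open>The permutation form of the right-hand side of the theorem. The marked cycles are listed in the order of their
words, because \<open>\<kappa>\<kappa>\<close> is not assumed to be invariant under rotation.\<close>

definition circ_sum where
 "circ_sum \<tau> \<kappa> \<kappa>\<kappa> u v = annulus_sum \<tau> \<kappa> u v +
   (\<Sum>q\<in>disc v. dwt \<tau> v q * (\<Sum>Y\<in>orbs (set v) q. cprod (set v - Y) \<kappa> q *
    marked_sum \<tau> \<kappa> (%c. \<kappa>\<kappa> (block u (set c)) (block v Y)) u))"

lemma block_sub:
 assumes "distinct (x @ y @ z)" "X <= set y" shows "block (x @ y @ z) X = block y X"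
proof -
 have "filter (%j. j \<in> X) x = []" "filter (%j. j \<in> X) z = []" using assms by (auto simp: filter_empty_conv)
 thus ?thesis by (simp add: block_def)
qed

lemma block_take: "distinct u ==> X <= set (take s u) ==> block (take s u) X = block u X"
 using block_sub[of "[]" "take s u" "drop s u" X] by simp

lemma block_drop: "distinct u ==> X <= set (drop s u) ==> block (drop s u) X = block u X"
 using block_sub[of "take s u" "drop s u" "[]" X] by simp

lemma mprod_cong:
 assumes "perm_on S p" "!!c. cycle_list p c ==> set c <= S ==> g c = h c"
 shows "mprod S f g p = mprod S f h p"
 unfolding mprod_def
proof (rule sum_congI)
 fix X assume X: "X \<in> orbs S p"
 note o = orbs_choice_support[OF assms(1) X]
 have "g (support p (SOME i. i \<in> X)) = h (support p (SOME i. i \<in> X))"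
  by (rule assms(2)[OF o(1)]) (use o(2,3) in blast)
 thus "g (support p (SOME i. i \<in> X)) * cprod (S - X) f p = h (support p (SOME i. i \<in> X)) * cprod (S - X) f p" by simp
qed

lemma marked_sum_cong:
 assumes "!!c. set c <= set u ==> g c = h c"
 shows "marked_sum \<tau> f g u = marked_sum \<tau> f h u"
 unfolding marked_sum_def
proof (rule sum_congI)
 fix p assume p: "p \<in> disc u"
 show "dwt \<tau> u p * mprod (set u) f g p = dwt \<tau> u p * mprod (set u) f h p"
  using mprod_cong[OF discD(2)[OF p], of g h f] assms by simp
qed

lemma sum_over_orbs:
 assumes "perm_on S q"
 shows "(\<Sum>w\<in>S. f (orbit q w) w) = (\<Sum>Y\<in>orbs S q. \<Sum>w\<in>Y. f Y w)"
proof -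
 have "(\<Sum>w\<in>S. f (orbit q w) w) = (\<Sum>Y\<in>orbs S q. \<Sum>w\<in>{w \<in> S. orbit q w = Y}. f (orbit q w) w)"
  unfolding orbs_def by (rule sum.image_gen[OF perm_onD(1)[OF assms]])
 also have "... = (\<Sum>Y\<in>orbs S q. \<Sum>w\<in>Y. f Y w)"
 proof (rule sum_congI)
  fix Y assume "Y \<in> orbs S q"
  then obtain y where y: "y \<in> S" "Y = orbit q y" by (auto simp: orbs_def)
  have "{w \<in> S. orbit q w = Y} = Y"
   using y orbit_eq_iff[OF perm_onD(2)[OF assms], of _ y] orbit_sub[OF assms y(1)] by auto
  thus "(\<Sum>w\<in>{w \<in> S. orbit q w = Y}. f (orbit q w) w) = (\<Sum>w\<in>Y. f Y w)"
   by (intro sum.cong) auto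
 qed
 finally show ?thesis .
qed

lemma sum_nth_set:
 assumes "distinct v" shows "(\<Sum>i<length v. f (v ! i)) = (\<Sum>x\<in>set v. f x)"
 using sum.reindex_bij_betw[OF bij_betw_nth[OF assms refl refl], of f] by simp

lemma marked_sum_single:
 assumes "rot_inv \<tau>" "\<tau> [a] = 1" shows "marked_sum \<tau> \<kappa> g [a] = g [a]"
proof -
 have c: "cycle_list id [a]" "permutation (id :: 'a => 'a)" by (auto simp: cycle_list_def)
 have 1: "cprod {a} \<tau> id = 1" using cprod_cycle_list[OF c(2) assms(1) c(1)] assms(2) by simp
 have o: "orbs {a} id = {{a}}" by (simp add: orbs_def orbit_eq_singleton_iff[THEN iffD2])
 have s: "support id a = [a]" using support_eqI[OF c(2,1)] by simp
 have sing: "(\<Sum>X\<in>{b}. h X) = h b" for h :: "'a set => 'b" and b by simp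
 have "(SOME i. i \<in> {a}) = a" by simp
 hence "mprod {a} \<kappa> g id = g [a]" unfolding mprod_def o sing s by (simp only: s) simp
 thus ?thesis using 1 by (simp add: marked_sum_def)
qed

lemma support_take_sum:
 assumes "distinct V" "V ~= []"
 shows "(\<Sum>x\<in>set V - {hd V}. F x (takeWhile (%y. y ~= x) V) * \<kappa> (dropWhile (%y. y ~= x) V))
  = (\<Sum>i=1..<length V. F (V ! i) (take i V) * \<kappa> (drop i V))"
proof -
 have "(\<Sum>x\<in>set V - {hd V}. F x (takeWhile (%y. y ~= x) V) * \<kappa> (dropWhile (%y. y ~= x) V))
  = (\<Sum>i=1..<length V. F (V ! i) (takeWhile (%y. y ~= V ! i) V) * \<kappa> (dropWhile (%y. y ~= V ! i) V))"
  using sum_nth_tl[OF assms, of "%x. F x (takeWhile (%y. y ~= x) V) * \<kappa> (dropWhile (%y. y ~= x) V)"] by simp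
 also have "... = (\<Sum>i=1..<length V. F (V ! i) (take i V) * \<kappa> (drop i V))"
 proof (rule sum_congI)
  fix i assume i: "i \<in> {1..<length V}"
  have "V ! i ~: set (take i V)"
   using assms(1) i by (auto simp: in_set_conv_nth nth_eq_iff_index_eq)
  from takeWhile_neq_append[OF this, of "drop i V"] i
  show "F (V ! i) (takeWhile (%y. y ~= V ! i) V) * \<kappa> (dropWhile (%y. y ~= V ! i) V) = F (V ! i) (take i V) * \<kappa> (drop i V)"
   by (simp add: hd_drop_conv_nth)
 qed
 finally show ?thesis .
qed

text \<open>The amount by which the recursion fails at the pair of cycles V and Y. The derivative of the first-order defect
comes from marked pairs, the first product from a marked cycle that consists of the first letter alone, and the sums
over w from cycles that join the two circles.\<close>

definition defect2 where
 "defect2 \<kappa> g c V q Y = defect1 \<kappa> g c V - c * (g [hd V] * \<kappa> V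
   + (\<Sum>i<length V. (\<Sum>w\<in>Y. \<kappa> (take i V @ V ! i # support q w)) * \<kappa> (drop i V))
   + (\<Sum>w\<in>Y. J \<kappa> (V @ support q w) w))"

text \<open>The sum over cuts at letters of the other circle in \<open>annulus_expansion\<close> is exactly what \<open>slit_sum\<close> produces
from the joined words, so it cancels. All remaining annular terms are indexed by pairs of disc permutations, like
the marked terms, and together with these they form \<open>defect2\<close>.\<close>

theorem two_circle_expansion:
 fixes \<tau> \<tau>0 \<kappa> :: "'a list => 'r::comm_ring_1" and \<kappa>\<kappa> :: "'a list => 'a list => 'r" and \<epsilon> :: "nat => 'a"
 assumes d: "distinct (u @ v)" and u: "u ~= []" and v: "v ~= []" and \<tau>: "rot_inv \<tau>" and \<kappa>: "rot_inv \<kappa>"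
  and m: "tl u ~= [] ==> merges (hd u) (last u) \<tau> \<tau>0"
  and ig: "!!x. x \<in> set u ==> ignores x (\<tau>x x) \<tau>"
  and ige: "!!i. i < length v ==> ignores (\<epsilon> i) (\<tau>e i) \<tau>"
  and e: "!!i. i < length v ==> \<epsilon> i ~: set u Un set v"
  and \<kappa>e: "!!i c. i < length v ==> \<kappa> (c @ [\<epsilon> i]) = \<kappa> (c @ [v ! i])"
  and def0: "!!V. V ~= [] ==> distinct V ==> set V <= set u Un set v ==> hd V = hd u ==> defect \<kappa> c V = 0"
 shows "circ_sum \<tau> \<kappa> \<kappa>\<kappa> u v - c * (circ_sum \<tau>0 \<kappa> \<kappa>\<kappa> (tl u) v
   + (\<Sum>s<length u. circ_sum (\<tau>x (u ! s)) \<kappa> \<kappa>\<kappa> (take (Suc s) u) v * disc_sum \<tau> \<kappa> (drop s u))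
   + (\<Sum>s=1..<length u. disc_sum (\<tau>x (u ! s)) \<kappa> (take (Suc s) u) * circ_sum \<tau> \<kappa> \<kappa>\<kappa> (drop s u) v)
   + (\<Sum>i<length v. disc_sum (\<tau>e i) \<kappa> (u @ rotate i v @ [\<epsilon> i])))
  = (\<Sum>p\<in>disc u. \<Sum>q\<in>disc v. dwt \<tau> u p * dwt \<tau> v q *
    (cprod (set u - orbit p (hd u)) \<kappa> p * (\<Sum>Y\<in>orbs (set v) q. cprod (set v - Y) \<kappa> q *
      defect2 \<kappa> (%c. \<kappa>\<kappa> (block u (set c)) (block v Y)) c (support p (hd u)) q Y)))"
proof -
 define a where "a = hd u"
 have a: "a \<in> set u" using u by (simp add: a_def)
 have dis: "set u Int set v = {}" and du: "distinct u" and dv: "distinct v" using d by auto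
 define P where "P = (%p. dwt \<tau> u p)"
 define Q where "Q = (%q. dwt \<tau> v q)"
 define C where "C = (%p. cprod (set u - orbit p a) \<kappa> p)"
 define R where "R = (%q Y. cprod (set v - Y) \<kappa> q)"
 let ?S = "%f. \<Sum>q\<in>disc v. Q q * (\<Sum>Y\<in>orbs (set v) q. R q Y * f q Y)"
 define g where "g = (%Y c. \<kappa>\<kappa> (block u (set c)) (block v Y))"
 define V where "V = (%p. support p a)"
 define D where "D = disc_sum \<tau> \<kappa>"
 have g: "rot_inv (g Y)" for Y by (simp add: rot_inv_def g_def)
 have V: "set (V p) = orbit p a" "distinct (V p)" "V p ~= []" "hd (V p) = a" if "p \<in> disc u" for p
  unfolding V_def by (rule support_facts[OF discD(4)[OF that]])+
 have td: "take s u @ drop s u = u" "take s u ~= []" "drop s u ~= []" "hd (drop s u) = u ! s" "hd (take s u) = a"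
  "take (Suc s) u = take s u @ [u ! s]" if "s \<in> {1..<length u}" for s
  using that u by (auto simp: hd_drop_conv_nth a_def take_Suc_conv_app_nth)

 define I where "I = (%s. annulus_insert_sum \<tau> \<kappa> (take s u) v (u ! s))"
 define L where "L = (%x. \<Sum>p\<in>{p \<in> annulus u v. x \<in> orbit p a}. awt \<tau> u v p *
      (cprod (set u Un set v - orbit p a) \<kappa> p * cut_term \<kappa> (support p a) x))"
 define \<Phi> where "\<Phi> = (%x V'. ?S (%q Y. (\<Sum>w\<in>Y. \<kappa> (V' @ x # support q w))))"
 have orb: "(\<Sum>w\<in>set v. cprod (set v - orbit q w) \<kappa> q * h w) = (\<Sum>Y\<in>orbs (set v) q. R q Y * (\<Sum>w\<in>Y. h w))"
  if "q \<in> disc v" for q h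
  unfolding R_def sum_distrib_left
  by (rule sum_over_orbs[OF discD(2)[OF that], of "%Y w. cprod (set v - Y) \<kappa> q * h w"])
 have A: "annulus_sum \<tau> \<kappa> u v - c * annulus_sum \<tau>0 \<kappa> (tl u) v
   - c * (\<Sum>s=1..<length u. I s * D (drop s u) + disc_sum (\<tau>x (u ! s)) \<kappa> (take (Suc s) u) * annulus_sum \<tau> \<kappa> (drop s u) v)
   - c * (\<Sum>x\<in>set v. L x) = 0"
 proof -
  have "(\<Sum>p\<in>annulus u v. awt \<tau> u v p *
    (cprod (set u Un set v - orbit p (hd u)) \<kappa> p * defect \<kappa> c (support p (hd u)))) = 0"
  proof (intro sum.neutral ballI)
   fix p assume p: "p \<in> annulus u v"
   note sf = support_facts[OF annulusD(4)[OF p], of "hd u"]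
   have "defect \<kappa> c (support p (hd u)) = 0"
    by (rule def0[OF sf(3,2) _ sf(4)])
     (use sf(1) orbit_sub[OF annulusD(2)[OF p], of "hd u"] u in auto)
   thus "awt \<tau> u v p *
    (cprod (set u Un set v - orbit p (hd u)) \<kappa> p * defect \<kappa> c (support p (hd u))) = 0" by simp
  qed
  note zero = this
  have ig': "!!x. x \<in> set (tl u) ==> ignores x (\<tau>x x) \<tau>" using ig u by (meson list.set_sel(2))
  have "annulus_sum \<tau> \<kappa> u v - c * annulus_sum \<tau>0 \<kappa> (tl u) v
   - c * (\<Sum>s=1..<length u. I s * D (drop s u) + disc_sum (\<tau>x (u ! s)) \<kappa> (take (Suc s) u) * annulus_sum \<tau> \<kappa> (drop s u) v)
   - c * (\<Sum>x\<in>set v. L x) = (\<Sum>p\<in>annulus u v. awt \<tau> u v p *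
    (cprod (set u Un set v - orbit p (hd u)) \<kappa> p * defect \<kappa> c (support p (hd u))))"
   unfolding I_def D_def L_def a_def
   by (rule annulus_expansion[OF d u v \<tau> \<kappa>]) (use m ig' in blast)+
  thus ?thesis using zero by (rule trans)
 qed
 have B: "annulus_sum (\<tau>x (u ! s)) \<kappa> (take (Suc s) u) v = I s + join_sum \<tau> \<kappa> (take s u) v (u ! s)"
  if s: "s \<in> {1..<length u}" for s
 proof -
  have "distinct (take s u @ u ! s # v)"
  proof -
   have "distinct (take (Suc s) u @ v)" using d by (auto dest: in_set_takeD)
   thus ?thesis unfolding td(6)[OF s] by simp
  qed
  thus ?thesis unfolding td(6)[OF s] I_def
   by (rule annulus_sum_insert[OF _ td(2)[OF s] v ig \<kappa>]) (use s in simp)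
 qed
 have J\<Phi>: "join_sum \<tau> \<kappa> u' v x = (\<Sum>p\<in>disc u'. dwt \<tau> u' p *
   (cprod (set u' - orbit p (hd u')) \<kappa> p * \<Phi> x (support p (hd u'))))" for u' x
 proof -
  have "join_sum \<tau> \<kappa> u' v x = (\<Sum>p\<in>disc u'. \<Sum>q\<in>disc v. dwt \<tau> u' p * Q q *
    (cprod (set u' - orbit p (hd u')) \<kappa> p * (\<Sum>Y\<in>orbs (set v) q. R q Y * (\<Sum>w\<in>Y. \<kappa> (support p (hd u') @ x # support q w)))))"
   unfolding join_sum_def Q_def by (intro sum.cong refl) (simp only: orb)
  thus ?thesis unfolding \<Phi>_def sum_distrib_left by (simp only: mult_ac)
 qed
 have S0: "annulus_sum (\<tau>x a) \<kappa> [a] v = \<Phi> a []"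
 proof -
  have "distinct (a # v)" using dis a dv by auto
  from annulus_sum_single[OF this v ig[OF a] \<kappa>]
  have "annulus_sum (\<tau>x a) \<kappa> [a] v = (\<Sum>q\<in>disc v. Q q * (\<Sum>w\<in>set v. cprod (set v - orbit q w) \<kappa> q * \<kappa> (a # support q w)))"
   by (simp only: Q_def)
  also have "... = \<Phi> a []" unfolding \<Phi>_def by (intro sum.cong refl) (simp only: orb append_Nil)
  finally show ?thesis .
 qed
 have JD: "(\<Sum>s=1..<length u. join_sum \<tau> \<kappa> (take s u) v (u ! s) * D (drop s u))
  = (\<Sum>p\<in>disc u. P p * (C p * (\<Sum>i=1..<length (V p). \<Phi> (V p ! i) (take i (V p)) * \<kappa> (drop i (V p)))))"
 proof -
  define W where "W = (%p x. \<Phi> x (takeWhile (%y. y ~= x) (V p)) * \<kappa> (dropWhile (%y. y ~= x) (V p)))"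
  have "(\<Sum>s=1..<length u. join_sum \<tau> \<kappa> (take s u) v (u ! s) * D (drop s u))
   = (\<Sum>s=1..<length u. \<Sum>p\<in>{p \<in> disc u. u ! s \<in> orbit p a}. P p * (C p * W p (u ! s)))"
  proof (rule sum_congI)
   fix s assume s: "s \<in> {1..<length u}"
   from disc_cut_weighted[of "take s u" "drop s u", unfolded td(1,4,5)[OF s], OF du td(2,3)[OF s] \<kappa>, of \<tau> "\<Phi> (u ! s)"]
   show "join_sum \<tau> \<kappa> (take s u) v (u ! s) * D (drop s u) = (\<Sum>p\<in>{p \<in> disc u. u ! s \<in> orbit p a}. P p * (C p * W p (u ! s)))"
    unfolding J\<Phi> td(5)[OF s] by (simp only: D_def P_def C_def W_def V_def)
  qed
  also have "... = (\<Sum>x\<in>set u - {a}. \<Sum>p\<in>{p \<in> disc u. x \<in> orbit p a}. P p * (C p * W p x))"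
   using sum_nth_tl[OF du u, of "%x. \<Sum>p\<in>{p \<in> disc u. x \<in> orbit p a}. P p * (C p * W p x)"] by (simp add: a_def)
  also have "... = (\<Sum>p\<in>disc u. \<Sum>x\<in>(set u - {a}) Int orbit p a. P p * (C p * W p x))"
   by (rule sum_swap_filter) (simp_all add: finite_disc)
  also have "... = (\<Sum>p\<in>disc u. P p * (C p * (\<Sum>i=1..<length (V p). \<Phi> (V p ! i) (take i (V p)) * \<kappa> (drop i (V p)))))"
  proof (rule sum_congI)
   fix p assume p: "p \<in> disc u"
   have "orbit p a <= set u" by (rule orbit_sub[OF discD(2)[OF p] a])
   hence "(set u - {a}) Int orbit p a = set (V p) - {hd (V p)}" unfolding V[OF p] by auto
   thus "(\<Sum>x\<in>(set u - {a}) Int orbit p a. P p * (C p * W p x))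
    = P p * (C p * (\<Sum>i=1..<length (V p). \<Phi> (V p ! i) (take i (V p)) * \<kappa> (drop i (V p))))"
    unfolding support_take_sum[OF V(2,3)[OF p], symmetric] sum_distrib_left by (simp only: W_def)
  qed
  finally show ?thesis .
 qed
 have Du: "D u = (\<Sum>p\<in>disc u. P p * (C p * \<kappa> (V p)))"
  unfolding D_def disc_sum_def
 proof (rule sum_congI)
  fix p assume "p \<in> disc u"
  from cprod_orbit[OF discD(2)[OF this] \<kappa> a]
  show "dwt \<tau> u p * cprod (set u) \<kappa> p = P p * (C p * \<kappa> (V p))"
   by (simp only: P_def C_def V_def mult_ac)
 qed
 define \<Psi> where "\<Psi> = (%V'. ?S (%q Y. (\<Sum>w\<in>Y. J \<kappa> (V' @ support q w) w)))"
 have SL: "(\<Sum>i<length v. disc_sum (\<tau>e i) \<kappa> (u @ rotate i v @ [\<epsilon> i])) = (\<Sum>x\<in>set v. L x) + (\<Sum>p\<in>disc u. P p * (C p * \<Psi> (V p)))"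
 proof -
  define N where "N = (%x. \<Sum>p\<in>disc u. \<Sum>q\<in>disc v. P p * Q q * (C p * (cprod (set v - orbit q x) \<kappa> q * J \<kappa> (V p @ support q x) x)))"
  have "disc_sum (\<tau>e i) \<kappa> (u @ rotate i v @ [\<epsilon> i]) = L (v ! i) + N (v ! i)" if i: "i < length v" for i
  proof -
   have h: "hd (rotate i v) = v ! i" using i v by (simp add: hd_rotate_conv_nth)
   have dd: "distinct (u @ rotate i v @ [\<epsilon> i])" using d e[OF i] by auto
   have ne: "rotate i v ~= []" using v by simp
   from slit_sum[OF dd u ne ige[OF i] \<kappa>, unfolded h, OF \<kappa>e[OF i]]
   show ?thesis
    unfolding annulus_rotate[OF dv] disc_rotate[OF dv] cl_rotate[OF dv] set_rotate
    by (simp only: L_def N_def P_def Q_def C_def V_def a_def)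
  qed
  hence "(\<Sum>i<length v. disc_sum (\<tau>e i) \<kappa> (u @ rotate i v @ [\<epsilon> i])) = (\<Sum>i<length v. L (v ! i) + N (v ! i))" by simp
  also have "... = (\<Sum>x\<in>set v. L x + N x)" by (rule sum_nth_set[OF dv])
  also have "... = (\<Sum>x\<in>set v. L x) + (\<Sum>x\<in>set v. N x)" by (rule sum.distrib)
  also have "(\<Sum>x\<in>set v. N x) = (\<Sum>p\<in>disc u. \<Sum>x\<in>set v. \<Sum>q\<in>disc v. P p * Q q * (C p * (cprod (set v - orbit q x) \<kappa> q * J \<kappa> (V p @ support q x) x)))"
   unfolding N_def by (rule sum.swap)
  also have "... = (\<Sum>p\<in>disc u. \<Sum>q\<in>disc v. \<Sum>x\<in>set v. P p * Q q * (C p * (cprod (set v - orbit q x) \<kappa> q * J \<kappa> (V p @ support q x) x)))"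
   by (intro sum.cong refl sum.swap)
  also have "... = (\<Sum>p\<in>disc u. \<Sum>q\<in>disc v. P p * Q q * (C p * (\<Sum>x\<in>set v. cprod (set v - orbit q x) \<kappa> q * J \<kappa> (V p @ support q x) x)))"
   by (simp only: sum_distrib_left)
  also have "... = (\<Sum>p\<in>disc u. \<Sum>q\<in>disc v. P p * Q q * (C p * (\<Sum>Y\<in>orbs (set v) q. R q Y * (\<Sum>w\<in>Y. J \<kappa> (V p @ support q w) w))))"
   by (intro sum.cong refl) (simp only: orb)
  also have "... = (\<Sum>p\<in>disc u. P p * (C p * \<Psi> (V p)))"
   unfolding \<Psi>_def sum_distrib_left by (simp only: mult_ac)
  finally show ?thesis .
 qed

 \<comment> \<open>\<open>E\<close> is the part of \<open>circ_sum\<close> with two marked cycles; the weight on the second circle does not see the changes on the first.\<close>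
 define M where "M = (%t Y u'. marked_sum t \<kappa> (g Y) u')"
 define E where "E = (%t u'. ?S (%q Y. M t Y u'))"
 have circ: "circ_sum t \<kappa> \<kappa>\<kappa> u' v = annulus_sum t \<kappa> u' v + E t u'"
  if t: "!!c. set c <= set v ==> t c = \<tau> c" and b: "!!X. X <= set u' ==> block u' X = block u X" for t u'
 proof -
  have "dwt t v q = Q q" if q: "q \<in> disc v" for q
  proof -
   have K: "perm_on (set v) (inv q o cl v)"
    by (intro perm_on_compose perm_on_inv discD(2)[OF q] cl_perm_on) auto
   show ?thesis unfolding Q_def by (rule cprod_cong_fun[OF K]) (rule t)
  qed
  moreover have "marked_sum t \<kappa> (%c. \<kappa>\<kappa> (block u' (set c)) (block v Y)) u' = M t Y u'" for Y
   unfolding M_def by (rule marked_sum_cong) (simp add: g_def b)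
  ultimately show ?thesis unfolding circ_sum_def E_def by (simp add: R_def)
 qed
 have c1: "circ_sum \<tau> \<kappa> \<kappa>\<kappa> u v = annulus_sum \<tau> \<kappa> u v + E \<tau> u" by (rule circ) auto
 have c2: "circ_sum \<tau>0 \<kappa> \<kappa>\<kappa> (tl u) v = annulus_sum \<tau>0 \<kappa> (tl u) v + E \<tau>0 (tl u)"
 proof (cases "tl u = []")
  case True
  thus ?thesis by (simp add: circ_sum_def E_def M_def marked_sum_def)
 next
  case False
  have l: "last u \<in> set u" using u by simp
  show ?thesis
  proof (rule circ)
   fix c :: "'a list" assume "set c <= set v"
   hence "a ~: set c" "last u ~: set c" using a l dis by auto
   thus "\<tau>0 c = \<tau> c" using m[OF False] by (simp add: merges_def a_def)
  next
   fix X assume "X <= set (tl u)"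
   thus "block (tl u) X = block u X" using block_drop[OF du, of X 1] by (simp add: drop_Suc)
  qed
 qed
 have c3: "circ_sum (\<tau>x (u ! s)) \<kappa> \<kappa>\<kappa> (take (Suc s) u) v = annulus_sum (\<tau>x (u ! s)) \<kappa> (take (Suc s) u) v + E (\<tau>x (u ! s)) (take (Suc s) u)"
  if s: "s < length u" for s
 proof (rule circ)
  fix c :: "'a list" assume "set c <= set v"
  hence "u ! s ~: set c" using s dis by (metis disjoint_iff nth_mem subsetD)
  thus "\<tau>x (u ! s) c = \<tau> c" using ig[of "u ! s"] s by (simp add: ignores_def)
 qed (rule block_take[OF du])
 have c4: "circ_sum \<tau> \<kappa> \<kappa>\<kappa> (drop s u) v = annulus_sum \<tau> \<kappa> (drop s u) v + E \<tau> (drop s u)" for s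
  by (rule circ) (auto intro: block_drop[OF du])
 have Ma: "M (\<tau>x a) Y [a] = g Y [a]" for Y
  unfolding M_def using ig[OF a] by (intro marked_sum_single) (simp_all add: ignores_def)
 have EM: "M \<tau> Y u - c * M \<tau>0 Y (tl u) - c * (\<Sum>s=1..<length u. disc_sum (\<tau>x (u ! s)) \<kappa> (take (Suc s) u) * M \<tau> Y (drop s u)
    + M (\<tau>x (u ! s)) Y (take (Suc s) u) * D (drop s u)) = (\<Sum>p\<in>disc u. P p * (C p * defect1 \<kappa> (g Y) c (V p)))" for Y
 proof -
  have z: "defect \<kappa> c (support p (hd u)) = 0" if p: "p \<in> disc u" for p
  proof -
   have "defect \<kappa> c (V p) = 0"
    by (rule def0[OF V(3,2)[OF p]])
     (use V(1,4)[OF p] orbit_sub[OF discD(2)[OF p] a] in "auto simp: a_def")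
   thus ?thesis by (simp only: V_def a_def)
  qed
  have ig': "!!x. x \<in> set (tl u) ==> ignores x (\<tau>x x) \<tau>" using ig u by (meson list.set_sel(2))
  show ?thesis unfolding M_def D_def P_def C_def V_def a_def
   by (rule disc_expansion_marked[OF du u \<tau> \<kappa> _ _ g]) (use m ig' z in blast)+
 qed
 have lin: "(?S (%q Y. (x * f q Y))) = x * (?S (%q Y. f q Y))" for x f
  unfolding sum_distrib_left by (simp only: mult_ac)
 have lin2: "(?S (%q Y. (\<Sum>s\<in>T. f s q Y))) = (\<Sum>s\<in>T. ?S (%q Y. f s q Y))" for T :: "'z set" and f
 proof -
  have "Q q * (\<Sum>Y\<in>orbs (set v) q. R q Y * (\<Sum>s\<in>T. f s q Y)) = (\<Sum>s\<in>T. Q q * (\<Sum>Y\<in>orbs (set v) q. R q Y * f s q Y))" for q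
  proof -
   have "(\<Sum>Y\<in>orbs (set v) q. R q Y * (\<Sum>s\<in>T. f s q Y)) = (\<Sum>Y\<in>orbs (set v) q. \<Sum>s\<in>T. R q Y * f s q Y)"
    by (intro sum.cong refl sum_distrib_left)
   also have "... = (\<Sum>s\<in>T. \<Sum>Y\<in>orbs (set v) q. R q Y * f s q Y)" by (rule sum.swap)
   finally show ?thesis by (simp only: sum_distrib_left[of "Q q" _ T])
  qed
  hence "(?S (%q Y. (\<Sum>s\<in>T. f s q Y))) = (\<Sum>q\<in>disc v. \<Sum>s\<in>T. Q q * (\<Sum>Y\<in>orbs (set v) q. R q Y * f s q Y))"
   by (simp only:)
  also have "... = (\<Sum>s\<in>T. ?S (%q Y. f s q Y))" by (rule sum.swap)
  finally show ?thesis .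
 qed
 have lin3: "(?S (%q Y. (f q Y + h q Y))) =
   (?S (%q Y. f q Y)) + (?S (%q Y. h q Y))" for f h
  by (simp only: distrib_left sum.distrib)
 have lin4: "(?S (%q Y. (f q Y - h q Y))) =
   (?S (%q Y. f q Y)) - (?S (%q Y. h q Y))" for f h
  by (simp only: right_diff_distrib sum_subtractf)
 have lin5: "(?S (%q Y. (f q Y * x))) = (?S (%q Y. f q Y)) * x" for x f
  using lin[of x f] by (simp only: mult.commute)
 have EE: "E \<tau> u - c * E \<tau>0 (tl u) - c * (\<Sum>s=1..<length u. disc_sum (\<tau>x (u ! s)) \<kappa> (take (Suc s) u) * E \<tau> (drop s u)
    + E (\<tau>x (u ! s)) (take (Suc s) u) * D (drop s u)) =
   (\<Sum>p\<in>disc u. P p * (C p * (?S (%q Y. defect1 \<kappa> (g Y) c (V p)))))"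
 proof -
  have "(?S (%q Y. (M \<tau> Y u - c * M \<tau>0 Y (tl u) - c * (\<Sum>s=1..<length u. disc_sum (\<tau>x (u ! s)) \<kappa> (take (Suc s) u) * M \<tau> Y (drop s u)
    + M (\<tau>x (u ! s)) Y (take (Suc s) u) * D (drop s u))))) =
   (?S (%q Y. (\<Sum>p\<in>disc u. P p * (C p * defect1 \<kappa> (g Y) c (V p)))))"
   by (simp only: EM)
  also have "... = (\<Sum>p\<in>disc u. P p * (C p * (?S (%q Y. defect1 \<kappa> (g Y) c (V p)))))"
   by (simp only: lin2 lin)
  finally show ?thesis unfolding lin4 lin lin2 lin3 lin5 E_def .
 qed
 have Ea: "E (\<tau>x a) [a] = (?S (%q Y. g Y [a]))"
  unfolding E_def Ma ..

 \<comment> \<open>The summand s = 0 is separated, as cuts happen at the letters after the first.\<close>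
 define n where "n = length u"
 have n: "0 < n" using u by (simp add: n_def)
 have s0: "(\<Sum>s<n. f s) = f 0 + (\<Sum>s=1..<n. f s)" for f :: "nat => 'r"
 proof -
  have "{..<n} = insert 0 {1..<n}" using n by auto
  thus ?thesis by simp
 qed
 have u0: "u ! 0 = a" "take (Suc 0) u = [a]" "drop 0 u = u" using u by (auto simp: a_def hd_conv_nth take_Suc)
 define Z where "Z = (%s. disc_sum (\<tau>x (u ! s)) \<kappa> (take (Suc s) u))"
 have T1: "(\<Sum>s<n. circ_sum (\<tau>x (u ! s)) \<kappa> \<kappa>\<kappa> (take (Suc s) u) v * D (drop s u))
  = (\<Phi> a [] + E (\<tau>x a) [a]) * D u + (\<Sum>s=1..<n. I s * D (drop s u)) + (\<Sum>s=1..<n. join_sum \<tau> \<kappa> (take s u) v (u ! s) * D (drop s u))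
    + (\<Sum>s=1..<n. E (\<tau>x (u ! s)) (take (Suc s) u) * D (drop s u))"
 proof -
  have "circ_sum (\<tau>x (u ! s)) \<kappa> \<kappa>\<kappa> (take (Suc s) u) v * D (drop s u) = I s * D (drop s u)
    + join_sum \<tau> \<kappa> (take s u) v (u ! s) * D (drop s u) + E (\<tau>x (u ! s)) (take (Suc s) u) * D (drop s u)" if "s \<in> {1..<n}" for s
   using that c3[of s] B[of s] by (simp add: n_def distrib_right)
  hence "(\<Sum>s=1..<n. circ_sum (\<tau>x (u ! s)) \<kappa> \<kappa>\<kappa> (take (Suc s) u) v * D (drop s u)) = (\<Sum>s=1..<n. I s * D (drop s u)
    + join_sum \<tau> \<kappa> (take s u) v (u ! s) * D (drop s u) + E (\<tau>x (u ! s)) (take (Suc s) u) * D (drop s u))"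
   by (rule sum_congI)
  moreover have "circ_sum (\<tau>x (u ! 0)) \<kappa> \<kappa>\<kappa> (take (Suc 0) u) v = \<Phi> a [] + E (\<tau>x a) [a]"
   using c3[of 0] n S0 unfolding u0 n_def by simp
  ultimately show ?thesis unfolding s0 sum.distrib u0 by (simp add: algebra_simps)
 qed
 have T2: "(\<Sum>s=1..<n. Z s * circ_sum \<tau> \<kappa> \<kappa>\<kappa> (drop s u) v) = (\<Sum>s=1..<n. Z s * annulus_sum \<tau> \<kappa> (drop s u) v) + (\<Sum>s=1..<n. Z s * E \<tau> (drop s u))"
  by (simp only: c4 distrib_left sum.distrib)
 have fin: "(\<Sum>p\<in>disc u. P p * (C p * (?S (%q Y. defect1 \<kappa> (g Y) c (V p)))))
   - c * (\<Phi> a [] * D u + E (\<tau>x a) [a] * D u + (\<Sum>s=1..<n. join_sum \<tau> \<kappa> (take s u) v (u ! s) * D (drop s u))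
    + (\<Sum>p\<in>disc u. P p * (C p * \<Psi> (V p))))
   = (\<Sum>p\<in>disc u. \<Sum>q\<in>disc v. P p * Q q * (C p * (\<Sum>Y\<in>orbs (set v) q. R q Y * defect2 \<kappa> (g Y) c (V p) q Y)))"
 proof -
  have "(\<Sum>q\<in>disc v. P p * Q q * (C p * (\<Sum>Y\<in>orbs (set v) q. R q Y * defect2 \<kappa> (g Y) c (V p) q Y)))
   = P p * (C p * (?S (%q Y. defect1 \<kappa> (g Y) c (V p))))
    - c * (\<Phi> a [] * (P p * (C p * \<kappa> (V p))) + E (\<tau>x a) [a] * (P p * (C p * \<kappa> (V p)))
     + P p * (C p * (\<Sum>i=1..<length (V p). \<Phi> (V p ! i) (take i (V p)) * \<kappa> (drop i (V p)))) + P p * (C p * \<Psi> (V p)))"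
   if p: "p \<in> disc u" for p
  proof -
   have l: "{..<length (V p)} = insert 0 {1..<length (V p)}" using V(3)[OF p] by auto
   have i0: "(\<Sum>i<length (V p). (\<Sum>w\<in>Y. \<kappa> (take i (V p) @ V p ! i # support q w)) * \<kappa> (drop i (V p)))
     = (\<Sum>w\<in>Y. \<kappa> (a # support q w)) * \<kappa> (V p) + (\<Sum>i=1..<length (V p). (\<Sum>w\<in>Y. \<kappa> (take i (V p) @ V p ! i # support q w)) * \<kappa> (drop i (V p)))" for q Y
    unfolding l using V(3,4)[OF p] by (simp add: hd_conv_nth[symmetric])
   have "(\<Sum>q\<in>disc v. P p * Q q * (C p * (\<Sum>Y\<in>orbs (set v) q. R q Y * defect2 \<kappa> (g Y) c (V p) q Y)))
    = P p * (C p * (?S (%q Y. defect2 \<kappa> (g Y) c (V p) q Y)))"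
    unfolding sum_distrib_left by (simp only: mult_ac)
   also have "(?S (%q Y. defect2 \<kappa> (g Y) c (V p) q Y)) =
    (?S (%q Y. defect1 \<kappa> (g Y) c (V p)))
     - c * (E (\<tau>x a) [a] * \<kappa> (V p) + (\<Phi> a [] * \<kappa> (V p) + (\<Sum>i=1..<length (V p). \<Phi> (V p ! i) (take i (V p)) * \<kappa> (drop i (V p)))) + \<Psi> (V p))"
   proof -
    have *: "(?S (%q Y. (\<Sum>i=1..<length (V p). (\<Sum>w\<in>Y. \<kappa> (take i (V p) @ V p ! i # support q w)) * \<kappa> (drop i (V p)))))
     = (\<Sum>i=1..<length (V p). \<Phi> (V p ! i) (take i (V p)) * \<kappa> (drop i (V p)))"
    proof -
     have "(?S (%q Y. (\<Sum>i=1..<length (V p). (\<Sum>w\<in>Y. \<kappa> (take i (V p) @ V p ! i # support q w)) * \<kappa> (drop i (V p)))))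
      = (\<Sum>i=1..<length (V p). ?S (%q Y. ((\<Sum>w\<in>Y. \<kappa> (take i (V p) @ V p ! i # support q w)) * \<kappa> (drop i (V p)))))"
      by (rule lin2)
     thus ?thesis by (simp only: lin5 \<Phi>_def)
    qed
    show ?thesis unfolding defect2_def V(4)[OF p] i0 lin4 lin lin3 lin5 * unfolding Ea \<Phi>_def \<Psi>_def by (simp only: append_Nil)
   qed
   finally show ?thesis by (simp add: algebra_simps)
  qed
  hence "(\<Sum>p\<in>disc u. \<Sum>q\<in>disc v. P p * Q q * (C p * (\<Sum>Y\<in>orbs (set v) q. R q Y * defect2 \<kappa> (g Y) c (V p) q Y)))
   = (\<Sum>p\<in>disc u. P p * (C p * (?S (%q Y. defect1 \<kappa> (g Y) c (V p))))
    - c * (\<Phi> a [] * (P p * (C p * \<kappa> (V p))) + E (\<tau>x a) [a] * (P p * (C p * \<kappa> (V p)))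
     + P p * (C p * (\<Sum>i=1..<length (V p). \<Phi> (V p ! i) (take i (V p)) * \<kappa> (drop i (V p)))) + P p * (C p * \<Psi> (V p))))"
   by (rule sum_congI)
  thus ?thesis
   by (simp only: sum_subtractf sum_distrib_left[symmetric] sum.distrib JD[folded n_def] Du)
 qed
 have "circ_sum \<tau> \<kappa> \<kappa>\<kappa> u v - c * (circ_sum \<tau>0 \<kappa> \<kappa>\<kappa> (tl u) v
   + (\<Sum>s<n. circ_sum (\<tau>x (u ! s)) \<kappa> \<kappa>\<kappa> (take (Suc s) u) v * D (drop s u))
   + (\<Sum>s=1..<n. Z s * circ_sum \<tau> \<kappa> \<kappa>\<kappa> (drop s u) v)
   + (\<Sum>i<length v. disc_sum (\<tau>e i) \<kappa> (u @ rotate i v @ [\<epsilon> i])))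
  = (annulus_sum \<tau> \<kappa> u v - c * annulus_sum \<tau>0 \<kappa> (tl u) v
   - c * (\<Sum>s=1..<n. I s * D (drop s u) + Z s * annulus_sum \<tau> \<kappa> (drop s u) v) - c * (\<Sum>x\<in>set v. L x))
   + (E \<tau> u - c * E \<tau>0 (tl u) - c * (\<Sum>s=1..<n. Z s * E \<tau> (drop s u) + E (\<tau>x (u ! s)) (take (Suc s) u) * D (drop s u)))
   - c * (\<Phi> a [] * D u + E (\<tau>x a) [a] * D u + (\<Sum>s=1..<n. join_sum \<tau> \<kappa> (take s u) v (u ! s) * D (drop s u))
    + (\<Sum>p\<in>disc u. P p * (C p * \<Psi> (V p))))"
  unfolding T1 T2 SL c1 c2 sum.distrib by (simp add: algebra_simps)
 also have "... = (\<Sum>p\<in>disc u. \<Sum>q\<in>disc v. P p * Q q * (C p * (\<Sum>Y\<in>orbs (set v) q. R q Y * defect2 \<kappa> (g Y) c (V p) q Y)))"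
 proof -
  have A': "annulus_sum \<tau> \<kappa> u v - c * annulus_sum \<tau>0 \<kappa> (tl u) v
   - c * (\<Sum>s=1..<n. I s * D (drop s u) + Z s * annulus_sum \<tau> \<kappa> (drop s u) v) - c * (\<Sum>x\<in>set v. L x) = 0"
   using A by (simp only: n_def Z_def)
  have EE': "E \<tau> u - c * E \<tau>0 (tl u) - c * (\<Sum>s=1..<n. Z s * E \<tau> (drop s u) + E (\<tau>x (u ! s)) (take (Suc s) u) * D (drop s u))
   = (\<Sum>p\<in>disc u. P p * (C p * (?S (%q Y. defect1 \<kappa> (g Y) c (V p)))))"
   using EE by (simp only: n_def Z_def)
  show ?thesis unfolding A' EE' fin[symmetric] by (simp only: add_0)
 qed
 finally show ?thesis by (simp only: n_def Z_def D_def P_def Q_def C_def R_def g_def V_def a_def)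
qed

section \<open>Non-crossing partitions as planar permutations\<close>

lemma sorted_split2:
 fixes a b :: "'a::linorder"
 assumes "sorted L" "distinct L" "a \<in> set L" "b \<in> set L" "a < b"
 obtains us ys zs where "L = us @ a # ys @ b # zs"
  "!!c. c \<in> set L ==> a < c ==> c < b ==> c \<in> set ys" "!!d. d \<in> set L ==> b < d ==> d \<in> set zs"
  "set ys = {c \<in> set L. a < c \<and> c < b}"
proof -
 obtain us t where L: "L = us @ a # t" using assms(3) by (metis split_list)
 have us: "!!y. y \<in> set us ==> y < a" "!!y. y \<in> set t ==> a < y"
  using assms(1,2) unfolding L by (fastforce simp: sorted_append)+
 have "b \<in> set t" using assms(4,5) us(1) unfolding L by force
 then obtain ys zs where t: "t = ys @ b # zs" by (metis split_list)
 have ys: "!!y. y \<in> set ys ==> y < b" "!!y. y \<in> set zs ==> b < y"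
  using assms(1,2) unfolding L t by (fastforce simp: sorted_append)+
 show ?thesis
 proof (rule that[of us ys zs])
  show "L = us @ a # ys @ b # zs" using L t by simp
  have tb: "!!y. y \<in> set ys ==> a < y" "!!y. y \<in> set zs ==> a < y" using us(2) t by auto
  have L': "c \<in> set L \<longleftrightarrow> c \<in> set us \<or> c = a \<or> c \<in> set ys \<or> c = b \<or> c \<in> set zs" for c
   unfolding L t by auto
  show 1: "c \<in> set ys" if "c \<in> set L" "a < c" "c < b" for c
   using that L'[of c] us(1)[of c] ys(2)[of c] by (auto dest: less_asym)
  show "d \<in> set zs" if "d \<in> set L" "b < d" for d
   using that L'[of d] us(1)[of d] ys(1)[of d] assms(5) by (auto dest: less_asym order.strict_trans)
  show "set ys = {c \<in> set L. a < c \<and> c < b}"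
   using 1 ys(1) tb(1) L' by blast
 qed
qed

lemma orbs_partition: "perm_on S p ==> partition_on S (orbs S p)"
 unfolding partition_on_def
proof (intro conjI)
 assume p: "perm_on S p"
 show "\<Union>(orbs S p) = S" using orbit_sub[OF p] in_own_orbit[OF p] by (auto simp: orbs_def)
 show "disjoint (orbs S p)"
 proof (rule disjointI)
  fix X Y assume X: "X \<in> orbs S p" and Y: "Y \<in> orbs S p" and "X ~= Y"
  obtain x y where x: "X = orbit p x" "Y = orbit p y" using X Y by (auto simp: orbs_def)
  have "X = Y" if "i \<in> X" "i \<in> Y" for i
   using that orbit_eq_iff[OF perm_onD(2)[OF p], of i] unfolding x by metis
  thus "X Int Y = {}" using \<open>X ~= Y\<close> by blast
 qed
 show "{} ~: orbs S p" using in_own_orbit[OF p] by (auto simp: orbs_def)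
qed

lemma disc_orbs_NCP:
 fixes L :: "nat list"
 assumes "sorted L" "distinct L" "p \<in> disc L"
 shows "orbs (set L) p \<in> NCP (set L)"
proof -
 note d = discD[OF assms(3)]
 have "False" if B: "B \<in> orbs (set L) p" "B' \<in> orbs (set L) p" "B ~= B'" "a \<in> B" "b \<in> B" "c \<in> B'" "e \<in> B'" "a < c" "c < b" "b < e"
  for B B' a b c e
 proof -
  have orb: "orbit p i = X" if "X \<in> orbs (set L) p" "i \<in> X" for X i
   using that orbit_eq_iff[OF d(4), of i] by (auto simp: orbs_def)
  have sub: "X <= set L" if "X \<in> orbs (set L) p" for X using that orbit_sub[OF d(2)] by (auto simp: orbs_def)
  have in': "a \<in> set L" "b \<in> set L" "c \<in> set L" "e \<in> set L" using B sub by blast+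
  obtain us ys zs where s: "L = us @ a # ys @ b # zs" "c \<in> set ys" "e \<in> set zs"
   using sorted_split2[OF assms(1,2) in'(1,2)] in' B(8-10) by (metis order.strict_trans)
  have "b \<in> orbit p a" "e \<in> orbit p c" using orb[OF B(1,4)] orb[OF B(2,6)] B by auto
  hence "c \<in> orbit p a" using disc_noncrossing[OF assms(2,3) s(1,2), of e] s(3) by auto
  hence "c \<in> B" using orb[OF B(1,4)] by simp
  thus False using orb[OF B(1)] orb[OF B(2,6)] B(3) by metis
 qed
 thus ?thesis unfolding NCP_def using orbs_partition[OF d(2)] by blast
qed

lemma NCP_partition: "P \<in> NCP S ==> partition_on S P" by (simp add: NCP_def)

lemma NCP_noncrossing:
 assumes "P \<in> NCP S" "B \<in> P" "B' \<in> P" "B ~= B'" "a \<in> B" "b \<in> B" "c \<in> B'" "d \<in> B'" "a < c" "c < b" "b < d"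
 shows False
 using assms unfolding NCP_def by blast

lemma NCP_refine:
 assumes "P \<in> NCP S" "partition_on T Q" "!!B. B \<in> Q ==> \<phi> B \<in> P \<and> B <= \<phi> B" "inj_on \<phi> Q"
 shows "Q \<in> NCP T"
proof -
 have "False" if "B \<in> Q" "B' \<in> Q" "B ~= B'" "a \<in> B" "b \<in> B" "c \<in> B'" "d \<in> B'" "a < c" "c < b" "b < d" for B B' a b c d
 proof (rule NCP_noncrossing[OF assms(1), of "\<phi> B" "\<phi> B'" a b c d])
  show "\<phi> B ~= \<phi> B'" using assms(4) that(1-3) by (auto simp: inj_on_def)
 qed (use that assms(3) in auto)
 thus ?thesis unfolding NCP_def using assms(2) by blast
qed

lemma orbs_insert_fixed:
 "p a = a ==> orbs (insert a S) p = insert {a} (orbs S p)"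
 by (simp add: orbs_def orbit_eq_singleton_iff[THEN iffD2])

lemma partition_onD_all:
 assumes "partition_on S P"
 shows "\<Union>P = S" "{} ~: P" "!!B B' x. B \<in> P ==> B' \<in> P ==> x \<in> B ==> x \<in> B' ==> B = B'"
proof -
 show "\<Union>P = S" "{} ~: P" using assms by (simp_all add: partition_on_def)
 have "disjoint P" using assms by (simp add: partition_on_def)
 thus "B = B'" if "B \<in> P" "B' \<in> P" "x \<in> B" "x \<in> B'" for B B' x
  using disjointD[of P B B'] that by auto
qed

lemma partition_onI_all:
 assumes "\<Union>P = S" "{} ~: P" "!!B B' x. B \<in> P ==> B' \<in> P ==> x \<in> B ==> x \<in> B' ==> B = B'"
 shows "partition_on S P"
 unfolding partition_on_def disjoint_def using assms by blast

text \<open>Induction on the number of letters. If the first letter a is a block, it is removed. Otherwise the word is cut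
at the second element x of its block; no other block meets both parts, and the two partitions, with a split off from its
block, are glued by \<open>disc_cut\<close>.\<close>

theorem NCP_from_disc:
 fixes L :: "nat list"
 assumes "sorted L" "distinct L" "L ~= []" "P \<in> NCP (set L)"
 shows "\<exists>p\<in>disc L. orbs (set L) p = P"
 using assms
proof (induction "length L" arbitrary: L P rule: less_induct)
 case less
 obtain a w where L: "L = a # w" using less.prems(3) by (cases L) auto
 note pD = partition_onD_all[OF NCP_partition[OF less.prems(4)]]
 have aw: "a ~: set w" "!!y. y \<in> set w ==> a < y"
  using less.prems(1,2) unfolding L by (auto simp: order.order_iff_strict)
 obtain U where U: "U \<in> P" "a \<in> U" using pD(1) by (auto simp: L)
 have Usub: "U <= set L" using U pD(1) by blast
 show ?case
 proof (cases "U = {a}")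
  case True
  show ?thesis
  proof (cases "w = []")
   case w: True
   have "B = U" if "B \<in> P" for B
   proof -
    have "B ~= {}" using pD(2) that by metis
    then obtain x where "x \<in> B" by auto
    hence "x = a" using that pD(1) w unfolding L by auto
    thus ?thesis using pD(3)[OF that U(1) \<open>x \<in> B\<close>] U(2) by simp
   qed
   hence "P <= {U}" by blast
   hence "P = {{a}}" using U True by blast
   thus ?thesis using w L by (simp add: orbs_def orbit_eq_singleton_iff[THEN iffD2])
  next
   case w: False
   have UP: "\<Union>(P - {U}) = set w"
   proof
    show "\<Union>(P - {U}) <= set w"
    proof
     fix x assume "x \<in> \<Union>(P - {U})"
     then obtain B where B: "B \<in> P" "B ~= U" "x \<in> B" by auto
     hence "x ~= a" using pD(3)[OF B(1) U(1)] U(2) by blast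
     thus "x \<in> set w" using B pD(1) unfolding L by auto
    qed
    show "set w <= \<Union>(P - {U})"
    proof
     fix x assume x: "x \<in> set w"
     then obtain B where B: "B \<in> P" "x \<in> B" using pD(1) unfolding L by auto
     hence "B ~= U" using True x aw by auto
     thus "x \<in> \<Union>(P - {U})" using B by auto
    qed
   qed
   have "P - {U} \<in> NCP (set w)"
    by (rule NCP_refine[OF less.prems(4), where \<phi> = id])
     (auto intro!: partition_onI_all[OF UP] simp: pD(2) dest: pD(3))
   then obtain p where p: "p \<in> disc w" "orbs (set w) p = P - {U}"
    using less.hyps[of w "P - {U}"] less.prems(1,2) w by (auto simp: L)
   have "p \<in> {p \<in> disc (a # w). p a = a}" using disc_fixed[of a w] less.prems(2) w p(1) by (simp add: L)
   moreover from this have "orbs (set L) p = insert {a} (P - {U})" using orbs_insert_fixed[of p a "set w"] p(2) by (simp add: L)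
   ultimately show ?thesis using U True by (auto simp: L insert_absorb)
  qed
 next
  case False
  define x where "x = Min (U - {a})"
  have fU: "finite (U - {a})" "U - {a} ~= {}" using Usub finite_subset U False by auto
  have x: "x \<in> U" "x ~= a" "!!y. y \<in> U ==> y ~= a ==> x \<le> y"
   using Min_in[OF fU] Min_le[OF fU(1)] by (auto simp: x_def)
  have "x \<in> set w" using x Usub by (auto simp: L)
  then obtain w1 w2 where w: "w = w1 @ x # w2" by (metis split_list)
  define u1 where "u1 = a # w1"
  define u2 where "u2 = x # w2"
  have uu: "L = u1 @ u2" "u1 ~= []" "u2 ~= []" "hd u1 = a" "hd u2 = x" by (auto simp: u1_def u2_def L w)
  have d: "distinct (u1 @ u2)" and so: "sorted u1" "sorted u2" using less.prems(1,2) unfolding uu(1) by (auto simp: sorted_append)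
  have lt1: "!!y. y \<in> set u1 ==> y < x"
   using less.prems(1) d unfolding uu(1) by (force simp: sorted_append u2_def)
  have le2: "!!y. y \<in> set u2 ==> x \<le> y" using so(2) by (auto simp: u2_def)
  have ax: "a < x" "a \<in> set u1" "x \<in> set u2" "a ~: set u2" using lt1 le2 by (auto simp: u1_def u2_def) (use lt1 u1_def in force)
  have part: "B <= set u1 \<or> B <= set u2" if B: "B \<in> P" "B ~= U" for B
  proof (rule ccontr)
   assume "\<not> ?thesis"
   then obtain c e where c: "c \<in> B" "c ~: set u2" and e: "e \<in> B" "e ~: set u1" by auto
   have "c \<in> set L" "e \<in> set L" using c e B pD(1) by auto
   hence c1: "c \<in> set u1" and e1: "e \<in> set u2" using c e uu(1) by auto
   have "c ~= a" "e ~= x" using c e B pD(3)[OF B(1) U(1)] U(2) x(1) by blast+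
   hence "a < c" "c < x" "x < e"
    using c1 lt1 le2[OF e1] aw(2)[of c] by (auto simp: u1_def w)
   thus False using NCP_noncrossing[OF less.prems(4) U(1) B(1) _ U(2) x(1) c(1) e(1)] B(2) by blast
  qed
  have Uu1: "U Int set u1 = {a}" using U(2) ax x(3) lt1 by (force simp: not_le[symmetric])
  have Uu2: "U - {a} <= set u2" using Usub Uu1 uu(1) by auto
  define P1 where "P1 = insert {a} {B \<in> P. B ~= U \<and> B <= set u1}"
  define P2 where "P2 = insert (U - {a}) {B \<in> P. B ~= U \<and> B <= set u2}"
  have notin: "y ~: B" if "B \<in> P" "B ~= U" "y \<in> U" for B y using pD(3)[OF that(1) U(1)] that by blast
  have un: "\<exists>B\<in>P. y \<in> B" if "y \<in> set u1 Un set u2" for y using that pD(1) uu(1) by auto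
  have dis12: "set u1 Int set u2 = {}" using d by auto
  have P1: "P1 \<in> NCP (set u1)"
  proof (rule NCP_refine[OF less.prems(4), where \<phi> = "%B. if B = {a} then U else B"])
   show "partition_on (set u1) P1"
   proof (rule partition_onI_all)
    show "\<Union>P1 = set u1"
    proof
     show "\<Union>P1 <= set u1" using ax by (auto simp: P1_def)
     show "set u1 <= \<Union>P1"
     proof
      fix y assume y: "y \<in> set u1"
      obtain B where B: "B \<in> P" "y \<in> B" using un y by auto
      show "y \<in> \<Union>P1"
      proof (cases "B = U")
       case True thus ?thesis using B y Uu1 by (auto simp: P1_def)
      next
       case F: False
       have "B <= set u1" using part[OF B(1) F] B(2) y dis12 by blast
       thus ?thesis using B F by (auto simp: P1_def)
      qed
     qed
    qed
    show "{} ~: P1" using pD(2) by (auto simp: P1_def)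
    show "!!B B' y. B \<in> P1 ==> B' \<in> P1 ==> y \<in> B ==> y \<in> B' ==> B = B'"
     using notin[OF _ _ U(2)] pD(3) by (auto simp: P1_def)
   qed
   show "inj_on (%B. if B = {a} then U else B) P1" by (auto simp: inj_on_def P1_def)
  qed (use U in "auto simp: P1_def")
  have P2: "P2 \<in> NCP (set u2)"
  proof (rule NCP_refine[OF less.prems(4), where \<phi> = "%B. if B = U - {a} then U else B"])
   have xU: "x \<in> U - {a}" using x by simp
   show "partition_on (set u2) P2"
   proof (rule partition_onI_all)
    show "\<Union>P2 = set u2"
    proof
     show "\<Union>P2 <= set u2" using Uu2 by (auto simp: P2_def)
     show "set u2 <= \<Union>P2"
     proof
      fix y assume y: "y \<in> set u2"
      obtain B where B: "B \<in> P" "y \<in> B" using un y by auto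
      show "y \<in> \<Union>P2"
      proof (cases "B = U")
       case True thus ?thesis using B y ax by (auto simp: P2_def)
      next
       case F: False
       have "B <= set u2" using part[OF B(1) F] B(2) y dis12 by blast
       thus ?thesis using B F by (auto simp: P2_def)
      qed
     qed
    qed
    show "{} ~: P2" using pD(2) xU by (auto simp: P2_def)
    show "B = B'" if m: "B \<in> P2" "B' \<in> P2" "y \<in> B" "y \<in> B'" for B B' y
    proof -
     have c: "B = U - {a} \<or> B \<in> P \<and> B ~= U" "B' = U - {a} \<or> B' \<in> P \<and> B' ~= U"
      using m(1,2) unfolding P2_def by blast+
     show ?thesis
     proof (cases "y \<in> U")
      case True
      hence "B = U - {a}" "B' = U - {a}" using c m(3,4) notin by blast+
      thus ?thesis by simp
     next
      case False
      hence "B \<in> P" "B' \<in> P" using c m(3,4) by auto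
      thus ?thesis using pD(3) m(3,4) by blast
     qed
    qed
   qed
   show "inj_on (%B. if B = U - {a} then U else B) P2" by (auto simp: inj_on_def P2_def)
  qed (use U in "auto simp: P2_def")
  obtain p1 where p1: "p1 \<in> disc u1" "orbs (set u1) p1 = P1"
   using less.hyps[of u1 P1] so d uu P1 by auto
  obtain p2 where p2: "p2 \<in> disc u2" "orbs (set u2) p2 = P2"
   using less.hyps[of u2 P2] so d uu P2 by auto
  define q where "q = p1 o p2"
  define p where "p = swp a x o q"
  have pin: "p \<in> disc L"
   using bij_betwE[OF disc_cut[OF d uu(2,3)]] p1(1) p2(1) unfolding p_def q_def uu by auto
  note d1 = discD[OF p1(1)] and d2 = discD[OF p2(1)]
  note ps = prod_support[OF d1(1) d2(1) dis12 finite_set finite_set]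
  have perm: "permutation q" unfolding q_def by (rule perm_comp_permutation[OF d1(1) d2(1) finite_set finite_set])
  have qL: "perm_on (set L) q" unfolding q_def uu(1) set_append
   by (rule permutes_perm_on[OF perm_prod_permutes[OF d1(1) d2(1)]]) simp
  have orb_in: "orbit r y = B" if "perm_on T r" "B \<in> orbs T r" "y \<in> B" for r T B y
   using that orbit_eq_iff[OF perm_onD(2)[OF that(1)], of y] by (auto simp: orbs_def)
  have o1: "orbit q a = {a}" using ps(2)[OF ax(2)] orb_in[OF d1(2), of "{a}" a] p1(2) by (simp add: q_def P1_def)
  have o2: "orbit q x = U - {a}" using ps(4)[OF ax(3)] orb_in[OF d2(2), of "U - {a}" x] p2(2) x by (simp add: q_def P2_def)
  have "x ~: orbit q a" using o1 x by simp
  from support_join(3)[OF perm this] have oa: "orbit p a = U" unfolding p_def o1 o2 using U by auto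
  have pD4: "perm_on (set L) p" by (rule discD(2)[OF pin])
  have "orbs (set L) p = insert U (orbs (set L - U) p)"
   using orbs_Diff[OF pD4, of U] oa ax uu(1) by (auto simp: orbs_def)
  also have "orbs (set L - U) p = orbs (set L - U) q"
  proof (rule orbs_cong[symmetric])
   have Uq: "perm_on U q"
    using perm_on_Un[OF perm_on_orbit[OF perm, of a] perm_on_orbit[OF perm, of x]] U(2) unfolding o1 o2 by (simp add: insert_absorb)
   show R: "perm_on (set L - U) q" by (rule perm_on_Diff[OF qL Uq])
   fix y assume "y \<in> set L - U"
   hence "q y \<in> set L - U" using perm_onD(6)[OF R] by blast
   hence "q y ~= a" "q y ~= x" using U x by auto
   thus "q y = p y" by (simp add: p_def)
  qed
  also have "orbs (set L - U) q = orbs (set u1 - {a}) p1 Un orbs (set u2 - (U - {a})) p2"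
  proof -
   have "set L - U = (set u1 - {a}) Un (set u2 - (U - {a}))" using uu(1) Uu1 Uu2 ax by auto
   moreover have "orbs (set u1 - {a}) q = orbs (set u1 - {a}) p1"
    unfolding orbs_def q_def by (rule image_cong[OF refl]) (simp add: ps(2))
   moreover have "orbs (set u2 - (U - {a})) q = orbs (set u2 - (U - {a})) p2"
    unfolding orbs_def q_def by (rule image_cong[OF refl]) (simp add: ps(4))
   ultimately show ?thesis by (simp only: orbs_union)
  qed
  also have "orbs (set u1 - {a}) p1 = P1 - {{a}}" using orbs_Diff[OF d1(2), of "{a}"] p1(2) by (simp add: P1_def)
  also have "orbs (set u2 - (U - {a})) p2 = P2 - {U - {a}}" using orbs_Diff[OF d2(2), of "U - {a}"] p2(2) by (simp add: P2_def)
  also have "insert U ((P1 - {{a}}) Un (P2 - {U - {a}})) = P"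
  proof
   show "insert U ((P1 - {{a}}) Un (P2 - {U - {a}})) <= P" using U by (auto simp: P1_def P2_def)
   show "P <= insert U ((P1 - {{a}}) Un (P2 - {U - {a}}))"
   proof
    fix B assume B: "B \<in> P"
    show "B \<in> insert U ((P1 - {{a}}) Un (P2 - {U - {a}}))"
    proof (cases "B = U")
     case False
     have "B ~= {a}" using notin[OF B False U(2)] by auto
     moreover have "B ~= U - {a}" using notin[OF B False x(1)] x by auto
     ultimately show ?thesis using part[OF B False] B False by (auto simp: P1_def P2_def)
    qed simp
   qed
  qed
  finally show ?thesis using pin by blast
 qed
qed

lemma disc_orbs_inj:
 assumes "distinct L" "p \<in> disc L" "q \<in> disc L" "orbs (set L) p = orbs (set L) q"
 shows "p = q"
proof
 fix x
 show "p x = q x"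
 proof (cases "x \<in> set L")
  case True
  note dp = discD[OF assms(2)] and dq = discD[OF assms(3)]
  have "orbit p x \<in> orbs (set L) q" using True assms(4) by (auto simp: orbs_def)
  then obtain y where "orbit p x = orbit q y" by (auto simp: orbs_def)
  moreover have "x \<in> orbit p x" by (rule in_own_orbit[OF dp(2)])
  ultimately have e: "orbit p x = orbit q x" using orbit_eq_iff[OF dq(4), of x y] by simp
  have cp: "cycle_list p (filter (%j. j \<in> orbit p x) L)" by (rule disc_sorted[OF assms(1,2) True])
  have cq: "cycle_list q (filter (%j. j \<in> orbit p x) L)" unfolding e by (rule disc_sorted[OF assms(1,3) True])
  show ?thesis by (rule cycle_list_agree[OF cp cq]) (use True \<open>x \<in> orbit p x\<close> in simp)
 next
  case False
  thus ?thesis using permutes_not_in discD(1) assms(2,3) by metis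
 qed
qed

theorem NCP_bij:
 fixes L :: "nat list"
 assumes "sorted L" "distinct L" "L ~= []"
 shows "bij_betw (orbs (set L)) (disc L) (NCP (set L))"
 unfolding bij_betw_def
proof
 show "inj_on (orbs (set L)) (disc L)" using disc_orbs_inj[OF assms(2)] by (auto simp: inj_on_def)
 show "orbs (set L) ` disc L = NCP (set L)"
  using disc_orbs_NCP[OF assms(1,2)] NCP_from_disc[OF assms] by (auto simp: image_iff)
qed

lemma set_ys_image_cl:
 assumes "distinct L" "L = us @ r # ys @ s # zs"
 shows "cl L ` set (r # ys) = insert s (set ys)"
proof -
 have L: "rotate (length us) L = r # ys @ s # zs @ us" unfolding assms(2) by (simp add: rotate_append)
 have "cycle_list (cl L) (r # ys @ s # zs @ us)"
  using cycle_list_rotate[OF cycle_list_cl[OF assms(1)], of "length us"] unfolding L using assms(2) by simp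
 hence "map (cl L) (r # ys @ s # zs @ us) = ys @ s # zs @ us @ [r]" by (simp add: cycle_list_def)
 hence "map (cl L) (r # ys) @ map (cl L) (s # zs @ us) = (ys @ [s]) @ (zs @ us @ [r])" by simp
 hence "map (cl L) (r # ys) = ys @ [s]" by (subst (asm) append_eq_append_conv) auto
 hence "set (map (cl L) (r # ys)) = set (ys @ [s])" by (rule arg_cong)
 thus ?thesis by simp
qed

text \<open>No block separates the arcs at r and s iff p preserves the set I of the letters after r up to s. The rotation maps
the letters from r up to the one before s onto I, so in this case the complement does the same, and an orbit of the
complement that started at r and avoided s would stay among these letters and yet lie in I, which does not contain r.
The converse uses that the complement is planar as well.\<close>

lemma kreweras_rel:
 fixes L :: "nat list"
 assumes "sorted L" "distinct L" "p \<in> disc L" "r \<in> set L" "s \<in> set L" "r < s"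
 shows "(\<forall>B\<in>orbs (set L) p. B <= {r<..s} \<or> B Int {r<..s} = {}) \<longleftrightarrow> s \<in> orbit (inv p o cl L) r"
proof -
 note d = discD[OF assms(3)]
 let ?K = "inv p o cl L"
 have K: "?K \<in> disc L" by (rule kreweras_disc[OF assms(3)])
 note dK = discD[OF K]
 obtain us ys zs where L: "L = us @ r # ys @ s # zs" and ys: "set ys = {c \<in> set L. r < c \<and> c < s}"
  using sorted_split2[OF assms(1,2,4,5,6)] by metis
 let ?A = "insert r (set ys)" and ?I = "insert s (set ys)"
 have I: "set L Int {r<..s} = ?I"
 proof (rule set_eqI)
  fix c show "c \<in> set L Int {r<..s} \<longleftrightarrow> c \<in> ?I" unfolding ys using assms(5,6) by (cases "c = s") auto
 qed
 have gA: "cl L ` ?A = ?I" using set_ys_image_cl[OF assms(2) L] by simp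
 have IL: "?I <= set L" using L by auto
 have "(\<forall>B\<in>orbs (set L) p. B <= {r<..s} \<or> B Int {r<..s} = {}) \<longleftrightarrow> p ` ?I = ?I"
 proof
  assume *: "\<forall>B\<in>orbs (set L) p. B <= {r<..s} \<or> B Int {r<..s} = {}"
  have "p y \<in> ?I" if y: "y \<in> ?I" for y
  proof -
   have yL: "y \<in> set L" using y IL by auto
   have "orbit p y \<in> orbs (set L) p" using yL by (auto simp: orbs_def)
   moreover have "y \<in> orbit p y" by (rule in_own_orbit[OF d(2)])
   moreover have "y \<in> {r<..s}" using y I by auto
   ultimately have "orbit p y <= {r<..s}" using * by blast
   moreover have "p y \<in> orbit p y" by (rule orbit.base)
   ultimately show ?thesis using perm_onD(6)[OF d(2) yL] I by auto
  qed
  hence "perm_on ?I p" by (intro perm_on_finite_closed d(4)) auto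
  thus "p ` ?I = ?I" by (rule perm_onD)
 next
  assume im: "p ` ?I = ?I"
  have pI: "perm_on ?I p" using perm_on_subset[OF d(2) IL im] .
  show "\<forall>B\<in>orbs (set L) p. B <= {r<..s} \<or> B Int {r<..s} = {}"
  proof
   fix B assume "B \<in> orbs (set L) p"
   then obtain y where y: "y \<in> set L" "B = orbit p y" by (auto simp: orbs_def)
   have BL: "B <= set L" using orbit_sub[OF d(2) y(1)] y(2) by simp
   show "B <= {r<..s} \<or> B Int {r<..s} = {}"
   proof (cases "B Int {r<..s} = {}")
    case False
    then obtain i where i: "i \<in> B" "i \<in> ?I" using BL I by blast
    hence "B = orbit p i" using y(2) orbit_eq_iff[OF d(4), of i y] by simp
    hence "B <= ?I" using orbit_sub[OF pI i(2)] by simp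
    thus ?thesis using I by auto
   qed simp
  qed
 qed
 also have "... \<longleftrightarrow> s \<in> orbit ?K r"
 proof
  assume im: "p ` ?I = ?I"
  have "inv p ` ?I = ?I"
   using perm_onD(3)[OF perm_on_inv[OF perm_on_subset[OF d(2) IL im]]] .
  hence KA: "?K ` ?A = ?I" using gA by (metis image_comp)
  show "s \<in> orbit ?K r"
  proof (rule ccontr)
   assume ns: "s ~: orbit ?K r"
   have "y \<in> ?A" if "y \<in> orbit ?K r" for y
    using that
   proof induction
    case base
    have "?K r \<in> ?I" using KA by blast
    moreover have "?K r ~= s" using ns by (metis orbit.base)
    ultimately show ?case by auto
   next
    case (step y)
    have "?K y \<in> ?I" using KA step.IH by blast
    moreover have "?K y ~= s" using ns step.hyps by (metis orbit.step)
    ultimately show ?case by auto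
   qed
   hence "orbit ?K r <= ?A" by blast
   moreover have "?K ` orbit ?K r = orbit ?K r" by (rule perm_onD(3)[OF perm_on_orbit[OF dK(4)]])
   ultimately have "orbit ?K r <= ?I" using KA by blast
   hence "r \<in> ?I" using in_own_orbit[OF dK(2), of r] by blast
   thus False using ys assms(6) by auto
  qed
 next
  assume s: "s \<in> orbit ?K r"
  let ?u1 = "r # ys" and ?u2 = "s # zs @ us"
  have rot: "rotate (length us) L = ?u1 @ ?u2" unfolding L by (simp add: rotate_append)
  have dd: "distinct (?u1 @ ?u2)" using assms(2) unfolding rot[symmetric] by simp
  have K': "?K \<in> disc (?u1 @ ?u2)" using K disc_rotate[OF assms(2), of "length us"] unfolding rot by simp
  have "?K \<in> (%(p, q). swp (hd ?u1) (hd ?u2) o (p o q)) ` (disc ?u1 \<times> disc ?u2)"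
   using bij_betw_imp_surj_on[OF disc_cut[OF dd]] K' s by simp
  then obtain K1 K2 where K12: "K1 \<in> disc ?u1" "K2 \<in> disc ?u2" "?K = swp r s o (K1 o K2)" by auto
  let ?Q = "K1 o K2"
  have QA: "?Q ` ?A = ?A" using two_disc_count(3)[OF dd K12(1,2)] by simp
  have "swp r s ` ?A = ?I"
  proof -
   have "r ~: set ys" "s ~: set ys" using ys by auto
   hence "swp r s ` set ys = set ys" by (intro swp_image_same) auto
   thus ?thesis by simp
  qed
  hence "swp r s ` (?Q ` ?A) = ?I" unfolding QA .
  moreover have "?K ` ?A = swp r s ` (?Q ` ?A)" unfolding K12(3) by (simp only: image_comp)
  ultimately have "?K ` ?A = ?I" by (simp only:)
  hence "inv p ` ?I = ?I" using gA by (metis image_comp)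
  hence "p ` inv p ` ?I = p ` ?I" by simp
  moreover have "p ` inv p ` ?I = ?I" using perm_on_inv_f(2)[OF d(2)] by (simp add: image_image)
  ultimately show "p ` ?I = ?I" by simp
 qed
 finally show ?thesis .
qed

theorem kreweras_orbs:
 fixes L :: "nat list"
 assumes "sorted L" "distinct L" "p \<in> disc L"
 shows "kreweras (set L) (orbs (set L) p) = orbs (set L) (inv p o cl L)"
proof -
 let ?K = "inv p o cl L" and ?S = "set L"
 let ?R = "{(r, s). r \<in> ?S \<and> s \<in> ?S \<and>
   (\<forall>B\<in>orbs ?S p. B <= {min r s<..max r s} \<or> B Int {min r s<..max r s} = {})}"
 note dK = discD[OF kreweras_disc[OF assms(3)]]
 have "(r, s) \<in> ?R \<longleftrightarrow> s \<in> orbit ?K r" if "r \<in> ?S" "s \<in> ?S" for r s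
 proof -
  consider "r < s" | "r = s" | "s < r" by linarith
  thus ?thesis
  proof cases
   case 1
   thus ?thesis using kreweras_rel[OF assms that 1] that by simp
  next
   case 2
   thus ?thesis using that in_own_orbit[OF dK(2), of r] by simp
  next
   case 3
   thus ?thesis using kreweras_rel[OF assms that(2,1) 3] that orbit_sym[OF dK(4), of s r] by (simp add: min_def max_def)
  qed
 qed
 hence "?R `` {r} = orbit ?K r" if "r \<in> ?S" for r
  using that orbit_sub[OF dK(2) that] by blast
 thus ?thesis unfolding kreweras_def quotient_def orbs_def by auto
qed

section \<open>Relabelling the sums\<close>

text \<open>Cumulants are defined through positions in a list; conjugation carries sums over positions to sums over labels.\<close>

definition relabel :: "('a => 'b) => 'a set => ('a => 'a) => 'b => 'b" where
 "relabel h T p j = (if j \<in> h ` T then h (p (inv_into T h j)) else j)"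

definition unlabel :: "('a => 'b) => 'a set => ('b => 'b) => 'a => 'a" where
 "unlabel h T q x = (if x \<in> T then inv_into T h (q (h x)) else x)"

lemma relabel_apply: "inj_on h T ==> x \<in> T ==> relabel h T p (h x) = h (p x)"
 by (simp add: relabel_def)

lemma relabel_permutes:
 assumes "inj_on h T" "p permutes T" shows "relabel h T p permutes h ` T"
proof (rule bij_imp_permutes)
 have "bij_betw h T (h ` T)" using assms(1) by (simp add: bij_betw_def)
 hence "bij_betw (h o p o inv_into T h) (h ` T) (h ` T)"
  using bij_betw_trans[OF bij_betw_trans[OF bij_betw_inv_into permutes_imp_bij[OF assms(2)]]] by (simp add: comp_assoc)
 thus "bij_betw (relabel h T p) (h ` T) (h ` T)"
  by (rule bij_betw_cong[THEN iffD1, rotated]) (simp add: relabel_def)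
qed (simp add: relabel_def)

lemma unlabel_permutes:
 assumes "inj_on h T" "q permutes h ` T" shows "unlabel h T q permutes T" "relabel h T (unlabel h T q) = q"
proof -
 have qh: "q (h x) \<in> h ` T" if "x \<in> T" for x using permutes_in_image[OF assms(2)] that by blast
 have b: "bij_betw h T (h ` T)" using assms(1) by (simp add: bij_betw_def)
 show "unlabel h T q permutes T"
 proof (rule bij_imp_permutes)
  have "bij_betw (inv_into T h o q o h) T T"
   using bij_betw_trans[OF b bij_betw_trans[OF permutes_imp_bij[OF assms(2)] bij_betw_inv_into[OF b]]] by (simp add: comp_assoc)
  thus "bij_betw (unlabel h T q) T T"
   by (rule bij_betw_cong[THEN iffD1, rotated]) (simp add: unlabel_def)
 qed (simp add: unlabel_def)
 show "relabel h T (unlabel h T q) = q"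
 proof
  fix j show "relabel h T (unlabel h T q) j = q j"
  proof (cases "j \<in> h ` T")
   case True
   then obtain x where x: "x \<in> T" "j = h x" by auto
   thus ?thesis using relabel_apply[OF assms(1) x(1)] f_inv_into_f[OF qh[OF x(1)]] by (simp add: unlabel_def)
  next
   case False
   thus ?thesis using permutes_not_in[OF assms(2)] by (simp add: relabel_def)
  qed
 qed
qed

lemma relabel_inj:
 assumes "inj_on h T" "p permutes T" "p' permutes T" "relabel h T p = relabel h T p'" shows "p = p'"
proof
 fix x show "p x = p' x"
 proof (cases "x \<in> T")
  case True
  hence "h (p x) = h (p' x)" using relabel_apply[OF assms(1) True] assms(4) by metis
  thus ?thesis using assms(1) permutes_in_image[OF assms(2), of x] permutes_in_image[OF assms(3), of x] True
   by (auto simp: inj_on_def)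
 qed (use permutes_not_in assms(2,3) in metis)
qed

lemma relabel_kreweras:
 assumes "inj_on h T" "p permutes T" "!!x. x \<in> T ==> g x \<in> T" "!!x. x \<in> T ==> g' (h x) = h (g x)" "x \<in> T"
 shows "(inv (relabel h T p) o g') (h x) = h ((inv p o g) x)"
proof -
 have gx: "g x \<in> T" by (rule assms(3)[OF assms(5)])
 have ip: "inv p (g x) \<in> T" using permutes_in_image[OF permutes_inv[OF assms(2)]] gx by blast
 have "relabel h T p (h (inv p (g x))) = h (g x)"
  using relabel_apply[OF assms(1) ip] permutes_inverses(1)[OF assms(2)] by simp
 hence "inv (relabel h T p) (h (g x)) = h (inv p (g x))"
  using permutes_inverses(2)[OF relabel_permutes[OF assms(1,2)]] by metis
 thus ?thesis using assms(4)[OF assms(5)] by simp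
qed

lemma cl_map:
 assumes "distinct u" "inj_on h (set u)" "x \<in> set u"
 shows "cl (map h u) (h x) = h (cl u x)"
proof -
 have ne: "u ~= []" using assms(3) by auto
 have "cycle_list (cl (map h u)) (map h u)" using assms ne by (intro cycle_list_cl) (auto simp: distinct_map)
 moreover have "cycle_list (cl u) u" by (rule cycle_list_cl[OF assms(1) ne])
 ultimately have "map (cl (map h u)) (map h u) = map h (map (cl u) u)" by (simp add: cycle_list_def rotate1_map)
 thus ?thesis using assms(3) by (simp add: map_eq_conv)
qed

lemma relabel_kreweras_disc:
 assumes "distinct u" "inj_on h (set u)" "p permutes set u" "x \<in> set u"
 shows "(inv (relabel h (set u) p) o cl (map h u)) (h x) = h ((inv p o cl u) x)"
proof (rule relabel_kreweras[of h "set u" p "cl u" "cl (map h u)" x, OF assms(2,3)])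
 show "cl u y \<in> set u" if "y \<in> set u" for y using permutes_in_image[OF cl_permutes[of u]] that by blast
qed (use cl_map[OF assms(1,2)] assms(4) in simp_all)

lemma relabel_disc:
 assumes "distinct u" "inj_on h (set u)" "p permutes set u"
 shows "relabel h (set u) p \<in> disc (map h u) \<longleftrightarrow> p \<in> disc u"
proof -
 let ?T = "set u" and ?q = "relabel h (set u) p"
 have p: "perm_on ?T p" using assms(3) by (simp add: permutes_perm_on)
 have clin: "cl u x \<in> ?T" if "x \<in> ?T" for x using permutes_in_image[OF cl_permutes[of u]] that by blast
 have K: "perm_on ?T (inv p o cl u)" by (intro perm_on_compose perm_on_inv p cl_perm_on) auto
 have 1: "ncyc (h ` ?T) ?q = ncyc ?T p" by (rule relabel_ncyc[OF p assms(2) relabel_apply[OF assms(2)]])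
 have 2: "ncyc (h ` ?T) (inv ?q o cl (map h u)) = ncyc ?T (inv p o cl u)"
  by (rule relabel_ncyc[of ?T "inv p o cl u" h "inv ?q o cl (map h u)", OF K assms(2) relabel_kreweras_disc[OF assms]])
 show ?thesis using 1 2 relabel_permutes[OF assms(2,3)] assms(3) by (simp add: disc_def)
qed

lemma relabel_disc_bij:
 assumes "distinct u" "inj_on h (set u)"
 shows "bij_betw (relabel h (set u)) (disc u) (disc (map h u))"
 unfolding bij_betw_def
proof
 show "inj_on (relabel h (set u)) (disc u)"
  using relabel_inj[OF assms(2)] discD(1) by (metis inj_onI)
 show "relabel h (set u) ` disc u = disc (map h u)"
 proof
  show "relabel h (set u) ` disc u <= disc (map h u)" using relabel_disc[OF assms] discD(1) by blast
  show "disc (map h u) <= relabel h (set u) ` disc u"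
  proof
   fix q assume q: "q \<in> disc (map h u)"
   have "q permutes h ` set u" using discD(1)[OF q] by simp
   note ul = unlabel_permutes[OF assms(2) this]
   have "unlabel h (set u) q \<in> disc u" using relabel_disc[OF assms ul(1)] ul(2) q by simp
   thus "q \<in> relabel h (set u) ` disc u" using ul(2) by (metis imageI)
  qed
 qed
qed

lemma disc_sum_map:
 assumes "distinct u" "inj_on h (set u)" "rot_inv \<tau>" "rot_inv \<kappa>"
 shows "disc_sum \<tau> \<kappa> (map h u) = disc_sum (%c. \<tau> (map h c)) (%c. \<kappa> (map h c)) u"
 unfolding disc_sum_def
proof (subst sum.reindex_bij_betw[OF relabel_disc_bij[OF assms(1,2)], symmetric], rule sum_congI)
 fix p assume p: "p \<in> disc u"
 let ?T = "set u" and ?q = "relabel h (set u) p"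
 note d = discD[OF p]
 have dq: "?q \<in> disc (map h u)" using relabel_disc[OF assms(1,2) d(1)] p by simp
 have clin: "cl u x \<in> ?T" if "x \<in> ?T" for x using permutes_in_image[OF cl_permutes[of u]] that by blast
 have K: "perm_on ?T (inv p o cl u)" by (intro perm_on_compose perm_on_inv d(2) cl_perm_on) auto
 have q: "perm_on (h ` ?T) ?q" using discD(2)[OF dq] by simp
 have Kq: "perm_on (h ` ?T) (inv ?q o cl (map h u))" by (intro perm_on_compose perm_on_inv q cl_perm_on) auto
 have 1: "cprod (h ` ?T) \<kappa> ?q = cprod ?T (%c. \<kappa> (map h c)) p"
  by (rule relabel_cprod[OF d(2) assms(2) relabel_apply[OF assms(2)] q assms(4)])
 have 2: "cprod (h ` ?T) \<tau> (inv ?q o cl (map h u)) = cprod ?T (%c. \<tau> (map h c)) (inv p o cl u)"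
  by (rule relabel_cprod[of ?T "inv p o cl u" h "inv ?q o cl (map h u)", OF K assms(2) relabel_kreweras_disc[OF assms(1,2) d(1)] Kq assms(3)])
 show "dwt \<tau> (map h u) ?q * cprod (set (map h u)) \<kappa> ?q =
  cprod ?T (%c. \<tau> (map h c)) (inv p o cl u) * cprod ?T (%c. \<kappa> (map h c)) p"
  unfolding set_map 1 2 ..
qed

lemma marked_sum_map:
 fixes \<tau> \<kappa> \<gamma> :: "'b list => 'r::comm_ring_1"
 assumes "distinct u" "inj_on h (set u)" "rot_inv \<tau>" "rot_inv \<kappa>" "rot_inv \<gamma>"
 shows "marked_sum \<tau> \<kappa> \<gamma> (map h u) = marked_sum (%c. \<tau> (map h c)) (%c. \<kappa> (map h c)) (%c. \<gamma> (map h c)) u"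
proof -
 have "dual \<kappa> \<gamma> (map h c) = dual (%c. \<kappa> (map h c)) (%c. \<gamma> (map h c)) c" for c by (simp add: dual_def)
 hence "disc_sum (%c. [:\<tau> c:]) (dual \<kappa> \<gamma>) (map h u) =
  disc_sum (%c. [:\<tau> (map h c):]) (dual (%c. \<kappa> (map h c)) (%c. \<gamma> (map h c))) u"
  using disc_sum_map[OF assms(1,2) rot_inv_const[OF assms(3)] rot_inv_dual[OF assms(4,5)]] by simp
 from arg_cong[OF this, of "%p. coeff p (Suc 0)"] show ?thesis by (simp only: coeff_disc_sum_dual(2))
qed

lemma cl2_map:
 assumes "distinct (u @ v)" "inj_on h (set u Un set v)" "x \<in> set u Un set v"
 shows "(cl (map h u) o cl (map h v)) (h x) = h ((cl u o cl v) x)" "(cl u o cl v) x \<in> set u Un set v"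
proof -
 have iu: "inj_on h (set u)" "inj_on h (set v)" using assms(2) by (auto intro: inj_on_subset)
 have dis: "set u Int set v = {}" and du: "distinct u" "distinct v" using assms(1) by auto
 have dis': "set (map h u) Int set (map h v) = {}" using assms(2) dis by (auto simp: inj_on_def)
 show "(cl u o cl v) x \<in> set u Un set v"
  using assms(3) permutes_in_image[OF perm_prod_permutes[OF cl_permutes[of u] cl_permutes[of v]]] by blast
 show "(cl (map h u) o cl (map h v)) (h x) = h ((cl u o cl v) x)"
 proof (cases "x \<in> set u")
  case True
  hence "h x \<in> set (map h u)" by simp
  thus ?thesis using cl_comp_apply(1)[OF dis True] cl_comp_apply(1)[OF dis', of "h x"] cl_map[OF du(1) iu(1) True] by simp
 next
  case False
  hence x: "x \<in> set v" using assms(3) by simp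
  hence "h x \<in> set (map h v)" by simp
  thus ?thesis using cl_comp_apply(2)[OF dis x] cl_comp_apply(2)[OF dis', of "h x"] cl_map[OF du(2) iu(2) x] by simp
 qed
qed

lemma relabel_kreweras_annulus:
 assumes "distinct (u @ v)" "inj_on h (set u Un set v)" "p permutes (set u Un set v)" "x \<in> set u Un set v"
 shows "(inv (relabel h (set u Un set v) p) o (cl (map h u) o cl (map h v))) (h x) = h ((inv p o (cl u o cl v)) x)"
 by (rule relabel_kreweras[of h "set u Un set v" p "cl u o cl v" "cl (map h u) o cl (map h v)" x, OF assms(2,3)
   cl2_map(2)[OF assms(1,2)] cl2_map(1)[OF assms(1,2)] assms(4)])

lemma relabel_annulus:
 assumes "distinct (u @ v)" "inj_on h (set u Un set v)" "p permutes (set u Un set v)"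
 shows "relabel h (set u Un set v) p \<in> annulus (map h u) (map h v) \<longleftrightarrow> p \<in> annulus u v"
proof -
 let ?T = "set u Un set v" and ?q = "relabel h (set u Un set v) p"
 have p: "perm_on ?T p" using assms(3) by (simp add: permutes_perm_on)
 have K: "perm_on ?T (inv p o (cl u o cl v))" by (intro perm_on_compose perm_on_inv p cl_perm_on) auto
 have 1: "ncyc (h ` ?T) ?q = ncyc ?T p" by (rule relabel_ncyc[OF p assms(2) relabel_apply[OF assms(2)]])
 have 2: "ncyc (h ` ?T) (inv ?q o (cl (map h u) o cl (map h v))) = ncyc ?T (inv p o (cl u o cl v))"
  by (rule relabel_ncyc[of ?T "inv p o (cl u o cl v)" h "inv ?q o (cl (map h u) o cl (map h v))", OF K assms(2) relabel_kreweras_annulus[OF assms]])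
 have 3: "(\<exists>i\<in>set (map h u). ?q i \<in> set (map h v)) \<longleftrightarrow> (\<exists>i\<in>set u. p i \<in> set v)"
 proof -
  have "?q (h i) \<in> h ` set v \<longleftrightarrow> p i \<in> set v" if "i \<in> set u" for i
  proof -
   have "?q (h i) = h (p i)" using relabel_apply[OF assms(2)] that by blast
   moreover have "p i \<in> ?T" using perm_onD(6)[OF p] that by blast
   ultimately show ?thesis using assms(2) by (auto simp: inj_on_def)
  qed
  thus ?thesis by auto
 qed
 have im: "set (map h u) Un set (map h v) = h ` ?T" by auto
 show ?thesis unfolding annulus_def mem_Collect_eq 3 im 1 2 using relabel_permutes[OF assms(2,3)] assms(3) by simp
qed

lemma annulus_sum_map:
 assumes "distinct (u @ v)" "inj_on h (set u Un set v)" "rot_inv \<tau>" "rot_inv \<kappa>"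
 shows "annulus_sum \<tau> \<kappa> (map h u) (map h v) = annulus_sum (%c. \<tau> (map h c)) (%c. \<kappa> (map h c)) u v"
proof -
 let ?T = "set u Un set v"
 have im: "set (map h u) Un set (map h v) = h ` ?T" by auto
 have bij: "bij_betw (relabel h ?T) (annulus u v) (annulus (map h u) (map h v))"
  unfolding bij_betw_def
 proof
  show "inj_on (relabel h ?T) (annulus u v)"
   using relabel_inj[OF assms(2)] annulusD(1) by (metis inj_onI)
  show "relabel h ?T ` annulus u v = annulus (map h u) (map h v)"
  proof
   show "relabel h ?T ` annulus u v <= annulus (map h u) (map h v)" using relabel_annulus[OF assms(1,2)] annulusD(1) by blast
   show "annulus (map h u) (map h v) <= relabel h ?T ` annulus u v"
   proof
    fix q assume q: "q \<in> annulus (map h u) (map h v)"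
    have "q permutes h ` ?T" using annulusD(1)[OF q] unfolding im .
    note ul = unlabel_permutes[OF assms(2) this]
    have "unlabel h ?T q \<in> annulus u v" using relabel_annulus[OF assms(1,2) ul(1)] ul(2) q by simp
    thus "q \<in> relabel h ?T ` annulus u v" using ul(2) by (metis imageI)
   qed
  qed
 qed
 show ?thesis
  unfolding annulus_sum_def im
 proof (subst sum.reindex_bij_betw[OF bij, symmetric], rule sum_congI)
  fix p assume p: "p \<in> annulus u v"
  let ?q = "relabel h ?T p"
  note d = annulusD[OF p]
  have dq: "?q \<in> annulus (map h u) (map h v)" using relabel_annulus[OF assms(1,2) d(1)] p by simp
  have K: "perm_on ?T (inv p o (cl u o cl v))" by (intro perm_on_compose perm_on_inv d(2) cl_perm_on) auto
  have q: "perm_on (h ` ?T) ?q" using annulusD(2)[OF dq] unfolding im .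
  have Kq: "perm_on (h ` ?T) (inv ?q o (cl (map h u) o cl (map h v)))" by (intro perm_on_compose perm_on_inv q cl_perm_on) auto
  have 1: "cprod (h ` ?T) \<kappa> ?q = cprod ?T (%c. \<kappa> (map h c)) p"
   by (rule relabel_cprod[OF d(2) assms(2) relabel_apply[OF assms(2)] q assms(4)])
  have 2: "cprod (h ` ?T) \<tau> (inv ?q o (cl (map h u) o cl (map h v))) = cprod ?T (%c. \<tau> (map h c)) (inv p o (cl u o cl v))"
   by (rule relabel_cprod[of ?T "inv p o (cl u o cl v)" h "inv ?q o (cl (map h u) o cl (map h v))", OF K assms(2) relabel_kreweras_annulus[OF assms(1,2) d(1)] Kq assms(3)])
  show "cprod (h ` ?T) \<tau> (inv ?q o (cl (map h u) o cl (map h v))) * cprod (h ` ?T) \<kappa> ?q =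
   cprod ?T (%c. \<tau> (map h c)) (inv p o (cl u o cl v)) * cprod ?T (%c. \<kappa> (map h c)) p"
   unfolding 1 2 ..
 qed
qed

section \<open>Sums over non-crossing partitions\<close>

lemma block_eq_sorted:
 fixes L :: "nat list"
 assumes "sorted L" "distinct L" "X <= set L"
 shows "block L X = sorted_list_of_set X"
proof -
 have "set (block L X) = X" using assms(3) by (auto simp: block_def)
 moreover have "sorted (block L X)" "distinct (block L X)" using assms by (auto simp: block_def sorted_wrt_filter)
 ultimately show ?thesis by (metis sorted_list_of_set.idem_if_sorted_distinct)
qed

lemma cprod_disc:
 assumes "distinct u" "p \<in> disc u" "rot_inv g" "U \<in> orbs (set u) p \<or> U = {}"
 shows "cprod (set u - U) g p = (\<Prod>X\<in>orbs (set u) p - {U}. g (block u X))"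
proof -
 note d = discD[OF assms(2)]
 have o: "orbs (set u - U) p = orbs (set u) p - {U}"
 proof (cases "U = {}")
  case True
  thus ?thesis using orbs_partition[OF d(2)] by (auto simp: partition_on_def)
 qed (use orbs_Diff[OF d(2)] assms(4) in auto)
 have R: "perm_on (set u - U) p"
 proof (cases "U = {}")
  case False
  then obtain x where "U = orbit p x" using assms(4) by (auto simp: orbs_def)
  thus ?thesis using perm_on_rest[OF d(2)] by simp
 qed (use d(2) in simp)
 have "cycle_list p (block u X) \<and> set (block u X) = X" if X: "X \<in> orbs (set u - U) p" for X
 proof -
  obtain x where x: "x \<in> set u" "X = orbit p x" using X by (auto simp: orbs_def)
  thus ?thesis using disc_sorted[OF assms(1,2) x(1)] orbit_sub[OF d(2) x(1)] by (auto simp: block_def)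
 qed
 from cprod_choice[OF R assms(3) this] show ?thesis by (simp only: o)
qed

lemma cprod_disc_full:
 assumes "distinct u" "p \<in> disc u" "rot_inv g"
 shows "cprod (set u) g p = (\<Prod>X\<in>orbs (set u) p. g (block u X))"
proof -
 have "{} ~: orbs (set u) p" using orbs_partition[OF discD(2)[OF assms(2)]] by (simp add: partition_on_def)
 thus ?thesis using cprod_disc[OF assms, of "{}"] by simp
qed

lemma mprod_disc:
 assumes "distinct u" "p \<in> disc u" "rot_inv f"
 shows "mprod (set u) f (%c. H (set c)) p = (\<Sum>U\<in>orbs (set u) p. H U * (\<Prod>X\<in>orbs (set u) p - {U}. f (block u X)))"
 unfolding mprod_def
proof (rule sum_congI)
 fix U assume U: "U \<in> orbs (set u) p"
 have "set (support p (SOME i. i \<in> U)) = U" by (rule orbs_choice_support(2)[OF discD(2)[OF assms(2)] U])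
 thus "H (set (support p (SOME i. i \<in> U))) * cprod (set u - U) f p = H U * (\<Prod>X\<in>orbs (set u) p - {U}. f (block u X))"
  using cprod_disc[OF assms, of U] U by (simp only: simp_thms)
qed

theorem NCP_disc_sum:
 fixes L :: "nat list"
 assumes "sorted L" "distinct L" "L ~= []" "rot_inv f" "rot_inv g"
 shows "(\<Sum>P\<in>NCP (set L). (\<Prod>B\<in>kreweras (set L) P. f (block L B)) * (\<Prod>B\<in>P. g (block L B))) = disc_sum f g L"
  "(\<Sum>P\<in>NCP (set L). (\<Prod>B\<in>kreweras (set L) P. f (block L B)) * (\<Sum>U\<in>P. H U * (\<Prod>B\<in>P - {U}. g (block L B))))
    = marked_sum f g (%c. H (set c)) L"
proof -
 have K: "dwt f L p = (\<Prod>B\<in>kreweras (set L) (orbs (set L) p). f (block L B))" if "p \<in> disc L" for p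
  unfolding kreweras_orbs[OF assms(1,2) that] by (rule cprod_disc_full[OF assms(2) kreweras_disc[OF that] assms(4)])
 show "(\<Sum>P\<in>NCP (set L). (\<Prod>B\<in>kreweras (set L) P. f (block L B)) * (\<Prod>B\<in>P. g (block L B))) = disc_sum f g L"
  unfolding disc_sum_def sum.reindex_bij_betw[OF NCP_bij[OF assms(1-3)], symmetric]
  by (intro sum.cong refl) (simp only: K cprod_disc_full[OF assms(2) _ assms(5)])
 show "(\<Sum>P\<in>NCP (set L). (\<Prod>B\<in>kreweras (set L) P. f (block L B)) * (\<Sum>U\<in>P. H U * (\<Prod>B\<in>P - {U}. g (block L B))))
    = marked_sum f g (%c. H (set c)) L"
  unfolding marked_sum_def sum.reindex_bij_betw[OF NCP_bij[OF assms(1-3)], symmetric]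
  by (intro sum.cong refl) (simp only: K mprod_disc[OF assms(2) _ assms(5)])
qed

lemma nths_block:
 assumes "B <= {..<length w}" shows "nths (map h w) B = map h (map ((!) w) (block [0..<length w] B))"
proof -
 have "nths w B = map ((!) w) (filter (%i. i \<in> B) [0..<length w])"
 proof -
  have z: "zip w [0..<length w] = map (%i. (w ! i, i)) [0..<length w]"
   by (rule nth_equalityI) auto
  show ?thesis unfolding nths_def z by (simp add: filter_map comp_def)
 qed
 thus ?thesis by (simp add: nths_map block_def)
qed

lemma kreweras_subset: "B \<in> kreweras S P ==> B <= S"
 unfolding kreweras_def quotient_def by auto

lemma inj_on_nth': "distinct w ==> inj_on ((!) w) (set [0..<length w])"
 by (auto simp: inj_on_def nth_eq_iff_index_eq)

theorem NCP_positions: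
 fixes w :: "'a list" and h :: "'a => 'b" and F G :: "'b list => 'r::comm_ring_1"
 assumes "distinct w" "w ~= []" "rot_inv (%c. F (map h c))" "rot_inv (%c. G (map h c))"
 defines "xs \<equiv> map h w"
 shows "(\<Sum>P\<in>NCP {..<length xs}. (\<Prod>B\<in>kreweras {..<length xs} P. F (nths xs B)) * (\<Prod>B\<in>P. G (nths xs B)))
   = disc_sum (%c. F (map h c)) (%c. G (map h c)) w"
  "(\<Sum>P\<in>NCP {..<length xs}. (\<Prod>B\<in>kreweras {..<length xs} P. F (nths xs B)) *
    (\<Sum>U\<in>P. H (nths xs U) * (\<Prod>B\<in>P - {U}. G (nths xs B))))
   = marked_sum (%c. F (map h c)) (%c. G (map h c)) (%c. H (map h (block w (set c)))) w"
proof -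
 define L where "L = [0..<length w]"
 have L: "sorted L" "distinct L" "L ~= []" "set L = {..<length w}" using assms(2) by (auto simp: L_def)
 let ?F = "%c. F (map h (map ((!) w) c))" and ?G = "%c. G (map h (map ((!) w) c))"
 have rF: "rot_inv ?F" "rot_inv ?G" using rot_inv_map[OF assms(3), of "(!) w"] rot_inv_map[OF assms(4), of "(!) w"] by simp_all
 have n: "nths xs B = map h (map ((!) w) (block L B))" if "B <= {..<length w}" for B
  unfolding xs_def L_def by (rule nths_block[OF that])
 have Psub: "B <= {..<length w}" if "P \<in> NCP {..<length w}" "B \<in> P" for B P using NCP_block_subset[OF that] .
 have len: "length xs = length w" by (simp add: xs_def)
 have inj: "inj_on ((!) w) (set L)" unfolding L_def by (rule inj_on_nth'[OF assms(1)])
 have map: "map ((!) w) L = w" unfolding L_def by (rule map_nth)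
 have "(\<Sum>P\<in>NCP {..<length w}. (\<Prod>B\<in>kreweras {..<length w} P. F (nths xs B)) * (\<Prod>B\<in>P. G (nths xs B)))
  = (\<Sum>P\<in>NCP (set L). (\<Prod>B\<in>kreweras (set L) P. ?F (block L B)) * (\<Prod>B\<in>P. ?G (block L B)))"
  unfolding L(4)
 proof (rule sum_congI)
  fix P assume P: "P \<in> NCP {..<length w}"
  have "(\<Prod>B\<in>kreweras {..<length w} P. F (nths xs B)) = (\<Prod>B\<in>kreweras {..<length w} P. ?F (block L B))"
   by (rule prod.cong[OF refl]) (simp only: n[OF kreweras_subset])
  moreover have "(\<Prod>B\<in>P. G (nths xs B)) = (\<Prod>B\<in>P. ?G (block L B))"
   by (rule prod.cong[OF refl]) (simp only: n[OF Psub[OF P]])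
  ultimately show "(\<Prod>B\<in>kreweras {..<length w} P. F (nths xs B)) * (\<Prod>B\<in>P. G (nths xs B)) =
   (\<Prod>B\<in>kreweras {..<length w} P. ?F (block L B)) * (\<Prod>B\<in>P. ?G (block L B))" by simp
 qed
 also have "... = disc_sum ?F ?G L" by (rule NCP_disc_sum(1)[OF L(1-3) rF])
 also have "... = disc_sum (%c. F (map h c)) (%c. G (map h c)) (map ((!) w) L)"
  by (rule disc_sum_map[symmetric, OF L(2) inj assms(3,4)])
 finally show "(\<Sum>P\<in>NCP {..<length xs}. (\<Prod>B\<in>kreweras {..<length xs} P. F (nths xs B)) * (\<Prod>B\<in>P. G (nths xs B)))
   = disc_sum (%c. F (map h c)) (%c. G (map h c)) w"
  unfolding len map .
 let ?H = "%U. H (map h (map ((!) w) (block L U)))"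
 have "(\<Sum>P\<in>NCP {..<length w}. (\<Prod>B\<in>kreweras {..<length w} P. F (nths xs B)) *
    (\<Sum>U\<in>P. H (nths xs U) * (\<Prod>B\<in>P - {U}. G (nths xs B))))
  = (\<Sum>P\<in>NCP (set L). (\<Prod>B\<in>kreweras (set L) P. ?F (block L B)) * (\<Sum>U\<in>P. ?H U * (\<Prod>B\<in>P - {U}. ?G (block L B))))"
  unfolding L(4)
 proof (rule sum_congI)
  fix P assume P: "P \<in> NCP {..<length w}"
  have "(\<Prod>B\<in>kreweras {..<length w} P. F (nths xs B)) = (\<Prod>B\<in>kreweras {..<length w} P. ?F (block L B))"
   by (rule prod.cong[OF refl]) (simp only: n[OF kreweras_subset])
  moreover have "(\<Sum>U\<in>P. H (nths xs U) * (\<Prod>B\<in>P - {U}. G (nths xs B))) = (\<Sum>U\<in>P. ?H U * (\<Prod>B\<in>P - {U}. ?G (block L B)))"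
  proof (rule sum_congI)
   fix U assume U: "U \<in> P"
   have "(\<Prod>B\<in>P - {U}. G (nths xs B)) = (\<Prod>B\<in>P - {U}. ?G (block L B))"
   proof (rule prod.cong[OF refl])
    fix B assume "B \<in> P - {U}"
    hence "B \<in> P" by simp
    thus "G (nths xs B) = ?G (block L B)" by (simp only: n[OF Psub[OF P]])
   qed
   thus "H (nths xs U) * (\<Prod>B\<in>P - {U}. G (nths xs B)) = ?H U * (\<Prod>B\<in>P - {U}. ?G (block L B))"
    by (simp only: n[OF Psub[OF P U]])
  qed
  ultimately show "(\<Prod>B\<in>kreweras {..<length w} P. F (nths xs B)) * (\<Sum>U\<in>P. H (nths xs U) * (\<Prod>B\<in>P - {U}. G (nths xs B))) =
   (\<Prod>B\<in>kreweras {..<length w} P. ?F (block L B)) * (\<Sum>U\<in>P. ?H U * (\<Prod>B\<in>P - {U}. ?G (block L B)))" by simp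
 qed
 also have "... = marked_sum ?F ?G (%c. ?H (set c)) L" by (rule NCP_disc_sum(2)[OF L(1-3) rF])
 also have "... = marked_sum ?F ?G (%c. H (map h (block w (set (map ((!) w) c))))) L"
 proof (rule marked_sum_cong)
  fix c assume c: "set c <= set L"
  have "block w (set (map ((!) w) c)) = map ((!) w) (block L (set c))"
  proof -
   have "block (map ((!) w) L) ((!) w ` set c) = map ((!) w) (filter (%i. w ! i \<in> (!) w ` set c) L)"
    unfolding block_def by (simp add: filter_map comp_def)
   also have "filter (%i. w ! i \<in> (!) w ` set c) L = block L (set c)"
    unfolding block_def by (rule filter_cong[OF refl]) (use inj c in "auto simp: inj_on_def subset_iff")
   finally show ?thesis by (simp add: map)
  qed
  thus "?H (set c) = H (map h (block w (set (map ((!) w) c))))" by simp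
 qed
 also have "... = marked_sum (%c. F (map h c)) (%c. G (map h c)) (%c. H (map h (block w (set c)))) (map ((!) w) L)"
  by (rule marked_sum_map[symmetric, OF L(2) inj assms(3,4)]) (simp add: rot_inv_def)
 finally show "(\<Sum>P\<in>NCP {..<length xs}. (\<Prod>B\<in>kreweras {..<length xs} P. F (nths xs B)) *
    (\<Sum>U\<in>P. H (nths xs U) * (\<Prod>B\<in>P - {U}. G (nths xs B))))
   = marked_sum (%c. F (map h c)) (%c. G (map h c)) (%c. H (map h (block w (set c)))) w"
  unfolding len map .
qed

section \<open>Free cumulants of cyclically invariant functions\<close>

lemma block_rotate1: "block (rotate1 w) Y = block w Y \<or> block (rotate1 w) Y = rotate1 (block w Y)"
 by (cases w) (auto simp: block_def)

lemma length_block_proper: "distinct w ==> \<not> set w <= Y ==> length (block w Y) < length w"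
 unfolding block_def by (auto intro: length_filter_less)

lemma disc_full_orbit:
 assumes "distinct w" "w ~= []" "p \<in> disc w" "set w \<in> orbs (set w) p" shows "p = cl w"
proof -
 obtain x where x: "x \<in> set w" "set w = orbit p x" using assms(4) by (auto simp: orbs_def)
 have "filter (%j. j \<in> orbit p x) w = w" using x(2) by (simp add: filter_id_conv)
 hence "cycle_list p w" using disc_sorted[OF assms(1,3) x(1)] by simp
 thus ?thesis by (rule cl_eqI) (use permutes_not_in[OF discD(1)[OF assms(3)]] in simp)
qed

text \<open>Rotating the positions permutes the planar permutations and keeps the one with a single cycle. A block is
moved to the same list or to its rotation, so the induction hypothesis applies to all proper blocks.\<close>

theorem free_cumulant_rotate1:
 fixes f :: "'a list => complex"
 assumes "!!xs. set xs <= S ==> f (rotate1 xs) = f xs" "set xs <= S"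
 shows "free_cumulant f (rotate1 xs) = free_cumulant f xs"
 using assms(2)
proof (induction "length xs" arbitrary: xs rule: less_induct)
 case less
 show ?case
 proof (cases "xs = []")
  case False
  define n where "n = length xs"
  define w where "w = [0..<n]"
  have w: "distinct w" "w ~= []" "set w = {..<n}" "length w = n" "sorted w" using False by (auto simp: w_def n_def)
  let ?k = "free_cumulant f"
  have fc: "?k ys = f ys - (\<Sum>p\<in>disc w - {cl w}. \<Prod>X\<in>orbs (set w) p. ?k (map ((!) ys) (block w X)))"
   if len: "length ys = n" for ys
  proof -
   have one: "orbs (set w) (cl w) = {{..<n}}" using orbs_cycle_list[OF cycle_list_cl[OF w(1,2)]] w(3) by simp
   have cin: "cl w \<in> disc w" by (rule cl_in_disc[OF w(1,2)])
   have nn: "{..<n} ~= {}" using w(2,3) by auto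
   have bij: "bij_betw (orbs (set w)) (disc w - {cl w}) (NCP {..<n} - {{{..<n}}})"
    using bij_betw_DiffI[OF NCP_bij[OF w(5,1,2)], of "{cl w}" "{{{..<n}}}"] cin one
    using full_in_NCP[of "{..<n}", OF nn] w(3) by (simp add: bij_betw_def)
   have "(\<Sum>P\<in>NCP {..<n} - {{{..<n}}}. \<Prod>B\<in>P. ?k (nths ys B)) = (\<Sum>p\<in>disc w - {cl w}. \<Prod>X\<in>orbs (set w) p. ?k (nths ys X))"
    by (rule sum.reindex_bij_betw[OF bij, symmetric])
   also have "... = (\<Sum>p\<in>disc w - {cl w}. \<Prod>X\<in>orbs (set w) p. ?k (map ((!) ys) (block w X)))"
   proof (intro sum.cong prod.cong refl)
    fix p X assume "p \<in> disc w - {cl w}" "X \<in> orbs (set w) p"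
    hence "X <= {..<length ys}" using orbit_sub[OF discD(2), of p w] w(3) len by (auto simp: orbs_def)
    from nths_block[OF this, of "%x. x"] show "?k (nths ys X) = ?k (map ((!) ys) (block w X))" by (simp add: w_def len)
   qed
   finally show ?thesis using free_cumulant.simps[of f ys] len by simp
  qed
  let ?h = "cl w"
  have inj: "inj_on ?h (set w)" using permutes_inj[OF cl_permutes[of w]] inj_on_subset by blast
  have mh: "map ?h w = rotate1 w" using cycle_list_cl[OF w(1,2)] by (simp add: cycle_list_def)
  have hw: "?h ` set w = set w" using permutes_image[OF cl_permutes[of w]] .
  have dr: "disc (rotate1 w) = disc w" using disc_rotate[OF w(1), of 1] by simp
  define \<phi> where "\<phi> = relabel ?h (set w)"
  have \<phi>: "bij_betw \<phi> (disc w) (disc w)" using relabel_disc_bij[OF w(1) inj] unfolding mh dr \<phi>_def .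
  have \<phi>o: "orbs (set w) (\<phi> p) = (`) ?h ` orbs (set w) p" "inj_on ((`) ?h) (orbs (set w) p)" if "p \<in> disc w" for p
   using relabel_orbs[OF discD(2)[OF that] inj relabel_apply[OF inj, of _ p]] unfolding hw \<phi>_def by auto
  have \<phi>c: "\<phi> (cl w) = cl w"
  proof (rule disc_full_orbit[OF w(1,2)])
   show "\<phi> (cl w) \<in> disc w" using bij_betwE[OF \<phi>] cl_in_disc[OF w(1,2)] by blast
   show "set w \<in> orbs (set w) (\<phi> (cl w))"
    unfolding \<phi>o(1)[OF cl_in_disc[OF w(1,2)]] orbs_cycle_list[OF cycle_list_cl[OF w(1,2)]] using hw by simp
  qed
  have \<phi>': "bij_betw \<phi> (disc w - {cl w}) (disc w - {cl w})"
   using bij_betw_DiffI[OF \<phi>, of "{cl w}" "{cl w}"] cl_in_disc[OF w(1,2)] \<phi>c by (simp add: bij_betw_def)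
  have nth: "rotate1 xs ! i = xs ! ?h i" if "i \<in> set w" for i
  proof -
   have i: "i < n" using that w by simp
   have "?h (w ! i) = w ! (Suc i mod n)" using cycle_list_nth[OF cycle_list_cl[OF w(1,2)], of i] i w(4) by simp
   moreover have "w ! i = i" "w ! (Suc i mod n) = Suc i mod n" using i by (simp_all add: w_def)
   ultimately show ?thesis using i by (simp add: nth_rotate1 n_def)
  qed
  have bl: "map ?h (block w X) = block (rotate1 w) (?h ` X)" if "X <= set w" for X
  proof -
   have "block (map ?h w) (?h ` X) = map ?h (filter (%i. ?h i \<in> ?h ` X) w)" by (simp add: block_def filter_map comp_def)
   also have "filter (%i. ?h i \<in> ?h ` X) w = block w X"
    unfolding block_def by (rule filter_cong[OF refl]) (use inj that in "auto simp: inj_on_def subset_iff")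
   finally show ?thesis by (simp add: mh)
  qed
  have "(\<Sum>p\<in>disc w - {cl w}. \<Prod>X\<in>orbs (set w) p. ?k (map ((!) (rotate1 xs)) (block w X)))
   = (\<Sum>p\<in>disc w - {cl w}. \<Prod>Y\<in>orbs (set w) (\<phi> p). ?k (map ((!) xs) (block (rotate1 w) Y)))"
  proof (rule sum_congI)
   fix p assume p: "p \<in> disc w - {cl w}"
   hence pd: "p \<in> disc w" by simp
   have "(\<Prod>X\<in>orbs (set w) p. ?k (map ((!) (rotate1 xs)) (block w X))) = (\<Prod>X\<in>orbs (set w) p. ?k (map ((!) xs) (block (rotate1 w) (?h ` X))))"
   proof (rule prod.cong[OF refl])
    fix X assume "X \<in> orbs (set w) p"
    hence X: "X <= set w" using orbit_sub[OF discD(2)[OF pd]] by (auto simp: orbs_def)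
    have "map ((!) (rotate1 xs)) (block w X) = map ((!) xs) (map ?h (block w X))"
     using nth by (auto simp: block_def)
    thus "?k (map ((!) (rotate1 xs)) (block w X)) = ?k (map ((!) xs) (block (rotate1 w) (?h ` X)))"
     using bl[OF X] by simp
   qed
   thus "(\<Prod>X\<in>orbs (set w) p. ?k (map ((!) (rotate1 xs)) (block w X))) = (\<Prod>Y\<in>orbs (set w) (\<phi> p). ?k (map ((!) xs) (block (rotate1 w) Y)))"
    unfolding \<phi>o(1)[OF pd] using prod.reindex[OF \<phi>o(2)[OF pd], of "%Y. ?k (map ((!) xs) (block (rotate1 w) Y))"] by simp
  qed
  also have "... = (\<Sum>q\<in>disc w - {cl w}. \<Prod>Y\<in>orbs (set w) q. ?k (map ((!) xs) (block (rotate1 w) Y)))"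
   by (rule sum.reindex_bij_betw[OF \<phi>'])
  also have "... = (\<Sum>q\<in>disc w - {cl w}. \<Prod>Y\<in>orbs (set w) q. ?k (map ((!) xs) (block w Y)))"
  proof (intro sum.cong prod.cong refl)
   fix q Y assume q: "q \<in> disc w - {cl w}" and Y: "Y \<in> orbs (set w) q"
   have Ysub: "Y <= set w" using Y orbit_sub[OF discD(2), of q w] q by (auto simp: orbs_def)
   have "Y ~= set w" using disc_full_orbit[OF w(1,2), of q] q Y by auto
   hence l: "length (map ((!) xs) (block w Y)) < length xs"
    using length_block_proper[OF w(1), of Y] Ysub w(4) n_def by auto
   have s: "set (map ((!) xs) (block w Y)) <= S"
    using less.prems w(3) n_def by (auto simp: block_def)
   show "?k (map ((!) xs) (block (rotate1 w) Y)) = ?k (map ((!) xs) (block w Y))"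
    using block_rotate1[of w Y] less.hyps[OF l s] by (auto simp: rotate1_map)
  qed
  finally show ?thesis using fc[of xs] fc[of "rotate1 xs"] assms(1)[OF less.prems] by (simp add: n_def)
 qed simp
qed

section \<open>Annular non-crossing permutations as planar permutations\<close>

lemma cyclic_succ_sorted:
 assumes "sorted c" "distinct c" "m < length c"
 shows "cyclic_succ (set c) (c ! m) = c ! (Suc m mod length c)"
proof -
 have sw: "c ! i < c ! j" if "i < j" "j < length c" for i j
  using strict_sorted_iff[THEN iffD2, OF conjI[OF assms(1,2)]] that by (metis sorted_wrt_nth_less)
 show ?thesis
 proof (cases "Suc m < length c")
  case True
  have "c ! Suc m \<in> set c" "c ! m < c ! Suc m" using True sw[of m "Suc m"] by auto
  moreover have "c ! Suc m \<le> j" if "j \<in> set c" "c ! m < j" for j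
  proof -
   obtain i where i: "i < length c" "j = c ! i" using \<open>j \<in> set c\<close> by (auto simp: in_set_conv_nth)
   have "m < i" using that(2) i sw[of i m] assms(3) by (metis less_asym' linorder_neqE_nat)
   thus ?thesis using i sorted_nth_mono[OF assms(1), of "Suc m" i] by simp
  qed
  ultimately have "Min {j \<in> set c. c ! m < j} = c ! Suc m" by (intro Min_eqI) auto
  thus ?thesis using True \<open>c ! Suc m \<in> set c\<close> \<open>c ! m < c ! Suc m\<close> by (auto simp: cyclic_succ_def)
 next
  case False
  hence m: "Suc m = length c" using assms(3) by simp
  have "\<not> c ! m < j" if jc: "j \<in> set c" for j
  proof -
   obtain i where i: "i < length c" "j = c ! i" using jc by (auto simp: in_set_conv_nth)
   hence "c ! i \<le> c ! m" using sorted_nth_mono[OF assms(1), of i m] m by simp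
   thus ?thesis using i by simp
  qed
  moreover have "Min (set c) = c ! 0"
  proof (rule Min_eqI)
   fix j assume "j \<in> set c"
   then obtain i where i: "i < length c" "j = c ! i" by (auto simp: in_set_conv_nth)
   thus "c ! 0 \<le> j" using sorted_nth_mono[OF assms(1), of 0 i] by simp
  next
   show "c ! 0 \<in> set c" using assms(3) by (intro nth_mem) linarith
  qed simp
  ultimately show ?thesis using m by (auto simp: cyclic_succ_def)
 qed
qed

lemma disc_cyclic_succ:
 fixes L :: "nat list"
 assumes "sorted L" "distinct L" "q \<in> disc L" "i \<in> set L"
 shows "q i = cyclic_succ (orbit q i) i"
proof -
 define c where "c = filter (%j. j \<in> orbit q i) L"
 have c: "cycle_list q c" unfolding c_def by (rule disc_sorted[OF assms(2-4)])
 have s: "sorted c" "distinct c" using assms(1,2) by (simp_all add: c_def sorted_wrt_filter)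
 have i: "i \<in> set c" using assms(4) in_own_orbit[OF discD(2)[OF assms(3)]] by (simp add: c_def)
 then obtain m where m: "m < length c" "i = c ! m" by (auto simp: in_set_conv_nth)
 have "orbit q i = set c" by (rule cycle_list_orbit[OF c i])
 thus ?thesis using cyclic_succ_sorted[OF s m(1)] cycle_list_nth[OF c m(1)] m(2) by simp
qed

text \<open>Since a planar permutation runs through its cycles in the order of the word, it is the cyclic successor on
the blocks of its own partition.\<close>

theorem disc_iff_NCP:
 assumes "distinct w" "w ~= []" "p permutes set w"
 shows "(\<exists>P\<in>NCP {..<length w}. \<forall>B\<in>P. \<forall>i\<in>B. p (w ! i) = w ! cyclic_succ B i) \<longleftrightarrow> p \<in> disc w"
proof -
 define L where "L = [0..<length w]"
 have L: "sorted L" "distinct L" "L ~= []" "set L = {..<length w}" using assms(2) by (auto simp: L_def)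
 have inj: "inj_on ((!) w) (set L)" unfolding L_def by (rule inj_on_nth'[OF assms(1)])
 have map: "map ((!) w) L = w" unfolding L_def by (rule map_nth)
 have im: "(!) w ` set L = set w" using map by (metis set_map)
 show ?thesis
 proof
  assume "\<exists>P\<in>NCP {..<length w}. \<forall>B\<in>P. \<forall>i\<in>B. p (w ! i) = w ! cyclic_succ B i"
  then obtain P where P: "P \<in> NCP (set L)" "!!B i. B \<in> P ==> i \<in> B ==> p (w ! i) = w ! cyclic_succ B i"
   unfolding L(4) by blast
  obtain q where q: "q \<in> disc L" "orbs (set L) q = P" using NCP_from_disc[OF L(1-3) P(1)] by blast
  have e: "p (w ! i) = w ! q i" if "i \<in> set L" for i
  proof -
   have "orbit q i \<in> P" "i \<in> orbit q i"
    using q(2) that in_own_orbit[OF discD(2)[OF q(1)]] by (auto simp: orbs_def)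
   thus ?thesis using P(2) disc_cyclic_succ[OF L(1,2) q(1) that] by simp
  qed
  have "p = relabel ((!) w) (set L) q"
  proof
   fix x show "p x = relabel ((!) w) (set L) q x"
   proof (cases "x \<in> set w")
    case True
    then obtain i where i: "i \<in> set L" "x = w ! i" using im by blast
    thus ?thesis using e relabel_apply[OF inj i(1), of q] by simp
   next
    case False
    thus ?thesis using permutes_not_in[OF assms(3)] unfolding relabel_def im by simp
   qed
  qed
  thus "p \<in> disc w" using relabel_disc[OF L(2) inj discD(1)[OF q(1)]] q(1) map by simp
 next
  assume "p \<in> disc w"
  hence "p \<in> relabel ((!) w) (set L) ` disc L"
   using bij_betw_imp_surj_on[OF relabel_disc_bij[OF L(2) inj]] map by simp
  then obtain q where q: "q \<in> disc L" "p = relabel ((!) w) (set L) q" by blast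
  have "orbs (set L) q \<in> NCP {..<length w}" using disc_orbs_NCP[OF L(1,2) q(1)] L(4) by simp
  moreover have "p (w ! i) = w ! cyclic_succ B i" if B: "B \<in> orbs (set L) q" "i \<in> B" for B i
  proof -
   obtain x where x: "x \<in> set L" "B = orbit q x" using B(1) by (auto simp: orbs_def)
   have i: "i \<in> set L" using orbit_sub[OF discD(2)[OF q(1)] x(1)] B(2) x(2) by blast
   have "B = orbit q i" using orbit_eq_iff[OF discD(4)[OF q(1)], of i x] B(2) x(2) by simp
   thus ?thesis using disc_cyclic_succ[OF L(1,2) q(1) i] relabel_apply[OF inj i, of q] q(2) by simp
  qed
  ultimately show "\<exists>P\<in>NCP {..<length w}. \<forall>B\<in>P. \<forall>i\<in>B. p (w ! i) = w ! cyclic_succ B i" by blast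
 qed
qed

lemma cl_rotate_append:
 assumes "distinct (u @ v)" "a < length u" "b < length v"
 shows "cl (rotate a u @ rotate b v) = swp (u ! a) (v ! b) o (cl u o cl v)"
proof -
 have ne: "u ~= []" "v ~= []" using assms(2,3) by auto
 hence "hd (rotate a u) = u ! a" "hd (rotate b v) = v ! b" using assms(2,3) by (simp_all add: hd_rotate_conv_nth)
 thus ?thesis using cl_append[of "rotate a u" "rotate b v"] assms(1) ne by (simp add: cl_rotate)
qed

text \<open>A planar permutation of the slit annulus is one of the annulus as soon as it joins the circles,
 because slitting changes the number of cycles of the complement by one; conversely the slit can
 always be placed next to a step of the permutation that leads from the outer to the inner circle.\<close>

theorem annulus_iff_slit:
 assumes "distinct (u @ v)" "p permutes (set u Un set v)"
 shows "p \<in> annulus u v \<longleftrightarrow> (\<exists>a<length u. \<exists>b<length v. p \<in> disc (rotate a u @ rotate b v)) \<and> (\<exists>i\<in>set u. p i \<in> set v)"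
proof -
 let ?S = "set u Un set v" and ?g = "cl u o cl v"
 have p: "perm_on ?S p" using assms(2) by (simp add: permutes_perm_on)
 have g: "perm_on ?S ?g" by (rule perm_on_comp_cl) auto
 have K: "perm_on ?S (inv p o ?g)" by (rule perm_on_compose[OF perm_on_inv[OF p] g])
 have kr: "inv p o cl (rotate a u @ rotate b v) = swp (inv p (u ! a)) (inv p (v ! b)) o (inv p o ?g)"
  if "a < length u" "b < length v" for a b
  unfolding cl_rotate_append[OF assms(1) that]
  using comp_swp[OF perm_onD(2)[OF perm_on_inv[OF p]], of "u ! a" "v ! b"] by (metis comp_assoc)
 have ds: "p \<in> disc (rotate a u @ rotate b v) \<longleftrightarrow>
   ncyc ?S p + ncyc ?S (swp (inv p (u ! a)) (inv p (v ! b)) o (inv p o ?g)) = Suc (length u + length v)"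
  if "a < length u" "b < length v" for a b
  using assms(2) kr[OF that] by (simp add: disc_def)
 show ?thesis
 proof
  assume pa: "p \<in> annulus u v"
  then obtain i where i: "i \<in> set u" "p i \<in> set v" using annulusD(5) by blast
  have gi: "?g i \<in> set u" using i(1) assms(1) cl_comp_apply(1)[of u v i] permutes_in_image[OF cl_permutes[of u]] by simp
  obtain a b where ab: "a < length u" "u ! a = ?g i" "b < length v" "v ! b = p i" using gi i(2) by (auto simp: in_set_conv_nth)
  let ?x = "inv p (u ! a)" and ?y = "inv p (v ! b)"
  have xy: "?y = i" "?x = (inv p o ?g) i" using ab perm_on_inv_f(1)[OF p] by simp_all
  have "?x ~= ?y" using ab i gi assms(1) perm_on_inv_f[OF p] by (metis IntI distinct_append empty_iff)
  moreover have "?y \<in> orbit (inv p o ?g) ?x"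
   unfolding xy orbit_sym[OF perm_onD(2)[OF K], of i] by (rule orbit.base)
  moreover have "?x \<in> ?S" by (rule perm_on_inv_in[OF p]) (use gi ab in auto)
  ultimately have "ncyc ?S (swp ?x ?y o (inv p o ?g)) = Suc (ncyc ?S (inv p o ?g))" using ncyc_split(1)[OF K] by blast
  hence "p \<in> disc (rotate a u @ rotate b v)" using ds[OF ab(1,3)] annulusD(3)[OF pa] by simp
  thus "(\<exists>a<length u. \<exists>b<length v. p \<in> disc (rotate a u @ rotate b v)) \<and> (\<exists>i\<in>set u. p i \<in> set v)" using ab i by blast
 next
  assume "(\<exists>a<length u. \<exists>b<length v. p \<in> disc (rotate a u @ rotate b v)) \<and> (\<exists>i\<in>set u. p i \<in> set v)"
  then obtain a b i where ab: "a < length u" "b < length v" "p \<in> disc (rotate a u @ rotate b v)" "i \<in> set u" "p i \<in> set v" by blast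
  let ?x = "inv p (u ! a)" and ?y = "inv p (v ! b)"
  have "?x \<in> ?S" "?y \<in> ?S" using perm_on_inv_in[OF p] ab(1,2) by auto
  hence "ncyc ?S (swp ?x ?y o (inv p o ?g)) \<le> Suc (ncyc ?S (inv p o ?g))" by (rule ncyc_swp_le[OF K])
  hence "ncyc ?S p + ncyc ?S (inv p o ?g) = length u + length v"
   using ds[OF ab(1,2)] ab(3) annulus_bound[OF assms(1) p ab(4,5)] by linarith
  thus "p \<in> annulus u v" using assms(2) ab by (auto simp: annulus_def)
 qed
qed

theorem annular_NCP_annulus: "annular_NCP k l = annulus [0..<k] [k..<k + l]"
proof -
 let ?u = "[0..<k]" and ?v = "[k..<k + l]"
 have S: "set ?u Un set ?v = {..<k + l}" by auto
 have d: "distinct (?u @ ?v)" by auto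
 have "p \<in> annular_NCP k l \<longleftrightarrow> p \<in> annulus ?u ?v" if p: "p permutes {..<k + l}" for p
 proof -
  have pp: "p permutes (set ?u Un set ?v)" using p S by simp
  have D: "(\<exists>P\<in>NCP {..<k + l}. \<forall>B\<in>P. \<forall>i\<in>B. p (w ! i) = w ! cyclic_succ B i) \<longleftrightarrow> p \<in> disc w"
   if "a < k" "b < l" "w = rotate a ?u @ rotate b ?v" for a b w
  proof -
   have "distinct w" "w ~= []" "length w = k + l" "set w = {..<k + l}" using that d S by auto
   thus ?thesis using disc_iff_NCP[of w p] p by simp
  qed
  have C: "(\<exists>i<k. \<exists>j\<in>{k..<k + l}. j \<in> orbit p i) \<longleftrightarrow> (\<exists>i\<in>set ?u. p i \<in> set ?v)"
  proof
   assume "\<exists>i<k. \<exists>j\<in>{k..<k + l}. j \<in> orbit p i"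
   then obtain i j where ij: "i < k" "k \<le> j" "j < k + l" "j \<in> orbit p i" by auto
   show "\<exists>i\<in>set ?u. p i \<in> set ?v"
   proof (rule ccontr)
    assume "\<not> (\<exists>i\<in>set ?u. p i \<in> set ?v)"
    hence c: "p i \<in> {..<k}" if "i \<in> {..<k}" for i using that permutes_in_image[OF p, of i] by force
    have "perm_on {..<k} p" by (rule perm_on_of_image_subset[OF p _ _ c]) auto
    thus False using orbit_sub[of "{..<k}" p i] ij by auto
   qed
  next
   assume "\<exists>i\<in>set ?u. p i \<in> set ?v"
   then obtain i where "i < k" "p i \<in> {k..<k + l}" by auto
   thus "\<exists>i<k. \<exists>j\<in>{k..<k + l}. j \<in> orbit p i" using orbit.base[of p i] by blast
  qed
  show ?thesis unfolding annulus_iff_slit[OF d pp] annular_NCP_def mem_Collect_eq Let_def C length_upt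
   using p by (simp add: D[OF _ _ refl] cong: conj_cong)
 qed
 moreover have "p permutes {..<k + l}" if "p \<in> annular_NCP k l \<or> p \<in> annulus ?u ?v" for p
  using that annulusD(1)[of p ?u ?v] unfolding S by (auto simp: annular_NCP_def)
 ultimately show ?thesis by blast
qed

lemma annulus_rotation_cl: "annulus_rotation k l = cl [0..<k] o cl [k..<k + l]"
proof
 fix i
 have dis: "set [0..<k] Int set [k..<k + l] = {}" by auto
 consider "i < k" | "k \<le> i" "i < k + l" | "k + l \<le> i" by linarith
 thus "annulus_rotation k l i = (cl [0..<k] o cl [k..<k + l]) i"
 proof cases
  case 1
  have "cl [0..<k] ([0..<k] ! i) = [0..<k] ! (Suc i mod k)"
   using cycle_list_nth[OF cycle_list_cl[of "[0..<k]"], of i] 1 by simp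
  moreover have "Suc i mod k < k" using 1 by simp
  ultimately show ?thesis using 1 cl_comp_apply(1)[OF dis, of i] by (simp add: annulus_rotation_def)
 next
  case 2
  have "cl [k..<k + l] ([k..<k + l] ! (i - k)) = [k..<k + l] ! (Suc (i - k) mod l)"
   using cycle_list_nth[OF cycle_list_cl[of "[k..<k + l]"], of "i - k"] 2 by simp
  moreover have "Suc (i - k) mod l < l" using 2 by simp
  ultimately show ?thesis using 2 cl_comp_apply(2)[OF dis, of i] by (simp add: annulus_rotation_def)
 next
  case 3
  thus ?thesis using cl_comp_apply(3)[OF dis, of i] by (simp add: annulus_rotation_def)
 qed
qed

text \<open>Each cycle has exactly one least element.\<close>

lemma cprod_cycles_upto:
 assumes "perm_on {..<n} p" "rot_inv f"
 shows "cprod {..<n} f p = (\<Prod>c\<in>cycles_upto n p. f c)"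
proof -
 let ?I = "{i. i < n \<and> (\<forall>j. i \<le> (p ^^ j) i)}"
 have perm: "permutation p" using perm_onD(2)[OF assms(1)] .
 have fin: "finite X" "X ~= {}" "Min X \<in> X" "orbit p (Min X) = X" "Min X < n" if X: "X \<in> orbs {..<n} p" for X
 proof -
  obtain x where x: "x < n" "X = orbit p x" using X by (auto simp: orbs_def)
  hence sub: "X <= {..<n}" using orbit_sub[OF assms(1), of x] by simp
  show 1: "finite X" using sub finite_subset by blast
  show 2: "X ~= {}" using x in_own_orbit[OF assms(1)] by blast
  show 3: "Min X \<in> X" using 1 2 by (rule Min_in)
  show "orbit p (Min X) = X" using orbit_eq_iff[OF perm, of "Min X" x] 3 x by simp
  show "Min X < n" using 3 sub by blast
 qed
 have orb: "orbit p i = {(p ^^ j) i |j. True}" for i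
  by (rule orbit_altdef_self_in[OF permutation_self_in_orbit[OF perm]])
 have I: "?I = {i. i < n \<and> i = Min (orbit p i)}"
 proof -
  have "(\<forall>j. i \<le> (p ^^ j) i) \<longleftrightarrow> i = Min (orbit p i)" if "i < n" for i
  proof -
   have X: "orbit p i \<in> orbs {..<n} p" using that by (auto simp: orbs_def)
   have "i = Min (orbit p i) \<longleftrightarrow> (\<forall>x\<in>orbit p i. i \<le> x)"
    using fin(1,3)[OF X] in_own_orbit[OF assms(1), of i] that
    by (metis Min.coboundedI Min_eqI lessThan_iff)
   thus ?thesis unfolding orb by auto
  qed
  thus ?thesis by blast
 qed
 have bij: "bij_betw Min (orbs {..<n} p) ?I"
 proof (rule bij_betwI[where g = "orbit p"])
  show "Min \<in> orbs {..<n} p \<rightarrow> ?I" unfolding I using fin(4,5) by auto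
  show "orbit p \<in> ?I \<rightarrow> orbs {..<n} p" by (auto simp: orbs_def)
  show "orbit p (Min X) = X" if "X \<in> orbs {..<n} p" for X by (rule fin(4)[OF that])
  show "Min (orbit p i) = i" if "i \<in> ?I" for i using that unfolding I by simp
 qed
 have "cprod {..<n} f p = (\<Prod>X\<in>orbs {..<n} p. f (support p (Min X)))"
  by (rule cprod_choice[OF assms]) (use cycle_support(1)[OF perm] set_support[OF perm] fin(4) in auto)
 also have "... = (\<Prod>i\<in>?I. f (support p i))" by (rule prod.reindex_bij_betw[OF bij])
 also have "... = (\<Prod>c\<in>cycles_upto n p. f c)"
 proof -
  have "inj_on (support p) ?I" by (rule inj_on_inverseI[where g = hd]) (rule cycle_support(2)[OF perm])
  thus ?thesis unfolding cycles_upto_def by (simp add: prod.reindex)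
 qed
 finally show ?thesis .
qed

section \<open>Moments and cumulants as sums over permutations\<close>

lemma circ_sum_marked:
 assumes "distinct v"
 shows "circ_sum \<tau> \<kappa> \<kappa>\<kappa> u v = annulus_sum \<tau> \<kappa> u v +
  marked_sum \<tau> \<kappa> (%d. marked_sum \<tau> \<kappa> (%c. \<kappa>\<kappa> (block u (set c)) (block v (set d))) u) v"
proof -
 have "(\<Sum>Y\<in>orbs (set v) q. cprod (set v - Y) \<kappa> q * H Y) = mprod (set v) \<kappa> (%d. H (set d)) q" if "q \<in> disc v" for q H
  unfolding mprod_def
 proof (rule sum_congI)
  fix Y assume "Y \<in> orbs (set v) q"
  thus "cprod (set v - Y) \<kappa> q * H Y = H (set (support q (SOME i. i \<in> Y))) * cprod (set v - Y) \<kappa> q"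
   using orbs_choice_support(2)[OF discD(2)[OF that]] by (simp add: mult.commute)
 qed
 thus ?thesis unfolding circ_sum_def marked_sum_def[of _ _ _ v] by simp
qed

lemma sum_marked_NCP_pairs:
 assumes "finite S" "finite T"
 shows "(\<Sum>(P, U, Q, V)\<in>marked_NCP_pairs S T. f P U Q V) = (\<Sum>Q\<in>NCP T. \<Sum>V\<in>Q. \<Sum>P\<in>NCP S. \<Sum>U\<in>P. f P U Q V)"
proof -
 have fin: "finite Q" if "Q \<in> NCP R" "finite R" for Q R
  using that by (auto simp: NCP_def intro: finite_elements)
 let ?A = "SIGMA Q:NCP T. SIGMA V:Q. SIGMA P:NCP S. P"
 have "(\<Sum>Q\<in>NCP T. \<Sum>V\<in>Q. \<Sum>P\<in>NCP S. \<Sum>U\<in>P. f P U Q V) = (\<Sum>(Q, V, P, U)\<in>?A. f P U Q V)"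
 proof (subst sum.Sigma[symmetric])
  show "finite (NCP T)" by (rule finite_NCP[OF assms(2)])
  show "\<forall>Q\<in>NCP T. finite (SIGMA V:Q. SIGMA P:NCP S. P)"
   using fin assms by (auto intro!: finite_SigmaI finite_NCP)
  show "(\<Sum>Q\<in>NCP T. \<Sum>V\<in>Q. \<Sum>P\<in>NCP S. \<Sum>U\<in>P. f P U Q V) = (\<Sum>Q\<in>NCP T. \<Sum>(V, P, U)\<in>(SIGMA V:Q. SIGMA P:NCP S. P). f P U Q V)"
  proof (rule sum_congI)
   fix Q assume Q: "Q \<in> NCP T"
   show "(\<Sum>V\<in>Q. \<Sum>P\<in>NCP S. \<Sum>U\<in>P. f P U Q V) = (\<Sum>(V, P, U)\<in>(SIGMA V:Q. SIGMA P:NCP S. P). f P U Q V)"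
    using fin assms Q by (subst sum.Sigma[symmetric]) (auto simp: sum.Sigma finite_NCP intro!: finite_SigmaI sum.cong)
  qed
 qed
 also have "... = (\<Sum>(P, U, Q, V)\<in>marked_NCP_pairs S T. f P U Q V)"
  by (rule sum.reindex_bij_witness[of _ "%(P, U, Q, V). (Q, V, P, U)" "%(Q, V, P, U). (P, U, Q, V)"])
   (auto simp: marked_NCP_pairs_def)
 finally show ?thesis by simp
qed

lemma NCP_Nil: "P \<in> NCP {} ==> P = {}"
 by (auto simp: NCP_def partition_on_def)

lemma rot_inv_one: "rot_inv (%_. 1)" by (simp add: rot_inv_def)

theorem moment_disc_sum:
 assumes "distinct w" "w ~= []" "rot_inv (%c. free_cumulant f (map h c))"
 shows "f (map h w) = disc_sum (%_. 1) (%c. free_cumulant f (map h c)) w"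
proof -
 have "f (map h w) = (\<Sum>P\<in>NCP {..<length (map h w)}. (\<Prod>B\<in>kreweras {..<length (map h w)} P. (%_. 1) (nths (map h w) B)) *
   (\<Prod>B\<in>P. free_cumulant f (nths (map h w) B)))"
  using moment_free_cumulant[of "map h w" f] assms(2) by simp
 also have "... = disc_sum (%c. (%_. 1) (map h c)) (%c. free_cumulant f (map h c)) w"
  by (rule NCP_positions(1)[OF assms(1,2) _ assms(3)]) (rule rot_inv_one)
 finally show ?thesis by simp
qed

text \<open>The defining relation of the second-order cumulants, with all traces equal to one.\<close>

theorem second_moment_circ_sum:
 fixes f :: "'b list => complex" and h :: "'a => 'b"
 assumes "distinct (u @ v)" "u ~= []" "v ~= []" "rot_inv (%c. free_cumulant f (map h c))"
 shows "f2 (map h u) (map h v) = circ_sum (%_. 1) (%c. free_cumulant f (map h c))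
   (%a b. second_order_cumulant f f2 (map h a) (map h b)) u v"
proof -
 let ?xs = "map h u" and ?ys = "map h v" and ?k = "free_cumulant f" and ?kk = "second_order_cumulant f f2"
 let ?K = "length u" and ?L = "length v"
 have d: "distinct u" "distinct v" using assms(1) by simp_all

 have ann: "(\<Sum>p\<in>annular_NCP ?K ?L. \<Prod>c\<in>cycles_upto (?K + ?L) p. ?k (map ((!) (?xs @ ?ys)) c)) = annulus_sum (%_. 1) (%c. ?k (map h c)) u v"
 proof -
  let ?a = "[0..<?K]" and ?b = "[?K..<?K + ?L]"
  have S: "set ?a Un set ?b = {..<?K + ?L}" by auto
  have inj: "inj_on ((!) (u @ v)) (set ?a Un set ?b)" using inj_on_nth'[OF assms(1)] S by (simp add: lessThan_atLeast0)
  have mu: "map ((!) (u @ v)) ?a = u" "map ((!) (u @ v)) ?b = v"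
   by (auto intro!: nth_equalityI simp: nth_append)
  have r: "rot_inv (%c. ?k (map h (map ((!) (u @ v)) c)))" using rot_inv_map[OF assms(4), of "(!) (u @ v)"] by simp
  have "annulus_sum (%_. 1) (%c. ?k (map h c)) (map ((!) (u @ v)) ?a) (map ((!) (u @ v)) ?b)
    = annulus_sum (%_. 1) (%c. ?k (map h (map ((!) (u @ v)) c))) ?a ?b"
   by (rule annulus_sum_map[OF _ inj rot_inv_one assms(4)]) auto
  also have "... = (\<Sum>p\<in>annular_NCP ?K ?L. \<Prod>c\<in>cycles_upto (?K + ?L) p. ?k (map ((!) (?xs @ ?ys)) c))"
   unfolding annulus_sum_def annular_NCP_annulus S
  proof (rule sum_congI)
   fix p assume p: "p \<in> annulus ?a ?b"
   have po: "perm_on {..<?K + ?L} p" using annulusD(2)[OF p] unfolding S .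
   have "map h (map ((!) (u @ v)) c) = map ((!) (?xs @ ?ys)) c" if "c \<in> cycles_upto (?K + ?L) p" for c
   proof -
    obtain i where i: "i < ?K + ?L" "c = support p i" using \<open>c \<in> _\<close> by (auto simp: cycles_upto_def)
    have "set c <= {..<?K + ?L}" using i set_support[OF perm_onD(2)[OF po]] orbit_sub[OF po, of i] by simp
    thus ?thesis by (auto simp: map_append[symmetric] simp del: map_append)
   qed
   hence "(\<Prod>c\<in>cycles_upto (?K + ?L) p. ?k (map h (map ((!) (u @ v)) c))) = (\<Prod>c\<in>cycles_upto (?K + ?L) p. ?k (map ((!) (?xs @ ?ys)) c))"
    by (intro prod.cong refl) (simp only:)
   thus "cprod {..<?K + ?L} (%_. 1) (inv p o (cl ?a o cl ?b)) * cprod {..<?K + ?L} (%c. ?k (map h (map ((!) (u @ v)) c))) p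
    = (\<Prod>c\<in>cycles_upto (?K + ?L) p. ?k (map ((!) (?xs @ ?ys)) c))"
    unfolding cprod_cycles_upto[OF po r] by (simp add: cprod_def del: map_map)
  qed
  finally show ?thesis unfolding mu by simp
 qed
 have mk: "(\<Sum>P\<in>NCP {..<length (map h w)}. \<Sum>U\<in>P. H (nths (map h w) U) * (\<Prod>B\<in>P - {U}. ?k (nths (map h w) B)))
   = marked_sum (%_. 1) (%c. ?k (map h c)) (%c. H (map h (block w (set c)))) w"
  if "distinct w" "w ~= []" "rot_inv (%c. ?k (map h c))" for h :: "'a => 'b" and w :: "'a list" and H
  using NCP_positions(2)[where F = "%_. 1" and G = ?k and H = H and h = h, OF that(1,2) rot_inv_one that(3)] by simp
 have "(\<Sum>(P, U, Q, V)\<in>marked_NCP_pairs {..<length ?xs} {..<length ?ys}. ?kk (nths ?xs U) (nths ?ys V)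
     * (\<Prod>B\<in>P - {U}. ?k (nths ?xs B)) * (\<Prod>B\<in>Q - {V}. ?k (nths ?ys B)))
   = (\<Sum>Q\<in>NCP {..<length ?ys}. \<Sum>V\<in>Q. (\<Sum>P\<in>NCP {..<length ?xs}. \<Sum>U\<in>P. ?kk (nths ?xs U) (nths ?ys V)
     * (\<Prod>B\<in>P - {U}. ?k (nths ?xs B))) * (\<Prod>B\<in>Q - {V}. ?k (nths ?ys B)))"
  by (simp only: sum_marked_NCP_pairs finite_lessThan sum_distrib_right)
 also have "... = marked_sum (%_. 1) (%c. ?k (map h c)) (%d. marked_sum (%_. 1) (%c. ?k (map h c))
   (%c. ?kk (map h (block u (set c))) (map h (block v (set d)))) u) v"
 proof -
  have i: "(\<Sum>P\<in>NCP {..<length ?xs}. \<Sum>U\<in>P. ?kk (nths ?xs U) b * (\<Prod>B\<in>P - {U}. ?k (nths ?xs B)))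
    = marked_sum (%_. 1) (%c. ?k (map h c)) (%c. ?kk (map h (block u (set c))) b) u" for b
   by (rule mk[where H = "%a. ?kk a b", OF d(1) assms(2,4)])
  show ?thesis unfolding i
   by (rule mk[where H = "%b. marked_sum (%_. 1) (%c. ?k (map h c)) (%c. ?kk (map h (block u (set c))) b) u", OF d(2) assms(3,4)])
 qed
 finally show ?thesis
  unfolding circ_sum_marked[OF d(2)] using moment_second_order_cumulant[of ?xs ?ys f2 f] assms(2,3) ann by simp
qed

lemma mfrak_disc_sum:
 fixes A :: "'a => complex^'n^'n"
 assumes "distinct w" "w ~= []" "rot_inv (%c. m_circ (map z c))" "rot_inv (%c. ntr (matrix_prod_list (map A c)))"
 shows "mfrak (map (%j. (z j, A j)) w) = disc_sum (%c. ntr (matrix_prod_list (map A c))) (%c. m_circ (map z c)) w"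
proof -
 let ?h = "%j. (z j, A j)"
 have F: "(%c. ntr (matrix_prod_list (map snd (map ?h c)))) = (%c. ntr (matrix_prod_list (map A c)))"
  "(%c. m_circ (map fst (map ?h c))) = (%c. m_circ (map z c))" by (simp_all add: comp_def)
 show ?thesis
  unfolding mfrak_def m_circ_def[symmetric]
  using NCP_positions(1)[of w "%c. ntr (matrix_prod_list (map snd c))" ?h "%c. m_circ (map fst c)", OF assms(1,2)] assms(3,4)
  unfolding F by simp
qed

section \<open>Normalized traces of products\<close>

lemma matrix_prod_list_append: "matrix_prod_list (a @ b) = matrix_prod_list a ** matrix_prod_list b"
 by (induction a) (simp_all add: matrix_prod_list_def matrix_mul_assoc)

lemma matrix_prod_list_single [simp]: "matrix_prod_list [A] = A" by (simp add: matrix_prod_list_def)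

abbreviation word_trace :: "('a => complex^'n^'n) => 'a list => complex" where
 "word_trace A c \<equiv> ntr (matrix_prod_list (map A c))"

lemma rot_inv_word_trace: "rot_inv (word_trace A)"
 unfolding rot_inv_def
proof
 fix c show "word_trace A (rotate1 c) = word_trace A c"
 proof (cases c)
  case (Cons a d)
  have "matrix_prod_list (map A c) = A a ** matrix_prod_list (map A d)" by (simp add: Cons matrix_prod_list_def)
  moreover have "matrix_prod_list (map A (rotate1 c)) = matrix_prod_list (map A d) ** A a"
   by (simp add: Cons matrix_prod_list_append)
  ultimately show ?thesis by (simp add: ntr_def trace_mul_sym[of "A a"])
 qed simp
qed

lemma ntr_one: "ntr (mat 1 :: complex^'n^'n) = 1"
 by (simp add: ntr_def trace_def mat_def)

lemma word_trace_cong: "(!!x. x \<in> set c ==> A x = B x) ==> word_trace A c = word_trace B c"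
 by (metis (mono_tags, lifting) map_eq_conv)

lemma ignores_word_trace:
 assumes "B x = mat 1" "!!y. y ~= x ==> B y = A y"
 shows "ignores x (word_trace B) (word_trace A)"
 unfolding ignores_def
proof (intro conjI allI impI rot_inv_word_trace)
 show "word_trace B [x] = 1" using assms(1) by (simp add: ntr_one)
 show e: "word_trace B c = word_trace A c" if "x ~: set c" for c by (rule word_trace_cong) (use assms(2) that in metis)
 show "word_trace B (c @ [x]) = word_trace A c" if "c ~= []" "x ~: set c" for c
  using e[OF that(2)] assms(1) by (simp add: matrix_prod_list_append)
qed

lemma merges_word_trace:
 assumes "a ~= l" "B l = A l ** A a" "!!y. y ~= a ==> y ~= l ==> B y = A y"
 shows "merges a l (word_trace A) (word_trace B)"
 unfolding merges_def
proof (intro conjI allI impI rot_inv_word_trace)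
 show "word_trace A c = word_trace B c" if "a ~: set c" "l ~: set c" for c by (rule word_trace_cong) (use assms(3) that in metis)
 show "word_trace A (c @ [a]) = word_trace B c" if c: "c ~= []" "distinct c" "last c = l" "a ~: set c" for c
 proof -
  obtain b where b: "c = b @ [l]" using c by (metis append_butlast_last_id)
  have "A x = B x" if "x \<in> set b" for x     proof -
   have "x ~= a" "x ~= l" using c b that by auto
   thus ?thesis by (simp add: assms(3))
  qed
  hence e: "map A b = map B b" by simp
  show ?thesis unfolding b map_append e matrix_prod_list_append
   by (simp add: assms(2) matrix_mul_assoc[symmetric] matrix_prod_list_def)
 qed
qed

section \<open>Iterated difference quotients\<close>

text \<open>Removable singularity included, so that the difference quotient of a holomorphic function is holomorphic
and can be iterated with repeated nodes.\<close>

definition dquot :: "(complex => complex) => complex => complex => complex" where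
 "dquot f a z = (if z = a then deriv f a else (f z - f a) / (z - a))"

fun idq :: "(complex => complex) => complex list => complex" where
 "idq f [] = 0"
| "idq f [a] = f a"
| "idq f (a # b # r) = idq (dquot f a) (b # r)"

lemma idq_Cons: "r ~= [] ==> idq f (a # r) = idq (dquot f a) r"
 by (cases r) auto

context
 fixes S :: "complex set"
 assumes opn: "open S"
begin

lemma holomorphic_dquot: "f holomorphic_on S ==> dquot f a holomorphic_on S"
 unfolding dquot_def[abs_def] by (rule pole_lemma_open[OF _ opn])

lemma dquot_cong:
 assumes "f holomorphic_on S" "!!z. z \<in> S ==> f z = g z" "a \<in> S" "z \<in> S"
 shows "dquot f a z = dquot g a z"
proof -
 have "g holomorphic_on S" using assms(1,2) by (rule holomorphic_transform)
 hence "deriv f a = deriv g a" by (rule complex_derivative_transform_within_open[OF assms(1) _ opn assms(3,2)])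
 thus ?thesis using assms(2)[OF assms(3)] assms(2)[OF assms(4)] by (simp add: dquot_def)
qed

lemma idq_cong:
 assumes "f holomorphic_on S" "!!z. z \<in> S ==> f z = g z" "set zs <= S"
 shows "idq f zs = idq g zs"
 using assms
proof (induction f zs arbitrary: g rule: idq.induct)
 case (3 f a b r)
 show ?case unfolding idq.simps
 proof (rule "3.IH")
  show "dquot f a z = dquot g a z" if "z \<in> S" for z by (rule dquot_cong[OF "3.prems"(1,2) _ that]) (use "3.prems"(3) in auto)
 qed (use "3.prems" holomorphic_dquot in auto)
qed auto

lemma deriv_linear_comb:
 assumes "f holomorphic_on S" "g holomorphic_on S" "a \<in> S"
 shows "deriv (%z. f z + c * g z) a = deriv f a + c * deriv g a"
 by (rule DERIV_imp_deriv)
  (auto intro!: derivative_eq_intros holomorphic_derivI[OF assms(1) opn assms(3)] holomorphic_derivI[OF assms(2) opn assms(3)])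

lemma idq_linear:
 assumes "f holomorphic_on S" "g holomorphic_on S" "set zs <= S"
 shows "idq (%z. f z + c * g z) zs = idq f zs + c * idq g zs"
 using assms
proof (induction f zs arbitrary: g rule: idq.induct)
 case (3 f a b r)
 have a: "a \<in> S" using "3.prems"(3) by simp
 have "dquot (%z. f z + c * g z) a = (%z. dquot f a z + c * dquot g a z)"
 proof
  fix z show "dquot (%z. f z + c * g z) a z = dquot f a z + c * dquot g a z"
  proof (cases "z = a")
   case False
   have "(f z + c * g z - (f a + c * g a)) / (z - a) = ((f z - f a) + c * (g z - g a)) / (z - a)" by (simp add: algebra_simps)
   thus ?thesis using False by (simp add: dquot_def add_divide_distrib)
  qed (simp add: dquot_def deriv_linear_comb[OF "3.prems"(1,2) a])
 qed
 thus ?case using "3.IH"[of "dquot g a"] "3.prems" holomorphic_dquot by simp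
qed auto

text \<open>Two difference quotients at distinct points combine to a difference of difference quotients;
 the right-hand side is symmetric, so difference quotients commute.\<close>

lemma dquot_dquot:
 assumes "f holomorphic_on S" "a \<in> S" "b \<in> S" "a ~= b" "x \<in> S"
 shows "dquot (dquot f a) b x = (dquot f b x - dquot f a x) / (b - a)"
proof -
 consider "x = b" | "x = a" | "x ~= a" "x ~= b" by blast
 thus ?thesis
 proof cases
  case 1
  have "((%z. (f z - f a) / (z - a)) has_field_derivative (deriv f b * (b - a) - (f b - f a)) / (b - a)\<^sup>2) (at b)"
   using assms(4) by (auto intro!: derivative_eq_intros holomorphic_derivI[OF assms(1) opn assms(3)] simp: power2_eq_square)
  hence "(dquot f a has_field_derivative (deriv f b * (b - a) - (f b - f a)) / (b - a)\<^sup>2) (at b)"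
   by (rule has_field_derivative_transform_within_open[of _ _ _ "- {a}"]) (use assms(4) in "auto simp: dquot_def")
  hence "deriv (dquot f a) b = (deriv f b * (b - a) - (f b - f a)) / (b - a)\<^sup>2" by (rule DERIV_imp_deriv)
  thus ?thesis using 1 assms(4) by (simp add: dquot_def field_simps power2_eq_square)
 next
  case 2
  thus ?thesis using assms(4) by (simp add: dquot_def divide_simps) (simp add: algebra_simps)
 next
  case 3
  thus ?thesis using assms(4) by (simp add: dquot_def divide_simps) (simp add: algebra_simps)
 qed
qed

lemma idq_Cons2:
 assumes "f holomorphic_on S" "a \<in> S" "b \<in> S" "set r <= S" "a ~= b"
 shows "idq f (a # b # r) = (idq f (b # r) - idq f (a # r)) / (b - a)"
proof (cases "r = []")
 case False
 have hb: "(%z. dquot f b z / (b - a)) holomorphic_on S" and h: "(%z. dquot f b z / (b - a) + (- 1 / (b - a)) * dquot f a z) holomorphic_on S"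
  using assms by (auto intro!: holomorphic_intros holomorphic_dquot)
 have "idq f (a # b # r) = idq (dquot (dquot f a) b) r" using False by (simp add: idq_Cons)
 also have "... = idq (%z. 0 + (1 / (b - a)) * (dquot f b z + (- 1) * dquot f a z)) r"
  by (rule idq_cong) (use assms dquot_dquot[OF assms(1-3,5)] holomorphic_dquot in "auto simp: field_simps")
 also have "... = idq (%_. 0) r + (1 / (b - a)) * (idq (dquot f b) r + (- 1) * idq (dquot f a) r)"
  using assms holomorphic_dquot[OF assms(1)]
  by (subst idq_linear, (auto intro!: holomorphic_intros)[3]) (subst idq_linear, auto)
 also have "idq (%_. 0) r = 0"
 proof -
  have "idq (%_. 0) zs = 0" for zs
  proof (induction zs rule: induct_list012)
   case (3 x y zs)
   moreover have "dquot (%_. 0) x = (%_. 0)" by (auto simp: dquot_def)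
   ultimately show ?case by simp
  qed auto
  thus ?thesis .
 qed
 finally show ?thesis using False by (simp add: idq_Cons field_simps)
qed (use assms in "auto simp: dquot_def")

lemma idq_swap:
 assumes "f holomorphic_on S" "set (xs @ a # b # ys) <= S"
 shows "idq f (xs @ a # b # ys) = idq f (xs @ b # a # ys)"
 using assms
proof (induction xs arbitrary: f)
 case Nil
 show ?case
 proof (cases "a = b")
  case False
  have "(idq f (b # ys) - idq f (a # ys)) / (b - a) = (idq f (a # ys) - idq f (b # ys)) / (a - b)"
   by (metis minus_diff_eq minus_divide_divide)
  thus ?thesis using False Nil idq_Cons2[of f a b ys] idq_Cons2[of f b a ys] by simp
 qed simp
next
 case (Cons c xs)
 thus ?case using Cons.IH[OF holomorphic_dquot[OF Cons.prems(1)]] by (simp add: idq_Cons)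
qed

lemma idq_move_front:
 assumes "f holomorphic_on S" "set (xs @ a # ys) <= S"
 shows "idq f (xs @ a # ys) = idq f (a # xs @ ys)"
 using assms
proof (induction xs arbitrary: ys rule: rev_induct)
 case (snoc x xs)
 thus ?case using idq_swap[OF assms(1), of xs x a ys] snoc.IH[of "x # ys"] by simp
qed simp

theorem idq_symmetric:
 assumes "f holomorphic_on S" "set xs <= S" "mset xs = mset ys"
 shows "idq f xs = idq f ys"
 using assms
proof (induction xs arbitrary: f ys)
 case (Cons a xs)
 have "a \<in> set ys" using Cons.prems(3) by (metis list.set_intros(1) mset_eq_setD)
 then obtain y1 y2 where y: "ys = y1 @ a # y2" by (meson split_list)
 have m: "mset xs = mset (y1 @ y2)" using Cons.prems(3) y by simp
 have s: "set ys <= S" using Cons.prems by (metis mset_eq_setD)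
 have "idq f ys = idq f (a # y1 @ y2)" unfolding y by (rule idq_move_front[OF Cons.prems(1)]) (use s y in simp)
 also have "... = idq f (a # xs)"
 proof (cases "xs = []")
  case False
  hence "y1 @ y2 ~= []" using m by auto
  thus ?thesis using False Cons.IH[OF holomorphic_dquot[OF Cons.prems(1)] _ m] Cons.prems(2) by (simp add: idq_Cons)
 qed (use m in auto)
 finally show ?case by simp
qed simp

text \<open>Differentiate f = f(a) + (z - a) g, where g is the difference quotient, by the Leibniz rule.\<close>

lemma higher_deriv_dquot:
 assumes "f holomorphic_on S" "a \<in> S"
 shows "(deriv ^^ n) (dquot f a) a = (deriv ^^ Suc n) f a / of_nat (Suc n)"
proof -
 let ?g = "dquot f a"
 have h: "(%z. (z - a) * ?g z) holomorphic_on S" "(%z. z - a) holomorphic_on S"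
  by (intro holomorphic_intros holomorphic_dquot assms)+
 have "(deriv ^^ Suc n) f a = (deriv ^^ Suc n) (%z. f a + (z - a) * ?g z) a"
 proof (rule higher_deriv_transform_within_open[OF assms(1) _ opn assms(2)])
  show "(%z. f a + (z - a) * ?g z) holomorphic_on S" by (intro holomorphic_intros holomorphic_dquot assms)
 qed (simp add: dquot_def)
 also have "... = (deriv ^^ Suc n) (%z. (z - a) * ?g z) a"
  by (subst higher_deriv_add[OF _ h(1) opn assms(2)]) (simp_all add: holomorphic_on_const)
 also have "... = (\<Sum>i = 0..Suc n. of_nat (Suc n choose i) * (deriv ^^ i) (%z. z - a) a * (deriv ^^ (Suc n - i)) ?g a)"
  by (rule higher_deriv_mult[OF h(2) holomorphic_dquot[OF assms(1)] opn assms(2)])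
 also have "... = (\<Sum>i\<in>{1}. of_nat (Suc n choose i) * (deriv ^^ i) (%z. z - a) a * (deriv ^^ (Suc n - i)) ?g a)"
 proof (rule sum.mono_neutral_right)
  have "(deriv ^^ i) (%z. z - a) a = 0" if "i ~= 1" for i
   by (subst higher_deriv_diff[of _ UNIV]) (use that in "auto intro: holomorphic_intros")
  thus "\<forall>i\<in>{0..Suc n} - {1}. of_nat (Suc n choose i) * (deriv ^^ i) (%z. z - a) a * (deriv ^^ (Suc n - i)) ?g a = 0" by simp
 qed auto
 also have "... = of_nat (Suc n) * (deriv ^^ n) ?g a"
  by simp
 finally show ?thesis by (simp add: field_simps del: of_nat_Suc)
qed

lemma idq_replicate:
 assumes "f holomorphic_on S" "a \<in> S"
 shows "idq f (replicate (Suc n) a) = (deriv ^^ n) f a / fact n"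
 using assms(1)
proof (induction n arbitrary: f)
 case (Suc n)
 have "idq f (replicate (Suc (Suc n)) a) = idq (dquot f a) (replicate (Suc n) a)" by simp
 thus ?case unfolding Suc.IH[OF holomorphic_dquot[OF Suc.prems]] higher_deriv_dquot[OF Suc.prems assms(2), of n] fact_Suc divide_divide_eq_left .
qed simp

theorem divided_difference_idq:
 assumes "f holomorphic_on S" "set zs <= S"
 shows "divided_difference f zs = idq f zs"
 using assms(2)
proof (induction "length zs" arbitrary: zs rule: less_induct)
 case less
 show ?case
 proof (cases "zs = [] \<or> (\<forall>w\<in>set zs. w = hd zs)")
  case True
  thus ?thesis
  proof
   assume z: "\<forall>w\<in>set zs. w = hd zs"
   show ?thesis
   proof (cases zs)
    case (Cons a r)
    have "zs = replicate (Suc (length r)) a" using z Cons by (intro replicate_eqI) auto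
    thus ?thesis using idq_replicate[OF assms(1), of a "length r"] less.prems Cons z
     by (subst divided_difference.simps) simp
   qed (simp add: divided_difference.simps)
  qed (simp add: divided_difference.simps)
 next
  case False
  define a where "a = hd zs"
  define w where "w = hd (filter (%w. w ~= a) zs)"
  have "filter (%w. w ~= a) zs ~= []" using False by (auto simp: a_def filter_empty_conv)
  hence w: "w \<in> set zs" "w ~= a" using hd_in_set unfolding w_def by fastforce+
  have zs: "zs = a # tl zs" using False by (simp add: a_def)
  have wt: "w \<in> set (tl zs)" using w zs by (metis set_ConsD)
  define r where "r = remove1 w (tl zs)"
  have m1: "mset (tl zs) = mset (w # r)" using wt by (simp add: r_def)
  have m2: "mset (remove1 w zs) = mset (a # r)"
  proof -
   have "remove1 w zs = a # r" using w(2) zs remove1.simps(2)[of w a "tl zs"] by (simp add: r_def)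
   thus ?thesis by simp
  qed
  have m3: "mset zs = mset (a # w # r)" by (subst zs) (simp add: m1)
  have "set zs = insert a (set (tl zs))" using zs by (metis list.simps(15))
  hence s: "set (tl zs) <= S" "set (remove1 w zs) <= S" "a \<in> S" "w \<in> S" "set r <= S"
   using less.prems w(1) set_remove1_subset[of w zs] set_remove1_subset[of w "tl zs"] by (auto simp: r_def)
  have l: "length (tl zs) < length zs" "length (remove1 w zs) < length zs"
   using False w(1) by (auto simp: length_remove1)
  have "divided_difference f zs = (divided_difference f (tl zs) - divided_difference f (remove1 w zs)) / (w - a)"
  proof -
   have nz: "zs ~= []" and nall: "(\<forall>w\<in>set zs. w = hd zs) = False" using False by simp_all
   show ?thesis by (subst divided_difference.simps) (simp only: nz nall if_False Let_def w_def a_def)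
  qed
  also have "... = (idq f (tl zs) - idq f (remove1 w zs)) / (w - a)" using less.hyps[OF l(1) s(1)] less.hyps[OF l(2) s(2)] by simp
  also have "... = (idq f (w # r) - idq f (a # r)) / (w - a)"
   using idq_symmetric[OF assms(1) s(1) m1] idq_symmetric[OF assms(1) s(2) m2] by simp
  also have "... = idq f (a # w # r)" using idq_Cons2[OF assms(1) s(3-5)] w(2) by simp
  also have "... = idq f zs" using idq_symmetric[OF assms(1) less.prems m3] by simp
  finally show ?thesis .
 qed
qed

lemma dquot_mult:
 assumes "f holomorphic_on S" "g holomorphic_on S" "a \<in> S" "z \<in> S"
 shows "dquot (%z. f z * g z) a z = dquot f a z * g z + f a * dquot g a z"
proof (cases "z = a")
 case True
 have "deriv (%z. f z * g z) a = deriv f a * g a + f a * deriv g a"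
  by (rule DERIV_imp_deriv) (auto intro!: derivative_eq_intros holomorphic_derivI[OF assms(1) opn assms(3)] holomorphic_derivI[OF assms(2) opn assms(3)])
 thus ?thesis using True by (simp add: dquot_def)
next
 case False
 have "f z * g z - f a * g a = (f z - f a) * g z + f a * (g z - g a)" by (simp add: algebra_simps)
 thus ?thesis using False by (simp add: dquot_def add_divide_distrib)
qed

text \<open>With the nodes treated one after the other, this is the product rule
for a single difference quotient, applied to the first node.\<close>

theorem idq_Leibniz:
 assumes "f holomorphic_on S" "g holomorphic_on S" "set zs <= S" "zs ~= []"
 shows "idq (%z. f z * g z) zs = (\<Sum>s<length zs. idq f (take (Suc s) zs) * idq g (drop s zs))"
 using assms
proof (induction f zs arbitrary: g rule: idq.induct)
 case (3 f a b r)
 let ?w = "b # r"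
 have a: "a \<in> S" and w: "set ?w <= S" using "3.prems" by auto
 note h = holomorphic_dquot[OF "3.prems"(1), of a] holomorphic_dquot[OF "3.prems"(2), of a]
 have "idq (%z. f z * g z) (a # ?w) = idq (dquot (%z. f z * g z) a) ?w" by simp
 also have "... = idq (%z. dquot f a z * g z + f a * dquot g a z) ?w"
  by (rule idq_cong[OF holomorphic_dquot _ w]) (use dquot_mult[OF "3.prems"(1,2) a] "3.prems" in "auto intro!: holomorphic_intros")
 also have "... = idq (%z. dquot f a z * g z) ?w + f a * idq (dquot g a) ?w"
  by (rule idq_linear[OF _ h(2) w]) (intro holomorphic_intros h(1) "3.prems"(2))
 also have "idq (%z. dquot f a z * g z) ?w = (\<Sum>s<length ?w. idq (dquot f a) (take (Suc s) ?w) * idq g (drop s ?w))"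
  by (rule "3.IH"[OF h(1) "3.prems"(2) w]) simp
 also have "... = (\<Sum>s<length ?w. idq f (take (Suc (Suc s)) (a # ?w)) * idq g (drop (Suc s) (a # ?w)))" by simp
 finally have e: "idq (%z. f z * g z) (a # ?w) = f a * idq g (a # ?w) +
   (\<Sum>s<length ?w. idq f (take (Suc (Suc s)) (a # ?w)) * idq g (drop (Suc s) (a # ?w)))" by simp
 have "length (a # ?w) = Suc (length ?w)" by simp
 thus ?case unfolding e by (simp only: sum.lessThan_Suc_shift) simp
qed auto

end

section \<open>The Stieltjes transform of the semicircle law\<close>

text \<open>With z = - (w + 1/w) the substitution x = 2 cos t turns the integrand into the function below,
 whose antiderivative is elementary: sin^2 t / Q is a combination of 1, cos t and 1/Q for
 Q = (1 + w e^(it)) (1 + w e^(-it)), and partial fractions integrate 1/Q to logarithms. The logarithms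
 agree at both ends of the interval.\<close>

lemma integral_sin_squared:
 fixes w :: complex
 assumes "norm w < 1" "w ~= 0"
 shows "((%t. (of_real (sin t))\<^sup>2 / ((1 + w * cis t) * (1 + w * cis (- t)))) has_integral (pi / 2)) {0..pi}"
proof -
 define L where "L = (%t::real. Ln (1 + w * cis t))"
 define C :: complex where "C = - ((1 - w\<^sup>2) / (4 * w\<^sup>2))"
 define F where "F = (%t. C * (of_real t + \<i> * L t - \<i> * L (- t)) + (1 + w\<^sup>2) / (4 * w\<^sup>2) * of_real t - of_real (sin t) / (2 * w))"
 have nz: "0 < Re (1 + w * cis t)" for t
 proof -
  have "\<bar>Re (w * cis t)\<bar> \<le> norm (w * cis t)" by (rule abs_Re_le_cmod)
  also have "... < 1" using assms(1) by (simp add: norm_mult)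
  finally show ?thesis by simp
 qed
 have nz': "1 + w * cis t ~= 0" "1 + w * cis t ~: \<real>\<^sub>\<le>\<^sub>0" for t
 proof -
  show "1 + w * cis t ~: \<real>\<^sub>\<le>\<^sub>0" using nz[of t] by (auto simp: complex_nonpos_Reals_iff)
  thus "1 + w * cis t ~= 0" by auto
 qed
 have w2: "1 - w\<^sup>2 ~= 0"
 proof
  assume "1 - w\<^sup>2 = 0"
  hence "norm w ^ 2 = 1" by (metis eq_iff_diff_eq_0 norm_one norm_power)
  thus False using assms(1) power_less_one_iff[of "norm w" 2] by simp
 qed
 have dL: "(L has_vector_derivative (\<i> * w * cis t / (1 + w * cis t))) (at t within X)" for t X
 proof -
  have "((%t. 1 + w * cis t) has_vector_derivative (w * (\<i> * cis t))) (at t within X)"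
  proof -
   have "((%z. 1 + w * exp (\<i> * z)) has_field_derivative (w * (\<i> * cis t))) (at (of_real t))"
    by (auto intro!: derivative_eq_intros simp: cis_conv_exp)
   from has_vector_derivative_real_field[OF this] show ?thesis by (simp add: cis_conv_exp)
  qed
  hence "((Ln o (%t. 1 + w * cis t)) has_vector_derivative (w * (\<i> * cis t)) * inverse (1 + w * cis t)) (at t within X)"
   by (rule field_vector_diff_chain_within) (use nz' in "auto intro!: derivative_eq_intros simp: divide_inverse")
  thus ?thesis by (simp add: L_def comp_def divide_inverse mult_ac)
 qed
 have dL': "((%t. L (- t)) has_vector_derivative - (\<i> * w * cis (- t) / (1 + w * cis (- t)))) (at t within X)" for t X
  using vector_diff_chain_within[of uminus "-1" t X L "\<i> * w * cis (- t) / (1 + w * cis (- t))"] dL[of "- t" "uminus ` X"]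
  by (auto simp: comp_def has_vector_derivative_def intro!: derivative_eq_intros)
 have dF: "(F has_vector_derivative ((of_real (sin t))\<^sup>2 / ((1 + w * cis t) * (1 + w * cis (- t))))) (at t within X)" for t X
 proof -
  let ?u = "cis t" and ?v = "cis (- t)"
  have uv: "?u * ?v = 1" by (simp add: cis_mult)
  have c: "of_real (cos t) = (?u + ?v) / 2" "of_real (sin t) = (?u - ?v) / (2 * \<i>)"
   by (auto simp: complex_eq_iff)
  have ds: "((%t. complex_of_real (sin t)) has_vector_derivative of_real (cos t)) (at t within X)"
   by (auto intro!: derivative_eq_intros simp: has_real_derivative_iff_has_vector_derivative[symmetric])
  have "(F has_vector_derivative C * (1 + \<i> * (\<i> * w * ?u / (1 + w * ?u)) - \<i> * - (\<i> * w * ?v / (1 + w * ?v)))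
    + (1 + w\<^sup>2) / (4 * w\<^sup>2) - of_real (cos t) / (2 * w)) (at t within X)"
   unfolding F_def by (rule derivative_eq_intros dL dL' ds refl | simp)+
  moreover have "C * (1 + \<i> * (\<i> * w * ?u / (1 + w * ?u)) - \<i> * - (\<i> * w * ?v / (1 + w * ?v)))
    + (1 + w\<^sup>2) / (4 * w\<^sup>2) - of_real (cos t) / (2 * w) = (of_real (sin t))\<^sup>2 / ((1 + w * ?u) * (1 + w * ?v))"
  proof -
   have first: "1 + \<i> * (\<i> * w * ?u / (1 + w * ?u)) - \<i> * - (\<i> * w * ?v / (1 + w * ?v)) = (1 - w\<^sup>2) / ((1 + w * ?u) * (1 + w * ?v))"
    using nz'(1)[of t] nz'(1)[of "- t"] uv by (simp add: divide_simps) (simp add: algebra_simps power2_eq_square)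
   define Q s where "Q = (1 + w * ?u) * (1 + w * ?v)" and "s = ?u + ?v"
   have Q: "Q ~= 0" using nz'(1)[of t] nz'(1)[of "- t"] by (simp add: Q_def)
   have Qs: "Q = 1 + w\<^sup>2 + w * s" using uv by (simp add: Q_def s_def algebra_simps power2_eq_square)
   have sin2: "((?u - ?v) / (2 * \<i>))\<^sup>2 = (4 - s\<^sup>2) / 4"
    using uv by (simp add: s_def power_divide power_mult_distrib) (simp add: power2_eq_square algebra_simps)
   have "C * ((1 - w\<^sup>2) / Q) + (1 + w\<^sup>2) / (4 * w\<^sup>2) - (s / 2) / (2 * w)
     = (- (1 - w\<^sup>2)\<^sup>2 + (1 + w\<^sup>2) * Q - w * s * Q) / (4 * w\<^sup>2 * Q)"
    using Q assms(2) unfolding C_def by (simp add: divide_simps power2_eq_square algebra_simps)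
   also have "- (1 - w\<^sup>2)\<^sup>2 + (1 + w\<^sup>2) * Q - w * s * Q = w\<^sup>2 * (4 - s\<^sup>2)"
    unfolding Qs by (simp add: power2_eq_square algebra_simps)
   also have "w\<^sup>2 * (4 - s\<^sup>2) / (4 * w\<^sup>2 * Q) = ((4 - s\<^sup>2) / 4) / Q" using assms(2) Q by (simp add: field_simps)
   finally show ?thesis unfolding c first by (simp only: Q_def[symmetric] s_def[symmetric] sin2)
  qed
  ultimately show ?thesis by simp
 qed
 have "((%t. (of_real (sin t))\<^sup>2 / ((1 + w * cis t) * (1 + w * cis (- t)))) has_integral (F pi - F 0)) {0..pi}"
  by (rule fundamental_theorem_of_calculus[OF pi_ge_zero dF])
 moreover have "F pi - F 0 = pi / 2"
 proof -
  have "cis (- pi) = - 1" by (simp add: complex_eq_iff)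
  hence "L pi = L (- pi)" "L 0 = L (- 0)" by (simp_all add: L_def)
  hence "F pi - F 0 = (C + (1 + w\<^sup>2) / (4 * w\<^sup>2)) * of_real pi" by (simp add: F_def algebra_simps)
  also have "C + (1 + w\<^sup>2) / (4 * w\<^sup>2) = 1 / 2" using assms(2) by (simp add: C_def field_simps)
  finally show ?thesis by simp
 qed
 ultimately show ?thesis by simp
qed

text \<open>The two roots of w^2 + z w + 1 = 0 have product 1. If their modulus were 1 they would be conjugate and z
would be real.\<close>

lemma nonreal_root:
 fixes z :: complex
 assumes "z ~: \<real>"
 obtains w where "w ~= 0" "norm w < 1" "z = - (w + 1 / w)"
proof -
 define s where "s = csqrt (z\<^sup>2 - 4)"
 define a b where "a = (- z + s) / 2" and "b = (- z - s) / 2"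
 have s2: "s\<^sup>2 = z\<^sup>2 - 4" by (simp add: s_def)
 have ab: "a * b = 1" "a + b = - z" using s2 by (simp_all add: a_def b_def field_simps power2_eq_square)
 have nz: "a ~= 0" "b ~= 0" using ab(1) by auto
 have inv: "b = 1 / a" "a = 1 / b" using ab(1) nz by (simp_all add: field_simps)
 have za: "z = - (a + 1 / a)" "z = - (b + 1 / b)" using ab(2) inv by (metis add.commute minus_minus)+
 have "norm a ~= 1"
 proof
  assume "norm a = 1"
  hence "b = cnj a" using ab(1) nz complex_norm_square[of a] by (metis mult_cancel_left of_real_1 one_power2)
  hence "z = - of_real (2 * Re a)" using ab(2) complex_add_cnj[of a] by (metis minus_minus)
  thus False using assms by simp
 qed
 hence "norm a < 1 \<or> norm b < 1"
  using inv(1) by (simp add: norm_divide) (metis less_divide_eq_1_pos linorder_neqE_linordered_idom norm_ge_zero divide_less_eq_1_pos zero_less_one less_trans)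
 thus ?thesis using that nz za by blast
qed

theorem msc_root:
 assumes "w ~= 0" "norm w < 1" "- (w + 1 / w) ~: \<real>"
 shows "msc (- (w + 1 / w)) = w"
proof -
 let ?z = "- (w + 1 / w)"
 let ?f = "%x::real. complex_of_real (sqrt (4 - x\<^sup>2) / (2 * pi)) / (complex_of_real x - ?z)"
 have nz: "complex_of_real x - ?z ~= 0" for x using assms(3) by (metis Reals_of_real right_minus_eq)
 have cont: "continuous_on {-2..2} ?f" using nz by (intro continuous_intros) auto
 have "msc ?z = (LINT x:{-2..2}|lborel. ?f x)"
  unfolding msc_def set_lebesgue_integral_def semicircle_density_def
  by (intro Bochner_Integration.integral_cong refl) (auto simp: indicator_def)
 also have "... = integral {-2..2} ?f"
  by (rule set_borel_integral_eq_integral(2)) (unfold set_integrable_def, rule borel_integrable_compact, use cont in auto)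
 finally have m: "msc ?z = integral {-2..2} ?f" .
 have "((%t. (- 2 * sin t) *\<^sub>R ?f (2 * cos t)) has_integral (integral {2 * cos 0..2 * cos pi} ?f - integral {2 * cos pi..2 * cos 0} ?f)) {0..pi}"
 proof (rule has_integral_substitution_general[of "{}" 0 pi "%t. 2 * cos t" "-2" 2 ?f])
  show "(%t. 2 * cos t) ` {0..pi} <= {-2..2}"
  proof
   fix x assume "x \<in> (%t. 2 * cos t) ` {0..pi}"
   then obtain t where "x = 2 * cos t" by blast
   thus "x \<in> {-2..2}" using cos_le_one[of t] cos_ge_minus_one[of t] by simp
  qed
 qed (use cont in "auto intro!: continuous_intros derivative_eq_intros")
 hence 1: "((%t. (- 2 * sin t) *\<^sub>R ?f (2 * cos t)) has_integral (- msc ?z)) {0..pi}" unfolding m by simp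
 have "((%t. (- 2 * w / pi) * ((of_real (sin t))\<^sup>2 / ((1 + w * cis t) * (1 + w * cis (- t))))) has_integral (- 2 * w / pi) * (pi / 2)) {0..pi}"
  by (rule has_integral_mult_right[OF integral_sin_squared[OF assms(2,1)]])
 moreover have "(- 2 * w / pi) * ((of_real (sin t))\<^sup>2 / ((1 + w * cis t) * (1 + w * cis (- t)))) = (- 2 * sin t) *\<^sub>R ?f (2 * cos t)"
  if t: "t \<in> {0..pi}" for t
 proof -
  have "4 - (2 * cos t)\<^sup>2 = (2 * sin t)\<^sup>2"
   by (simp add: sin_squared_eq power_mult_distrib)
  hence sq: "sqrt (4 - (2 * cos t)\<^sup>2) = 2 * sin t" using sin_ge_zero[of t] t by (metis atLeastAtMost_iff mult_nonneg_nonneg real_sqrt_unique zero_le_numeral)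
  have cc: "cis t + cis (- t) = 2 * of_real (cos t)" "cis t * cis (- t) = 1" by (auto simp: complex_eq_iff cis_mult)
  have "(1 + w * cis t) * (1 + w * cis (- t)) = 1 + w * (cis t + cis (- t)) + w * w * (cis t * cis (- t))" by (simp add: algebra_simps)
  also have "... = w * (of_real (2 * cos t) - ?z)" unfolding cc using assms(1) by (simp add: field_simps)
  finally show ?thesis using nz[of "2 * cos t"] assms(1) unfolding sq by (simp add: scaleR_conv_of_real divide_simps power2_eq_square)
 qed
 ultimately have "((%t. (- 2 * sin t) *\<^sub>R ?f (2 * cos t)) has_integral (- 2 * w / pi) * (pi / 2)) {0..pi}"
  by (rule has_integral_eq[rotated])
 from has_integral_unique[OF 1 this] show ?thesis by simp
qed

corollary msc_nonreal:
 assumes "z ~: \<real>"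
 shows "msc z ~= 0" "norm (msc z) < 1" "msc z + z = - 1 / msc z"
proof -
 obtain w where w: "w ~= 0" "norm w < 1" "z = - (w + 1 / w)" by (rule nonreal_root[OF assms])
 hence "msc z = w" using msc_root[OF w(1,2)] assms by simp
 thus "msc z ~= 0" "norm (msc z) < 1" "msc z + z = - 1 / msc z" using w by simp_all
qed

definition nonreal :: "complex set" where "nonreal = - \<real>"

lemma open_nonreal: "open nonreal"
 unfolding nonreal_def using closed_complex_Reals by (simp add: open_Compl)

text \<open>On nonreal z the function is the inverse of the injective map w |-> - (w + 1/w) on the punctured disc, and
inverses of injective holomorphic maps are holomorphic.\<close>

lemma msc_holomorphic: "msc holomorphic_on nonreal"
proof -
 let ?D = "ball 0 1 - {0::complex}" and ?J = "%w::complex. - (w + 1 / w)"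
 have inj: "inj_on ?J ?D"
 proof (rule inj_onI)
  fix v w assume vw: "v \<in> ?D" "w \<in> ?D" and "?J v = ?J w"
  hence "v + 1 / v = w + 1 / w" by (metis minus_equation_iff)
  hence "(v - w) * (v * w - 1) = 0" using vw by (simp add: field_simps)
  moreover have "v * w ~= 1"
  proof
   assume "v * w = 1"
   moreover have "norm v * norm w < 1" using vw mult_strict_mono[of "norm v" 1 "norm w" 1] by simp
   ultimately show False by (metis norm_mult norm_one less_irrefl)
  qed
  ultimately show "v = w" by simp
 qed
 have J: "?J holomorphic_on ?D" by (intro holomorphic_intros) auto
 have "open ?D" by (simp add: open_delete)
 then obtain g where g: "g holomorphic_on ?J ` ?D" "!!w. w \<in> ?D ==> g (?J w) = w"
  by (rule holomorphic_has_inverse[OF J _ inj]) (rule that; assumption)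
 have e: "z \<in> ?J ` ?D \<and> g z = msc z" if "z \<in> nonreal" for z
 proof -
  have z: "z ~: \<real>" using that by (simp add: nonreal_def)
  obtain w where w: "w ~= 0" "norm w < 1" "z = ?J w" by (rule nonreal_root[OF z])
  hence "w \<in> ?D" by simp
  thus ?thesis using g(2)[of w] msc_root[OF w(1,2)] w(3) z by auto
 qed
 have "g holomorphic_on nonreal" using g(1) e by (blast intro: holomorphic_on_subset)
 thus ?thesis by (rule holomorphic_transform) (use e in blast)
qed

lemma mdd_idq: "set zs <= nonreal ==> mdd zs = idq msc zs"
 by (rule divided_difference_idq[OF open_nonreal msc_holomorphic])

lemma mdd_symmetric:
 assumes "set xs <= nonreal" "mset xs = mset ys" shows "mdd xs = mdd ys"
proof -
 have "set ys <= nonreal" using assms by (metis mset_eq_setD)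
 thus ?thesis using idq_symmetric[OF open_nonreal msc_holomorphic assms] mdd_idq assms(1) by simp
qed

lemma mdd_single: "z \<in> nonreal ==> mdd [z] = msc z"
 by (simp add: mdd_idq)

text \<open>The Leibniz rule turns the quadratic equation of the semicircle law into a recursion for its
 divided differences.\<close>

theorem mdd_recursion:
 assumes "set zs <= nonreal" "2 \<le> length zs"
 shows "mdd zs = msc (hd zs) * (mdd (tl zs) + (\<Sum>s=1..<length zs. mdd (take (Suc s) zs) * mdd (drop s zs)))"
proof -
 let ?D = "idq msc"
 obtain a b r where zs: "zs = a # b # r" using assms(2) by (cases zs rule: remdups_adj.cases) auto
 have a: "a \<in> nonreal" "a ~: \<real>" and ne: "zs ~= []" using assms(1) zs by (auto simp: nonreal_def)
 note h = msc_holomorphic open_nonreal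
 have id: "idq (%z. z * msc z) zs = a * ?D zs + ?D (tl zs)"
 proof -
  have "dquot (%z. z) a = (%_. 1)" by (auto simp: dquot_def)
  have "idq (%z. z * msc z) zs = idq (dquot (%z. z * msc z) a) (b # r)" by (simp add: zs)
  also have "... = idq (%z. msc z + a * dquot msc a z) (b # r)"
  proof (rule idq_cong[OF h(2)])
   show "dquot (%z. z * msc z) a holomorphic_on nonreal" by (intro holomorphic_dquot holomorphic_intros h)
   show "dquot (%z. z * msc z) a z = msc z + a * dquot msc a z" if "z \<in> nonreal" for z
    using dquot_mult[OF h(2) holomorphic_on_ident h(1) a(1) that] \<open>dquot (%z. z) a = _\<close> by simp
  qed (use assms(1) zs in auto)
  also have "... = ?D (b # r) + a * idq (dquot msc a) (b # r)"
   by (rule idq_linear[OF h(2,1) holomorphic_dquot[OF h(2,1)]]) (use assms(1) zs in auto)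
  finally show ?thesis by (simp add: zs)
 qed
 have one: "idq (%_. - 1) zs = 0"
 proof -
  have "dquot (%_. c) x = (%_. 0)" for c x by (auto simp: dquot_def)
  moreover have "idq (%_. 0) l = 0" for l
   by (induction l rule: induct_list012) (simp_all add: \<open>!!c x. dquot (%_. c) x = (%_. 0)\<close>)
  ultimately show ?thesis by (simp add: zs)
 qed
 have "0 = idq (%z. msc z * msc z + 1 * (z * msc z)) zs"
  unfolding one[symmetric]
 proof (rule idq_cong[OF h(2)])
  show "- 1 = msc z * msc z + 1 * (z * msc z)" if "z \<in> nonreal" for z
   using msc_nonreal[of z] that by (simp add: nonreal_def field_simps)
 qed (use assms(1) in auto)
 also have "... = idq (%z. msc z * msc z) zs + 1 * idq (%z. z * msc z) zs"
  by (rule idq_linear[OF h(2) _ _ assms(1)]) (intro holomorphic_intros h)+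
 also have "idq (%z. msc z * msc z) zs = (\<Sum>s<length zs. ?D (take (Suc s) zs) * ?D (drop s zs))"
  by (rule idq_Leibniz[OF h(2,1,1) assms(1) ne])
 also have "... = msc a * ?D zs + (\<Sum>s=1..<length zs. ?D (take (Suc s) zs) * ?D (drop s zs))"
  using sum.atLeast_Suc_lessThan[of 0 "length zs" "%s. ?D (take (Suc s) zs) * ?D (drop s zs)"] zs
  by (simp add: lessThan_atLeast0 del: sum.op_ivl_Suc)
 finally have "(msc a + a) * ?D zs + ?D (tl zs) + (\<Sum>s=1..<length zs. ?D (take (Suc s) zs) * ?D (drop s zs)) = 0"
  unfolding id by (simp add: algebra_simps)
 hence "?D zs = msc a * (?D (tl zs) + (\<Sum>s=1..<length zs. ?D (take (Suc s) zs) * ?D (drop s zs)))"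
 proof -
  have "m * (X + Y) = D" if "- 1 / m * D + X + Y = 0" "m ~= 0" for m D X Y :: complex
  proof -
   have "X + Y = D / m" using that(1) by (simp add: algebra_simps eq_neg_iff_add_eq_0)
   thus ?thesis using that(2) by simp
  qed
  moreover assume "(msc a + a) * ?D zs + ?D (tl zs) + (\<Sum>s=1..<length zs. ?D (take (Suc s) zs) * ?D (drop s zs)) = 0"
  ultimately show ?thesis using msc_nonreal[OF a(2)] by metis
 qed
 moreover have "mdd (take (Suc s) zs) * mdd (drop s zs) = ?D (take (Suc s) zs) * ?D (drop s zs)" for s
  using mdd_idq assms(1) set_take_subset set_drop_subset by (metis order_trans)
 ultimately show ?thesis using mdd_idq[of zs] mdd_idq[of "tl zs"] assms(1) zs by simp
qed

section \<open>The recursions\<close>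

lemma rot_inv_m_circ: "(!!x. z x \<in> nonreal) ==> rot_inv (%c. m_circ (map z c))"
 unfolding rot_inv_def m_circ_def
proof
 fix c assume z: "!!x. z x \<in> nonreal"
 show "free_cumulant mdd (map z (rotate1 c)) = free_cumulant mdd (map z c)"
  unfolding rotate1_map[symmetric]
 proof (rule free_cumulant_rotate1[of nonreal])
  show "mdd (rotate1 xs) = mdd xs" if "set xs <= nonreal" for xs by (rule mdd_symmetric) (use that in "cases xs; simp")+
 qed (use z in auto)
qed

lemma disc_sum_single: "rot_inv \<tau> ==> rot_inv \<kappa> ==> disc_sum \<tau> \<kappa> [x] = \<tau> [x] * \<kappa> [x]"
proof -
 assume r: "rot_inv \<tau>" "rot_inv \<kappa>"
 have c: "cycle_list id [x]" "permutation (id :: 'a => 'a)" by (auto simp: cycle_list_def)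
 have "cl [x] = id" using disc_single[of x] cl_in_disc[of "[x]"] by simp
 moreover have "cprod {x} f id = f [x]" if "rot_inv f" for f :: "'a list => 'b"
  using cprod_cycle_list[OF c(2) that c(1)] by simp
 ultimately show ?thesis using r by (simp add: disc_sum_def)
qed

lemma ignores_one: "ignores x (%_. 1) (%_. 1)" by (simp add: ignores_def rot_inv_def)

lemma merges_one: "merges a l (%_. 1) (%_. 1)" by (simp add: merges_def rot_inv_def)

lemma cprod_one: "cprod T (%_. 1) p = 1" by (simp add: cprod_def)

lemma sum_single_nonzero:
 assumes "finite A" "a \<in> A" "!!x. x \<in> A ==> x ~= a ==> f x = 0" shows "sum f A = f a"
 using sum.remove[OF assms(1,2), of f] sum.neutral[of "A - {a}" f] assms(3) by simp

lemma support_disc: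
 assumes "distinct u" "u ~= []" "p \<in> disc u"
 shows "support p (hd u) = block u (orbit p (hd u))" "set (support p (hd u)) <= set u"
  "hd (support p (hd u)) = hd u" "distinct (support p (hd u))" "support p (hd u) ~= []"
  "p ~= cl u ==> length (support p (hd u)) < length u"
proof -
 note d = discD[OF assms(3)]
 have h: "hd u \<in> set u" "hd u \<in> orbit p (hd u)" using assms(2) in_own_orbit[OF d(2)] by auto
 have c: "cycle_list p (block u (orbit p (hd u)))" unfolding block_def by (rule disc_sorted[OF assms(1,3) h(1)])
 have "hd (block u (orbit p (hd u))) = hd u" using h assms(2) by (cases u) (auto simp: block_def)
 thus b: "support p (hd u) = block u (orbit p (hd u))" using support_eqI[OF d(4) c] by simp
 show "hd (support p (hd u)) = hd u" by (rule cycle_support(2)[OF d(4)])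
 show "set (support p (hd u)) <= set u" unfolding b by (auto simp: block_def)
 show "distinct (support p (hd u))" unfolding b using assms(1) by (simp add: block_def)
 show "support p (hd u) ~= []" by (rule support_ne[OF d(4)])
 assume ne: "p ~= cl u"
 have "orbit p (hd u) ~= set u"
 proof
  assume e: "orbit p (hd u) = set u"
  hence "set u \<in> orbs (set u) p" using h(1) unfolding orbs_def by (metis imageI)
  thus False using disc_full_orbit[OF assms(1,2,3)] ne by simp
 qed
 hence "\<not> set u <= orbit p (hd u)" using orbit_sub[OF d(2) h(1)] by blast
 thus "length (support p (hd u)) < length u" unfolding b by (rule length_block_proper[OF assms(1)])
qed

lemma support_cl: "distinct u ==> u ~= [] ==> support (cl u) (hd u) = u"
 by (rule support_eqI[OF cl_permutation cycle_list_cl])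

lemma orbit_cl: "distinct u ==> x \<in> set u ==> orbit (cl u) x = set u"
 by (rule cycle_list_orbit[OF cycle_list_cl]) auto

text \<open>With all traces equal to one, \<open>disc_expansion\<close> and \<open>mdd_recursion\<close> show that the sum of the defects
vanishes. The cycles of the first letter are shorter than V except for the single permutation with one cycle.\<close>

theorem defect_m_circ:
 fixes z :: "'a => complex"
 assumes z: "!!x. z x \<in> nonreal" and "distinct V" "V ~= []"
 shows "defect (%c. m_circ (map z c)) (msc (z (hd V))) V = 0"
 using assms(2,3)
proof (induction "length V" arbitrary: V rule: less_induct)
 case less
 let ?\<kappa> = "%c. m_circ (map z c)" and ?c = "msc (z (hd V))"
 let ?D = "disc_sum (%_. 1) ?\<kappa>"
 note \<kappa> = rot_inv_m_circ[of z, OF z]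
 have md: "?D w = mdd (map z w)" if "distinct w" "w ~= []" for w
  using moment_disc_sum[of w mdd z] that \<kappa> by (simp add: m_circ_def)
 have nz: "set (map z w) <= nonreal" for w using z by auto
 have "?D V - ?c * (if tl V = [] then 1 else ?D (tl V)) - ?c * (\<Sum>s=1..<length V. ?D (take (Suc s) V) * ?D (drop s V)) = 0"
 proof (cases "tl V = []")
  case True
  then obtain x where "V = [x]" using less.prems(2) by (cases V) auto
  thus ?thesis using md[of "[x]"] mdd_single z by simp
 next
  case False
  have s: "?D (take (Suc s) V) * ?D (drop s V) = mdd (take (Suc s) (map z V)) * mdd (drop s (map z V))" if "s \<in> {1..<length V}" for s
   using md[of "take (Suc s) V"] md[of "drop s V"] less.prems that by (simp add: take_map drop_map)
  have S: "(\<Sum>s=1..<length V. ?D (take (Suc s) V) * ?D (drop s V)) = (\<Sum>s=1..<length V. mdd (take (Suc s) (map z V)) * mdd (drop s (map z V)))"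
   by (rule sum.cong[OF refl s])
  have "mdd (map z V) = ?c * (mdd (map z (tl V)) + (\<Sum>s=1..<length V. ?D (take (Suc s) V) * ?D (drop s V)))"
   unfolding S
   using mdd_recursion[OF nz, of V] False less.prems(2) by (simp add: hd_map map_tl Suc_le_eq length_greater_0_conv[symmetric] del: length_greater_0_conv)
  thus ?thesis using False md[of V] md[of "tl V"] less.prems by (simp add: distinct_tl algebra_simps)
 qed
 also have "?D V - ?c * (if tl V = [] then 1 else ?D (tl V)) - ?c * (\<Sum>s=1..<length V. ?D (take (Suc s) V) * ?D (drop s V))
  = (\<Sum>p\<in>disc V. dwt (%_. 1) V p * (cprod (set V - orbit p (hd V)) ?\<kappa> p * defect ?\<kappa> ?c (support p (hd V))))"
  using disc_expansion[where u = V and \<tau> = "%_. 1" and \<tau>0 = "%_. 1" and \<tau>x = "%_ _. 1" and \<kappa> = ?\<kappa> and c = ?c,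
   OF less.prems rot_inv_one \<kappa> merges_one ignores_one] by simp
 also have "... = dwt (%_. 1) V (cl V) * (cprod (set V - orbit (cl V) (hd V)) ?\<kappa> (cl V) * defect ?\<kappa> ?c (support (cl V) (hd V)))"
 proof (rule sum_single_nonzero[OF finite_disc cl_in_disc[OF less.prems]])
  fix p assume p: "p \<in> disc V" "p ~= cl V"
  note s = support_disc[OF less.prems p(1)]
  have "defect ?\<kappa> ?c (support p (hd V)) = 0" using less.hyps[OF s(6)[OF p(2)] s(4,5)] s(3) by simp
  thus "dwt (%_. 1) V p * (cprod (set V - orbit p (hd V)) ?\<kappa> p * defect ?\<kappa> ?c (support p (hd V))) = 0" by simp
 qed
 also have "... = defect ?\<kappa> ?c V"
  using less.prems by (simp add: cprod_one support_cl orbit_cl)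
 finally show ?case by simp
qed

section \<open>The recursion for the second-order function\<close>

text \<open>The defining equation with sums that start at 0, in the form in which lists are cut by \<open>take\<close> and \<open>drop\<close>.\<close>

lemma mfrak_GUE_rec:
 fixes a b :: "(complex \<times> (complex^'n^'n)) list"
 assumes "a ~= []"
 defines "q \<equiv> qsc (fst (hd a)) (fst (last a))" and "t \<equiv> ntr (snd (last a))"
 shows "mfrak_GUE a b = msc (fst (hd a)) *
  ((if length a = 1 then 0 else mfrak_GUE (tl (butlast a) @ [(fst (last a), snd (last a) ** snd (hd a))]) b
    + q * mfrak_GUE (tl (butlast a) @ [(fst (last a), snd (hd a))]) b * t)
   + (\<Sum>s<length a - 1. mfrak_GUE (close_list (take (Suc s) a)) b * (mfrak (drop s a) + q * mfrak (close_list (drop s a)) * t))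
   + (\<Sum>s=1..<length a. mfrak (close_list (take (Suc s) a)) * (mfrak_GUE (drop s a) b + q * mfrak_GUE (close_list (drop s a)) b * t))
   + (\<Sum>i<length b. mfrak (a @ rotate i b @ [(fst (b ! i), mat 1)]) + q * t * mfrak (close_list a @ rotate i b @ [(fst (b ! i), mat 1)])))"
proof -
 have 1: "(\<Sum>j = 1..n. f j) = (\<Sum>s<n. f (Suc s))" for f :: "nat => complex" and n
  using sum.atLeast1_atMost_eq[of f n] by simp
 have 2: "(\<Sum>j = 2..n. f j) = (\<Sum>s=1..<n. f (Suc s))" for f :: "nat => complex" and n
  using sum.shift_bounds_Suc_ivl[of f 1 n] by (simp add: atLeastLessThanSuc_atLeastAtMost numeral_2_eq_2)
 show ?thesis
  by (subst mfrak_GUE.simps) (simp only: assms(1) if_False Let_def sfrak_GUE_def 1 2 q_def t_def diff_Suc_1)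
qed

abbreviation ident :: "complex list => (complex \<times> (complex^'n^'n)) list" where
 "ident zs \<equiv> map (%z. (z, mat 1)) zs"

lemma close_list_ident: "zs ~= [] ==> close_list (ident zs) = ident zs"
 by (cases zs rule: rev_cases) (auto simp: close_list_def)

lemma matrix_prod_list_one: "(!!M. M \<in> set Ms ==> M = mat 1) ==> matrix_prod_list Ms = mat 1"
 by (induction Ms) (simp_all add: matrix_prod_list_def)

lemma mfrak_ident:
 assumes "zs ~= []" shows "mfrak (ident zs :: (complex \<times> (complex^'n^'n)) list) = mdd zs"
proof -
 have "matrix_prod_list (map snd (nths (ident zs) B)) = (mat 1 :: complex^'n^'n)" for B
 proof -
  have "snd ` set (nths (ident zs :: (complex \<times> (complex^'n^'n)) list) B) <= {mat 1}" using notin_set_nthsI by (fastforce dest: in_set_nthsD)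
  thus ?thesis by (intro matrix_prod_list_one) auto
 qed
 moreover have "map fst (nths (ident zs :: (complex \<times> (complex^'n^'n)) list) B) = nths zs B" for B by (simp add: nths_map comp_def)
 ultimately show ?thesis unfolding mfrak_def using moment_free_cumulant[OF assms, of mdd] by (simp add: ntr_one)
qed

lemma one_minus_mult_nonzero:
 assumes "z \<in> nonreal" "w \<in> nonreal" shows "1 - msc z * msc w ~= 0"
proof
 assume "1 - msc z * msc w = 0"
 hence "norm (msc z) * norm (msc w) = 1" by (metis eq_iff_diff_eq_0 norm_mult norm_one)
 moreover have "norm (msc z) < 1" "norm (msc w) < 1" using msc_nonreal assms by (simp_all add: nonreal_def)
 hence "norm (msc z) * norm (msc w) < 1" using mult_strict_mono[of "norm (msc z)" 1 "norm (msc w)" 1] by simp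
 ultimately show False by simp
qed

text \<open>For identity matrices every term of the defining recursion carries the factor 1 + q = 1 / (1 - m_1 m_k),
whose removal brings back the term j = k.\<close>

theorem m_GUE_recursion:
 fixes N :: "'n::finite itself"
 assumes "zs ~= []" "set zs <= nonreal"
 shows "m_GUE N zs ws = msc (hd zs) * (m_GUE N (tl zs) ws
  + (\<Sum>s<length zs. m_GUE N (take (Suc s) zs) ws * mdd (drop s zs))
  + (\<Sum>s=1..<length zs. mdd (take (Suc s) zs) * m_GUE N (drop s zs) ws)
  + (\<Sum>i<length ws. mdd (zs @ rotate i ws @ [ws ! i])))"
proof -
 let ?G = "ident :: complex list => (complex \<times> (complex^'n^'n)) list"
 let ?X = "%w. mfrak_GUE (?G w) (?G ws)"
 let ?k = "length zs" and ?q = "qsc (hd zs) (last zs)" and ?m = "msc (hd zs)" and ?n = "msc (last zs)"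
 have ne: "?G zs ~= []" and n1: "ntr (mat 1 :: complex^'n^'n) = 1" using assms(1) by (simp_all add: ntr_one)
 have hl: "hd (?G zs) = (hd zs, mat 1)" "last (?G zs) = (last zs, mat 1)" using assms(1) by (simp_all add: hd_map last_map)
 have tl0: "(if length (?G zs) = 1 then 0 else mfrak_GUE (tl (butlast (?G zs)) @ [(fst (last (?G zs)), snd (last (?G zs)) ** snd (hd (?G zs)))]) (?G ws)
    + ?q * mfrak_GUE (tl (butlast (?G zs)) @ [(fst (last (?G zs)), snd (hd (?G zs)))]) (?G ws) * ntr (snd (last (?G zs)))) = (1 + ?q) * ?X (tl zs)"
 proof (cases "?k = 1")
  case True
  hence "tl zs = []" by (cases zs) auto
  thus ?thesis using True by simp
 next
  case False
  hence "tl zs ~= []" using assms(1) by (cases zs) auto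
  hence "tl zs = tl (butlast zs) @ [last zs]" by (metis append_butlast_last_id butlast_tl last_tl)
  hence "?G (tl zs) = tl (butlast (?G zs)) @ [(last zs, mat 1)]" by (metis (no_types, lifting) list.simps(8,9) map_append map_butlast map_tl)
  thus ?thesis using False by (simp add: hl n1 algebra_simps)
 qed
 have S1: "(\<Sum>s<length (?G zs) - 1. mfrak_GUE (close_list (take (Suc s) (?G zs))) (?G ws) * (mfrak (drop s (?G zs)) + ?q * mfrak (close_list (drop s (?G zs))) * ntr (snd (last (?G zs)))))
   = (\<Sum>s<?k - 1. (1 + ?q) * (?X (take (Suc s) zs) * mdd (drop s zs)))"
  by (rule sum.cong) (use assms(1) in "simp_all add: take_map drop_map close_list_ident mfrak_ident hl n1 algebra_simps")
 have S2: "(\<Sum>s=1..<length (?G zs). mfrak (close_list (take (Suc s) (?G zs))) * (mfrak_GUE (drop s (?G zs)) (?G ws) + ?q * mfrak_GUE (close_list (drop s (?G zs))) (?G ws) * ntr (snd (last (?G zs)))))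
   = (\<Sum>s=1..<?k. (1 + ?q) * (mdd (take (Suc s) zs) * ?X (drop s zs)))"
  by (rule sum.cong) (use assms(1) in "simp_all add: take_map drop_map close_list_ident mfrak_ident hl n1 algebra_simps")
 have S3: "(\<Sum>i<length (?G ws). mfrak (?G zs @ rotate i (?G ws) @ [(fst (?G ws ! i), mat 1)]) + ?q * ntr (snd (last (?G zs))) * mfrak (close_list (?G zs) @ rotate i (?G ws) @ [(fst (?G ws ! i), mat 1)]))
   = (\<Sum>i<length ws. (1 + ?q) * mdd (zs @ rotate i ws @ [ws ! i]))"
 proof (rule sum.cong)
  fix i assume "i \<in> {..<length ws}"
  hence e: "?G zs @ rotate i (?G ws) @ [(fst (?G ws ! i), mat 1)] = ?G (zs @ rotate i ws @ [ws ! i])" by (simp add: rotate_map)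
  have m: "mfrak (?G (zs @ rotate i ws @ [ws ! i])) = mdd (zs @ rotate i ws @ [ws ! i])" by (rule mfrak_ident) simp
  show "mfrak (?G zs @ rotate i (?G ws) @ [(fst (?G ws ! i), mat 1)]) + ?q * ntr (snd (last (?G zs))) * mfrak (close_list (?G zs) @ rotate i (?G ws) @ [(fst (?G ws ! i), mat 1)])
    = (1 + ?q) * mdd (zs @ rotate i ws @ [ws ! i])"
   by (simp only: close_list_ident[OF assms(1)] e m hl n1 snd_conv) (simp add: distrib_right)
 qed simp
 define Y where "Y = ?X (tl zs) + (\<Sum>s<?k - 1. ?X (take (Suc s) zs) * mdd (drop s zs)) + (\<Sum>s=1..<?k. mdd (take (Suc s) zs) * ?X (drop s zs))
   + (\<Sum>i<length ws. mdd (zs @ rotate i ws @ [ws ! i]))"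
 have nz: "1 - ?m * ?n ~= 0" using assms by (intro one_minus_mult_nonzero) auto
 have "?X zs = ?m * ((1 + ?q) * Y)"
 proof -
  have hf: "fst (hd (?G zs)) = hd zs" "fst (last (?G zs)) = last zs" by (simp_all add: hl)
  show ?thesis
   unfolding mfrak_GUE_rec[OF ne, of "?G ws"] hf
   unfolding tl0[unfolded hf] S1 S2 S3 Y_def by (simp only: sum_distrib_left[symmetric] distrib_left[symmetric])
 qed
 hence 1: "?X zs * (1 - ?m * ?n) = ?m * Y" using nz by (simp add: qsc_def field_simps)
 have last: "(\<Sum>s<?k. ?X (take (Suc s) zs) * mdd (drop s zs)) = (\<Sum>s<?k - 1. ?X (take (Suc s) zs) * mdd (drop s zs)) + ?X zs * ?n"
 proof -
  obtain n where n: "?k = Suc n" using assms(1) by (cases zs) auto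
  have "drop n zs = [last zs]" using n assms(1) by (metis append_butlast_last_id append_eq_conv_conj diff_Suc_1 length_butlast)
  moreover have "last zs \<in> nonreal" using assms by auto
  ultimately show ?thesis using n mdd_single by simp
 qed
 have "?X zs = ?m * (Y + ?X zs * ?n)" using 1 by (simp add: algebra_simps)
 thus ?thesis unfolding m_GUE_def last Y_def by (simp add: algebra_simps)
qed

section \<open>Vanishing of the second-order defect\<close>

lemma block_block: "X <= Y ==> block (block u Y) X = block u X"
 unfolding block_def by (auto intro: filter_cong)

lemma block_self: "block u (set u) = u"
 by (simp add: block_def)

lemma defect2_cong:
 assumes V: "V ~= []" and g: "!!c. set c <= set V ==> g c = g' c" and s: "!!w. w \<in> Y ==> support q w = support q' w"
 shows "defect2 \<kappa> g c V q Y = defect2 \<kappa> g' c V q' Y"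
proof -
 have d: "g (drop i V) = g' (drop i V)" for i by (rule g[OF set_drop_subset])
 have J: "J1 \<kappa> g (take i V) (V ! i) = J1 \<kappa> g' (take i V) (V ! i)" if "i < length V" for i
 proof -
  have i: "V ! i \<in> set V" "set (take i V) <= set V" using that by (simp_all add: set_take_subset)
  have "g (take i V @ [V ! i]) = g' (take i V @ [V ! i])" by (rule g) (use i in auto)
  moreover have "g (take t (take i V)) = g' (take t (take i V))" for t by (rule g) (use i set_take_subset[of t "take i V"] in auto)
  moreover have "g (drop t (take i V) @ [V ! i]) = g' (drop t (take i V) @ [V ! i])" for t
   by (rule g) (use i set_drop_subset[of t "take i V"] in auto)
  ultimately show ?thesis unfolding J1_def by (simp only:)
 qed
 have "defect1 \<kappa> g c V = defect1 \<kappa> g' c V"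
  unfolding defect1_def using J d g[of V] by (auto intro!: sum.cong)
 moreover have "g [hd V] = g' [hd V]" by (rule g) (use V in auto)
 moreover have "(\<Sum>w\<in>Y. \<kappa> (take i V @ V ! i # support q w)) = (\<Sum>w\<in>Y. \<kappa> (take i V @ V ! i # support q' w))" for i
  by (rule sum_congI) (simp only: s)
 moreover have "(\<Sum>w\<in>Y. J \<kappa> (V @ support q w) w) = (\<Sum>w\<in>Y. J \<kappa> (V @ support q' w) w)"
  by (rule sum_congI) (simp only: s)
 ultimately show ?thesis unfolding defect2_def by (simp only:)
qed

text \<open>The defect of two cycles depends only on the two words they form, so it can be moved to shorter words.\<close>

lemma defect2_on_blocks:
 assumes "distinct u" "u ~= []" "p \<in> disc u" "distinct v" "q \<in> disc v" "Y \<in> orbs (set v) q"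
 defines "V \<equiv> support p (hd u)" and "W \<equiv> block v Y"
 shows "defect2 \<kappa> (%c. \<kappa>\<kappa> (block u (set c)) W) c V q Y = defect2 \<kappa> (%c. \<kappa>\<kappa> (block V (set c)) W) c V (cl W) (set W)"
  "distinct W" "W ~= []" "set W = Y" "Y <= set v"
proof -
 note s = support_disc[OF assms(1-3)]
 obtain y where y: "y \<in> set v" "Y = orbit q y" using assms(6) by (auto simp: orbs_def)
 have W: "cycle_list q W" unfolding W_def block_def y(2) by (rule disc_sorted[OF assms(4,5) y(1)])
 thus dW: "distinct W" "W ~= []" by (simp_all add: cycle_list_def)
 show Y: "Y <= set v" unfolding y(2) by (rule orbit_sub[OF discD(2)[OF assms(5)] y(1)])
 thus sW: "set W = Y" by (auto simp: W_def block_def)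
 have sup: "support q w = support (cl W) w" if "w \<in> Y" for w
 proof -
  have c: "cycle_list (cl W) (support (cl W) w)" "hd (support (cl W) w) = w" "set (support (cl W) w) = Y"
  proof -
   have "orbit (cl W) w = Y" using orbit_cl[OF dW(1), of w] sW that by simp
   thus "set (support (cl W) w) = Y" using set_support[OF cl_permutation, of W w] by (rule trans[rotated])
  qed (rule cycle_support[OF cl_permutation])+
  have "cycle_list q (support (cl W) w)"
   using c(1,3) cycle_list_cong[of "support (cl W) w" q "cl W"] cycle_list_agree[OF W cycle_list_cl[OF dW]] sW by blast
  from support_eqI[OF discD(4)[OF assms(5)] this] show ?thesis using c(2) by simp
 qed
 have b: "block u (set c) = block V (set c)" if "set c <= set V" for c
 proof -
  have V: "V = block u (orbit p (hd u))" unfolding V_def by (rule s(1))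
  hence "set V <= orbit p (hd u)" by (auto simp: block_def)
  thus ?thesis using block_block[of "set c" "orbit p (hd u)" u] that V by auto
 qed
 show "defect2 \<kappa> (%c. \<kappa>\<kappa> (block u (set c)) W) c V q Y = defect2 \<kappa> (%c. \<kappa>\<kappa> (block V (set c)) W) c V (cl W) (set W)"
  unfolding sW by (rule defect2_cong) (use s(5) b sup in "auto simp: V_def")
qed

context
 fixes z :: "'a => complex" and e :: "'a => 'a" and S :: "'a set"
 assumes z: "!!x. z x \<in> nonreal" and e: "!!x. x \<in> S ==> e x ~: S" "!!x. x \<in> S ==> z (e x) = z x"
begin

abbreviation (input) cum :: "'a list => complex" where "cum c \<equiv> m_circ (map z c)"

abbreviation (input) cum2 :: "'n::finite itself => 'a list => 'a list => complex" where
 "cum2 N a b \<equiv> m_circcirc N (map z a) (map z b)"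

lemma m_circ_mdd: "distinct w ==> w ~= [] ==> disc_sum (%_. 1) cum w = mdd (map z w)"
 using moment_disc_sum[of w mdd z] rot_inv_m_circ[of z, OF z] by (simp add: m_circ_def)

lemma circ_sum_Nil: "circ_sum \<tau> f g [] v = 0"
 by (simp add: circ_sum_def annulus_sum_def marked_sum_def)

lemma m_circcirc_m_GUE:
 fixes N :: "'n::finite itself"
 assumes "distinct (u @ v)" "v ~= []"
 shows "circ_sum (%_. 1) cum (cum2 N) u v = m_GUE N (map z u) (map z v)"
proof (cases "u = []")
 case False
 thus ?thesis
  using second_moment_circ_sum[OF assms(1) False assms(2), of mdd z "m_GUE N"] rot_inv_m_circ[of z, OF z]
  by (simp add: m_circ_def m_circcirc_def)
qed (simp add: circ_sum_Nil m_GUE_def)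

text \<open>The points \<open>e x\<close> are fresh copies of x with the same spectral parameter, which carry the identity matrix when
the second circle is entered at x.\<close>

lemma two_circle_expansion_m_circ:
 fixes N :: "'n::finite itself"
 assumes "distinct (u @ v)" "u ~= []" "v ~= []" "set u Un set v <= S" "rot_inv \<tau>"
  "tl u ~= [] ==> merges (hd u) (last u) \<tau> \<tau>0" "!!x. x \<in> set u ==> ignores x (\<tau>x x) \<tau>" "!!x. x \<in> set v ==> ignores (e x) (\<tau>x (e x)) \<tau>"
 defines "c \<equiv> msc (z (hd u))"
 shows "circ_sum \<tau> cum (cum2 N) u v - c * (circ_sum \<tau>0 cum (cum2 N) (tl u) v
   + (\<Sum>s<length u. circ_sum (\<tau>x (u ! s)) cum (cum2 N) (take (Suc s) u) v * disc_sum \<tau> cum (drop s u))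
   + (\<Sum>s=1..<length u. disc_sum (\<tau>x (u ! s)) cum (take (Suc s) u) * circ_sum \<tau> cum (cum2 N) (drop s u) v)
   + (\<Sum>i<length v. disc_sum (\<tau>x (e (v ! i))) cum (u @ rotate i v @ [e (v ! i)])))
  = (\<Sum>p\<in>disc u. \<Sum>q\<in>disc v. dwt \<tau> u p * dwt \<tau> v q *
    (cprod (set u - orbit p (hd u)) cum p * (\<Sum>Y\<in>orbs (set v) q. cprod (set v - Y) cum q *
      defect2 cum (%c. cum2 N (block (support p (hd u)) (set c)) (block v Y)) c (support p (hd u)) (cl (block v Y)) (set (block v Y)))))"
proof -
 have d: "distinct u" "distinct v" using assms(1) by simp_all
 have vi: "v ! i \<in> set v" "v ! i \<in> S" if "i < length v" for i using that assms(4) nth_mem[OF that] by auto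
 have ee: "e (v ! i) ~: set u Un set v" if "i < length v" for i using e(1)[OF vi(2)[OF that]] assms(4) by blast
 have ke: "cum (w @ [e (v ! i)]) = cum (w @ [v ! i])" if "i < length v" for w i using e(2)[OF vi(2)[OF that]] by simp
 have d0: "defect cum c V = 0" if "V ~= []" "distinct V" "set V <= set u Un set v" "hd V = hd u" for V
  using defect_m_circ[of z, OF z that(2,1)] that(4) by (simp add: c_def)
 show ?thesis
 proof (rule trans[OF two_circle_expansion[where \<epsilon> = "%i. e (v ! i)" and \<tau>e = "%i. \<tau>x (e (v ! i))" and \<kappa> = cum and \<tau> = \<tau> and \<tau>0 = \<tau>0 and \<tau>x = \<tau>x and c = c and \<kappa>\<kappa> = "cum2 N",
    OF assms(1-3,5) rot_inv_m_circ[of z, OF z] assms(6,7) assms(8)[OF vi(1)] ee ke d0]])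
 qed (assumption | rule refl | intro sum.cong refl arg_cong2[where f = "(*)"] defect2_on_blocks(1)[OF d(1) assms(2) _ d(2)])+
qed

text \<open>Apart from the pair of one-cycle permutations, every summand of the expansion is a multiple of a defect of two
shorter words, and the sum is zero by the recursion for identity matrices.\<close>

theorem defect2_m_circcirc:
 fixes N :: "'n::finite itself"
 assumes "distinct (V @ W)" "V ~= []" "W ~= []" "set V Un set W <= S"
 shows "defect2 cum (%c. cum2 N (block V (set c)) W) (msc (z (hd V))) V (cl W) (set W) = 0"
 using assms
proof (induction "length V + length W" arbitrary: V W rule: less_induct)
 case less

 have d: "distinct V" "distinct W" using less.prems(1) by simp_all
 let ?c = "msc (z (hd V))"
 let ?T = "%p q. \<Sum>Y\<in>orbs (set W) q. cprod (set W - Y) cum q *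
      defect2 cum (%c. cum2 N (block (support p (hd V)) (set c)) (block W Y)) ?c (support p (hd V)) (cl (block W Y)) (set (block W Y))"
 have cs: "circ_sum (%_. 1) cum (cum2 N) w W = m_GUE N (map z w) (map z W)" if "distinct w" "set w <= set V" for w
  by (rule m_circcirc_m_GUE) (use that less.prems in auto)
 have ds: "disc_sum (%_. 1) cum w = mdd (map z w)" if "distinct w" "w ~= []" for w using m_circ_mdd that .
 have E: "(\<Sum>i<length W. disc_sum (%_. 1) cum (V @ rotate i W @ [e (W ! i)])) = (\<Sum>i<length W. mdd (map z V @ rotate i (map z W) @ [map z W ! i]))"
 proof (rule sum_congI)
  fix i assume "i \<in> {..<length W}"
  hence i: "i < length W" "W ! i \<in> S" using less.prems(4) nth_mem[of i W] by auto
  have "e (W ! i) ~: set V Un set W" using e(1)[OF i(2)] less.prems(4) by blast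
  thus "disc_sum (%_. 1) cum (V @ rotate i W @ [e (W ! i)]) = mdd (map z V @ rotate i (map z W) @ [map z W ! i])"
   using ds[of "V @ rotate i W @ [e (W ! i)]"] less.prems(1) e(2)[OF i(2)] i(1) by (simp add: rotate_map)
 qed
 have nr: "set (map z V) <= nonreal" using z by auto
 have A: "(\<Sum>s<length V. circ_sum (%_. 1) cum (cum2 N) (take (Suc s) V) W * disc_sum (%_. 1) cum (drop s V))
   = (\<Sum>s<length (map z V). m_GUE N (take (Suc s) (map z V)) (map z W) * mdd (drop s (map z V)))"
  by (rule sum.cong) (use d in "simp_all add: cs ds take_map drop_map set_take_subset")
 have B: "(\<Sum>s=1..<length V. disc_sum (%_. 1) cum (take (Suc s) V) * circ_sum (%_. 1) cum (cum2 N) (drop s V) W)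
   = (\<Sum>s=1..<length (map z V). mdd (take (Suc s) (map z V)) * m_GUE N (drop s (map z V)) (map z W))"
  by (rule sum.cong) (use d less.prems(2) in "simp_all add: cs ds take_map drop_map set_drop_subset")
 have tl: "circ_sum (%_. 1) cum (cum2 N) (tl V) W = m_GUE N (tl (map z V)) (map z W)"
  using cs[of "tl V"] d(1) less.prems(2) by (simp add: distinct_tl map_tl list.set_sel(2) subsetI)
 have "0 = (\<Sum>p\<in>disc V. \<Sum>q\<in>disc W. dwt (%_. 1) V p * dwt (%_. 1) W q *
    (cprod (set V - orbit p (hd V)) cum p * ?T p q))"
  unfolding two_circle_expansion_m_circ[where \<tau> = "%_. 1" and \<tau>0 = "%_. 1" and \<tau>x = "%_ _. 1" and N = N,
    OF less.prems rot_inv_one merges_one ignores_one ignores_one, symmetric] A B tl E cs[OF d(1) order_refl]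
  using m_GUE_recursion[OF _ nr, of N "map z W"] less.prems(2,3) by (simp add: hd_map)
 also have "... = (\<Sum>p\<in>disc V. \<Sum>q\<in>disc W. cprod (set V - orbit p (hd V)) cum p * ?T p q)"
  by (simp add: cprod_one)
 also have "... = (\<Sum>q\<in>disc W. cprod (set V - orbit (cl V) (hd V)) cum (cl V) * ?T (cl V) q)"
 proof (rule sum_single_nonzero[OF finite_disc cl_in_disc[OF d(1) less.prems(2)]])
  fix p assume p: "p \<in> disc V" "p ~= cl V"
  note s = support_disc[OF d(1) less.prems(2) p(1)]
  have "?T p q = 0" if q: "q \<in> disc W" for q
  proof (rule sum.neutral, rule ballI)
   fix Y assume Y: "Y \<in> orbs (set W) q"
   note b = defect2_on_blocks(2-5)[OF d(1) less.prems(2) p(1) d(2) q Y]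
   have l: "length (block W Y) \<le> length W" by (simp add: block_def)
   have "defect2 cum (%c. cum2 N (block V' (set c)) (block W Y)) (msc (z (hd V'))) V' (cl (block W Y)) (set (block W Y)) = 0"
    if "length V' < length V" "set V' <= set V" "distinct V'" "V' ~= []" for V'
    by (rule less.hyps) (use that l b less.prems in auto)
   from this[OF s(6)[OF p(2)] s(2,4,5)] show "cprod (set W - Y) cum q * defect2 cum (%c. cum2 N (block (support p (hd V)) (set c)) (block W Y)) ?c (support p (hd V)) (cl (block W Y)) (set (block W Y)) = 0"
    unfolding s(3) by simp
  qed
  thus "(\<Sum>q\<in>disc W. cprod (set V - orbit p (hd V)) cum p * ?T p q) = 0" by (simp add: sum.neutral)
 qed
 also have "... = (\<Sum>q\<in>disc W. ?T (cl V) q)" using orbit_cl[OF d(1)] less.prems(2) by simp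
 also have "... = ?T (cl V) (cl W)"
 proof (rule sum_single_nonzero[OF finite_disc cl_in_disc[OF d(2) less.prems(3)]])
  fix q assume q: "q \<in> disc W" "q ~= cl W"
  have p: "cl V \<in> disc V" by (rule cl_in_disc[OF d(1) less.prems(2)])
  show "?T (cl V) q = 0"
  proof (rule sum.neutral, rule ballI)
   fix Y assume Y: "Y \<in> orbs (set W) q"
   note b = defect2_on_blocks(2-5)[OF d(1) less.prems(2) p d(2) q(1) Y]
   have "\<not> set W <= Y"
   proof
    assume "set W <= Y"
    hence "set W \<in> orbs (set W) q" using Y b(4) by (simp add: subset_antisym)
    thus False using disc_full_orbit[OF d(2) less.prems(3) q(1)] q(2) by simp
   qed
   hence l: "length (block W Y) < length W" by (rule length_block_proper[OF d(2)])
   have "defect2 cum (%c. cum2 N (block V (set c)) (block W Y)) ?c V (cl (block W Y)) (set (block W Y)) = 0"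
    by (rule less.hyps) (use l b less.prems in auto)
   thus "cprod (set W - Y) cum q * defect2 cum (%c. cum2 N (block (support (cl V) (hd V)) (set c)) (block W Y)) ?c (support (cl V) (hd V)) (cl (block W Y)) (set (block W Y)) = 0"
    unfolding support_cl[OF d(1) less.prems(2)] by simp
  qed
 qed
 also have "... = defect2 cum (%c. cum2 N (block V (set c)) W) ?c V (cl W) (set W)"
  using orbs_cycle_list[OF cycle_list_cl[OF d(2) less.prems(3)]]
  by (simp add: support_cl[OF d(1) less.prems(2)] block_self)
 finally show ?case by simp
qed

end

section \<open>General matrices\<close>

abbreviation lab :: "('a => complex) => ('a => complex^'n^'n) => 'a list => (complex \<times> (complex^'n^'n)) list" where
 "lab z A w \<equiv> map (%j. (z j, A j)) w"

lemma lab_upd: "x ~: set w ==> lab z (A(x := M)) w = lab z A w"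
 by auto

lemma close_list_lab:
 assumes "distinct w" "w ~= []" shows "close_list (lab z A w) = lab z (A(last w := mat 1)) w"
 using assms by (cases w rule: rev_cases) (auto simp: close_list_def)

text \<open>All defects vanish, so \<open>circ_sum\<close> satisfies the recursion that still contains its term j = k. This term
involves the list closed by the identity; applying the recursion to that list as well and solving the two equations
gives the defining recursion with its factor q.\<close>

theorem mfrak_GUE_circ_sum:
 fixes z :: "'a => complex" and e :: "'a => 'a" and A :: "'a => complex^'n^'n"
 assumes z: "!!x. z x \<in> nonreal" and e: "!!x. x \<in> S ==> e x ~: S" "!!x. x \<in> S ==> z (e x) = z x"
  and "distinct (u @ v)" "v ~= []" "set u Un set v <= S"
 shows "mfrak_GUE (lab z A u) (lab z A v) =
  circ_sum (word_trace A) (%c. m_circ (map z c)) (%a b. m_circcirc TYPE('n) (map z a) (map z b)) u v"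
 using assms(4-6)
proof (induction "length u" arbitrary: u A rule: less_induct)
 case less
 let ?\<kappa> = "%c. m_circ (map z c)" and ?\<kappa>\<kappa> = "%a b. m_circcirc TYPE('n) (map z a) (map z b)"
 let ?F = "%A w. circ_sum (word_trace A) ?\<kappa> ?\<kappa>\<kappa> w v"
 let ?M = "%A w. disc_sum (word_trace A) ?\<kappa> w"
 note \<kappa> = rot_inv_m_circ[of z, OF z]
 show ?case
 proof (cases "u = []")
  case True
  thus ?thesis by (simp add: circ_sum_def annulus_sum_def marked_sum_def)
 next
  case ne: False
  have d: "distinct u" "distinct v" "set u Int set v = {}" using less.prems(1) by simp_all
  define k where "k = length u"
  define l where "l = last u"
  define c where "c = msc (z (hd u))"
  define q where "q = qsc (z (hd u)) (z l)"
  define t where "t = ntr (A l)"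
  have k: "0 < k" using ne by (simp add: k_def)
  have l: "l \<in> set u" "u ! (k - 1) = l" using ne by (simp_all add: l_def k_def last_conv_nth)
  have mf: "mfrak (lab z B w) = ?M B w" if "distinct w" "w ~= []" for w and B :: "'a => complex^'n^'n"
   by (rule mfrak_disc_sum[OF that \<kappa> rot_inv_word_trace])
  have IH: "mfrak_GUE (lab z B w) (lab z B v) = ?F B w" if "length w < length u" "distinct w" "set w <= set u" for w and B :: "'a => complex^'n^'n"
   by (rule less.hyps[OF that(1)]) (use that less.prems in auto)
  define A0 where "A0 = (%B :: 'a => complex^'n^'n. B(l := B l ** B (hd u)))"
  define A' where "A' = A(l := mat 1)"
  have tl_ne: "hd u ~= l" "l \<in> set (tl u)" if "tl u ~= []"
   using that d(1) ne unfolding l_def by (cases u; auto)+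
  define Y where "Y = (%B :: 'a => complex^'n^'n. c * (?F (A0 B) (tl u)
   + (\<Sum>s<k - 1. ?F (B(u ! s := mat 1)) (take (Suc s) u) * ?M B (drop s u))
   + (\<Sum>s=1..<k. ?M (B(u ! s := mat 1)) (take (Suc s) u) * ?F B (drop s u))
   + (\<Sum>i<length v. ?M (B(e (v ! i) := mat 1)) (u @ rotate i v @ [e (v ! i)]))))"
  have nat: "?F B u = Y B + c * ?F (B(l := mat 1)) u * (ntr (B l) * msc (z l))" for B :: "'a => complex^'n^'n"
  proof -
   have "?F B u - c * (?F (A0 B) (tl u)
    + (\<Sum>s<length u. ?F (B(u ! s := mat 1)) (take (Suc s) u) * ?M B (drop s u))
    + (\<Sum>s=1..<length u. ?M (B(u ! s := mat 1)) (take (Suc s) u) * ?F B (drop s u))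
    + (\<Sum>i<length v. ?M (B(e (v ! i) := mat 1)) (u @ rotate i v @ [e (v ! i)]))) = 0"
    unfolding c_def
   proof (rule trans[OF two_circle_expansion_m_circ[where \<tau> = "word_trace B" and \<tau>0 = "word_trace (A0 B)"
     and \<tau>x = "%x. word_trace (B(x := mat 1))" and N = "TYPE('n)", of z S e, OF z e less.prems(1) ne less.prems(2,3) rot_inv_word_trace]])
    show "merges (hd u) (last u) (word_trace B) (word_trace (A0 B))" if "tl u ~= []"
     by (rule merges_word_trace) (use tl_ne[OF that] in "auto simp: A0_def l_def")
    show "ignores x (word_trace (B(x := mat 1))) (word_trace B)" for x
     by (rule ignores_word_trace) auto
    thus "ignores x (word_trace (B(x := mat 1))) (word_trace B)" for x .
    show "(\<Sum>p\<in>disc u. \<Sum>q\<in>disc v. dwt (word_trace B) u p * dwt (word_trace B) v q *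
     (cprod (set u - orbit p (hd u)) ?\<kappa> p * (\<Sum>Y\<in>orbs (set v) q. cprod (set v - Y) ?\<kappa> q *
       defect2 ?\<kappa> (%c. ?\<kappa>\<kappa> (block (support p (hd u)) (set c)) (block v Y)) (msc (z (hd u))) (support p (hd u))
       (cl (block v Y)) (set (block v Y))))) = 0"
    proof (intro sum.neutral ballI)
     fix p q assume p: "p \<in> disc u" and q: "q \<in> disc v"
     note s = support_disc[OF d(1) ne p]
     have "(\<Sum>Y\<in>orbs (set v) q. cprod (set v - Y) ?\<kappa> q *
       defect2 ?\<kappa> (%c. ?\<kappa>\<kappa> (block (support p (hd u)) (set c)) (block v Y)) (msc (z (hd u))) (support p (hd u))
       (cl (block v Y)) (set (block v Y))) = 0"
     proof (intro sum.neutral ballI)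
      fix Y assume Y: "Y \<in> orbs (set v) q"
      note b = defect2_on_blocks(2-5)[OF d(1) ne p d(2) q Y]
      have "defect2 ?\<kappa> (%c. ?\<kappa>\<kappa> (block V (set c)) (block v Y)) (msc (z (hd V))) V (cl (block v Y)) (set (block v Y)) = 0"
       if "distinct V" "V ~= []" "set V <= set u" for V
       by (rule defect2_m_circcirc[of z S e, OF z e]) (use that b less.prems d in auto)
      from this[OF s(4,5,2)] show "cprod (set v - Y) ?\<kappa> q *
       defect2 ?\<kappa> (%c. ?\<kappa>\<kappa> (block (support p (hd u)) (set c)) (block v Y)) (msc (z (hd u))) (support p (hd u))
       (cl (block v Y)) (set (block v Y)) = 0" unfolding s(3) by simp
     qed
     thus "dwt (word_trace B) u p * dwt (word_trace B) v q *
     (cprod (set u - orbit p (hd u)) ?\<kappa> p * (\<Sum>Y\<in>orbs (set v) q. cprod (set v - Y) ?\<kappa> q *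
       defect2 ?\<kappa> (%c. ?\<kappa>\<kappa> (block (support p (hd u)) (set c)) (block v Y)) (msc (z (hd u))) (support p (hd u))
       (cl (block v Y)) (set (block v Y)))) = 0" by simp
    qed
   qed
   moreover have "(\<Sum>s<length u. ?F (B(u ! s := mat 1)) (take (Suc s) u) * ?M B (drop s u))
    = (\<Sum>s<k - 1. ?F (B(u ! s := mat 1)) (take (Suc s) u) * ?M B (drop s u)) + ?F (B(l := mat 1)) u * (ntr (B l) * msc (z l))"
   proof -
    obtain n where n: "length u = Suc n" "k - 1 = n" using k by (cases u) (auto simp: k_def)
    have dr: "drop n u = [l]" using n ne unfolding l_def by (metis append_butlast_last_id append_eq_conv_conj diff_Suc_1 length_butlast)
    have "?M B [l] = ntr (B l) * msc (z l)"
     using disc_sum_single[OF rot_inv_word_trace \<kappa>, of B l] disc_sum_single[OF rot_inv_one \<kappa>, of l]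
      mdd_single[OF z, of l] moment_disc_sum[of "[l]" mdd z] \<kappa> by (simp add: m_circ_def)
    thus ?thesis using n dr l(2) by simp
   qed
   ultimately show ?thesis by (simp add: Y_def k_def algebra_simps)
  qed
  have nz: "1 - c * msc (z l) ~= 0" unfolding c_def by (rule one_minus_mult_nonzero[OF z z])
  have F: "?F A u = Y A + q * t * Y A'"
  proof -
   have "?F A' u = Y A' + c * ?F A' u * msc (z l)" using nat[of A'] by (simp add: A'_def ntr_one)
   hence "?F A' u = Y A' / (1 - c * msc (z l))" using nz by (simp add: field_simps)
   thus ?thesis using nat[of A] nz by (simp add: q_def t_def qsc_def c_def A'_def[symmetric] field_simps)
  qed
  let ?a = "lab z A u" and ?b = "lab z A v"
  have a: "?a ~= []" "fst (hd ?a) = z (hd u)" "snd (hd ?a) = A (hd u)" "fst (last ?a) = z l" "snd (last ?a) = A l" "length ?a = k" "length ?b = length v"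
   using ne by (simp_all add: hd_map last_map l_def k_def)
  have bv: "lab z (B(x := M)) v = lab z B v" if "x \<in> set u" for x M and B :: "'a => complex^'n^'n" using d(3) that by (intro lab_upd) auto
  have bA: "?b = lab z A' v" "?b = lab z (A0 A) v" "?b = lab z (A0 A') v"
   unfolding A0_def A'_def bv[OF l(1)] by simp_all
  have us: "u ! s \<in> set u" "last (take (Suc s) u) = u ! s" "take (Suc s) u ~= []" if "s < k" for s
   using that by (simp_all add: k_def take_Suc_conv_app_nth)
  have dl: "last (drop s u) = l" "drop s u ~= []" if "s < k" for s using that by (simp_all add: k_def l_def)
  have cl1: "close_list (take (Suc s) ?a) = lab z (A(u ! s := mat 1)) (take (Suc s) u)" if "s < k" for s
   using close_list_lab[of "take (Suc s) u" z A] d(1) us[OF that] by (simp add: take_map)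
  have cl2: "close_list (drop s ?a) = lab z A' (drop s u)" if "s < k" for s
   using close_list_lab[of "drop s u" z A] d(1) dl[OF that] by (simp add: drop_map A'_def)
  have T1: "(if k = 1 then 0 else mfrak_GUE (tl (butlast ?a) @ [(z l, A l ** A (hd u))]) ?b
    + q * mfrak_GUE (tl (butlast ?a) @ [(z l, A (hd u))]) ?b * t) = ?F (A0 A) (tl u) + q * t * ?F (A0 A') (tl u)"
  proof (cases "k = 1")
   case True
   hence "tl u = []" by (cases u) (auto simp: k_def)
   thus ?thesis using True by (simp add: circ_sum_def annulus_sum_def marked_sum_def)
  next
   case False
   hence tu: "tl u ~= []" using ne by (cases u) (auto simp: k_def)
   have tlu: "tl u = tl (butlast u) @ [l]" using tu unfolding l_def by (metis append_butlast_last_id butlast_tl last_tl)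
   have ln: "l ~: set (tl (butlast u))" using d(1) tlu by (metis distinct_append distinct_tl list.set_intros(1) disjoint_iff)
   have up: "lab z (A0 B) (tl u) = tl (butlast ?a) @ [(z l, B l ** B (hd u))]" if "!!x. x ~= l ==> B x = A x" for B :: "'a => complex^'n^'n"
   proof -
    have "lab z (A0 B) (tl (butlast u)) = lab z A (tl (butlast u))" using ln that by (auto simp: A0_def)
    thus ?thesis unfolding tlu by (simp add: A0_def map_tl map_butlast)
   qed
   have tl: "length (tl u) < length u" "distinct (tl u)" "set (tl u) <= set u" using ne d(1) by (simp_all add: distinct_tl list.set_sel(2) subsetI)
   have "tl (butlast ?a) @ [(z l, A (hd u))] = lab z (A0 A') (tl u)" using up[of A'] tl_ne(1)[OF tu] by (simp add: A'_def)
   thus ?thesis using False up[of A] IH[OF tl, of "A0 A"] IH[OF tl, of "A0 A'"] by (simp add: bA(2,3)[symmetric] algebra_simps)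
  qed
  have T2: "(\<Sum>s<k - 1. mfrak_GUE (close_list (take (Suc s) ?a)) ?b * (mfrak (drop s ?a) + q * mfrak (close_list (drop s ?a)) * t))
   = (\<Sum>s<k - 1. ?F (A(u ! s := mat 1)) (take (Suc s) u) * ?M A (drop s u)) + q * t * (\<Sum>s<k - 1. ?F (A'(u ! s := mat 1)) (take (Suc s) u) * ?M A' (drop s u))"
   unfolding sum_distrib_left sum.distrib[symmetric]
  proof (rule sum_congI)
   fix s assume "s \<in> {..<k - 1}"
   hence s: "s < k" "Suc s < k" by auto
   have w: "length (take (Suc s) u) < length u" "distinct (take (Suc s) u)" "set (take (Suc s) u) <= set u"
    using s d(1) by (simp_all add: k_def set_take_subset)
   have ln: "l ~: set (take (Suc s) u)"
   proof
    assume "l \<in> set (take (Suc s) u)"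
    then obtain i where i: "i < Suc s" "u ! i = l" using s by (auto simp: in_set_conv_nth k_def)
    have "i = k - 1" using nth_eq_iff_index_eq[OF d(1), of i "k - 1"] i l(2) s by (simp add: k_def)
    thus False using i s by simp
   qed
   have e1: "lab z (A'(u ! s := mat 1)) (take (Suc s) u) = lab z (A(u ! s := mat 1)) (take (Suc s) u)"
    using ln by (auto simp: A'_def)
   have b1: "?b = lab z (A(u ! s := mat 1)) v" "?b = lab z (A'(u ! s := mat 1)) v"
    unfolding A'_def bv[OF us(1)[OF s(1)]] bv[OF l(1)] by simp_all
   have "mfrak_GUE (close_list (take (Suc s) ?a)) ?b = ?F (A(u ! s := mat 1)) (take (Suc s) u)"
    unfolding cl1[OF s(1)] b1(1) by (rule IH[OF w])
   moreover have "mfrak_GUE (close_list (take (Suc s) ?a)) ?b = ?F (A'(u ! s := mat 1)) (take (Suc s) u)"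
    unfolding cl1[OF s(1)] e1[symmetric] b1(2) by (rule IH[OF w])
   moreover have "mfrak (drop s ?a) = ?M A (drop s u)" "mfrak (close_list (drop s ?a)) = ?M A' (drop s u)"
    unfolding cl2[OF s(1)] unfolding drop_map by (rule mf; use d(1) dl[OF s(1)] in simp)+
   ultimately show "mfrak_GUE (close_list (take (Suc s) ?a)) ?b * (mfrak (drop s ?a) + q * mfrak (close_list (drop s ?a)) * t)
    = ?F (A(u ! s := mat 1)) (take (Suc s) u) * ?M A (drop s u) + q * t * (?F (A'(u ! s := mat 1)) (take (Suc s) u) * ?M A' (drop s u))"
    by (simp add: algebra_simps)
  qed
  have T3: "(\<Sum>s=1..<k. mfrak (close_list (take (Suc s) ?a)) * (mfrak_GUE (drop s ?a) ?b + q * mfrak_GUE (close_list (drop s ?a)) ?b * t))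
   = (\<Sum>s=1..<k. ?M (A(u ! s := mat 1)) (take (Suc s) u) * ?F A (drop s u)) + q * t * (\<Sum>s=1..<k. ?M (A'(u ! s := mat 1)) (take (Suc s) u) * ?F A' (drop s u))"
   unfolding sum_distrib_left sum.distrib[symmetric]
  proof (rule sum_congI)
   fix s assume "s \<in> {1..<k}"
   hence s: "s < k" "0 < s" by auto
   have w: "length (drop s u) < length u" "distinct (drop s u)" "set (drop s u) <= set u"
    using s d(1) by (simp_all add: k_def set_drop_subset)
   have e1: "lab z (A'(u ! s := mat 1)) (take (Suc s) u) = lab z (A(u ! s := mat 1)) (take (Suc s) u)"
   proof (cases "Suc s < k")
    case True
    have "l ~: set (take (Suc s) u)"
    proof
     assume "l \<in> set (take (Suc s) u)"
     then obtain i where i: "i < Suc s" "u ! i = l" using s by (auto simp: in_set_conv_nth k_def)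
     have "i = k - 1" using nth_eq_iff_index_eq[OF d(1), of i "k - 1"] i l(2) True by (simp add: k_def)
     thus False using i True by simp
    qed
    thus ?thesis by (auto simp: A'_def)
   next
    case False
    hence "u ! s = l" using s l(2) by (metis Suc_lessI diff_Suc_1)
    thus ?thesis by (simp add: A'_def)
   qed
   have tk: "mfrak (close_list (take (Suc s) ?a)) = ?M B (take (Suc s) u)" if "lab z B (take (Suc s) u) = lab z (A(u ! s := mat 1)) (take (Suc s) u)" for B :: "'a => complex^'n^'n"
    unfolding cl1[OF s(1)] that[symmetric] by (rule mf) (use d(1) us(3)[OF s(1)] in simp_all)
   have x1: "mfrak_GUE (drop s ?a) ?b = ?F A (drop s u)" unfolding drop_map by (rule IH[OF w])
   have x2: "mfrak_GUE (close_list (drop s ?a)) ?b = ?F A' (drop s u)" unfolding cl2[OF s(1)] bA(1) by (rule IH[OF w])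
   have dist: "m * (x + q * y * t) = m * x + q * t * (m * y)" for m x y by (simp add: algebra_simps)
   show "mfrak (close_list (take (Suc s) ?a)) * (mfrak_GUE (drop s ?a) ?b + q * mfrak_GUE (close_list (drop s ?a)) ?b * t)
    = ?M (A(u ! s := mat 1)) (take (Suc s) u) * ?F A (drop s u) + q * t * (?M (A'(u ! s := mat 1)) (take (Suc s) u) * ?F A' (drop s u))"
    unfolding dist by (intro arg_cong2[where f = "(+)"] arg_cong2[where f = "(*)"] refl x1 x2 tk[OF refl] tk[OF e1])
  qed
  have T4: "(\<Sum>i<length v. mfrak (?a @ rotate i ?b @ [(fst (?b ! i), mat 1)]) + q * t * mfrak (close_list ?a @ rotate i ?b @ [(fst (?b ! i), mat 1)]))
   = (\<Sum>i<length v. ?M (A(e (v ! i) := mat 1)) (u @ rotate i v @ [e (v ! i)])) + q * t * (\<Sum>i<length v. ?M (A'(e (v ! i) := mat 1)) (u @ rotate i v @ [e (v ! i)]))"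
   unfolding sum_distrib_left sum.distrib[symmetric]
  proof (rule sum_congI)
   fix i assume "i \<in> {..<length v}"
   hence i: "i < length v" "v ! i \<in> S" using less.prems(3) nth_mem[of i v] by auto
   let ?x = "e (v ! i)"
   have x: "?x ~: set u" "?x ~: set v" using e(1)[OF i(2)] less.prems(3) by blast+
   have g: "lab z B u @ rotate i (lab z B v) @ [(fst (lab z B v ! i), mat 1)] = lab z (B(?x := mat 1)) (u @ rotate i v @ [?x])" for B :: "'a => complex^'n^'n"
   proof -
    have "fst (lab z B v ! i) = z ?x" using i e(2) by simp
    thus ?thesis unfolding map_append rotate_map[symmetric] lab_upd[OF x(1)] lab_upd[OF x(2)] by simp
   qed
   have m: "mfrak (lab z B u @ rotate i (lab z B v) @ [(fst (lab z B v ! i), mat 1)]) = ?M (B(?x := mat 1)) (u @ rotate i v @ [?x])" for B :: "'a => complex^'n^'n"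
    unfolding g by (rule mf) (use x less.prems(1) in auto)
   have "close_list ?a = lab z A' u" using cl2[of 0] k by simp
   thus "mfrak (?a @ rotate i ?b @ [(fst (?b ! i), mat 1)]) + q * t * mfrak (close_list ?a @ rotate i ?b @ [(fst (?b ! i), mat 1)])
    = ?M (A(?x := mat 1)) (u @ rotate i v @ [?x]) + q * t * ?M (A'(?x := mat 1)) (u @ rotate i v @ [?x])"
    using m[of A] m[of A'] by (simp only: bA(1)[symmetric])
  qed
  have "mfrak_GUE ?a ?b = Y A + q * t * Y A'"
   unfolding mfrak_GUE_rec[OF a(1), of ?b] a(2-7) q_def[symmetric] t_def[symmetric] c_def[symmetric] T1 T2 T3 T4 Y_def
   by (simp only: distrib_left mult_ac add_ac)
  thus ?thesis using F by simp
 qed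
qed

section \<open>The formula for consecutive labels\<close>

text \<open>The cumulant weight is replaced by one that agrees with it on the labels in use, since rotation invariance
is needed for all lists.\<close>

lemma circ_sum_intervals:
 fixes \<tau> \<kappa> \<kappa>' :: "nat list => complex"
 assumes "rot_inv \<tau>" "rot_inv \<kappa>'" "0 < k" "0 < l" "!!c. set c <= {..<k + l} ==> \<kappa>' c = \<kappa> c"
  "!!a b. set a <= {..<k + l} ==> set b <= {..<k + l} ==> \<kappa>\<kappa>' a b = \<kappa>\<kappa> a b"
 shows "circ_sum \<tau> \<kappa>' \<kappa>\<kappa>' [0..<k] [k..<k + l] =
   (\<Sum>p\<in>annular_NCP k l. (\<Prod>c\<in>cycles_upto (k + l) (annular_kreweras k l p). \<tau> c) * (\<Prod>c\<in>cycles_upto (k + l) p. \<kappa> c))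
  + (\<Sum>(P, U, Q, V)\<in>marked_NCP_pairs {..<k} {k..<k + l}.
     (\<Prod>B\<in>kreweras {..<k} P. \<tau> (sorted_list_of_set B)) * (\<Prod>B\<in>kreweras {k..<k + l} Q. \<tau> (sorted_list_of_set B))
     * \<kappa>\<kappa> (sorted_list_of_set U) (sorted_list_of_set V)
     * (\<Prod>B\<in>P - {U}. \<kappa> (sorted_list_of_set B)) * (\<Prod>B\<in>Q - {V}. \<kappa> (sorted_list_of_set B)))"
proof -
 let ?u = "[0..<k]" and ?v = "[k..<k + l]"
 let ?s = "sorted_list_of_set :: nat set => nat list"
 have S: "set ?u Un set ?v = {..<k + l}" and u: "set ?u = {..<k}" and v: "set ?v = {k..<k + l}" by auto
 have ann: "annulus_sum \<tau> \<kappa>' ?u ?v =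
  (\<Sum>p\<in>annular_NCP k l. (\<Prod>c\<in>cycles_upto (k + l) (annular_kreweras k l p). \<tau> c) * (\<Prod>c\<in>cycles_upto (k + l) p. \<kappa> c))"
  unfolding annulus_sum_def annular_NCP_annulus S
 proof (rule sum_congI)
  fix p assume p: "p \<in> annulus ?u ?v"
  have po: "perm_on {..<k + l} p" using annulusD(2)[OF p] unfolding S .
  have K: "perm_on {..<k + l} (inv p o (cl ?u o cl ?v))"
   by (intro perm_on_compose perm_on_inv po cl_perm_on) auto
  have "(\<Prod>c\<in>cycles_upto (k + l) p. \<kappa>' c) = (\<Prod>c\<in>cycles_upto (k + l) p. \<kappa> c)"
  proof (rule prod.cong[OF refl])
   fix c assume "c \<in> cycles_upto (k + l) p"
   then obtain i where "i < k + l" "c = support p i" by (auto simp: cycles_upto_def)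
   hence "set c <= {..<k + l}" using set_support[OF perm_onD(2)[OF po]] orbit_sub[OF po, of i] by simp
   thus "\<kappa>' c = \<kappa> c" by (rule assms(5))
  qed
  thus "cprod {..<k + l} \<tau> (inv p o (cl ?u o cl ?v)) * cprod {..<k + l} \<kappa>' p =
   (\<Prod>c\<in>cycles_upto (k + l) (annular_kreweras k l p). \<tau> c) * (\<Prod>c\<in>cycles_upto (k + l) p. \<kappa> c)"
   unfolding cprod_cycles_upto[OF K assms(1)] cprod_cycles_upto[OF po assms(2)] annular_kreweras_def annulus_rotation_cl by simp
 qed
 have mk: "(\<Sum>P\<in>NCP (set L). (\<Prod>B\<in>kreweras (set L) P. \<tau> (?s B)) * (\<Sum>U\<in>P. H (?s U) * (\<Prod>B\<in>P - {U}. \<kappa> (?s B))))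
   = marked_sum \<tau> \<kappa>' (%c. H (block L (set c))) L"
  if L: "sorted L" "distinct L" "L ~= []" "set L <= {..<k + l}" for L and H :: "nat list => complex"
 proof -
  have b: "?s B = block L B" if "B <= set L" for B using block_eq_sorted[OF L(1,2) that] by simp
  have kp: "\<kappa> (?s B) = \<kappa>' (block L B)" if "B <= set L" for B
  proof -
   have "set (block L B) <= {..<k + l}" using L(4) by (auto simp: block_def)
   thus ?thesis unfolding b[OF that] by (rule assms(5)[symmetric])
  qed
  have "(\<Sum>P\<in>NCP (set L). (\<Prod>B\<in>kreweras (set L) P. \<tau> (?s B)) * (\<Sum>U\<in>P. H (?s U) * (\<Prod>B\<in>P - {U}. \<kappa> (?s B))))
   = (\<Sum>P\<in>NCP (set L). (\<Prod>B\<in>kreweras (set L) P. \<tau> (block L B)) * (\<Sum>U\<in>P. H (block L U) * (\<Prod>B\<in>P - {U}. \<kappa>' (block L B))))"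
  proof (rule sum_congI)
   fix P assume P: "P \<in> NCP (set L)"
   have "(\<Prod>B\<in>kreweras (set L) P. \<tau> (?s B)) = (\<Prod>B\<in>kreweras (set L) P. \<tau> (block L B))"
    by (rule prod.cong[OF refl]) (simp only: b[OF kreweras_subset])
   moreover have "(\<Prod>B\<in>P - {U}. \<kappa> (?s B)) = (\<Prod>B\<in>P - {U}. \<kappa>' (block L B))" for U
    by (rule prod.cong[OF refl]) (use kp NCP_block_subset[OF P] in blast)
   moreover have "H (?s U) = H (block L U)" if "U \<in> P" for U using b[OF NCP_block_subset[OF P that]] by simp
   ultimately show "(\<Prod>B\<in>kreweras (set L) P. \<tau> (?s B)) * (\<Sum>U\<in>P. H (?s U) * (\<Prod>B\<in>P - {U}. \<kappa> (?s B)))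
    = (\<Prod>B\<in>kreweras (set L) P. \<tau> (block L B)) * (\<Sum>U\<in>P. H (block L U) * (\<Prod>B\<in>P - {U}. \<kappa>' (block L B)))"
    by (simp cong: sum.cong)
  qed
  also have "... = marked_sum \<tau> \<kappa>' (%c. H (block L (set c))) L"
   by (rule NCP_disc_sum(2)[OF L(1-3) assms(1,2)])
  finally show ?thesis .
 qed
 have "(\<Sum>(P, U, Q, V)\<in>marked_NCP_pairs (set ?u) (set ?v).
     (\<Prod>B\<in>kreweras (set ?u) P. \<tau> (?s B)) * (\<Prod>B\<in>kreweras (set ?v) Q. \<tau> (?s B)) * \<kappa>\<kappa> (?s U) (?s V)
     * (\<Prod>B\<in>P - {U}. \<kappa> (?s B)) * (\<Prod>B\<in>Q - {V}. \<kappa> (?s B)))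
   = (\<Sum>Q\<in>NCP (set ?v). (\<Prod>B\<in>kreweras (set ?v) Q. \<tau> (?s B)) * (\<Sum>V\<in>Q.
     (\<Sum>P\<in>NCP (set ?u). (\<Prod>B\<in>kreweras (set ?u) P. \<tau> (?s B)) * (\<Sum>U\<in>P. \<kappa>\<kappa> (?s U) (?s V) * (\<Prod>B\<in>P - {U}. \<kappa> (?s B))))
     * (\<Prod>B\<in>Q - {V}. \<kappa> (?s B))))"
  unfolding sum_marked_NCP_pairs[OF finite_set finite_set] sum_distrib_left sum_distrib_right by (simp only: mult_ac)
 also have "... = (\<Sum>Q\<in>NCP (set ?v). (\<Prod>B\<in>kreweras (set ?v) Q. \<tau> (?s B)) * (\<Sum>V\<in>Q.
     marked_sum \<tau> \<kappa>' (%c. \<kappa>\<kappa> (block ?u (set c)) (?s V)) ?u * (\<Prod>B\<in>Q - {V}. \<kappa> (?s B))))"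
  by (subst mk[where L = ?u and H = "%a. \<kappa>\<kappa> a _"]) (use assms(3) in auto)
 also have "... = marked_sum \<tau> \<kappa>' (%d. marked_sum \<tau> \<kappa>' (%c. \<kappa>\<kappa> (block ?u (set c)) (block ?v (set d))) ?u) ?v"
  by (rule mk[where L = ?v and H = "%b. marked_sum \<tau> \<kappa>' (%c. \<kappa>\<kappa> (block ?u (set c)) b) ?u"]) (use assms(4) in auto)
 also have "... = marked_sum \<tau> \<kappa>' (%d. marked_sum \<tau> \<kappa>' (%c. \<kappa>\<kappa>' (block ?u (set c)) (block ?v (set d))) ?u) ?v"
 proof -
  have "\<kappa>\<kappa> (block ?u X) (block ?v Y) = \<kappa>\<kappa>' (block ?u X) (block ?v Y)" for X Y
   by (rule assms(6)[symmetric]) (auto simp: block_def)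
  thus ?thesis by simp
 qed
 finally show ?thesis unfolding circ_sum_marked[OF distinct_upt] ann u v by simp
qed

lemma mfrak_GUE_Nil_right: "mfrak_GUE a [] = 0"
proof (induction "length a" arbitrary: a rule: less_induct)
 case less
 show ?case
 proof (cases "a = []")
  case False
  hence n: "0 < length a" by simp
  have 1: "mfrak_GUE (tl (butlast a) @ [M]) [] = 0" if "length a ~= 1" for M
  proof (rule less.hyps)
   have "2 \<le> length a" using that n by linarith
   thus "length (tl (butlast a) @ [M]) < length a" by simp
  qed
  have 2: "mfrak_GUE (close_list (take (Suc s) a)) [] = 0" if "s < length a - 1" for s
   by (rule less.hyps) (use that n in "simp add: length_close_list")
  have 3: "mfrak_GUE (drop s a) [] = 0" "mfrak_GUE (close_list (drop s a)) [] = 0" if "1 \<le> s" "s < length a" for s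
   by (rule less.hyps, use that in "simp add: length_close_list")+
  show ?thesis unfolding mfrak_GUE_rec[OF False] using 1 2 3 by simp
 qed simp
qed

text \<open>The next \<open>k + l\<close> labels serve as the fresh copies; \<open>\<i>\<close> is an arbitrary nonreal value for all others.\<close>

theorem theorem2p4:
  fixes k l :: nat
    and z :: "nat \<Rightarrow> complex"
    and A :: "nat \<Rightarrow> complex^'n^'n"
  assumes "\<And>j. j < k + l \<Longrightarrow> z j \<notin> \<real>"
  shows "mfrak_GUE (map (\<lambda>j. (z j, A j)) [0..<k]) (map (\<lambda>j. (z j, A j)) [k..<k + l]) =
      (\<Sum>p\<in>annular_NCP k l.
         (\<Prod>c\<in>cycles_upto (k + l) (annular_kreweras k l p). ntr (matrix_prod_list (map A c)))
         * (\<Prod>c\<in>cycles_upto (k + l) p. m_circ (map z c)))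
    + (\<Sum>(P1, U1, P2, U2)\<in>marked_NCP_pairs {..<k} {k..<k + l}.
         (\<Prod>B\<in>kreweras {..<k} P1. ntr (matrix_prod_list (map A (sorted_list_of_set B))))
         * (\<Prod>B\<in>kreweras {k..<k + l} P2. ntr (matrix_prod_list (map A (sorted_list_of_set B))))
         * m_circcirc TYPE('n) (map z (sorted_list_of_set U1)) (map z (sorted_list_of_set U2))
         * (\<Prod>B\<in>P1 - {U1}. m_circ (map z (sorted_list_of_set B)))
         * (\<Prod>B\<in>P2 - {U2}. m_circ (map z (sorted_list_of_set B))))"
proof (cases "k = 0 \<or> l = 0")
  case True
  then have "annular_NCP k l = {}" by (auto simp: annular_NCP_def)
  moreover have "marked_NCP_pairs {..<k} {k..<k + l} = {}"
    using True by (auto simp: marked_NCP_pairs_def dest!: NCP_Nil)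
  ultimately show ?thesis using True mfrak_GUE_Nil_right by auto
next
  case False
  then have kl: "0 < k" "0 < l" by auto
  let ?n = "k + l"
  define z' where "z' = (\<lambda>j. if j < ?n then z j else if j < 2 * ?n then z (j - ?n) else \<i>)"
  have z': "z' j \<in> nonreal" for j
    using assms complex_is_Real_iff[of \<i>] by (auto simp: z'_def nonreal_def)
  have agree: "map z' c = map z c" if "set c \<subseteq> {..<?n}" for c using that by (auto simp: z'_def)
  have "mfrak_GUE (map (\<lambda>j. (z j, A j)) [0..<k]) (map (\<lambda>j. (z j, A j)) [k..<k + l]) = mfrak_GUE (lab z' A [0..<k]) (lab z' A [k..<k + l])"
    by (intro arg_cong2[where f = mfrak_GUE] map_cong refl) (auto simp: z'_def)
  also have "\<dots> = circ_sum (word_trace A) (\<lambda>c. m_circ (map z' c)) (\<lambda>a b. m_circcirc TYPE('n) (map z' a) (map z' b)) [0..<k] [k..<k + l]"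
    by (rule mfrak_GUE_circ_sum[of z' "{..<?n}" "\<lambda>j. j + ?n", OF z']) (use kl in \<open>auto simp: z'_def\<close>)
  finally have eq: "mfrak_GUE (map (\<lambda>j. (z j, A j)) [0..<k]) (map (\<lambda>j. (z j, A j)) [k..<k + l]) = \<dots>" .
  show ?thesis unfolding eq
    by (rule circ_sum_intervals[OF rot_inv_word_trace rot_inv_m_circ[of z', OF z'] kl]) (simp_all only: agree)
qed

end
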